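(* Let $r\ge 1$, let $A$ be a real positive definite symmetric $r\times r$ matrix, $B$ a vector of length $r$ and $C$ a scalar. Let $(Q_1,\dots,Q_r)\in(0,1)^r$ be the unique solution in $(0,1)^r$ of $$1-Q_i=\prod_{j=1}^r Q_j^{A_{ij}},\qquad i=1,\dots,r .$$ Then there is an asymptotic expansion $$F_{A,B,C}(e^{-\varepsilon})\,e^{-\alpha/\varepsilon}\;\sim\;\beta e^{-\gamma\varepsilon}\Bigl(1+\sum_{p=1}^\infty c_p\varepsilon^p\Bigr),\qquad \varepsilon\searrow0 ,$$ with coefficients $\alpha\in\mathbb{R}_+$, $\beta,\gamma\in\overline{\mathbb{Q}}$ and $c_p\in\overline{\mathbb{Q}}$ ($p\ge1$) given as follows. Put $\xi_i=\frac{Q_i}{1-Q_i}$ and $\widetilde A=A+\operatorname{diag}(\xi_1,\dots,\xi_r)$. Then $$\alpha=\sum_{i=1}^r\bigl(L(1)-L(Q_i)\bigr)>0,\qquad \beta=(\det\widetilde A)^{-1/2}\prod_{i=1}^r Q_i^{B_i}(1-Q_i)^{-1/2},\qquad \gamma=C+\frac1{24}\sum_{i=1}^r\frac{1+Q_i}{1-Q_i},$$ $$c_p=(\det\widetilde A)^{1/2}(2\pi)^{-r/2}\int_{\mathbb{R}^r}C_{2p}(B,\xi,t)\,e^{-\frac12t^T\widetilde A t}\,dt\qquad(p\ge1).$$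
   Context: For $0<q<1$, $(q)_n=\prod_{k=1}^n(1-q^k)$ and $$F_{A,B,C}(q)=\sum_{n\in(\mathbb{Z}_{\ge0})^r}\frac{q^{\frac12n^TAn+n^TB+C}}{(q)_{n_1}\cdots(q)_{n_r}} .$$ The asymptotic expansion means that for every $N\ge0$ the left-hand side equals $\beta e^{-\gamma\varepsilon}\bigl(1+\sum_{p=1}^N c_p\varepsilon^p\bigr)+o(\varepsilon^N)$ as $\varepsilon\searrow0$. $\overline{\mathbb{Q}}$ is the field of algebraic numbers. $L$ is the Rogers dilogarithm: $L(x)=\mathrm{Li}_2(x)+\frac12\log(x)\log(1-x)$ for $x\in(0,1)$, where $\mathrm{Li}_2(x)=\sum_{n\ge1}x^n/n^2$, and $L(1)=\pi^2/6$. Polynomials $C_p$: Let $B_p(X)=\sum_k\binom pk B_kX^{p-k}$ be the Bernoulli polynomials ($B_k$ the Bernoulli numbers, $B_1=-\frac12$). Define polynomials $P_k$ by $P_1(X)=X$, $P_{k+1}(X)=(X^2+X)P_k'(X)$ (so that $\mathrm{Li}_{2-p}(Q)=\sum_{n\ge 1} n^{p-2}Q^n=P_{p-1}\bigl(\tfrac{Q}{1-Q}\bigr)$ for $p\ge2$, $0<Q<1$). Define polynomials $D_p\in\mathbb{Q}[b,X,T]$, $p\ge0$, with $D_0=1$, by the identity of formal power series in $\varepsilon^{1/2}$ $$\exp\Bigl[\bigl(b+\tfrac12X\bigr)T\varepsilon^{1/2}-\sum_{p=3}^\infty\frac1{p!}B_p\bigl(T\varepsilon^{-1/2}\bigr)P_{p-1}(X)\,\varepsilon^{p-1}\Bigr]=1+\sum_{p=1}^\infty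 D_p(b,X,T)\,\varepsilon^{p/2}.$$ For $B=(B_1,\dots,B_r)$ (here $B_i$ denotes the entries of the vector $B$), $\xi=(\xi_1,\dots,\xi_r)$, $t=(t_1,\dots,t_r)$ put $$C_p(B,\xi,t)=\sum_{p_1+\dots+p_r=p,\;p_i\ge0}\ \prod_{i=1}^rD_{p_i}(B_i,\xi_i,t_i).$$
   Formalization: The claim that β, γ and the c_p are algebraic is made only when all entries of A and B, and C, are rational; for arbitrary real A, B, C it is false (e.g. r=1, A=2, B=0, C=π gives transcendental γ). All other claims are for real A, B, C. *)

theory Defs
  imports
    "HOL-Analysis.Analysis"
    "HOL-Library.Landau_Symbols"
    "HOL-Computational_Algebra.Computational_Algebra"
begin

definition qfact :: "real \<Rightarrow> nat \<Rightarrow> real" where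
  "qfact q n = (\<Prod>k=1..n. 1 - q ^ k)"

definition nahm_sum :: "real^'r^'r \<Rightarrow> real^'r \<Rightarrow> real \<Rightarrow> real \<Rightarrow> real" where
  "nahm_sum A B C q =
     (\<Sum>\<^sub>\<infinity>n\<in>(UNIV :: (nat^'r) set).
        (let v = (\<chi> i. real (n $ i))
         in q powr (1/2 * (v \<bullet> (A *v v)) + v \<bullet> B + C) / (\<Prod>i\<in>UNIV. qfact q (n $ i))))"

definition positive_definite :: "real^'r^'r \<Rightarrow> bool" where
  "positive_definite A \<longleftrightarrow> (\<forall>x. x \<noteq> 0 \<longrightarrow> x \<bullet> (A *v x) > 0)"

definition nahm_solution :: "real^'r^'r \<Rightarrow> real^'r \<Rightarrow> bool" where
  "nahm_solution A Q \<longleftrightarrow>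
     (\<forall>i. 0 < Q $ i \<and> Q $ i < 1) \<and>
     (\<forall>i. 1 - Q $ i = (\<Prod>j\<in>UNIV. (Q $ j) powr (A $ i $ j)))"

definition Li2 :: "real \<Rightarrow> real" where
  "Li2 x = (\<Sum>n. x ^ Suc n / (real (Suc n))\<^sup>2)"

(* Only used for 0 < x \<le> 1. *)
definition rogers_L :: "real \<Rightarrow> real" where
  "rogers_L x = (if x = 1 then pi\<^sup>2 / 6 else Li2 x + 1/2 * ln x * ln (1 - x))"

fun bernoulli :: "nat \<Rightarrow> real" where
  "bernoulli n =
     (if n = 0 then 1
      else - (\<Sum>k<n. real (Suc n choose k) * bernoulli k) / real (Suc n))"

declare bernoulli.simps [simp del]

definition bernoulli_poly :: "nat \<Rightarrow> real poly" where
  "bernoulli_poly p = (\<Sum>k\<le>p. monom (real (p choose k) * bernoulli k) (p - k))"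

(* The sequence starts at index 1; the value at 0 is a dummy. *)
fun polylog_poly :: "nat \<Rightarrow> real poly" where
  "polylog_poly 0 = 0"
| "polylog_poly (Suc 0) = [:0, 1:]"
| "polylog_poly (Suc (Suc k)) = [:0, 1, 1:] * pderiv (polylog_poly (Suc k))"

(* B_p(T \<epsilon>^(-1/2)) \<epsilon>^(p-1) as a power series in s = \<epsilon>^(1/2): the monomial X^j of B_p
   contributes T^j s^(2(p-1)-j).  The exponent is nonnegative for j \<le> p and p \<ge> 2, so the
   truncated subtraction on nat is harmless in the range p \<ge> 3 where this is used. *)
definition bernoulli_term :: "real \<Rightarrow> nat \<Rightarrow> real fps" where
  "bernoulli_term T p =
     (\<Sum>j\<le>p. fps_const (coeff (bernoulli_poly p) j * T ^ j) * fps_X ^ (2 * (p - 1) - j))"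

(* The argument of the exponential, again as a power series in s = \<epsilon>^(1/2).  The infinite sum
   is taken in the X-adic topology of real fps; its p-th summand is divisible by s^(p-2). *)
definition D_exponent :: "real \<Rightarrow> real \<Rightarrow> real \<Rightarrow> real fps" where
  "D_exponent b X T =
     fps_const ((b + 1/2 * X) * T) * fps_X
     - (\<Sum>m. let p = m + 3
             in fps_const (1 / fact p * poly (polylog_poly (p - 1)) X) * bernoulli_term T p)"

(* D_p(b,X,T), as the polynomial function on the reals. *)
definition D_coeff :: "nat \<Rightarrow> real \<Rightarrow> real \<Rightarrow> real \<Rightarrow> real" where
  "D_coeff p b X T = fps_nth (fps_exp 1 oo D_exponent b X T) p"

definition C_coeff :: "nat \<Rightarrow> real^'r \<Rightarrow> real^'r \<Rightarrow> real^'r \<Rightarrow> real" where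
  "C_coeff p B \<xi> t =
     (\<Sum>k | (\<Sum>i\<in>(UNIV :: 'r set). k i) = p. \<Prod>i\<in>UNIV. D_coeff (k i) (B $ i) (\<xi> $ i) (t $ i))"

end

theory Submission
  imports Defs "HOL-Probability.Distributions"
begin

no_notation fps_nth (infixl "$" 75)

text \<open>Put \<open>\<epsilon> = s\<^sup>2\<close> and \<open>Q\<^sub>i = exp (- u\<^sub>i)\<close>. The exponential rate of the summand at
  \<open>n = x / \<epsilon>\<close> is governed by the potential \<open>V x = x \<bullet> A x / 2 + (\<Sum>i. Li\<^sub>2 (exp (- x\<^sub>i)))\<close>, whose critical
  point is \<open>u\<close>. As the dilogarithm part is convex, \<open>V x \<ge> V u + (x - u) \<bullet> A (x - u) / 2\<close>, which gives a
  Gaussian bound for all summands. Close to the critical point, at \<open>n = u / \<epsilon> - t / s\<close>, the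
  Euler--Maclaurin formula for \<open>(\<Sum>k>0. ln (1 - exp (- x - k \<epsilon>)))\<close> turns the summand into
  \<open>exp (- t \<bullet> \<^bold>A t / 2) (\<Sum>p. C\<^sub>p t s\<^sup>p)\<close>, with \<open>\<^bold>A\<close> for the matrix \<open>A + diag \<xi>\<close>; the formula breaks down at
  \<open>x = 0\<close>, where the Jacobi triple product takes its place. Finally, the sum of a polynomial times a
  Gaussian over a translate of \<open>s\<int>\<^sup>r\<close> differs from the integral by less than any power of \<open>s\<close>, and
  the integrals for odd \<open>p\<close> vanish by symmetry.

  A real number is algebraic iff all derivations of the field of real numbers vanish on it.
  A derivation applied to the equations for \<open>Q\<close>, with rational \<open>A\<close>, yields a homogeneous linear system
  for its values on the \<open>Q\<^sub>i\<close> which is nonsingular because \<open>A\<close> is positive definite. Gaussian moments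
  are algebraic since the Gram--Schmidt process only takes square roots.\<close>


section \<open>Derivations and algebraic numbers\<close>

text \<open>Half powers of \<epsilon> are unavoidable: the vectors \<open>n\<close> that matter lie
  at distance of order \<open>1 / s\<close> from \<open>u / \<epsilon>\<close>, and only the parity
  of \<open>C_coeff\<close> in \<open>t\<close> removes the odd powers of \<open>s\<close> at the
  end. The translate \<open>u / s\<close> of the lattice moves with \<open>s\<close>, so all lattice
  estimates are uniform in the translate. The local expansion holds only for \<open>t\<close> small
  against a power of \<open>1 / s\<close>, and its remainders grow polynomially in \<open>t\<close>.
  Errors are therefore measured by \<open>(1 + norm t) ^ L * s ^ M\<close>: a Gaussian absorbs the
  first factor, and outside the local domain every lost power of \<open>s\<close> is bought back
  with powers of \<open>1 + norm t\<close>. At \<open>x = 0\<close> the function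
  \<open>ln (1 - exp (- x))\<close> is singular, which produces the term
  \<open>ln (2 * pi / \<epsilon>) / 2\<close>. The product identity trades its sum for sums of
  \<open>ln (1 + exp (- x))\<close>, which is smooth at 0, and a theta value whose size follows from
  the lattice estimate in dimension one. Derivations replace resultants: closure of the algebraic
  reals under an operation becomes a differentiation rule.\<close>

definition derivation :: "(real \<Rightarrow> real) \<Rightarrow> bool" where
  "derivation D \<longleftrightarrow> (\<forall>x y. D (x + y) = D x + D y) \<and> (\<forall>x y. D (x * y) = x * D y + D x * y)"

lemma derivation_add: "derivation D \<Longrightarrow> D (x + y) = D x + D y"
  and derivation_mult: "derivation D \<Longrightarrow> D (x * y) = x * D y + D x * y"
  by (auto simp: derivation_def)

lemma derivation_0: "derivation D \<Longrightarrow> D 0 = 0"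
  using derivation_add[of D 0 0] by simp

lemma derivation_1: "derivation D \<Longrightarrow> D 1 = 0"
  using derivation_mult[of D 1 1] by simp

lemma derivation_minus: "derivation D \<Longrightarrow> D (- x) = - D x"
  using derivation_add[of D x "-x"] derivation_0[of D] by simp

lemma derivation_diff: "derivation D \<Longrightarrow> D (x - y) = D x - D y"
  using derivation_add[of D x "-y"] derivation_minus[of D y] by simp

lemma derivation_of_nat: "derivation D \<Longrightarrow> D (of_nat n) = 0"
  by (induction n) (auto simp: derivation_0 derivation_1 derivation_add)

lemma derivation_of_int: "derivation D \<Longrightarrow> D (of_int n) = 0"
  by (cases n) (auto simp: derivation_of_nat derivation_minus derivation_diff derivation_1)

lemma derivation_poly:
  assumes D: "derivation D" and "\<And>i. D (coeff p i) = 0"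
  shows "D (poly p x) = poly (pderiv p) x * D x"
  using assms(2)
proof (induction p)
  case 0
  then show ?case using D by (simp add: derivation_0)
next
  case (pCons a p)
  have "D (coeff p i) = 0" for i
    using pCons.prems[of "Suc i"] by simp
  moreover have "D a = 0" using pCons.prems[of 0] by simp
  ultimately show ?case using pCons.IH
    by (simp add: derivation_add[OF D] derivation_mult[OF D] pderiv_pCons algebra_simps)
qed

text \<open>An integer polynomial of least degree with root \<open>x\<close> has a derivative that
  does not vanish at \<open>x\<close>, since that derivative has smaller degree. Applying
  \<open>D\<close> to \<open>poly p x = 0\<close> therefore forces \<open>D x = 0\<close>.\<close>

lemma derivation_algebraic:
  assumes D: "derivation D" and x: "algebraic x"
  shows "D x = 0"
proof -
  define P where "P p \<longleftrightarrow> (\<forall>i. coeff p i \<in> \<int>) \<and> p \<noteq> 0 \<and> poly p x = 0" for p :: "real poly"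
  obtain p0 where "P p0" using x unfolding algebraic_def P_def by blast
  then obtain p where p: "P p" and min: "\<And>q. P q \<Longrightarrow> degree p \<le> degree q"
    using ex_has_least_nat[of P p0 degree] by auto
  have deg: "degree p > 0"
    using p unfolding P_def by (metis degree_eq_zeroE gr0I pCons_0_0 poly_const_conv)
  hence nz: "pderiv p \<noteq> 0" by (simp add: pderiv_eq_0_iff)
  have "degree (pderiv p) < degree p" using deg by (simp add: degree_pderiv)
  hence "\<not> P (pderiv p)" using min[of "pderiv p"] by linarith
  moreover have "\<forall>i. coeff (pderiv p) i \<in> \<int>"
    using p unfolding P_def coeff_pderiv by (metis Ints_mult Ints_of_nat)
  ultimately have ne: "poly (pderiv p) x \<noteq> 0" using nz unfolding P_def by blast
  have "D (coeff p i) = 0" for i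
    using p D unfolding P_def by (metis Ints_cases derivation_of_int)
  hence "D (poly p x) = poly (pderiv p) x * D x" by (rule derivation_poly[OF D])
  thus ?thesis using p D ne by (simp add: P_def derivation_0)
qed

text \<open>A derivation on a subring of the reals, encoded by its graph so that chains in Zorn's
  lemma have plain unions as upper bounds. Closure under differences makes the last clause
  equivalent to single-valuedness.\<close>

definition derivation_graph :: "(real \<times> real) set \<Rightarrow> bool" where
  "derivation_graph G \<longleftrightarrow> (1, 0) \<in> G \<and>
     (\<forall>a a' b b'. (a, a') \<in> G \<longrightarrow> (b, b') \<in> G \<longrightarrow> (a - b, a' - b') \<in> G \<and> (a * b, a * b' + a' * b) \<in> G) \<and>
     (\<forall>c. (0, c) \<in> G \<longrightarrow> c = 0)"

context
  fixes G assumes G: "derivation_graph G"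
begin

lemma graph_1: "(1, 0) \<in> G"
  and graph_diff: "(a, a') \<in> G \<Longrightarrow> (b, b') \<in> G \<Longrightarrow> (a - b, a' - b') \<in> G"
  and graph_mult: "(a, a') \<in> G \<Longrightarrow> (b, b') \<in> G \<Longrightarrow> (a * b, a * b' + a' * b) \<in> G"
  and graph_zeroD: "(0, c) \<in> G \<Longrightarrow> c = 0"
  using G by (auto simp: derivation_graph_def)

lemma graph_0: "(0, 0) \<in> G" using graph_diff[OF graph_1 graph_1] by simp

lemma graph_minus: "(a, a') \<in> G \<Longrightarrow> (- a, - a') \<in> G"
  using graph_diff[OF graph_0] by force

lemma graph_add: "(a, a') \<in> G \<Longrightarrow> (b, b') \<in> G \<Longrightarrow> (a + b, a' + b') \<in> G"
  using graph_diff[OF _ graph_minus] by force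

lemma graph_sum: "(\<And>i. i \<in> I \<Longrightarrow> (f i, f' i) \<in> G) \<Longrightarrow> (sum f I, sum f' I) \<in> G"
  by (induction I rule: infinite_finite_induct) (auto simp: graph_0 graph_add)

lemma graph_of_nat_mult: "(a, a') \<in> G \<Longrightarrow> (of_nat n * a, of_nat n * a') \<in> G"
  by (induction n) (auto simp: graph_0 graph_add algebra_simps)

lemma graph_unique: "(a, b) \<in> G \<Longrightarrow> (a, c) \<in> G \<Longrightarrow> b = c"
  using graph_diff[of a b a c] graph_zeroD[of "b - c"] by simp

text \<open>\<open>p'\<close> arises from \<open>p\<close> by applying the partial derivation to
  each coefficient; it is a relation because the derivation is known only through its graph.\<close>

definition graph_poly :: "real poly \<Rightarrow> real poly \<Rightarrow> bool" where
  "graph_poly p p' \<longleftrightarrow> (\<forall>i. (coeff p i, coeff p' i) \<in> G)"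

text \<open>The value that an extension sending \<open>a\<close> to \<open>c\<close> must take at
  \<open>poly p a\<close>.\<close>

definition poly_diff :: "real \<Rightarrow> real \<Rightarrow> real poly \<Rightarrow> real poly \<Rightarrow> real" where
  "poly_diff a c p p' = poly p' a + poly (pderiv p) a * c"

definition adjoin :: "real \<Rightarrow> real \<Rightarrow> (real \<times> real) set" where
  "adjoin a c = {(poly p a, poly_diff a c p p') | p p'. graph_poly p p'}"

lemma graph_poly_const: "(b, b') \<in> G \<Longrightarrow> graph_poly [:b:] [:b':]"
  by (auto simp: graph_poly_def coeff_pCons graph_0 split: nat.split)

lemma graph_poly_diff: "graph_poly p p' \<Longrightarrow> graph_poly q q' \<Longrightarrow> graph_poly (p - q) (p' - q')"
  by (auto simp: graph_poly_def intro: graph_diff)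

lemma graph_poly_mult:
  "graph_poly p p' \<Longrightarrow> graph_poly q q' \<Longrightarrow> graph_poly (p * q) (p * q' + p' * q)"
  unfolding graph_poly_def coeff_add coeff_mult sum.distrib[symmetric]
  by (intro allI graph_sum graph_mult) auto

lemma graph_poly_pderiv: "graph_poly p p' \<Longrightarrow> graph_poly (pderiv p) (pderiv p')"
  by (auto simp: graph_poly_def coeff_pderiv simp del: of_nat_Suc intro: graph_of_nat_mult)

lemma graph_poly_monom: "(m, m') \<in> G \<Longrightarrow> graph_poly (monom m d) (monom m' d)"
  by (auto simp: graph_poly_def graph_0)

lemma graph_poly_zeroD: "graph_poly 0 p' \<Longrightarrow> p' = 0"
  by (auto simp: graph_poly_def poly_eq_iff intro: graph_zeroD)

text \<open>\<open>adjoin a c\<close> lives on the ring generated by the old domain and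
  \<open>a\<close>, and Leibniz's rule is formal there. What has to be ensured is that polynomials
  with the same value at \<open>a\<close> receive the same derivative; by taking differences this is
  the hypothesis on polynomials vanishing at \<open>a\<close>.\<close>

lemma graph_adjoin:
  assumes *: "\<And>p p'. graph_poly p p' \<Longrightarrow> poly p a = 0 \<Longrightarrow> poly_diff a c p p' = 0"
  shows "derivation_graph (adjoin a c)" and "G \<subseteq> adjoin a c" and "(a, c) \<in> adjoin a c"
proof -
  show sub: "G \<subseteq> adjoin a c"
  proof
    fix z assume "z \<in> G"
    moreover obtain b b' where "z = (b, b')" by (cases z)
    ultimately show "z \<in> adjoin a c"
      unfolding adjoin_def using graph_poly_const[of b b'] by (force simp: poly_diff_def)
  qed
  show "(a, c) \<in> adjoin a c"
  proof -
    have "graph_poly [:0,1:] 0"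
      by (auto simp: graph_poly_def coeff_pCons graph_0 graph_1 split: nat.split)
    thus ?thesis unfolding adjoin_def
      by (intro CollectI exI[of _ "[:0,1:]"] exI[of _ 0]) (simp add: poly_diff_def pderiv_pCons)
  qed
  show "derivation_graph (adjoin a c)"
    unfolding derivation_graph_def
  proof (intro conjI allI impI)
    show "(1, 0) \<in> adjoin a c" using sub graph_1 by auto
  next
    fix x x' y y' assume "(x, x') \<in> adjoin a c" "(y, y') \<in> adjoin a c"
    then obtain p p' q q' where p: "graph_poly p p'" "x = poly p a" "x' = poly_diff a c p p'"
      and q: "graph_poly q q'" "y = poly q a" "y' = poly_diff a c q q'"
      unfolding adjoin_def by blast
    show "(x - y, x' - y') \<in> adjoin a c"
      unfolding adjoin_def using graph_poly_diff[OF p(1) q(1)]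
      by (intro CollectI exI[of _ "p - q"] exI[of _ "p' - q'"])
         (simp add: p q poly_diff_def pderiv_diff algebra_simps)
    show "(x * y, x * y' + x' * y) \<in> adjoin a c"
      unfolding adjoin_def using graph_poly_mult[OF p(1) q(1)]
      by (intro CollectI exI[of _ "p * q"] exI[of _ "p * q' + p' * q"])
         (simp add: p q poly_diff_def pderiv_mult algebra_simps)
  next
    fix d assume "(0, d) \<in> adjoin a c"
    thus "d = 0" unfolding adjoin_def using * by auto
  qed
qed

text \<open>If \<open>a\<close> is a root of some polynomial over the domain of the derivation, the value at \<open>a\<close> is
  forced by a polynomial \<open>p\<close> of least degree; any other one is reduced modulo \<open>p\<close> up to a nonzero
  factor. If there is none, the value is arbitrary.\<close>

lemma graph_adjoin_ex:
  "\<exists>c. \<forall>p p'. graph_poly p p' \<longrightarrow> poly p a = 0 \<longrightarrow> poly_diff a c p p' = 0"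
proof (cases "\<exists>p p'. graph_poly p p' \<and> p \<noteq> 0 \<and> poly p a = 0")
  case False
  have "poly_diff a 0 p p' = 0" if "graph_poly p p'" "poly p a = 0" for p p'
    using False that graph_poly_zeroD[of p'] by (auto simp: poly_diff_def)
  thus ?thesis by blast
next
  case True
  define P where "P p \<longleftrightarrow> (\<exists>p'. graph_poly p p') \<and> p \<noteq> 0 \<and> poly p a = 0" for p
  obtain p0 where "P p0" using True unfolding P_def by blast
  then obtain p where p: "P p" and min: "\<And>q. P q \<Longrightarrow> degree p \<le> degree q"
    using ex_has_least_nat[of P p0 degree] by auto
  obtain p' where p': "graph_poly p p'" using p unfolding P_def by blast
  have deg: "degree p > 0"
    using p unfolding P_def by (metis degree_eq_zeroE gr0I pCons_0_0 poly_const_conv)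
  hence nz: "pderiv p \<noteq> 0" by (simp add: pderiv_eq_0_iff)
  have "degree (pderiv p) < degree p" using deg by (simp add: degree_pderiv)
  hence "\<not> P (pderiv p)" using min[of "pderiv p"] by linarith
  hence ne: "poly (pderiv p) a \<noteq> 0"
    using nz graph_poly_pderiv[OF p'] unfolding P_def by blast
  define c where "c = - poly p' a / poly (pderiv p) a"
  have c: "poly_diff a c p p' = 0" using ne by (simp add: poly_diff_def c_def)
  have "poly_diff a c g g' = 0" if "graph_poly g g'" "poly g a = 0" for g g'
    using that
  proof (induction "degree g" arbitrary: g g' rule: less_induct)
    case less
    show ?case
    proof (cases "g = 0")
      case True
      thus ?thesis using less.prems graph_poly_zeroD[of g'] by (auto simp: poly_diff_def)
    next
      case False
      hence "P g" using less.prems unfolding P_def by blast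
      hence le: "degree p \<le> degree g" by (rule min)
      define d where "d = degree g - degree p"
      define l l' where "l = lead_coeff p" and "l' = coeff p' (degree p)"
      define m m' where "m = lead_coeff g" and "m' = coeff g' (degree g)"
      have l: "(l, l') \<in> G" and m: "(m, m') \<in> G"
        using p' less.prems unfolding l_def l'_def m_def m'_def graph_poly_def by auto
      have l0: "l \<noteq> 0" using p unfolding l_def P_def by simp
      \<comment> \<open>One step of pseudo-division by \<open>p\<close>: the domain is only a ring,
        so \<open>g\<close> is multiplied by the leading coefficient of \<open>p\<close> before the
        leading terms cancel. \<open>r'\<close> is the matching coefficientwise derivative.\<close>
      define r where "r = [:l:] * g - monom m d * p"
      define r' where "r' = ([:l:] * g' + [:l':] * g) - (monom m d * p' + monom m' d * p)"
      have r: "graph_poly r r'" unfolding r_def r'_def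
        by (intro graph_poly_diff graph_poly_mult graph_poly_const graph_poly_monom l m p' less.prems)
      have ra: "poly r a = 0" using less.prems p by (simp add: r_def P_def)
      have m0: "m \<noteq> 0" using False by (simp add: m_def)
      have "coeff r (degree g) = 0"
        using le by (simp add: r_def coeff_monom_mult d_def l_def m_def)
      moreover have "degree (monom m d * p) = degree g"
        using le m0 p by (subst degree_mult_eq) (auto simp: degree_monom_eq d_def P_def)
      hence "degree r \<le> degree g" unfolding r_def
        by (intro degree_diff_le) (auto intro: order_trans[OF degree_mult_le])
      ultimately have "degree r < degree g"
        using le deg by (metis coeff_0 degree_0 le_neq_implies_less leading_coeff_0_iff less_le_trans)
      hence "poly_diff a c r r' = 0" using less.hyps r ra by blast
      moreover have "poly_diff a c r r' = l * poly_diff a c g g' - poly (monom m d) a * poly_diff a c p p'"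
        using less.prems p
        by (simp add: r_def r'_def poly_diff_def P_def pderiv_diff pderiv_mult pderiv_smult algebra_simps)
      ultimately show ?thesis using c l0 by simp
    qed
  qed
  thus ?thesis by blast
qed

end

text \<open>The zero derivation on the integers extends to the polynomials in \<open>x\<close> with
  value 1 at \<open>x\<close>, because no nonzero integer polynomial vanishes there. A maximal
  extension is defined everywhere, as \<open>graph_adjoin_ex\<close> would otherwise enlarge
  it.\<close>

lemma transcendental_derivation:
  assumes "\<not> algebraic (x :: real)"
  obtains D where "derivation D" "D x = 1"
proof -
  define GZ where "GZ = (\<lambda>n::int. (real_of_int n, 0::real)) ` UNIV"
  have GZ: "derivation_graph GZ"
    unfolding derivation_graph_def
  proof (intro conjI allI impI)
    show "(1, 0) \<in> GZ" unfolding GZ_def by (rule image_eqI[of _ _ 1]) auto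
  next
    fix a a' b b' assume "(a, a') \<in> GZ" "(b, b') \<in> GZ"
    then obtain m n where mn: "a = real_of_int m" "b = real_of_int n" "a' = 0" "b' = 0"
      by (auto simp: GZ_def)
    show "(a - b, a' - b') \<in> GZ" unfolding GZ_def mn by (rule image_eqI[of _ _ "m - n"]) auto
    show "(a * b, a * b' + a' * b) \<in> GZ" unfolding GZ_def mn by (rule image_eqI[of _ _ "m * n"]) auto
  qed (auto simp: GZ_def)
  have GZx: "poly_diff x 1 p p' = 0" if "graph_poly GZ p p'" "poly p x = 0" for p p'
  proof -
    have "(coeff p i, coeff p' i) \<in> GZ" for i using that unfolding graph_poly_def[OF GZ] by blast
    hence "coeff p i \<in> \<int>" for i unfolding GZ_def by (metis (no_types, lifting) Ints_of_int Pair_inject imageE)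
    hence "p = 0" using assms that unfolding algebraic_def by blast
    thus ?thesis using that graph_poly_zeroD[OF GZ, of p'] by (auto simp: poly_diff_def[OF GZ])
  qed
  define Gx where "Gx = adjoin GZ x 1"
  have Gx: "derivation_graph Gx" "(x, 1) \<in> Gx"
    using graph_adjoin[OF GZ GZx] unfolding Gx_def by auto
  define \<A> where "\<A> = {G. derivation_graph G \<and> Gx \<subseteq> G}"
  have "\<exists>M\<in>\<A>. \<forall>X\<in>\<A>. M \<subseteq> X \<longrightarrow> X = M"
  proof (rule subset_Zorn_nonempty)
    show "\<A> \<noteq> {}" using Gx by (auto simp: \<A>_def)
    fix \<C> assume ne: "\<C> \<noteq> {}" and ch: "subset.chain \<A> \<C>"
    hence dg: "\<And>G. G \<in> \<C> \<Longrightarrow> derivation_graph G" "\<And>G. G \<in> \<C> \<Longrightarrow> Gx \<subseteq> G"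
      by (auto simp: subset.chain_def \<A>_def)
    have "derivation_graph (\<Union>\<C>)"
      unfolding derivation_graph_def
    proof (intro conjI allI impI)
      show "(1, 0) \<in> \<Union>\<C>" using ne dg graph_1 by blast
    next
      fix a a' b b' assume "(a, a') \<in> \<Union>\<C>" "(b, b') \<in> \<Union>\<C>"
      then obtain X Y where XY: "X \<in> \<C>" "Y \<in> \<C>" "(a, a') \<in> X" "(b, b') \<in> Y" by blast
      then obtain Z where Z: "Z \<in> \<C>" "(a, a') \<in> Z" "(b, b') \<in> Z"
        using ch unfolding subset_chain_def by (metis subsetD)
      show "(a - b, a' - b') \<in> \<Union>\<C>" using Z graph_diff[OF dg(1)] by blast
      show "(a * b, a * b' + a' * b) \<in> \<Union>\<C>" using Z graph_mult[OF dg(1)] by blast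
    next
      fix c assume "(0, c) \<in> \<Union>\<C>"
      thus "c = 0" using graph_zeroD[OF dg(1)] by blast
    qed
    thus "\<Union>\<C> \<in> \<A>" using ne dg unfolding \<A>_def by blast
  qed
  then obtain M where M: "M \<in> \<A>" and max: "\<And>X. X \<in> \<A> \<Longrightarrow> M \<subseteq> X \<Longrightarrow> X = M" by blast
  have dM: "derivation_graph M" using M by (simp add: \<A>_def)
  have tot: "\<exists>c. (a, c) \<in> M" for a
  proof -
    obtain c where c: "\<And>p p'. graph_poly M p p' \<Longrightarrow> poly p a = 0 \<Longrightarrow> poly_diff a c p p' = 0"
      using graph_adjoin_ex[OF dM] by blast
    note ad = graph_adjoin[OF dM c]
    have "adjoin M a c \<in> \<A>" using ad M by (auto simp: \<A>_def)
    hence "adjoin M a c = M" using max ad by blast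
    thus ?thesis using ad by blast
  qed
  define D where "D a = (SOME c. (a, c) \<in> M)" for a
  have D: "(a, D a) \<in> M" for a unfolding D_def using tot by (rule someI_ex)
  note uniq = graph_unique[OF dM]
  have "derivation D" unfolding derivation_def
    using uniq[OF D graph_add[OF dM D D]] uniq[OF D graph_mult[OF dM D D]] by auto
  moreover have "D x = 1" using M Gx uniq[OF D] by (auto simp: \<A>_def)
  ultimately show ?thesis by (rule that)
qed

theorem algebraic_iff_derivation:
  "algebraic (x :: real) \<longleftrightarrow> (\<forall>D. derivation D \<longrightarrow> D x = 0)"
  using derivation_algebraic transcendental_derivation by (metis zero_neq_one)

section \<open>Closure properties of the algebraic numbers\<close>

lemma algebraic_add: "algebraic (x :: real) \<Longrightarrow> algebraic y \<Longrightarrow> algebraic (x + y)"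
  by (auto simp: algebraic_iff_derivation derivation_add)

lemma algebraic_mult: "algebraic (x :: real) \<Longrightarrow> algebraic y \<Longrightarrow> algebraic (x * y)"
  by (auto simp: algebraic_iff_derivation derivation_mult)

lemma algebraic_diff: "algebraic (x :: real) \<Longrightarrow> algebraic y \<Longrightarrow> algebraic (x - y)"
  by (auto simp: algebraic_iff_derivation derivation_diff)

lemma algebraic_divide: "algebraic (x :: real) \<Longrightarrow> algebraic y \<Longrightarrow> algebraic (x / y)"
  unfolding divide_inverse by (intro algebraic_mult algebraic_inverse)

lemma algebraic_sum: "(\<And>i. i \<in> I \<Longrightarrow> algebraic (f i :: real)) \<Longrightarrow> algebraic (sum f I)"
  by (induction I rule: infinite_finite_induct) (auto simp: algebraic_add)

lemma algebraic_prod: "(\<And>i. i \<in> I \<Longrightarrow> algebraic (f i :: real)) \<Longrightarrow> algebraic (prod f I)"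
  by (induction I rule: infinite_finite_induct) (auto simp: algebraic_mult rat_imp_algebraic)

text \<open>The rules for powers and products are stated for \<open>D x / x\<close>, since
  logarithmic derivatives turn the multiplicative Nahm equations into linear ones.\<close>

lemma derivation_power:
  assumes D: "derivation D" and x: "x \<noteq> 0"
  shows "D (x ^ n) / x ^ n = of_nat n * (D x / x)"
proof (induction n)
  case (Suc n)
  have "D (x ^ Suc n) / x ^ Suc n = D (x ^ n) / x ^ n + D x / x"
    using x by (simp add: derivation_mult[OF D] divide_simps)
  thus ?case using Suc by (simp add: algebra_simps add_divide_distrib)
qed (use D in \<open>simp add: derivation_1\<close>)

lemma derivation_inverse:
  assumes D: "derivation D" and x: "x \<noteq> 0"
  shows "D (inverse x) / inverse x = - (D x / x)"
proof -
  have "D (x * inverse x) = x * D (inverse x) + D x * inverse x" by (rule derivation_mult[OF D])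
  hence "x * D (inverse x) + D x * inverse x = 0" using x D by (simp add: derivation_1)
  thus ?thesis using x by (simp add: field_simps add_eq_0_iff)
qed

text \<open>With \<open>a = m / n\<close> and \<open>y = x powr a\<close>, the relation
  \<open>y ^ n = x powr m\<close> is compared through the logarithmic derivatives of both
  sides.\<close>

lemma derivation_powr:
  assumes D: "derivation D" and x: "x > 0" and a: "a \<in> \<rat>"
  shows "D (x powr a) / x powr a = a * (D x / x)"
proof -
  obtain m :: int and n :: nat where n: "n > 0" and a: "a = m / n"
    using a by (rule Rats_cases') (metis of_int_of_nat_eq zero_less_imp_eq_int of_nat_0_less_iff)
  define y where "y = x powr a"
  have y: "y > 0" using x by (simp add: y_def)
  have "y ^ n = x powr m" using n x by (simp add: y_def powr_power a)
  moreover have "D (x powr m) / x powr m = m * (D x / x)"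
  proof (cases "m \<ge> 0")
    case True
    then obtain k where "m = int k" using nonneg_int_cases by blast
    thus ?thesis using derivation_power[OF D, of x k] x by (simp add: powr_realpow)
  next
    case False
    then obtain k where k: "m = - int k" by (metis int_cases2 of_nat_0_le_iff)
    have "x powr m = inverse (x ^ k)" using x k by (simp add: powr_minus powr_realpow)
    moreover have "x ^ k \<noteq> 0" using x by simp
    ultimately show ?thesis
      using derivation_power[OF D, of x k] derivation_inverse[OF D, of "x ^ k"] x k by simp
  qed
  ultimately have "of_nat n * (D y / y) = m * (D x / x)"
    using derivation_power[OF D, of y n] y by simp
  hence "(of_nat n * (D y / y)) / of_nat n = (m * (D x / x)) / of_nat n" by simp
  hence "D y / y = m / n * (D x / x)" using n by simp
  thus ?thesis by (simp add: y_def a)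
qed

lemma algebraic_powr:
  fixes x :: real
  assumes "algebraic x" "x > 0" "a \<in> \<rat>"
  shows "algebraic (x powr a)"
  unfolding algebraic_iff_derivation
proof (intro allI impI)
  fix D assume D: "derivation D"
  hence "D x = 0" using assms by (simp add: algebraic_iff_derivation)
  hence "D (x powr a) / x powr a = 0" using derivation_powr[OF D, of x a] assms by simp
  thus "D (x powr a) = 0" using assms(2) by simp
qed

lemma derivation_prod:
  assumes D: "derivation D" and "finite I" "\<And>i. i \<in> I \<Longrightarrow> f i \<noteq> 0"
  shows "D (prod f I) / prod f I = (\<Sum>i\<in>I. D (f i) / f i)"
  using assms(2,3)
proof (induction I rule: finite_induct)
  case (insert i I)
  have "prod f I \<noteq> 0" using insert by auto
  thus ?case using insert by (simp add: derivation_mult[OF D] divide_simps) (simp add: algebra_simps)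
qed (use D in \<open>simp add: derivation_1\<close>)

lemma nahm_solution_algebraic:
  fixes A :: "real^'r^'r"
  assumes pd: "positive_definite A" and Q: "nahm_solution A Q" and A: "\<forall>i j. A $ i $ j \<in> \<rat>"
  shows "algebraic (Q $ i)"
  unfolding algebraic_iff_derivation
proof (intro allI impI)
  fix D assume D: "derivation D"
  define y where "y = (\<chi> i. D (Q $ i) / Q $ i)"
  have Q01: "0 < Q $ i" "Q $ i < 1" for i using Q by (auto simp: nahm_solution_def)
  \<comment> \<open>Logarithmic differentiation of equation \<open>i\<close>. The negative factor on
    the right makes the quadratic form of \<open>A\<close> nonpositive at \<open>y\<close>.\<close>
  have Ay: "(A *v y) $ i = - (Q $ i / (1 - Q $ i)) * y $ i" for i
  proof -
    have ne: "Q $ j powr A $ i $ j \<noteq> 0" for j using Q01[of j] by simp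
    have "1 - Q $ i = (\<Prod>j\<in>UNIV. Q $ j powr A $ i $ j)" using Q by (simp add: nahm_solution_def)
    hence "D (1 - Q $ i) / (1 - Q $ i) = (\<Sum>j\<in>UNIV. D (Q $ j powr A $ i $ j) / (Q $ j powr A $ i $ j))"
      using derivation_prod[OF D finite, of UNIV "\<lambda>j. Q $ j powr A $ i $ j"] ne by simp
    also have "\<dots> = (A *v y) $ i"
      by (simp add: matrix_vector_mult_def y_def derivation_powr[OF D Q01(1)] A[rule_format])
    also have "D (1 - Q $ i) = - D (Q $ i)"
      using D by (simp add: derivation_diff derivation_1)
    finally show ?thesis using Q01[of i] by (simp add: y_def field_simps)
  qed
  have "y \<bullet> (A *v y) = (\<Sum>i\<in>UNIV. - (Q $ i / (1 - Q $ i)) * (y $ i)\<^sup>2)"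
    by (simp add: inner_vec_def Ay power2_eq_square algebra_simps)
  also have "\<dots> \<le> 0" using Q01 by (intro sum_nonpos) (simp add: less_imp_le)
  finally have "y = 0" using pd unfolding positive_definite_def by force
  hence "y $ i = 0" by simp
  thus "D (Q $ i) = 0" using Q01[of i] by (simp add: y_def)
qed

section \<open>The potential of the Nahm equations\<close>

lemma summable_Li2:
  assumes "\<bar>x\<bar> \<le> 1" shows "summable (\<lambda>n. x ^ Suc n / (real (Suc n))\<^sup>2)"
proof (rule summable_comparison_test'[of "\<lambda>n. 1 / (real (Suc n))\<^sup>2" 0])
  show "summable (\<lambda>n. 1 / (real (Suc n))\<^sup>2)" using inverse_squares_sums by (auto simp: sums_iff)
  fix n :: nat
  have "\<bar>x\<bar> ^ Suc n \<le> 1" using assms by (intro power_le_one) auto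
  thus "norm (x ^ Suc n / (real (Suc n))\<^sup>2) \<le> 1 / (real (Suc n))\<^sup>2"
    by (simp add: power_abs divide_simps abs_mult)
qed

lemma Li2_1: "Li2 1 = pi\<^sup>2 / 6"
  using inverse_squares_sums by (simp add: Li2_def sums_iff)

lemma abs_Li2_le:
  assumes "\<bar>x\<bar> \<le> 1" shows "\<bar>Li2 x\<bar> \<le> pi\<^sup>2 / 6 * \<bar>x\<bar>"
proof -
  have s: "summable (\<lambda>n. 1 / (real (Suc n))\<^sup>2)" using inverse_squares_sums by (auto simp: sums_iff)
  have "norm (x ^ Suc n / (real (Suc n))\<^sup>2) \<le> \<bar>x\<bar> * (1 / (real (Suc n))\<^sup>2)" for n
  proof -
    have "\<bar>x\<bar> ^ n \<le> 1" using assms by (intro power_le_one) auto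
    hence "\<bar>x\<bar> * \<bar>x\<bar> ^ n \<le> \<bar>x\<bar> * 1" by (intro mult_left_mono) auto
    thus ?thesis by (simp add: power_abs divide_simps abs_mult)
  qed
  hence "norm (Li2 x) \<le> (\<Sum>n. \<bar>x\<bar> * (1 / (real (Suc n))\<^sup>2))"
    unfolding Li2_def using s by (intro norm_suminf_le summable_mult) auto
  also have "\<dots> = \<bar>x\<bar> * (pi\<^sup>2 / 6)"
    using s inverse_squares_sums by (subst suminf_mult) (auto simp: sums_iff)
  finally show ?thesis by (simp add: mult.commute)
qed

lemma Li2_nonneg: "0 \<le> x \<Longrightarrow> x \<le> 1 \<Longrightarrow> 0 \<le> Li2 x"
  unfolding Li2_def by (intro suminf_nonneg summable_Li2) auto

lemma continuous_on_Li2: "continuous_on {-1..1} Li2"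
proof -
  have "uniform_limit {-1..1} (\<lambda>n x. \<Sum>i<n. x ^ Suc i / (real (Suc i))\<^sup>2)
     (\<lambda>x. \<Sum>i. x ^ Suc i / (real (Suc i))\<^sup>2) sequentially"
  proof (rule Weierstrass_m_test)
    show "summable (\<lambda>n. 1 / (real (Suc n))\<^sup>2)" using inverse_squares_sums by (auto simp: sums_iff)
    fix n :: nat and x :: real assume "x \<in> {-1..1}"
    hence "\<bar>x\<bar> ^ Suc n \<le> 1" by (intro power_le_one) auto
    thus "norm (x ^ Suc n / (real (Suc n))\<^sup>2) \<le> 1 / (real (Suc n))\<^sup>2"
      by (simp add: power_abs divide_simps abs_mult)
  qed
  thus ?thesis unfolding Li2_def [abs_def]
    by (rule uniform_limit_theorem[rotated]) (auto intro!: always_eventually continuous_intros)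
qed

lemma minus_ln_series:
  assumes "\<bar>z::real\<bar> < 1" shows "(\<lambda>n. z ^ Suc n / real (Suc n)) sums (- ln (1 - z))"
proof -
  have "ln (1 - z) = (\<Sum>n. (- 1) ^ n * (1 / real (n + 1)) * (1 - z - 1) ^ Suc n)"
    using assms by (intro ln_series) auto
  also have "(\<lambda>n. (- 1) ^ n * (1 / real (n + 1)) * (1 - z - 1) ^ Suc n) = (\<lambda>n. - (z ^ Suc n / real (Suc n)))"
  proof
    fix n :: nat
    have "(1 - z - 1) ^ Suc n = (- 1) ^ Suc n * z ^ Suc n" by (simp add: power_mult_distrib[symmetric])
    thus "(- 1) ^ n * (1 / real (n + 1)) * (1 - z - 1) ^ Suc n = - (z ^ Suc n / real (Suc n))"
      by (simp add: power_add[symmetric] mult_2[symmetric] divide_simps flip: power_mult_distrib)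
  qed
  finally have ln: "ln (1 - z) = (\<Sum>n. - (z ^ Suc n / real (Suc n)))" .
  have "summable (\<lambda>n. z ^ Suc n / real (Suc n))"
  proof (rule summable_comparison_test'[of "\<lambda>n. \<bar>z\<bar> ^ Suc n" 0])
    show "summable (\<lambda>n. \<bar>z\<bar> ^ Suc n)" using assms by (intro summable_Suc_iff[THEN iffD2] summable_geometric) auto
    fix n
    have "\<bar>z\<bar> ^ Suc n * 1 \<le> \<bar>z\<bar> ^ Suc n * real (Suc n)" by (intro mult_left_mono) auto
    thus "norm (z ^ Suc n / real (Suc n)) \<le> \<bar>z\<bar> ^ Suc n"
      by (simp add: power_abs abs_mult divide_simps)
  qed
  thus ?thesis unfolding ln by (simp add: suminf_minus sums_iff)
qed

text \<open>Both signs occur: \<sigma> = 1 gives \<open>dilog\<close>, and \<sigma> = -1 the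
  primitive behind the sums of \<open>ln (1 + exp (- x))\<close> that evaluate
  \<open>tail_log\<close> at 0.\<close>

lemma DERIV_Li2_exp:
  fixes \<sigma> :: real
  assumes x: "x > 0" and \<sigma>: "\<bar>\<sigma>\<bar> = 1"
  shows "((\<lambda>x. Li2 (\<sigma> * exp (- x))) has_real_derivative ln (1 - \<sigma> * exp (- x))) (at x)"
proof -
  define c where "c n = (if n = 0 then 0 else 1 / (real n)\<^sup>2)" for n
  have Li2': "(\<lambda>n. c n * y ^ n) sums Li2 y" if "\<bar>y\<bar> \<le> 1" for y
  proof -
    have "(\<lambda>n. c (Suc n) * y ^ Suc n) sums Li2 y"
      using summable_sums[OF summable_Li2[OF that]] by (simp add: Li2_def c_def del: power_Suc of_nat_Suc)
    thus ?thesis by (subst (asm) sums_Suc_iff) (simp add: c_def)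
  qed
  hence Li2: "Li2 y = (\<Sum>n. c n * y ^ n)" and smc: "summable (\<lambda>n. c n * y ^ n)" if "\<bar>y\<bar> \<le> 1" for y
    using that by (auto simp: sums_iff)
  define z where "z = \<sigma> * exp (- x)"
  have z: "\<bar>z\<bar> < 1" using x \<sigma> by (simp add: z_def abs_mult)
  have s1: "summable (\<lambda>n. c n * 1 ^ n)"
    by (rule smc) simp
  have d0: "((\<lambda>y. \<Sum>n. c n * y ^ n) has_real_derivative (\<Sum>n. diffs c n * z ^ n)) (at z)"
    by (rule termdiffs_strong[OF s1]) (use z in auto)
  have "eventually (\<lambda>y. y \<in> {-1<..<1}) (nhds z)"
    using z by (intro eventually_nhds_in_open) auto
  hence "eventually (\<lambda>y. Li2 y = (\<Sum>n. c n * y ^ n)) (nhds z)"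
    by eventually_elim (auto intro!: Li2)
  note ev = this
  have d: "(Li2 has_real_derivative (\<Sum>n. diffs c n * z ^ n)) (at z)"
    using d0 by (subst DERIV_cong_ev[OF refl ev refl])
  have "((\<lambda>x. Li2 (\<sigma> * exp (- x))) has_real_derivative (\<Sum>n. diffs c n * z ^ n) * (\<sigma> * (exp (- x) * (- 1)))) (at x)"
    unfolding z_def by (rule DERIV_chain2[where f=Li2 and g="\<lambda>x. \<sigma> * exp (- x)", OF d[unfolded z_def]]) (auto intro!: derivative_eq_intros)
  also have "(\<Sum>n. diffs c n * z ^ n) * (\<sigma> * (exp (- x) * (- 1))) = - ((\<Sum>n. diffs c n * z ^ n) * z)"
    by (simp add: z_def)
  also have "(\<Sum>n. diffs c n * z ^ n) * z = - ln (1 - z)"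
  proof -
    have sm: "summable (\<lambda>n. diffs c n * z ^ n)"
      by (rule termdiff_converges[of z 1]) (use z in \<open>auto intro: smc\<close>)
    have "(\<Sum>n. diffs c n * z ^ n) * z = (\<Sum>n. diffs c n * z ^ n * z)"
      using sm by (rule suminf_mult2)
    also have "(\<lambda>n. diffs c n * z ^ n * z) = (\<lambda>n. z ^ Suc n / real (Suc n))"
      by (simp add: fun_eq_iff diffs_def c_def power2_eq_square)
    also have "suminf \<dots> = - ln (1 - z)" using minus_ln_series[OF z] by (simp add: sums_iff)
    finally show ?thesis .
  qed
  finally show ?thesis by (simp add: z_def)
qed

text \<open>In \<open>Li2 1 + Li2 (- 1)\<close> the terms with odd exponent cancel, and the others
  add up to half of \<open>Li2 1\<close>.\<close>

lemma Li2_m1: "Li2 (- 1) = - (pi\<^sup>2 / 12)"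
proof -
  define f :: "nat \<Rightarrow> real" where "f n = (1 + (-1) ^ Suc n) / (real (Suc n))\<^sup>2" for n
  have s: "summable (\<lambda>n. 1 ^ Suc n / (real (Suc n))\<^sup>2 :: real)" "summable (\<lambda>n. (-1) ^ Suc n / (real (Suc n))\<^sup>2 :: real)"
    by (rule summable_Li2; simp)+
  have "f sums (Li2 1 + Li2 (- 1))"
    unfolding Li2_def f_def add_divide_distrib
    using sums_add[OF summable_sums[OF s(1)] summable_sums[OF s(2)]] by (simp only: power_one)
  moreover have "(f \<circ> (\<lambda>m. 2 * m + 1)) sums (pi\<^sup>2 / 12)"
  proof -
    have "(\<lambda>m. 1 / 2 * (1 / (real (Suc m))\<^sup>2)) sums (1 / 2 * (pi\<^sup>2 / 6))"
      by (intro sums_mult) (use inverse_squares_sums in \<open>simp add: add.commute\<close>)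
    moreover have "1 / 2 * (1 / (real (Suc m))\<^sup>2) = f (2 * m + 1)" for m
      by (simp add: f_def divide_simps power2_eq_square) (simp add: algebra_simps)
    ultimately show ?thesis by (simp add: o_def)
  qed
  moreover have "(f \<circ> (\<lambda>m. 2 * m + 1)) sums c \<longleftrightarrow> f sums c" for c
    unfolding o_def
  proof (rule sums_mono_reindex)
    show "strict_mono (\<lambda>m::nat. 2 * m + 1)" by (auto simp: strict_mono_def)
    fix n :: nat assume "n \<notin> range (\<lambda>m. 2 * m + 1)"
    hence "even n" by (metis oddE rangeI)
    thus "f n = 0" by (simp add: f_def)
  qed
  ultimately have "f sums (Li2 1 + Li2 (- 1))" "f sums (pi\<^sup>2 / 12)" by blast+
  hence "Li2 1 + Li2 (- 1) = pi\<^sup>2 / 12" by (rule sums_unique2)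
  thus ?thesis by (simp add: Li2_1)
qed

text \<open>In the coordinate \<open>x = - ln Q\<close> the dilogarithm is convex on the half line,
  with derivative \<open>ln (1 - exp (- x))\<close>; this is the reason for working with
  \<open>u\<close> instead of \<open>Q\<close>.\<close>

definition dilog :: "real \<Rightarrow> real" where "dilog x = Li2 (exp (- x))"

lemma dilog_0: "dilog 0 = pi\<^sup>2 / 6" by (simp add: dilog_def Li2_1)

lemma dilog_nonneg: "x \<ge> 0 \<Longrightarrow> dilog x \<ge> 0" by (simp add: dilog_def Li2_nonneg)

lemma continuous_on_dilog: "continuous_on {0..} dilog"
proof -
  have "- 1 \<le> exp (- x)" for x :: real by (rule order_trans[of _ 0]) auto
  thus ?thesis unfolding dilog_def
    by (intro continuous_on_compose2[OF continuous_on_Li2]) (auto intro!: continuous_intros)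
qed

lemma DERIV_dilog: "x > 0 \<Longrightarrow> (dilog has_real_derivative ln (1 - exp (- x))) (at x)"
  using DERIV_Li2_exp[of x 1] by (simp add: dilog_def[abs_def])

lemma ln_one_minus_exp_mono:
  "0 < x \<Longrightarrow> x \<le> y \<Longrightarrow> ln (1 - exp (- x)) \<le> ln (1 - exp (- y :: real))"
  by (subst ln_le_cancel_iff) auto

text \<open>The derivative \<open>ln (1 - exp (- x))\<close> increases, so the graph lies above its
  tangents. The value \<open>v = 0\<close>, where the derivative formula breaks down, is reached by
  continuity; it occurs for vectors \<open>n\<close> with zero entries.\<close>

lemma dilog_tangent:
  assumes u: "u > 0" and v: "v \<ge> 0"
  shows "dilog v \<ge> dilog u + (v - u) * ln (1 - exp (- u))"
proof (cases v u rule: linorder_cases)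
  case less
  have "\<exists>l z. v < z \<and> z < u \<and> DERIV dilog z :> l \<and> dilog u - dilog v = (u - v) * l"
    using less v by (intro MVT)
      (auto intro: continuous_on_subset[OF continuous_on_dilog] simp: real_differentiable_def intro!: exI DERIV_dilog)
  then obtain l z where z: "v < z" "z < u" "DERIV dilog z :> l" "dilog u - dilog v = (u - v) * l" by blast
  have "l = ln (1 - exp (- z))" using z v by (intro DERIV_unique[OF z(3) DERIV_dilog]) auto
  also have "\<dots> \<le> ln (1 - exp (- u))" using z v by (intro ln_one_minus_exp_mono) auto
  finally have "(u - v) * l \<le> (u - v) * ln (1 - exp (- u))" using less by (intro mult_left_mono) auto
  thus ?thesis using z(4) by (simp add: algebra_simps)
next
  case greater
  have "\<exists>l z. u < z \<and> z < v \<and> DERIV dilog z :> l \<and> dilog v - dilog u = (v - u) * l"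
    using greater u by (intro MVT)
      (auto intro: continuous_on_subset[OF continuous_on_dilog] simp: real_differentiable_def intro!: exI DERIV_dilog)
  then obtain l z where z: "u < z" "z < v" "DERIV dilog z :> l" "dilog v - dilog u = (v - u) * l" by blast
  have "l = ln (1 - exp (- z))" using z u by (intro DERIV_unique[OF z(3) DERIV_dilog]) auto
  also have "\<dots> \<ge> ln (1 - exp (- u))" using z u by (intro ln_one_minus_exp_mono) auto
  finally have "(v - u) * l \<ge> (v - u) * ln (1 - exp (- u))" using greater by (intro mult_left_mono) auto
  thus ?thesis using z(4) by (simp add: algebra_simps)
qed auto

lemma qfact_pos:
  assumes "0 < q" "q < 1" shows "qfact q n > 0"
  unfolding qfact_def using assms by (intro prod_pos) (auto intro: power_less_one_iff[THEN iffD2])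

lemma qfact_Suc: "qfact q (Suc n) = qfact q n * (1 - q ^ Suc n)"
  by (simp add: qfact_def)

text \<open>The tangent inequality at \<open>k * \<epsilon>\<close> bounds
  \<open>- ln (1 - exp (- (k * \<epsilon>)))\<close> by the decrease of
  \<open>dilog / \<epsilon>\<close> over the step ending there, and these bounds telescope.\<close>

lemma inverse_qfact_le:
  assumes e: "\<epsilon> > 0"
  shows "1 / qfact (exp (- \<epsilon>)) n \<le> exp ((pi\<^sup>2 / 6 - dilog (real n * \<epsilon>)) / \<epsilon>)"
proof (induction n)
  case 0 then show ?case by (simp add: qfact_def dilog_0)
next
  case (Suc n)
  let ?u = "real (Suc n) * \<epsilon>"
  have pos: "?u > 0" using e by simp
  have lt: "exp (- ?u) < 1" using pos by (subst exp_less_one_iff) simp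
  have q: "exp (- \<epsilon>) ^ Suc n = exp (- ?u)" by (simp only: exp_of_nat_mult[symmetric]) simp
  have "dilog (real n * \<epsilon>) \<ge> dilog ?u + (real n * \<epsilon> - ?u) * ln (1 - exp (- ?u))"
    using pos e by (intro dilog_tangent) auto
  also have "real n * \<epsilon> - ?u = - \<epsilon>" by (simp add: algebra_simps)
  finally have "- ln (1 - exp (- ?u)) \<le> (dilog (real n * \<epsilon>) - dilog ?u) / \<epsilon>"
    using e by (simp add: field_simps)
  hence "exp (- ln (1 - exp (- ?u))) \<le> exp ((dilog (real n * \<epsilon>) - dilog ?u) / \<epsilon>)" by simp
  hence *: "1 / (1 - exp (- ?u)) \<le> exp ((dilog (real n * \<epsilon>) - dilog ?u) / \<epsilon>)"
    using lt by (simp add: exp_minus inverse_eq_divide)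
  have "1 / qfact (exp (- \<epsilon>)) (Suc n) = 1 / qfact (exp (- \<epsilon>)) n * (1 / (1 - exp (- ?u)))"
    unfolding qfact_Suc q by simp
  also have "\<dots> \<le> exp ((pi\<^sup>2 / 6 - dilog (real n * \<epsilon>)) / \<epsilon>) * exp ((dilog (real n * \<epsilon>) - dilog ?u) / \<epsilon>)"
    using lt by (intro mult_mono Suc.IH *) auto
  also have "\<dots> = exp ((pi\<^sup>2 / 6 - dilog ?u) / \<epsilon>)"
    by (simp add: exp_add[symmetric] add_divide_distrib[symmetric])
  finally show ?case .
qed

section \<open>Critical points of the potential\<close>

lemma symmetric_inner_matrix:
  fixes A :: "real^'r^'r"
  assumes "transpose A = A" shows "x \<bullet> (A *v y) = y \<bullet> (A *v x)"
  by (metis assms dot_lmul_matrix inner_commute vector_transpose_matrix)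

text \<open>The constant is the minimum of the quadratic form on the unit sphere.\<close>

lemma positive_definite_lower:
  fixes A :: "real^'r^'r"
  assumes "positive_definite A"
  obtains c where "c > 0" "\<And>x. x \<bullet> (A *v x) \<ge> c * (norm x)\<^sup>2"
proof -
  have "compact (sphere 0 1 :: (real^'r) set)" by simp
  moreover have "sphere 0 1 \<noteq> ({} :: (real^'r) set)" by simp
  moreover have "continuous_on (sphere 0 1) (\<lambda>x. x \<bullet> (A *v x))" by (intro continuous_intros)
  ultimately obtain x0 where x0: "x0 \<in> sphere 0 1" "\<And>x. x \<in> sphere 0 1 \<Longrightarrow> x0 \<bullet> (A *v x0) \<le> x \<bullet> (A *v x)"
    using continuous_attains_inf by metis
  define c where "c = x0 \<bullet> (A *v x0)"
  have "x0 \<noteq> 0" using x0 by auto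
  hence "c > 0" using assms unfolding positive_definite_def c_def by blast
  moreover have "x \<bullet> (A *v x) \<ge> c * (norm x)\<^sup>2" for x
  proof (cases "x = 0")
    case False
    have "c \<le> (x /\<^sub>R norm x) \<bullet> (A *v (x /\<^sub>R norm x))" unfolding c_def
      by (rule x0(2)) (use False in simp)
    also have "\<dots> = (x \<bullet> (A *v x)) / (norm x)\<^sup>2"
      by (simp add: matrix_vector_mult_scaleR power2_eq_square divide_simps)
    finally show ?thesis using False by (simp add: field_simps)
  qed simp
  ultimately show ?thesis by (rule that)
qed

definition nahm_potential :: "real^'r^'r \<Rightarrow> real^'r \<Rightarrow> real" where
  "nahm_potential A u = 1/2 * (u \<bullet> (A *v u)) + (\<Sum>i\<in>UNIV. dilog (u $ i))"

text \<open>Taking logarithms turns the Nahm equations into the vanishing of the gradient of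
  \<open>nahm_potential\<close>.\<close>

lemma nahm_solution_critical:
  fixes A :: "real^'r^'r"
  assumes "nahm_solution A Q"
  defines "u \<equiv> (\<chi> i. - ln (Q $ i))"
  shows "u $ i > 0" "Q $ i = exp (- u $ i)" "(A *v u) $ i = - ln (1 - exp (- u $ i))"
proof -
  have Q: "0 < Q $ i" "Q $ i < 1" for i using assms by (auto simp: nahm_solution_def)
  show "u $ i > 0" "Q $ i = exp (- u $ i)" using Q[of i] by (auto simp: u_def)
  have "1 - Q $ i = (\<Prod>j\<in>UNIV. Q $ j powr A $ i $ j)" using assms by (simp add: nahm_solution_def)
  hence "ln (1 - Q $ i) = ln (\<Prod>j\<in>UNIV. Q $ j powr A $ i $ j)" by (rule arg_cong)
  also have "\<dots> = (\<Sum>j\<in>UNIV. ln (Q $ j powr A $ i $ j))"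
    using Q by (intro ln_prod) (auto, metis less_irrefl)
  also have "\<dots> = - (A *v u) $ i"
    using Q by (simp add: matrix_vector_mult_def u_def ln_powr sum_negf)
  finally show "(A *v u) $ i = - ln (1 - exp (- u $ i))" using Q[of i] by (simp add: u_def)
qed

lemma critical_nahm_solution:
  fixes A :: "real^'r^'r"
  assumes u: "\<And>i. u $ i > 0" "\<And>i. (A *v u) $ i = - ln (1 - exp (- u $ i))"
  shows "nahm_solution A (\<chi> i. exp (- u $ i))"
  unfolding nahm_solution_def
proof (intro conjI allI)
  fix i
  show "0 < (\<chi> i. exp (- u $ i)) $ i" "(\<chi> i. exp (- u $ i)) $ i < 1" using u(1) by auto
  have "1 - exp (- u $ i) = exp (- (A *v u) $ i)" using u(1)[of i] u(2)[of i] by simp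
  also have "\<dots> = (\<Prod>j\<in>UNIV. exp (- u $ j) powr (A $ i $ j))"
    by (simp add: matrix_vector_mult_def sum_negf[symmetric] exp_sum powr_def algebra_simps)
  finally show "1 - (\<chi> i. exp (- u $ i)) $ i = (\<Prod>j\<in>UNIV. (\<chi> i. exp (- u $ i)) $ j powr A $ i $ j)"
    by simp
qed

text \<open>Summing the tangent inequalities over the coordinates leaves a linear term in
  \<open>v - u\<close>, which cancels the linear term of the quadratic part precisely because
  \<open>u\<close> is critical.\<close>

lemma nahm_potential_lower:
  fixes A :: "real^'r^'r"
  assumes sym: "transpose A = A"
    and u: "\<And>i. u $ i > 0" "\<And>i. (A *v u) $ i = - ln (1 - exp (- u $ i))"
    and v: "\<And>i. v $ i \<ge> 0"
  shows "nahm_potential A v \<ge> nahm_potential A u + 1/2 * ((v - u) \<bullet> (A *v (v - u)))"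
proof -
  have "(\<Sum>i\<in>UNIV. dilog (v $ i)) \<ge> (\<Sum>i\<in>UNIV. dilog (u $ i) + (v $ i - u $ i) * ln (1 - exp (- u $ i)))"
    by (intro sum_mono dilog_tangent u v)
  also have "(\<Sum>i\<in>UNIV. dilog (u $ i) + (v $ i - u $ i) * ln (1 - exp (- u $ i)))
     = (\<Sum>i\<in>UNIV. dilog (u $ i)) - (v - u) \<bullet> (A *v u)"
    by (simp add: inner_vec_def u(2) sum.distrib sum_negf algebra_simps sum_subtractf)
  finally show ?thesis
    using symmetric_inner_matrix[OF sym, of u v]
    by (simp add: nahm_potential_def matrix_vector_mult_diff_distrib inner_diff_left inner_diff_right algebra_simps)
qed

text \<open>The gradient of the potential is strictly monotone: the linear part by positive
  definiteness, the logarithmic part because \<open>ln (1 - exp (- x))\<close> increases.\<close>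

lemma nahm_critical_unique:
  fixes A :: "real^'r^'r"
  assumes pd: "positive_definite A"
    and u: "\<And>i. u $ i > 0" "\<And>i. (A *v u) $ i = - ln (1 - exp (- u $ i))"
    and v: "\<And>i. v $ i > 0" "\<And>i. (A *v v) $ i = - ln (1 - exp (- v $ i))"
  shows "u = v"
proof -
  have "(u - v) \<bullet> (A *v (u - v)) = (\<Sum>i\<in>UNIV. (u $ i - v $ i) * (ln (1 - exp (- v $ i)) - ln (1 - exp (- u $ i))))"
    by (simp add: inner_vec_def matrix_vector_mult_diff_distrib u v algebra_simps)
  also have "\<dots> \<le> 0"
  proof (intro sum_nonpos)
    fix i
    show "(u $ i - v $ i) * (ln (1 - exp (- v $ i)) - ln (1 - exp (- u $ i))) \<le> 0"
      using ln_one_minus_exp_mono[OF u(1)[of i], of "v $ i"] ln_one_minus_exp_mono[OF v(1)[of i], of "u $ i"]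
      by (cases "u $ i \<le> v $ i") (auto simp: mult_nonneg_nonpos mult_nonpos_nonneg)
  qed
  finally have "u - v = 0" using pd unfolding positive_definite_def by (meson linorder_not_le)
  thus ?thesis by simp
qed

text \<open>The potential along a coordinate line, the form in which minimality is exploited both at
  the boundary and in the interior.\<close>

lemma nahm_potential_shift:
  fixes A :: "real^'r^'r"
  assumes sym: "transpose A = A"
  shows "nahm_potential A (u + h *\<^sub>R axis i 1) =
    nahm_potential A u + h * (A *v u) $ i + h\<^sup>2 / 2 * A $ i $ i + dilog (u $ i + h) - dilog (u $ i)"
proof -
  have ax: "axis i 1 \<bullet> x = x $ i" for x :: "real^'r"
    by (simp add: inner_axis inner_commute)
  have "(\<Sum>j\<in>UNIV. dilog ((u + h *\<^sub>R axis i 1) $ j)) = (\<Sum>j\<in>UNIV. dilog (u $ j) + (if j = i then dilog (u $ i + h) - dilog (u $ i) else 0))"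
    by (intro sum.cong) (auto simp: axis_def)
  also have "\<dots> = (\<Sum>j\<in>UNIV. dilog (u $ j)) + (dilog (u $ i + h) - dilog (u $ i))"
    by (simp add: sum.distrib)
  finally have 1: "(\<Sum>j\<in>UNIV. dilog ((u + h *\<^sub>R axis i 1) $ j)) = (\<Sum>j\<in>UNIV. dilog (u $ j)) + (dilog (u $ i + h) - dilog (u $ i))" .
  have Aii: "axis i 1 \<bullet> (A *v axis i 1) = A $ i $ i"
    by (simp add: ax matrix_vector_mult_basis column_def)
  have "(u + h *\<^sub>R axis i 1) \<bullet> (A *v (u + h *\<^sub>R axis i 1)) = u \<bullet> (A *v u) + 2 * h * (A *v u) $ i + h\<^sup>2 * A $ i $ i"
    using symmetric_inner_matrix[OF sym, of u "axis i 1"] Aii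
    by (simp add: matrix_vector_right_distrib matrix_vector_mult_scaleR inner_add_left inner_add_right ax
        power2_eq_square algebra_simps)
  thus ?thesis unfolding nahm_potential_def 1 by (simp add: algebra_simps)
qed

text \<open>By coercivity the potential has a minimum on the closed orthant. It cannot lie on the
  boundary, since the slope of \<open>dilog\<close> tends to minus infinity at 0, and at an interior
  minimum all partial derivatives vanish.\<close>

lemma nahm_critical_ex:
  fixes A :: "real^'r^'r"
  assumes sym: "transpose A = A" and pd: "positive_definite A"
  obtains u where "\<And>i. u $ i > 0" "\<And>i. (A *v u) $ i = - ln (1 - exp (- u $ i))"
proof -
  obtain c where c: "c > 0" "\<And>x. x \<bullet> (A *v x) \<ge> c * (norm x)\<^sup>2"
    using positive_definite_lower[OF pd] by blast
  let ?f = "nahm_potential A"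
  \<comment> \<open>Outside the ball of radius \<open>R\<close> the quadratic part alone exceeds the
    value of the potential at 0.\<close>
  define R where "R = 2 * ?f 0 / c + 1"
  define K where "K = {u :: real^'r. \<forall>i. 0 \<le> u $ i} \<inter> cball 0 R"
  have f0: "?f 0 \<ge> 0" by (simp add: nahm_potential_def dilog_0)
  have R: "R \<ge> 1" using f0 c by (simp add: R_def)
  have "closed {u :: real^'r. \<forall>i. 0 \<le> u $ i}"
    by (intro closed_Collect_all closed_Collect_le continuous_intros)
  hence "compact K" unfolding K_def by (intro closed_Int_compact compact_cball)
  moreover have "0 \<in> K" using R by (simp add: K_def)
  moreover have "continuous_on K ?f"
    unfolding nahm_potential_def K_def
    by (intro continuous_intros continuous_on_compose2[OF continuous_on_dilog]) auto
  ultimately obtain u where u: "u \<in> K" "\<And>v. v \<in> K \<Longrightarrow> ?f u \<le> ?f v"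
    using continuous_attains_inf[of K ?f] by blast
  have u0: "0 \<le> u $ i" for i using u by (simp add: K_def)
  have min: "?f u \<le> ?f v" if v: "\<And>i. 0 \<le> v $ i" for v
  proof (cases "v \<in> K")
    case False
    hence nv: "norm v > R" using v by (simp add: K_def)
    have "?f u \<le> ?f 0" using u \<open>0 \<in> K\<close> by blast
    also have "\<dots> \<le> 1/2 * (c * R)" using c by (simp add: R_def field_simps)
    also have "\<dots> \<le> 1/2 * (c * (norm v)\<^sup>2)"
    proof -
      have "R * 1 \<le> norm v * norm v" using nv R by (intro mult_mono) auto
      thus ?thesis using c by (simp add: power2_eq_square)
    qed
    also have "\<dots> \<le> 1/2 * (v \<bullet> (A *v v))" using c(2)[of v] by simp
    also have "\<dots> \<le> ?f v" unfolding nahm_potential_def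
      using v by (simp add: sum_nonneg dilog_nonneg)
    finally show ?thesis .
  qed (use u in blast)
  have pos: "u $ i > 0" for i
  proof (rule ccontr)
    assume "\<not> u $ i > 0"
    hence ui: "u $ i = 0" using u0[of i] by simp
    \<comment> \<open>For \<open>h = exp (- a)\<close> the drop of \<open>dilog\<close> from 0 to
      \<open>h\<close> is at least \<open>h * a\<close>. This beats both contributions of
      \<open>A\<close>, and the summand 1 leaves a strict gain of \<open>h\<close>.\<close>
    define a where "a = \<bar>(A *v u) $ i\<bar> + \<bar>A $ i $ i\<bar> + 1"
    define h where "h = exp (- a)"
    have h: "0 < h" "h \<le> 1" by (auto simp: h_def a_def)
    have "?f u \<le> ?f (u + h *\<^sub>R axis i 1)"
      using u0 h by (intro min) (auto simp: axis_def)
    hence 1: "0 \<le> h * (A *v u) $ i + h\<^sup>2 / 2 * A $ i $ i + dilog h - dilog 0"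
      using ui by (simp add: nahm_potential_shift[OF sym])
    have "dilog 0 \<ge> dilog h + (0 - h) * ln (1 - exp (- h))" using h by (intro dilog_tangent) auto
    moreover have "ln (1 - exp (- h)) \<le> - a"
    proof -
      have "1 - exp (- h) \<le> h" using exp_ge_add_one_self[of "-h"] by simp
      hence "ln (1 - exp (- h)) \<le> ln h" using h by (subst ln_le_cancel_iff) auto
      thus ?thesis by (simp add: h_def)
    qed
    hence "h * ln (1 - exp (- h)) \<le> h * (- a)" using h by (intro mult_left_mono) auto
    moreover have "h * (A *v u) $ i \<le> h * \<bar>(A *v u) $ i\<bar>" using h by (intro mult_left_mono) auto
    moreover have "h\<^sup>2 / 2 * A $ i $ i \<le> h * \<bar>A $ i $ i\<bar>"
    proof -
      have "h\<^sup>2 \<le> h * 1" using h unfolding power2_eq_square by (intro mult_left_mono) auto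
      hence "h\<^sup>2 / 2 * \<bar>A $ i $ i\<bar> \<le> h * \<bar>A $ i $ i\<bar>" using h by (intro mult_right_mono) auto
      moreover have "h\<^sup>2 / 2 * A $ i $ i \<le> h\<^sup>2 / 2 * \<bar>A $ i $ i\<bar>" by (intro mult_left_mono) auto
      ultimately show ?thesis by linarith
    qed
    moreover have "h * \<bar>(A *v u) $ i\<bar> + h * \<bar>A $ i $ i\<bar> + h * (- a) = - h"
      by (simp add: a_def algebra_simps)
    ultimately show False using 1 h by simp
  qed
  moreover have "(A *v u) $ i = - ln (1 - exp (- u $ i))" for i
  proof -
    let ?g = "\<lambda>h. ?f u + h * (A *v u) $ i + h\<^sup>2 / 2 * A $ i $ i + dilog (u $ i + h) - dilog (u $ i)"
    have "(?g has_real_derivative (A *v u) $ i + ln (1 - exp (- u $ i))) (at 0)"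
    proof -
      have "((\<lambda>h. dilog (u $ i + h)) has_real_derivative ln (1 - exp (- u $ i)) * 1) (at 0)"
        by (rule DERIV_chain2[where f=dilog and g="\<lambda>h. u $ i + h"])
           (use DERIV_dilog[OF pos[of i]] in \<open>auto intro!: derivative_eq_intros\<close>)
      thus ?thesis by (auto intro!: derivative_eq_intros)
    qed
    moreover have "u $ i > 0" by (rule pos)
    moreover have "\<forall>y. \<bar>0 - y\<bar> < u $ i \<longrightarrow> ?g 0 \<le> ?g y"
    proof (intro allI impI)
      fix y assume y: "\<bar>0 - y\<bar> < u $ i"
      have "?f u \<le> ?f (u + y *\<^sub>R axis i 1)"
        using u0 y by (intro min) (auto simp: axis_def)
      thus "?g 0 \<le> ?g y" by (simp add: nahm_potential_shift[OF sym])
    qed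
    ultimately have "(A *v u) $ i + ln (1 - exp (- u $ i)) = 0" by (rule DERIV_local_min)
    thus ?thesis by simp
  qed
  ultimately show ?thesis by (rule that)
qed

lemma nahm_solution_unique:
  fixes A :: "real^'r^'r"
  assumes sym: "transpose A = A" and pd: "positive_definite A"
  shows "\<exists>!Q. nahm_solution A Q"
proof (rule ex_ex1I)
  show "\<exists>Q. nahm_solution A Q"
  proof (rule nahm_critical_ex[OF sym pd])
    fix u assume u: "\<And>i. u $ i > 0" "\<And>i. (A *v u) $ i = - ln (1 - exp (- u $ i))"
    show ?thesis using critical_nahm_solution[OF u] by blast
  qed
  fix Q R assume QR: "nahm_solution A Q" "nahm_solution A R"
  have "(\<chi> i. - ln (Q $ i)) = (\<chi> i. - ln (R $ i))"
    by (rule nahm_critical_unique[OF pd nahm_solution_critical(1,3)[OF QR(1)] nahm_solution_critical(1,3)[OF QR(2)]])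
  hence "ln (Q $ i) = ln (R $ i)" for i by (simp add: vec_eq_iff)
  moreover have "Q $ i > 0" "R $ i > 0" for i using QR by (auto simp: nahm_solution_def)
  ultimately show "Q = R" by (simp add: vec_eq_iff)
qed

text \<open>At the solution \<open>ln (Q $ i) * ln (1 - Q $ i)\<close> equals \<open>u $ i\<close>
  times the entry \<open>i\<close> of \<open>A *v u\<close>, so the logarithmic corrections in
  \<open>rogers_L\<close> add up to the quadratic part of the potential.\<close>

lemma sum_rogers_L:
  fixes A :: "real^'r^'r"
  assumes "nahm_solution A Q"
  shows "(\<Sum>i\<in>UNIV. rogers_L 1 - rogers_L (Q $ i)) = nahm_potential A 0 - nahm_potential A (\<chi> i. - ln (Q $ i))"
proof -
  define u where "u = (\<chi> i. - ln (Q $ i))"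
  note u = nahm_solution_critical[OF assms, folded u_def]
  have "rogers_L (Q $ i) = dilog (u $ i) + 1/2 * (u $ i * (A *v u) $ i)" for i
    using u(1)[of i] unfolding u(2)[of i] u(3)[of i] by (simp add: rogers_L_def dilog_def)
  hence "(\<Sum>i\<in>UNIV. rogers_L (Q $ i)) = nahm_potential A u"
    by (simp add: nahm_potential_def sum.distrib inner_vec_def sum_distrib_left)
  thus ?thesis
    by (simp add: sum_subtractf u_def[symmetric] rogers_L_def nahm_potential_def dilog_0)
qed

text \<open>The quadratic lower bound, taken at the point 0, leaves a gap of half the quadratic form
  at \<open>u\<close>.\<close>

lemma sum_rogers_L_pos:
  fixes A :: "real^'r^'r"
  assumes sym: "transpose A = A" and pd: "positive_definite A" and Q: "nahm_solution A Q"
  shows "(\<Sum>i\<in>UNIV. rogers_L 1 - rogers_L (Q $ i)) > 0"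
proof -
  define u where "u = (\<chi> i. - ln (Q $ i))"
  note u = nahm_solution_critical[OF Q, folded u_def]
  have "u \<noteq> 0" using u(1) by (metis less_irrefl zero_index)
  hence "0 < u \<bullet> (A *v u)" using pd by (simp add: positive_definite_def)
  moreover have "nahm_potential A 0 \<ge> nahm_potential A u + 1/2 * ((0 - u) \<bullet> (A *v (0 - u)))"
    by (rule nahm_potential_lower[OF sym u(1,3)]) auto
  ultimately show ?thesis unfolding sum_rogers_L[OF Q] u_def[symmetric]
    using matrix_vector_mult_diff_distrib[of A 0 u] by simp
qed

section \<open>Asymptotic expansions on a domain\<close>

locale expansion_domain =
  fixes D :: "(real \<times> 'a::real_normed_vector) set"
  assumes D01: "(s, t) \<in> D \<Longrightarrow> 0 < s \<and> s \<le> 1"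
begin

text \<open>Order \<open>s ^ M\<close> up to a polynomial in \<open>norm t\<close>. The degree
  \<open>L\<close> may depend on \<open>f\<close> and \<open>M\<close>; Gaussian factors absorb it
  in the end.\<close>

definition bigw :: "nat \<Rightarrow> (real \<Rightarrow> 'a \<Rightarrow> real) \<Rightarrow> bool" where
  "bigw M f \<longleftrightarrow> (\<exists>K L. \<forall>(s,t)\<in>D. \<bar>f s t\<bar> \<le> K * (1 + norm t) ^ L * s ^ M)"

lemma bigwI: "(\<And>s t. (s, t) \<in> D \<Longrightarrow> \<bar>f s t\<bar> \<le> K * (1 + norm t) ^ L * s ^ M) \<Longrightarrow> bigw M f"
  unfolding bigw_def by blast

lemma bigwE:
  assumes "bigw M f"
  obtains K L where "K \<ge> 0" "\<And>s t. (s, t) \<in> D \<Longrightarrow> \<bar>f s t\<bar> \<le> K * (1 + norm t) ^ L * s ^ M"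
proof -
  obtain K L where *: "\<And>s t. (s, t) \<in> D \<Longrightarrow> \<bar>f s t\<bar> \<le> K * (1 + norm t) ^ L * s ^ M"
    using assms unfolding bigw_def by blast
  have "\<bar>f s t\<bar> \<le> \<bar>K\<bar> * (1 + norm t) ^ L * s ^ M" if "(s, t) \<in> D" for s t
  proof -
    have "K * (1 + norm t) ^ L * s ^ M \<le> \<bar>K\<bar> * (1 + norm t) ^ L * s ^ M"
      using D01[OF that] by (intro mult_right_mono) auto
    thus ?thesis using *[OF that] by linarith
  qed
  thus ?thesis using that[of "\<bar>K\<bar>" L] by auto
qed

lemma bigw_add:
  assumes "bigw M f" "bigw M g" shows "bigw M (\<lambda>s t. f s t + g s t)"
proof -
  obtain K L where 1: "K \<ge> 0" "\<And>s t. (s, t) \<in> D \<Longrightarrow> \<bar>f s t\<bar> \<le> K * (1 + norm t) ^ L * s ^ M"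
    using assms(1) by (rule bigwE) blast
  obtain K' L' where 2: "K' \<ge> 0" "\<And>s t. (s, t) \<in> D \<Longrightarrow> \<bar>g s t\<bar> \<le> K' * (1 + norm t) ^ L' * s ^ M"
    using assms(2) by (rule bigwE) blast
  show ?thesis
  proof (rule bigwI)
    fix s t assume st: "(s, t) \<in> D"
    have "K * (1 + norm t) ^ L * s ^ M \<le> K * (1 + norm t) ^ (L + L') * s ^ M"
      using D01[OF st] 1 by (intro mult_right_mono mult_left_mono power_increasing) auto
    moreover have "K' * (1 + norm t) ^ L' * s ^ M \<le> K' * (1 + norm t) ^ (L + L') * s ^ M"
      using D01[OF st] 2 by (intro mult_right_mono mult_left_mono power_increasing) auto
    ultimately show "\<bar>f s t + g s t\<bar> \<le> (K + K') * (1 + norm t) ^ (L + L') * s ^ M"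
      using 1(2)[OF st] 2(2)[OF st] by (simp add: distrib_right)
  qed
qed

lemma bigw_mult:
  assumes "bigw M f" "bigw N g" shows "bigw (M + N) (\<lambda>s t. f s t * g s t)"
proof -
  obtain K L where 1: "K \<ge> 0" "\<And>s t. (s, t) \<in> D \<Longrightarrow> \<bar>f s t\<bar> \<le> K * (1 + norm t) ^ L * s ^ M"
    using assms(1) by (rule bigwE) blast
  obtain K' L' where 2: "K' \<ge> 0" "\<And>s t. (s, t) \<in> D \<Longrightarrow> \<bar>g s t\<bar> \<le> K' * (1 + norm t) ^ L' * s ^ N"
    using assms(2) by (rule bigwE) blast
  show ?thesis
  proof (rule bigwI)
    fix s t assume st: "(s, t) \<in> D"
    have "\<bar>f s t * g s t\<bar> \<le> (K * (1 + norm t) ^ L * s ^ M) * (K' * (1 + norm t) ^ L' * s ^ N)"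
      unfolding abs_mult using 1 2 D01[OF st] st by (intro mult_mono) auto
    thus "\<bar>f s t * g s t\<bar> \<le> (K * K') * (1 + norm t) ^ (L + L') * s ^ (M + N)"
      by (simp add: power_add algebra_simps)
  qed
qed

lemma bigw_mono:
  assumes "bigw M f" "N \<le> M" shows "bigw N f"
proof -
  obtain K L where 1: "K \<ge> 0" "\<And>s t. (s, t) \<in> D \<Longrightarrow> \<bar>f s t\<bar> \<le> K * (1 + norm t) ^ L * s ^ M"
    using assms(1) by (rule bigwE) blast
  show ?thesis
  proof (rule bigwI)
    fix s t assume st: "(s, t) \<in> D"
    have "K * (1 + norm t) ^ L * s ^ M \<le> K * (1 + norm t) ^ L * s ^ N"
      using D01[OF st] 1 assms(2) by (intro mult_left_mono power_decreasing) auto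
    thus "\<bar>f s t\<bar> \<le> K * (1 + norm t) ^ L * s ^ N" using 1(2)[OF st] by linarith
  qed
qed

lemma bigw_cong: "(\<And>s t. (s, t) \<in> D \<Longrightarrow> f s t = g s t) \<Longrightarrow> bigw M f \<longleftrightarrow> bigw M g"
  unfolding bigw_def by (metis (no_types, lifting) case_prodD case_prodI2)

lemma bigw_0: "bigw M (\<lambda>s t. 0)" by (rule bigwI[of _ 0 0]) auto

lemma bigw_const: "bigw 0 (\<lambda>s t. c)" by (rule bigwI[of _ "\<bar>c\<bar>" 0]) auto

lemma bigw_cmult: "bigw M f \<Longrightarrow> bigw M (\<lambda>s t. c * f s t)"
  using bigw_mult[OF bigw_const[of c], of M f] by simp

lemma bigw_minus: "bigw M f \<Longrightarrow> bigw M (\<lambda>s t. - f s t)"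
  using bigw_cmult[of M f "-1"] by simp

lemma bigw_diff: "bigw M f \<Longrightarrow> bigw M g \<Longrightarrow> bigw M (\<lambda>s t. f s t - g s t)"
  using bigw_add[OF _ bigw_minus] by simp

lemma bigw_sum: "(\<And>i. i \<in> I \<Longrightarrow> bigw M (f i)) \<Longrightarrow> bigw M (\<lambda>s t. \<Sum>i\<in>I. f i s t)"
  by (induction I rule: infinite_finite_induct) (auto simp: bigw_0 bigw_add)

lemma bigw_power: "bigw M f \<Longrightarrow> bigw (k * M) (\<lambda>s t. f s t ^ k)"
  by (induction k) (auto simp: bigw_const intro: bigw_mult)

text \<open>An asymptotic expansion in \<open>s\<close> with coefficients depending on
  \<open>t\<close>. Constants and degrees may change with the order, and nothing is said about
  convergence of the power series.\<close>

definition aexp :: "(real \<Rightarrow> 'a \<Rightarrow> real) \<Rightarrow> ('a \<Rightarrow> real fps) \<Rightarrow> bool" where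
  "aexp \<phi> \<Phi> \<longleftrightarrow> (\<forall>M. bigw M (\<lambda>s t. \<phi> s t - (\<Sum>p<M. fps_nth (\<Phi> t) p * s ^ p)))"

lemma aexpD: "aexp \<phi> \<Phi> \<Longrightarrow> bigw M (\<lambda>s t. \<phi> s t - (\<Sum>p<M. fps_nth (\<Phi> t) p * s ^ p))"
  by (simp add: aexp_def)

lemma aexp_bounded: "aexp \<phi> \<Phi> \<Longrightarrow> bigw 0 \<phi>"
  using aexpD[of \<phi> \<Phi> 0] by simp

text \<open>Each term is a difference of two consecutive truncations, so no separate growth
  condition on the coefficients has to be carried along.\<close>

lemma aexp_coeff: "aexp \<phi> \<Phi> \<Longrightarrow> bigw p (\<lambda>s t. fps_nth (\<Phi> t) p * s ^ p)"
  using bigw_diff[OF aexpD[of \<phi> \<Phi> p] bigw_mono[OF aexpD[of \<phi> \<Phi> "Suc p"], of p]] by simp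

lemma aexp_0: "aexp (\<lambda>s t. 0) (\<lambda>t. 0)"
  by (simp add: aexp_def bigw_0)

lemma aexp_add:
  assumes "aexp \<phi> \<Phi>" "aexp \<psi> \<Psi>" shows "aexp (\<lambda>s t. \<phi> s t + \<psi> s t) (\<lambda>t. \<Phi> t + \<Psi> t)"
  unfolding aexp_def using bigw_add[OF aexpD[OF assms(1)] aexpD[OF assms(2)]]
  by (simp add: distrib_right sum.distrib algebra_simps)

lemma aexp_sum: "(\<And>i. i \<in> I \<Longrightarrow> aexp (\<phi> i) (\<Phi> i)) \<Longrightarrow> aexp (\<lambda>s t. \<Sum>i\<in>I. \<phi> i s t) (\<lambda>t. \<Sum>i\<in>I. \<Phi> i t)"
  by (induction I rule: infinite_finite_induct) (auto simp: aexp_0 aexp_add)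

lemma aexp_monom:
  assumes "\<And>s t. (s, t) \<in> D \<Longrightarrow> \<bar>g t\<bar> \<le> K * (1 + norm t) ^ L"
  shows "aexp (\<lambda>s t. g t * s ^ k) (\<lambda>t. fps_const (g t) * fps_X ^ k)"
  unfolding aexp_def
proof
  fix M
  have b: "bigw k (\<lambda>s t. g t * s ^ k)"
  proof (rule bigwI)
    fix s t assume st: "(s, t) \<in> D"
    show "\<bar>g t * s ^ k\<bar> \<le> K * (1 + norm t) ^ L * s ^ k"
      using D01[OF st] assms[OF st] by (simp add: abs_mult mult_right_mono)
  qed
  have e: "(\<Sum>p<M. fps_nth (fps_const (g t) * fps_X ^ k) p * s ^ p) = (if k < M then g t * s ^ k else 0)" for s t
    by (simp add: fps_X_power_nth if_distrib[of "\<lambda>x. _ * x"] if_distrib[of "\<lambda>x. x * _"] cong: if_cong)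
  show "bigw M (\<lambda>s t. g t * s ^ k - (\<Sum>p<M. fps_nth (fps_const (g t) * fps_X ^ k) p * s ^ p))"
    unfolding e by (cases "k < M") (auto simp: bigw_0 intro: bigw_mono[OF b])
qed

lemma aexp_const: "aexp (\<lambda>s t. c) (\<lambda>t. fps_const c)"
  using aexp_monom[of "\<lambda>_. c" "\<bar>c\<bar>" 0 0] by simp

text \<open>With truncations \<open>a\<close> and \<open>b\<close>, the product splits as
  \<open>(\<phi> - a) * \<psi> + a * (\<psi> - b) + a * b\<close>; in \<open>a * b\<close> the
  surplus terms with \<open>p + q \<ge> M\<close> are small by \<open>aexp_coeff\<close>.\<close>

lemma aexp_mult:
  assumes "aexp \<phi> \<Phi>" "aexp \<psi> \<Psi>" shows "aexp (\<lambda>s t. \<phi> s t * \<psi> s t) (\<lambda>t. \<Phi> t * \<Psi> t)"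
  unfolding aexp_def
proof
  fix M
  define a where "a = (\<lambda>s t. \<Sum>p<M. fps_nth (\<Phi> t) p * s ^ p)"
  define b where "b = (\<lambda>s t. \<Sum>p<M. fps_nth (\<Psi> t) p * s ^ p)"
  have a0: "bigw 0 a" unfolding a_def
    by (intro bigw_sum bigw_mono[OF aexp_coeff[OF assms(1)]]) auto
  have 1: "bigw M (\<lambda>s t. (\<phi> s t - a s t) * \<psi> s t)"
    using bigw_mult[OF aexpD[OF assms(1)] aexp_bounded[OF assms(2)], of M] by (simp add: a_def)
  have 2: "bigw M (\<lambda>s t. a s t * (\<psi> s t - b s t))"
    using bigw_mult[OF a0 aexpD[OF assms(2)], of M] by (simp add: b_def)
  have 3: "bigw M (\<lambda>s t. \<Sum>p<M. \<Sum>q<M. if p + q < M then 0 else (fps_nth (\<Phi> t) p * s ^ p) * (fps_nth (\<Psi> t) q * s ^ q))"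
  proof (intro bigw_sum)
    fix p q
    show "bigw M (\<lambda>s t. if p + q < M then 0 else (fps_nth (\<Phi> t) p * s ^ p) * (fps_nth (\<Psi> t) q * s ^ q))"
      using bigw_mono[OF bigw_mult[OF aexp_coeff[OF assms(1), of p] aexp_coeff[OF assms(2), of q]]]
      by (cases "p + q < M") (auto simp: bigw_0)
  qed
  have e: "a s t * b s t = (\<Sum>n<M. fps_nth (\<Phi> t * \<Psi> t) n * s ^ n) +
     (\<Sum>p<M. \<Sum>q<M. if p + q < M then 0 else (fps_nth (\<Phi> t) p * s ^ p) * (fps_nth (\<Psi> t) q * s ^ q))" for s t
  proof -
    let ?h = "\<lambda>p q. (fps_nth (\<Phi> t) p * s ^ p) * (fps_nth (\<Psi> t) q * s ^ q)"
    have "(\<Sum>n<M. fps_nth (\<Phi> t * \<Psi> t) n * s ^ n) = (\<Sum>n<M. \<Sum>p\<le>n. ?h p (n - p))"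
    proof (intro sum.cong refl)
      fix n
      show "fps_nth (\<Phi> t * \<Psi> t) n * s ^ n = (\<Sum>p\<le>n. ?h p (n - p))"
        unfolding fps_mult_nth sum_distrib_right atLeast0AtMost
      proof (intro sum.cong refl)
        fix p assume "p \<in> {..n}"
        hence e: "s ^ n = s ^ p * s ^ (n - p)" by (simp flip: power_add)
        show "fps_nth (\<Phi> t) p * fps_nth (\<Psi> t) (n - p) * s ^ n = ?h p (n - p)"
          by (subst e) (simp add: mult_ac)
      qed
    qed
    also have "\<dots> = (\<Sum>(p,q)\<in>{(p,q). p + q < M}. ?h p q)"
      by (rule sum.triangle_reindex[symmetric])
    also have "\<dots> = (\<Sum>(p,q)\<in>{..<M}\<times>{..<M}. if p + q < M then ?h p q else 0)"
      by (intro sum.mono_neutral_cong_left) (auto split: if_splits)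
    finally have "(\<Sum>n<M. fps_nth (\<Phi> t * \<Psi> t) n * s ^ n) = (\<Sum>p<M. \<Sum>q<M. if p + q < M then ?h p q else 0)"
      by (simp add: sum.cartesian_product)
    moreover have "a s t * b s t = (\<Sum>p<M. \<Sum>q<M. ?h p q)"
      by (simp add: a_def b_def sum_product)
    ultimately show ?thesis
      by (auto simp: sum.distrib[symmetric] intro!: sum.cong)
  qed
  have "bigw M (\<lambda>s t. (\<phi> s t - a s t) * \<psi> s t + a s t * (\<psi> s t - b s t) +
     (\<Sum>p<M. \<Sum>q<M. if p + q < M then 0 else (fps_nth (\<Phi> t) p * s ^ p) * (fps_nth (\<Psi> t) q * s ^ q)))"
    by (intro bigw_add 1 2 3)
  also have "(\<lambda>s t. (\<phi> s t - a s t) * \<psi> s t + a s t * (\<psi> s t - b s t) +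
     (\<Sum>p<M. \<Sum>q<M. if p + q < M then 0 else (fps_nth (\<Phi> t) p * s ^ p) * (fps_nth (\<Psi> t) q * s ^ q)))
    = (\<lambda>s t. \<phi> s t * \<psi> s t - (\<Sum>p<M. fps_nth (\<Phi> t * \<Psi> t) p * s ^ p))"
    by (intro ext) (use e in \<open>simp add: algebra_simps\<close>)
  finally show "bigw M (\<lambda>s t. \<phi> s t * \<psi> s t - (\<Sum>p<M. fps_nth (\<Phi> t * \<Psi> t) p * s ^ p))" .
qed

lemma aexp_power: "aexp \<phi> \<Phi> \<Longrightarrow> aexp (\<lambda>s t. \<phi> s t ^ k) (\<lambda>t. \<Phi> t ^ k)"
  by (induction k) (use aexp_const[of 1] in \<open>auto intro: aexp_mult\<close>)

lemma aexp_prod: "(\<And>i. i \<in> I \<Longrightarrow> aexp (\<phi> i) (\<Phi> i)) \<Longrightarrow> aexp (\<lambda>s t. \<Prod>i\<in>I. \<phi> i s t) (\<lambda>t. \<Prod>i\<in>I. \<Phi> i t)"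
  by (induction I rule: infinite_finite_induct) (use aexp_const[of 1] in \<open>auto simp: aexp_mult\<close>)

text \<open>Allows a different approximant at each order, as provided by truncated exponential
  series and by Euler--Maclaurin sums.\<close>

lemma aexp_approx:
  assumes "\<And>M. \<exists>\<phi>' \<Phi>'. aexp \<phi>' \<Phi>' \<and> bigw M (\<lambda>s t. \<phi> s t - \<phi>' s t) \<and> (\<forall>t. \<forall>p<M. fps_nth (\<Phi>' t) p = fps_nth (\<Phi> t) p)"
  shows "aexp \<phi> \<Phi>"
  unfolding aexp_def
proof
  fix M
  obtain \<phi>' \<Phi>' where 1: "aexp \<phi>' \<Phi>'" "bigw M (\<lambda>s t. \<phi> s t - \<phi>' s t)" "\<And>t p. p < M \<Longrightarrow> fps_nth (\<Phi>' t) p = fps_nth (\<Phi> t) p"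
    using assms[of M] by blast
  show "bigw M (\<lambda>s t. \<phi> s t - (\<Sum>p<M. fps_nth (\<Phi> t) p * s ^ p))"
    using bigw_add[OF 1(2) aexpD[OF 1(1), of M]] 1(3) by simp
qed

text \<open>Serves to remove the factor \<open>s ^ 2\<close> that clears the denominators of
  \<open>local_exponent\<close>; \<open>k\<close> extra orders are spent on the division.\<close>

lemma aexp_shift:
  assumes "aexp (\<lambda>s t. s ^ k * \<phi> s t) (\<lambda>t. fps_X ^ k * \<Phi> t)"
  shows "aexp \<phi> \<Phi>"
  unfolding aexp_def
proof
  fix M
  obtain K L where 1: "\<And>s t. (s, t) \<in> D \<Longrightarrow> \<bar>s ^ k * \<phi> s t - (\<Sum>p<M+k. fps_nth (fps_X ^ k * \<Phi> t) p * s ^ p)\<bar> \<le> K * (1 + norm t) ^ L * s ^ (M+k)"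
    using aexpD[OF assms, of "M + k"] by (rule bigwE) blast
  show "bigw M (\<lambda>s t. \<phi> s t - (\<Sum>p<M. fps_nth (\<Phi> t) p * s ^ p))"
  proof (rule bigwI)
    fix s t assume st: "(s, t) \<in> D"
    have s: "s > 0" using D01[OF st] by simp
    have "(\<Sum>p<M+k. fps_nth (fps_X ^ k * \<Phi> t) p * s ^ p) = (\<Sum>p<M. fps_nth (\<Phi> t) p * s ^ (p + k))"
      by (induction M) (simp_all add: fps_X_power_mult_nth)
    also have "\<dots> = s ^ k * (\<Sum>p<M. fps_nth (\<Phi> t) p * s ^ p)"
      by (simp add: sum_distrib_left power_add mult_ac)
    finally have e: "(\<Sum>p<M+k. fps_nth (fps_X ^ k * \<Phi> t) p * s ^ p) = s ^ k * (\<Sum>p<M. fps_nth (\<Phi> t) p * s ^ p)" .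
    have "s ^ k * \<bar>\<phi> s t - (\<Sum>p<M. fps_nth (\<Phi> t) p * s ^ p)\<bar> = \<bar>s ^ k * (\<phi> s t - (\<Sum>p<M. fps_nth (\<Phi> t) p * s ^ p))\<bar>"
      using s by (simp only: abs_mult abs_of_pos zero_less_power)
    also have "\<dots> = \<bar>s ^ k * \<phi> s t - s ^ k * (\<Sum>p<M. fps_nth (\<Phi> t) p * s ^ p)\<bar>"
      by (simp only: right_diff_distrib)
    also have "\<dots> \<le> K * (1 + norm t) ^ L * s ^ (M + k)" using 1[OF st] unfolding e .
    finally have "s ^ k * \<bar>\<phi> s t - (\<Sum>p<M. fps_nth (\<Phi> t) p * s ^ p)\<bar> \<le> s ^ k * (K * (1 + norm t) ^ L * s ^ M)"
      by (simp add: power_add mult_ac)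
    thus "\<bar>\<phi> s t - (\<Sum>p<M. fps_nth (\<Phi> t) p * s ^ p)\<bar> \<le> K * (1 + norm t) ^ L * s ^ M"
      using s by (simp only: mult_le_cancel_left_pos zero_less_power)
  qed
qed

text \<open>The Lagrange remainder contains an exponential of a value bounded by \<phi>. A bound
  polynomial in \<open>t\<close> would not survive exponentiation, hence the uniform bound
  \<open>b\<close>. The vanishing constant terms make \<open>\<phi> ^ M\<close> of order
  \<open>s ^ M\<close>.\<close>

lemma aexp_exp:
  assumes \<phi>: "aexp \<phi> \<Phi>" and \<Phi>0: "\<And>t. fps_nth (\<Phi> t) 0 = 0" and bd: "\<And>s t. (s, t) \<in> D \<Longrightarrow> \<bar>\<phi> s t\<bar> \<le> b"
  shows "aexp (\<lambda>s t. exp (\<phi> s t)) (\<lambda>t. fps_exp 1 oo \<Phi> t)"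
proof (rule aexp_approx, intro exI conjI allI impI)
  fix M
  let ?\<phi> = "\<lambda>s t. \<Sum>j<M. 1 / fact j * \<phi> s t ^ j"
  let ?\<Phi> = "\<lambda>t. \<Sum>j<M. fps_const (1 / fact j) * \<Phi> t ^ j"
  show "aexp ?\<phi> ?\<Phi>" by (intro aexp_sum aexp_mult aexp_power aexp_const \<phi>)
  have "bigw (Suc 0) \<phi>" using aexpD[OF \<phi>, of "Suc 0"] \<Phi>0 by simp
  hence bM: "bigw M (\<lambda>s t. \<phi> s t ^ M)" using bigw_power[of "Suc 0" \<phi> M] by simp
  then obtain K L where K: "K \<ge> 0" "\<And>s t. (s, t) \<in> D \<Longrightarrow> \<bar>\<phi> s t ^ M\<bar> \<le> K * (1 + norm t) ^ L * s ^ M"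
    by (rule bigwE) blast
  show "bigw M (\<lambda>s t. exp (\<phi> s t) - ?\<phi> s t)"
  proof (rule bigwI)
    fix s t assume st: "(s, t) \<in> D"
    obtain x where x: "\<bar>x\<bar> \<le> \<bar>\<phi> s t\<bar>" "exp (\<phi> s t) = (\<Sum>m<M. \<phi> s t ^ m / fact m) + exp x / fact M * \<phi> s t ^ M"
      using Maclaurin_exp_le by blast
    have xb: "exp x / fact M \<le> exp b / 1"
      using x(1) bd[OF st] by (intro frac_le) (auto simp: fact_ge_1)
    have "\<bar>exp (\<phi> s t) - ?\<phi> s t\<bar> = exp x / fact M * \<bar>\<phi> s t ^ M\<bar>"
      using x(2) by (simp add: abs_mult)
    also have "\<dots> \<le> exp b * (K * (1 + norm t) ^ L * s ^ M)"
      using xb K st by (intro mult_mono) auto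
    finally show "\<bar>exp (\<phi> s t) - ?\<phi> s t\<bar> \<le> (exp b * K) * (1 + norm t) ^ L * s ^ M"
      by (simp add: mult_ac)
  qed
  fix t p assume p: "p < M"
  have "fps_nth (fps_exp 1 oo \<Phi> t) p = (\<Sum>j=0..p. 1 / fact j * fps_nth (\<Phi> t ^ j) p)"
    by (simp add: fps_compose_nth)
  also have "\<dots> = (\<Sum>j<M. 1 / fact j * fps_nth (\<Phi> t ^ j) p)"
    using p by (intro sum.mono_neutral_left) (auto simp: startsby_zero_power_prefix[OF \<Phi>0])
  finally show "fps_nth (?\<Phi> t) p = fps_nth (fps_exp 1 oo \<Phi> t) p"
    by (simp add: fps_sum_nth)
qed

end

section \<open>The Euler--Maclaurin formula\<close>

lemma bernoulli_0 [simp]: "bernoulli 0 = 1" by (simp add: bernoulli.simps)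

lemma bernoulli_sum: "(\<Sum>k<q. real (q choose k) * bernoulli k) = (if q = 1 then 1 else 0)"
proof (cases "q \<ge> 2")
  case True
  then obtain n where n: "q = Suc n" "n > 0" by (cases q) auto
  have "bernoulli n = - (\<Sum>k<n. real (Suc n choose k) * bernoulli k) / real (Suc n)"
    using n by (subst bernoulli.simps) simp
  hence "(\<Sum>k<n. real (Suc n choose k) * bernoulli k) + real (Suc n) * bernoulli n = 0"
    by (simp add: field_simps del: of_nat_Suc)
  thus ?thesis using n by simp
next
  case False
  hence "q = 0 \<or> q = 1" by auto
  thus ?thesis by auto
qed

lemma bernoulli_1: "bernoulli 1 = - 1 / 2"
  using bernoulli_sum[of 2] by (simp add: numeral_2_eq_2)

lemma bernoulli_2: "bernoulli 2 = 1 / 6"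
  using bernoulli_sum[of 3] bernoulli_1 by (simp add: eval_nat_numeral)

text \<open>The generating function satisfies \<open>B * (exp x - 1) = x\<close>. Replacing
  \<open>x\<close> by \<open>- x\<close> shows \<open>B (- x) = B x + x\<close>, and comparing
  coefficients kills the odd ones beyond the first.\<close>

lemma bernoulli_odd:
  assumes "odd n" "n \<ge> 3" shows "bernoulli n = 0"
proof -
  define B where "B = Abs_fps (\<lambda>n. bernoulli n / fact n)"
  have 1: "B * (fps_exp 1 - 1) = fps_X"
  proof (rule fps_ext)
    fix n
    have "fps_nth (B * (fps_exp 1 - 1)) n = (\<Sum>k\<le>n. bernoulli k / fact k * (1 / fact (n - k) - (if n - k = 0 then 1 else 0)))"
      by (simp add: B_def fps_mult_nth atLeast0AtMost)
    also have "\<dots> = (\<Sum>k<n. bernoulli k / fact k * (1 / fact (n - k)))"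
      by (rule sum.mono_neutral_cong_right) auto
    also have "\<dots> = (\<Sum>k<n. real (n choose k) * bernoulli k) / fact n"
      unfolding sum_divide_distrib by (intro sum.cong) (auto simp: binomial_fact field_simps)
    also have "\<dots> = fps_nth fps_X n" by (simp add: bernoulli_sum)
    finally show "fps_nth (B * (fps_exp 1 - 1)) n = fps_nth fps_X n" .
  qed
  define B' where "B' = B oo (fps_const (-1) * fps_X)"
  have "(B * (fps_exp 1 - 1)) oo (fps_const (-1) * fps_X) = B' * (fps_exp (-1) - 1)"
    unfolding B'_def by (subst fps_compose_mult_distrib)
       (simp_all add: fps_compose_sub_distrib fps_exp_compose_linear del: fps_const_minus fps_const_neg)
  moreover have neg: "fps_const (-1) * fps_X = - (fps_X :: real fps)" by (rule fps_ext) simp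
  hence "fps_X oo (fps_const (-1) * fps_X) = - (fps_X :: real fps)" by simp
  ultimately have "B' * (fps_exp (-1) - 1) = - fps_X" unfolding 1 by simp
  hence "B' * (fps_exp (-1) - 1) * fps_exp 1 = - fps_X * fps_exp 1" by simp
  moreover have "(fps_exp (-1) - 1) * fps_exp 1 = - (fps_exp 1 - 1 :: real fps)"
    using fps_exp_add_mult[of "-1::real" 1] by (simp add: algebra_simps)
  ultimately have *: "B' * (1 - fps_exp 1) = - (fps_X * fps_exp 1)" by (simp add: mult.assoc)
  have "B' * (fps_exp 1 - 1) = - (B' * (1 - fps_exp 1))" by (simp add: algebra_simps)
  also have "\<dots> = fps_X * fps_exp 1" unfolding * by simp
  also have "\<dots> = (B + fps_X) * (fps_exp 1 - 1)" using 1 by (simp add: algebra_simps)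
  finally have "(B' - B - fps_X) * (fps_exp 1 - 1) = 0" by (simp add: algebra_simps)
  moreover have "fps_exp 1 - 1 \<noteq> (0 :: real fps)"
  proof
    assume "fps_exp 1 - 1 = (0 :: real fps)"
    hence "fps_nth (fps_exp 1 - 1 :: real fps) 1 = 0" by simp
    thus False by simp
  qed
  ultimately have "B' - B - fps_X = 0" by simp
  hence "fps_nth B' n = fps_nth (B + fps_X) n" by (simp add: algebra_simps)
  hence "(-1) ^ n * (bernoulli n / fact n) = bernoulli n / fact n"
    using assms(2) unfolding B'_def fps_nth_compose_linear by (simp add: B_def)
  thus ?thesis using assms(1) by simp
qed

text \<open>The function to be summed is \<open>G 1\<close>, so that \<open>G 0\<close> is its
  primitive and supplies the integral in the summation formula. Exponential decay makes the sums
  converge and lets the telescope end at 0.\<close>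

locale derivative_family =
  fixes a :: real and G :: "nat \<Rightarrow> real \<Rightarrow> real"
  assumes deriv: "\<And>q x. x \<ge> a \<Longrightarrow> (G q has_real_derivative G (Suc q) x) (at x)"
    and decay: "\<And>q. \<exists>K. \<forall>x\<ge>a. \<bar>G q x\<bar> \<le> K * exp (- x)"
begin

lemma decayE:
  obtains K where "K \<ge> 0" "\<And>x. x \<ge> a \<Longrightarrow> \<bar>G q x\<bar> \<le> K * exp (- x)"
proof -
  obtain K where K: "\<And>x. x \<ge> a \<Longrightarrow> \<bar>G q x\<bar> \<le> K * exp (- x)" using decay[of q] by blast
  have "0 \<le> K * exp (- a)" using K[of a] by (intro order_trans[OF abs_ge_zero]) auto
  hence "K \<ge> 0" by (simp add: zero_le_mult_iff)
  thus ?thesis using that K by blast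
qed

lemma taylor_bound:
  assumes y: "y \<ge> a" and c: "c \<ge> a" and K: "K \<ge> 0" "\<And>x. x \<ge> a \<Longrightarrow> \<bar>G (p + n) x\<bar> \<le> K * exp (- x)"
  shows "\<bar>G p y - (\<Sum>m<n. G (p + m) c / fact m * (y - c) ^ m)\<bar> \<le> K * exp (- min y c) * \<bar>y - c\<bar> ^ n"
proof (cases "n = 0 \<or> y = c")
  case True
  show ?thesis
  proof (cases "n = 0")
    case True
    have "\<bar>G p y\<bar> \<le> K * exp (- y)" using K(2)[OF y] True by simp
    also have "\<dots> \<le> K * exp (- min y c)" using K by (intro mult_left_mono) auto
    finally show ?thesis using True by simp
  next
    case False
    then obtain k where n: "n = Suc k" by (cases n) auto
    have "y = c" using True False by simp
    hence "(\<Sum>m<n. G (p + m) c / fact m * (y - c) ^ m) = G p c"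
      unfolding n by (subst sum.lessThan_Suc_shift) simp
    thus ?thesis using \<open>y = c\<close> K by simp
  qed
next
  case False
  have "\<exists>t. (if y < c then y < t \<and> t < c else c < t \<and> t < y) \<and>
     G p y = (\<Sum>m<n. G (p + m) c / fact m * (y - c) ^ m) + G (p + n) t / fact n * (y - c) ^ n"
    by (rule Taylor[of n "\<lambda>m. G (p + m)" _ a "max y c"]) (use False y c deriv in auto)
  then obtain t where t: "min y c < t" and
    e: "G p y = (\<Sum>m<n. G (p + m) c / fact m * (y - c) ^ m) + G (p + n) t / fact n * (y - c) ^ n"
    by (auto split: if_splits)
  have "\<bar>G p y - (\<Sum>m<n. G (p + m) c / fact m * (y - c) ^ m)\<bar> = \<bar>G (p + n) t\<bar> / fact n * \<bar>y - c\<bar> ^ n"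
    using e by (simp add: abs_mult power_abs)
  also have "\<dots> \<le> (K * exp (- min y c)) / 1 * \<bar>y - c\<bar> ^ n"
  proof (intro mult_right_mono frac_le)
    have "\<bar>G (p + n) t\<bar> \<le> K * exp (- t)" using t y c by (intro K) auto
    also have "\<dots> \<le> K * exp (- min y c)" using t K by (intro mult_left_mono) auto
    finally show "\<bar>G (p + n) t\<bar> \<le> K * exp (- min y c)" .
  qed (use K in \<open>auto simp: fact_ge_1\<close>)
  finally show ?thesis by simp
qed

text \<open>The sign \<open>(-1) ^ p\<close> belongs to sums that start at
  \<open>x + \<epsilon>\<close> rather than at \<open>x\<close>: it turns the term of index 1
  around.\<close>

definition euler_maclaurin :: "nat \<Rightarrow> real \<Rightarrow> real \<Rightarrow> real" where
  "euler_maclaurin M \<epsilon> x = - (\<Sum>p\<le>M. (-1) ^ p * bernoulli p / fact p * \<epsilon> ^ p * G p x)"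

lemma bernoulli_sum':
  "(\<Sum>p\<le>q. (-1) ^ p * bernoulli p / fact p * ((-1) ^ (q - p) / fact (q - p))) =
    (-1) ^ q * bernoulli q / fact q - (if q = 1 then 1 else 0)"
proof -
  have "(\<Sum>p<q. (-1) ^ p * bernoulli p / fact p * ((-1) ^ (q - p) / fact (q - p))) =
      (\<Sum>p<q. (-1) ^ q * (real (q choose p) * bernoulli p) / fact q)"
  proof (intro sum.cong refl)
    fix p assume "p \<in> {..<q}"
    hence "(-1::real) ^ q = (-1) ^ p * (-1) ^ (q - p)" "p \<le> q" by (simp_all flip: power_add)
    thus "(-1) ^ p * bernoulli p / fact p * ((-1) ^ (q - p) / fact (q - p)) = (-1) ^ q * (real (q choose p) * bernoulli p) / fact q"
      by (simp add: binomial_fact field_simps)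
  qed
  also have "\<dots> = (-1) ^ q / fact q * (\<Sum>p<q. real (q choose p) * bernoulli p)"
    by (simp add: sum_distrib_left)
  also have "\<dots> = - (if q = 1 then 1 else 0)" unfolding bernoulli_sum by simp
  finally show ?thesis by (simp flip: lessThan_Suc_atMost)
qed

text \<open>The Euler--Maclaurin sum is a primitive of \<open>\<epsilon> G\<^sub>1\<close> for the difference operator, up to a
  Taylor remainder; the sum over \<open>k\<close> is then a telescope.\<close>

lemma euler_maclaurin_step:
  assumes M: "M \<ge> 1"
  obtains K where "K \<ge> 0" "\<And>y \<epsilon>. y \<ge> a \<Longrightarrow> \<epsilon> > 0 \<Longrightarrow> 
    \<bar>euler_maclaurin M \<epsilon> y - euler_maclaurin M \<epsilon> (y + \<epsilon>) - \<epsilon> * G 1 (y + \<epsilon>)\<bar> \<le> K * exp (- y) * \<epsilon> ^ (M + 1)"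
proof -
  obtain K where K: "K \<ge> 0" "\<And>x. x \<ge> a \<Longrightarrow> \<bar>G (M + 1) x\<bar> \<le> K * exp (- x)" using decayE by blast
  define b where "b p = (-1) ^ p * bernoulli p / fact p" for p
  define R where "R p \<epsilon> y = G p y - (\<Sum>m<M+1-p. G (p + m) (y + \<epsilon>) / fact m * (- \<epsilon>) ^ m)" for p \<epsilon> y
  have R: "\<bar>R p \<epsilon> y\<bar> \<le> K * exp (- y) * \<epsilon> ^ (M + 1 - p)" if "p \<le> M" "y \<ge> a" "\<epsilon> > 0" for p \<epsilon> y
    using taylor_bound[of y "y + \<epsilon>" K p "M + 1 - p"] K that by (simp add: R_def)
  show ?thesis
  proof (rule that)
    show "(\<Sum>p\<le>M. \<bar>b p\<bar> * K) \<ge> 0" using K by (intro sum_nonneg) auto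
    fix y \<epsilon> :: real assume y: "y \<ge> a" and e: "\<epsilon> > 0"
    let ?x = "y + \<epsilon>"
    have "(\<Sum>p\<le>M. b p * \<epsilon> ^ p * (\<Sum>m<M+1-p. G (p + m) ?x / fact m * (- \<epsilon>) ^ m))
       = (\<Sum>p\<le>M. \<Sum>m\<le>M-p. b p * \<epsilon> ^ p * (G (p + m) ?x / fact m * (- \<epsilon>) ^ m))"
    proof (intro sum.cong refl)
      fix p assume "p \<in> {..M}"
      hence "{..<M+1-p} = {..M-p}" by auto
      thus "b p * \<epsilon> ^ p * (\<Sum>m<M+1-p. G (p + m) ?x / fact m * (- \<epsilon>) ^ m) = (\<Sum>m\<le>M-p. b p * \<epsilon> ^ p * (G (p + m) ?x / fact m * (- \<epsilon>) ^ m))"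
        by (simp only: sum_distrib_left)
    qed
    also have "\<dots> = (\<Sum>(p,m)\<in>Sigma {..M} (\<lambda>p. {..M-p}). b p * \<epsilon> ^ p * (G (p + m) ?x / fact m * (- \<epsilon>) ^ m))"
      by (rule sum.Sigma) auto
    \<comment> \<open>Collect by the total order \<open>q = p + m\<close> of differentiation. The
      inner sums are then those of \<open>bernoulli_sum'\<close>, whose exceptional value at
      \<open>q = 1\<close> is the summand \<open>\<epsilon> * G 1\<close>.\<close>
    also have "\<dots> = (\<Sum>(q,p)\<in>Sigma {..M} (\<lambda>q. {..q}). \<epsilon> ^ q * G q ?x * (b p * ((-1) ^ (q - p) / fact (q - p))))"
      by (rule sum.reindex_bij_witness[of _ "\<lambda>(q,p). (p, q - p)" "\<lambda>(p,m). (p + m, p)"])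
         (auto simp: power_add power_minus[of \<epsilon>])
    also have "\<dots> = (\<Sum>q\<le>M. \<epsilon> ^ q * G q ?x * (\<Sum>p\<le>q. b p * ((-1) ^ (q - p) / fact (q - p))))"
      by (subst sum.Sigma[symmetric]) (auto simp: sum_distrib_left)
    also have "\<dots> = (\<Sum>q\<le>M. b q * \<epsilon> ^ q * G q ?x - (if q = 1 then \<epsilon> * G 1 ?x else 0))"
      unfolding b_def bernoulli_sum' by (intro sum.cong) (auto simp: algebra_simps)
    also have "\<dots> = (\<Sum>q\<le>M. b q * \<epsilon> ^ q * G q ?x) - \<epsilon> * G 1 ?x"
      using M by (simp add: sum_subtractf)
    finally have main: "(\<Sum>p\<le>M. b p * \<epsilon> ^ p * (\<Sum>m<M+1-p. G (p + m) ?x / fact m * (- \<epsilon>) ^ m)) =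
       (\<Sum>q\<le>M. b q * \<epsilon> ^ q * G q ?x) - \<epsilon> * G 1 ?x" .
    have "(\<Sum>p\<le>M. b p * \<epsilon> ^ p * G p y) = (\<Sum>p\<le>M. b p * \<epsilon> ^ p * (\<Sum>m<M+1-p. G (p + m) ?x / fact m * (- \<epsilon>) ^ m)) + (\<Sum>p\<le>M. b p * \<epsilon> ^ p * R p \<epsilon> y)"
      by (simp add: R_def sum.distrib[symmetric] distrib_left[symmetric])
    hence "euler_maclaurin M \<epsilon> y - euler_maclaurin M \<epsilon> ?x - \<epsilon> * G 1 ?x = - (\<Sum>p\<le>M. b p * \<epsilon> ^ p * R p \<epsilon> y)"
      unfolding main euler_maclaurin_def b_def[symmetric] by simp
    also have "\<bar>\<dots>\<bar> \<le> (\<Sum>p\<le>M. \<bar>b p * \<epsilon> ^ p * R p \<epsilon> y\<bar>)" by simp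
    also have "\<dots> \<le> (\<Sum>p\<le>M. \<bar>b p\<bar> * K * (exp (- y) * \<epsilon> ^ (M + 1)))"
    proof (intro sum_mono)
      fix p assume p: "p \<in> {..M}"
      have "\<bar>b p * \<epsilon> ^ p * R p \<epsilon> y\<bar> = \<bar>b p\<bar> * \<epsilon> ^ p * \<bar>R p \<epsilon> y\<bar>" using e by (simp add: abs_mult)
      also have "\<dots> \<le> \<bar>b p\<bar> * \<epsilon> ^ p * (K * exp (- y) * \<epsilon> ^ (M + 1 - p))"
        using R[of p y \<epsilon>] p y e by (intro mult_left_mono) auto
      also have "\<dots> = \<bar>b p\<bar> * K * (exp (- y) * (\<epsilon> ^ p * \<epsilon> ^ (M + 1 - p)))" by (simp add: mult_ac)
      also have "\<epsilon> ^ p * \<epsilon> ^ (M + 1 - p) = \<epsilon> ^ (M + 1)" using p by (simp flip: power_add)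
      finally show "\<bar>b p * \<epsilon> ^ p * R p \<epsilon> y\<bar> \<le> \<bar>b p\<bar> * K * (exp (- y) * \<epsilon> ^ (M + 1))" .
    qed
    finally show "\<bar>euler_maclaurin M \<epsilon> y - euler_maclaurin M \<epsilon> ?x - \<epsilon> * G 1 ?x\<bar> \<le> (\<Sum>p\<le>M. \<bar>b p\<bar> * K) * exp (- y) * \<epsilon> ^ (M + 1)"
      by (simp only: sum_distrib_right[symmetric] mult.assoc)
  qed
qed

lemma summable_shift:
  assumes x: "x \<ge> a" and e: "\<epsilon> > 0"
  shows "summable (\<lambda>k. G q (x + real (Suc k) * \<epsilon>))"
proof -
  obtain K where K: "K \<ge> 0" "\<And>x. x \<ge> a \<Longrightarrow> \<bar>G q x\<bar> \<le> K * exp (- x)" using decayE by blast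
  show ?thesis
  proof (rule summable_comparison_test'[of "\<lambda>k. K * exp (- x) * exp (- \<epsilon>) ^ Suc k" 0])
    show "summable (\<lambda>k. K * exp (- x) * exp (- \<epsilon>) ^ Suc k)"
      using e by (intro summable_mult summable_Suc_iff[THEN iffD2] summable_geometric) auto
    fix k
    have "x + real (Suc k) * \<epsilon> \<ge> a" using x e by (simp add: add_increasing2)
    hence "\<bar>G q (x + real (Suc k) * \<epsilon>)\<bar> \<le> K * exp (- (x + real (Suc k) * \<epsilon>))" by (rule K)
    also have "exp (- (x + real (Suc k) * \<epsilon>)) = exp (- x) * exp (- \<epsilon>) ^ Suc k"
      by (simp only: exp_of_nat_mult[symmetric] exp_add[symmetric]) simp
    finally show "norm (G q (x + real (Suc k) * \<epsilon>)) \<le> K * exp (- x) * exp (- \<epsilon>) ^ Suc k" by simp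
  qed
qed

lemma euler_maclaurin_tendsto_0:
  assumes e: "\<epsilon> > 0"
  shows "(\<lambda>k. euler_maclaurin M \<epsilon> (x + real k * \<epsilon>)) \<longlonglongrightarrow> 0"
proof -
  have lim: "filterlim (\<lambda>k. x + real k * \<epsilon>) at_top sequentially"
    using e by (intro filterlim_tendsto_add_at_top[OF tendsto_const] filterlim_at_top_mult_tendsto_pos[OF tendsto_const]
       filterlim_real_sequentially)
  have "(\<lambda>k. G p (x + real k * \<epsilon>)) \<longlonglongrightarrow> 0" for p
  proof -
    obtain K where K: "\<And>x. x \<ge> a \<Longrightarrow> \<bar>G p x\<bar> \<le> K * exp (- x)" using decayE by blast
    have "((\<lambda>x::real. exp (- x)) \<longlongrightarrow> 0) at_top"
      by (rule filterlim_compose[OF exp_at_bot filterlim_uminus_at_bot_at_top])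
    hence "((\<lambda>x. K * exp (- x)) \<longlongrightarrow> K * 0) at_top" by (intro tendsto_mult tendsto_const)
    moreover have "eventually (\<lambda>x. norm (G p x) \<le> K * exp (- x)) at_top"
      using eventually_ge_at_top[of a] by eventually_elim (use K in simp)
    ultimately have "(G p \<longlongrightarrow> 0) at_top" by (intro Lim_null_comparison[of "G p"]) simp_all
    thus ?thesis using lim by (rule filterlim_compose)
  qed
  hence "(\<lambda>k. euler_maclaurin M \<epsilon> (x + real k * \<epsilon>)) \<longlonglongrightarrow> - (\<Sum>p\<le>M. (-1) ^ p * bernoulli p / fact p * \<epsilon> ^ p * 0)"
    unfolding euler_maclaurin_def by (intro tendsto_intros)
  thus ?thesis by simp
qed

theorem euler_maclaurin_bound:
  obtains K where "K \<ge> 0" "\<And>x \<epsilon>. x \<ge> a \<Longrightarrow> 0 < \<epsilon> \<Longrightarrow> \<epsilon> \<le> 1 \<Longrightarrow>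
    \<bar>\<epsilon> * (\<Sum>k. G 1 (x + real (Suc k) * \<epsilon>)) - euler_maclaurin (Suc M) \<epsilon> x\<bar> \<le> K * \<epsilon> ^ Suc M"
proof -
  obtain K where K: "K \<ge> 0" "\<And>y \<epsilon>. y \<ge> a \<Longrightarrow> \<epsilon> > 0 \<Longrightarrow> 
    \<bar>euler_maclaurin (Suc M) \<epsilon> y - euler_maclaurin (Suc M) \<epsilon> (y + \<epsilon>) - \<epsilon> * G 1 (y + \<epsilon>)\<bar> \<le> K * exp (- y) * \<epsilon> ^ (Suc M + 1)"
    using euler_maclaurin_step[of "Suc M"] by auto
  show ?thesis
  proof (rule that)
    show "2 * K * exp (- a) \<ge> 0" using K by simp
    fix x \<epsilon> :: real assume x: "x \<ge> a" and e: "0 < \<epsilon>" "\<epsilon> \<le> 1"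
    let ?E = "\<lambda>k. euler_maclaurin (Suc M) \<epsilon> (x + real k * \<epsilon>)"
    have 1: "(\<lambda>k. ?E k - ?E (Suc k)) sums (?E 0 - 0)"
      by (rule telescope_sums'[OF euler_maclaurin_tendsto_0[OF e(1)]])
    have 2: "(\<lambda>k. \<epsilon> * G 1 (x + real (Suc k) * \<epsilon>)) sums (\<epsilon> * (\<Sum>k. G 1 (x + real (Suc k) * \<epsilon>)))"
      by (intro sums_mult summable_sums summable_shift x e)
    have 3: "(\<lambda>k. ?E k - ?E (Suc k) - \<epsilon> * G 1 (x + real (Suc k) * \<epsilon>)) sums
        (?E 0 - \<epsilon> * (\<Sum>k. G 1 (x + real (Suc k) * \<epsilon>)))"
      using sums_diff[OF 1 2] by simp
    have geo: "(\<lambda>k. K * exp (- x) * \<epsilon> ^ (Suc M + 1) * exp (- \<epsilon>) ^ k) sums (K * exp (- x) * \<epsilon> ^ (Suc M + 1) * (1 / (1 - exp (- \<epsilon>))))"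
      using e by (intro sums_mult geometric_sums) auto
    have "norm (?E k - ?E (Suc k) - \<epsilon> * G 1 (x + real (Suc k) * \<epsilon>)) \<le> K * exp (- x) * \<epsilon> ^ (Suc M + 1) * exp (- \<epsilon>) ^ k" for k
    proof -
      have "x + real k * \<epsilon> \<ge> a" using x e by (simp add: add_increasing2)
      from K(2)[OF this e(1)] have "\<bar>?E k - euler_maclaurin (Suc M) \<epsilon> (x + real k * \<epsilon> + \<epsilon>) - \<epsilon> * G 1 (x + real k * \<epsilon> + \<epsilon>)\<bar>
         \<le> K * exp (- (x + real k * \<epsilon>)) * \<epsilon> ^ (Suc M + 1)" .
      moreover have "x + real k * \<epsilon> + \<epsilon> = x + real (Suc k) * \<epsilon>" by (simp add: algebra_simps)
      moreover have "exp (- (x + real k * \<epsilon>)) = exp (- x) * exp (- \<epsilon>) ^ k"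
        by (simp only: exp_of_nat_mult[symmetric] exp_add[symmetric]) simp
      ultimately show ?thesis by (simp only: real_norm_def mult_ac)
    qed
    hence "norm (suminf (\<lambda>k. ?E k - ?E (Suc k) - \<epsilon> * G 1 (x + real (Suc k) * \<epsilon>))) \<le> suminf (\<lambda>k. K * exp (- x) * \<epsilon> ^ (Suc M + 1) * exp (- \<epsilon>) ^ k)"
      by (rule norm_suminf_le) (rule sums_summable[OF geo])
    hence "\<bar>?E 0 - \<epsilon> * (\<Sum>k. G 1 (x + real (Suc k) * \<epsilon>))\<bar> \<le> K * exp (- x) * \<epsilon> ^ (Suc M + 1) * (1 / (1 - exp (- \<epsilon>)))"
      using 3 geo by (simp only: sums_iff real_norm_def)
    \<comment> \<open>Summing the geometric series costs one factor \<open>1 / \<epsilon>\<close>;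
      this lowers the exponent from \<open>Suc M + 1\<close> for a single step to
      \<open>Suc M\<close> for the whole sum.\<close>
    also have "\<dots> \<le> K * exp (- a) * \<epsilon> ^ (Suc M + 1) * (2 / \<epsilon>)"
    proof (intro mult_mono)
      have "exp (- \<epsilon>) \<le> 1 - \<epsilon> / 2"
      proof -
        have "1 + \<epsilon> \<le> exp \<epsilon>" by (rule exp_ge_add_one_self)
        hence "exp (- \<epsilon>) \<le> 1 / (1 + \<epsilon>)" using e by (simp add: exp_minus field_simps)
        also have "\<dots> \<le> 1 - \<epsilon> / 2"
        proof -
          have "\<epsilon> * \<epsilon> \<le> \<epsilon> * 1" using e by (intro mult_left_mono) auto
          thus ?thesis using e by (simp add: field_simps)
        qed
        finally show ?thesis .
      qed
      thus "1 / (1 - exp (- \<epsilon>)) \<le> 2 / \<epsilon>" using e by (simp add: field_simps)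
    qed (use K e x in auto)
    also have "\<dots> = 2 * K * exp (- a) * \<epsilon> ^ Suc M" using e by simp
    finally show "\<bar>\<epsilon> * (\<Sum>k. G 1 (x + real (Suc k) * \<epsilon>)) - euler_maclaurin (Suc M) \<epsilon> x\<bar> \<le> 2 * K * exp (- a) * \<epsilon> ^ Suc M"
      by (simp add: abs_minus_commute)
  qed
qed

end

text \<open>The successive derivatives of \<open>Li2 (\<sigma> * exp (- x))\<close>: for
  \<open>y = \<sigma> / (exp x - \<sigma>)\<close> one has \<open>y' = - (y + y ^ 2)\<close>, so
  each derivative follows the recursion of \<open>polylog_poly\<close> with a change of sign. The
  primitive is a parameter because for \<sigma> = -1 it must be continued to the left of 0.\<close>

fun polylog_family :: "real \<Rightarrow> (real \<Rightarrow> real) \<Rightarrow> nat \<Rightarrow> real \<Rightarrow> real" where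
  "polylog_family \<sigma> G 0 x = G x"
| "polylog_family \<sigma> G (Suc 0) x = ln (1 - \<sigma> * exp (- x))"
| "polylog_family \<sigma> G (Suc (Suc k)) x = (-1) ^ k * poly (polylog_poly (Suc k)) (\<sigma> / (exp x - \<sigma>))"

lemma poly_polylog_0: "poly (polylog_poly k) 0 = 0"
  by (induction k rule: polylog_poly.induct) auto

lemma poly_bounded_by_abs:
  fixes p :: "real poly" assumes "poly p 0 = 0"
  obtains K where "K \<ge> 0" "\<And>x. \<bar>x\<bar> \<le> C \<Longrightarrow> \<bar>poly p x\<bar> \<le> K * \<bar>x\<bar>"
proof -
  have "[:0, 1:] dvd p" using assms by (simp add: poly_eq_0_iff_dvd)
  then obtain r where r: "p = [:0, 1:] * r" by (auto elim: dvdE)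
  have "bounded ((\<lambda>x. poly r x) ` {-C..C})"
    by (intro compact_imp_bounded compact_continuous_image continuous_intros) auto
  then obtain K where K: "\<forall>x\<in>{-C..C}. \<bar>poly r x\<bar> \<le> K"
    by (auto simp: bounded_iff)
  have "\<bar>poly p x\<bar> \<le> max K 0 * \<bar>x\<bar>" if "\<bar>x\<bar> \<le> C" for x
  proof -
    have "\<bar>poly r x\<bar> \<le> max K 0" using K[rule_format, of x] that by (auto simp: abs_le_iff)
    hence "\<bar>x\<bar> * \<bar>poly r x\<bar> \<le> \<bar>x\<bar> * max K 0" by (intro mult_left_mono) auto
    thus ?thesis by (simp add: r abs_mult mult.commute)
  qed
  thus ?thesis using that[of "max K 0"] by simp
qed

lemma abs_ln_one_minus_le:
  fixes z :: real assumes "z \<le> r" "r < 1" "r \<ge> 0"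
  shows "\<bar>ln (1 - z)\<bar> \<le> \<bar>z\<bar> / (1 - r)"
proof -
  have z: "z < 1" using assms by simp
  have r1: "\<bar>z\<bar> \<le> \<bar>z\<bar> / (1 - r)" using assms by (simp add: field_simps mult_left_le)
  have "ln (1 - z) \<le> - z" using ln_le_minus_one[of "1 - z"] z by simp
  hence "ln (1 - z) \<le> \<bar>z\<bar> / (1 - r)" using r1 by linarith
  moreover have "- ln (1 - z) \<le> \<bar>z\<bar> / (1 - r)"
  proof -
    have "- ln (1 - z) = ln (1 / (1 - z))" using z by (simp add: ln_div)
    also have "\<dots> \<le> 1 / (1 - z) - 1" using z by (intro ln_le_minus_one) auto
    also have "\<dots> = z / (1 - z)" using z by (simp add: field_simps)
    also have "\<dots> \<le> \<bar>z\<bar> / (1 - z)" using z by (intro divide_right_mono) auto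
    also have "\<dots> \<le> \<bar>z\<bar> / (1 - r)" using assms z by (intro divide_left_mono) auto
    finally show ?thesis .
  qed
  ultimately show ?thesis by linarith
qed

lemma polylog_family:
  assumes \<sigma>: "\<sigma> = 1 \<and> a > 0 \<or> \<sigma> = -1 \<and> a \<ge> 0"
    and G: "\<And>x. x \<ge> a \<Longrightarrow> (G has_real_derivative ln (1 - \<sigma> * exp (- x))) (at x)"
    and G': "\<exists>K. \<forall>x\<ge>a. \<bar>G x\<bar> \<le> K * exp (- x)"
  shows "derivative_family a (polylog_family \<sigma> G)"
proof
  \<comment> \<open>An upper bound for \<open>\<sigma> * exp (- x)\<close> on the half line that
    stays below 1 for both signs.\<close>
  define r where "r = (if \<sigma> = 1 then exp (- a) else 0)"
  have r: "0 \<le> r" "r < 1" using \<sigma> by (auto simp: r_def)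
  have zr: "\<sigma> * exp (- x) \<le> r" if "x \<ge> a" for x
    using \<sigma> that by (auto simp: r_def)
  have ex: "exp x - \<sigma> > 0" if "x \<ge> a" for x
  proof -
    have "\<sigma> * exp (- x) < 1" using zr[OF that] r by simp
    hence "\<sigma> * exp (- x) * exp x < 1 * exp x" by (intro mult_strict_right_mono) auto
    thus ?thesis by (simp add: mult.assoc flip: exp_add)
  qed
  fix q :: nat
  show "(polylog_family \<sigma> G q has_real_derivative polylog_family \<sigma> G (Suc q) x) (at x)" if x: "x \<ge> a" for x
  proof -
    have y: "((\<lambda>x. \<sigma> / (exp x - \<sigma>)) has_real_derivative - (\<sigma> / (exp x - \<sigma>) + (\<sigma> / (exp x - \<sigma>))\<^sup>2)) (at x)"
      using ex[OF x] by (auto intro!: derivative_eq_intros simp: divide_simps power2_eq_square) (simp add: algebra_simps)?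
    consider "q = 0" | "q = Suc 0" | k where "q = Suc (Suc k)" by (metis not0_implies_Suc)
    thus ?thesis
    proof cases
      case 1
      moreover have "polylog_family \<sigma> G 0 = G" by (rule ext) simp
      ultimately show ?thesis using G[OF x] by simp
    next
      case 2
      have "1 - \<sigma> * exp (- x) > 0" using zr[OF x] r by simp
      hence "((\<lambda>x. ln (1 - \<sigma> * exp (- x))) has_real_derivative (\<sigma> * exp (- x)) / (1 - \<sigma> * exp (- x))) (at x)"
        by (auto intro!: derivative_eq_intros simp: field_simps)
      moreover have "(\<sigma> * exp (- x)) / (1 - \<sigma> * exp (- x)) = \<sigma> / (exp x - \<sigma>)"
        using ex[OF x] by (simp add: exp_minus field_simps)
      moreover have "polylog_family \<sigma> G (Suc 0) = (\<lambda>x. ln (1 - \<sigma> * exp (- x)))" by (rule ext) simp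
      ultimately show ?thesis using 2 by simp
    next
      case 3
      have "((\<lambda>x. (-1) ^ k * poly (polylog_poly (Suc k)) (\<sigma> / (exp x - \<sigma>))) has_real_derivative
         (-1) ^ k * (poly (pderiv (polylog_poly (Suc k))) (\<sigma> / (exp x - \<sigma>)) * (- (\<sigma> / (exp x - \<sigma>) + (\<sigma> / (exp x - \<sigma>))\<^sup>2)))) (at x)"
        by (intro DERIV_cmult DERIV_chain2[OF poly_DERIV y])
      moreover have "polylog_family \<sigma> G q = (\<lambda>x. (-1) ^ k * poly (polylog_poly (Suc k)) (\<sigma> / (exp x - \<sigma>)))"
        unfolding 3 by (rule ext) simp
      ultimately show ?thesis using 3 by (simp add: power2_eq_square algebra_simps)
    qed
  qed
  show "\<exists>K. \<forall>x\<ge>a. \<bar>polylog_family \<sigma> G q x\<bar> \<le> K * exp (- x)"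
  proof -
    consider "q = 0" | "q = Suc 0" | k where "q = Suc (Suc k)" by (metis not0_implies_Suc)
    thus ?thesis
    proof cases
      case 1 thus ?thesis using G' by simp
    next
      case 2
      have "\<bar>ln (1 - \<sigma> * exp (- x))\<bar> \<le> 1 / (1 - r) * exp (- x)" if "x \<ge> a" for x
        using abs_ln_one_minus_le[OF zr[OF that] r(2,1)] \<sigma> by (auto simp: abs_mult)
      thus ?thesis using 2 by (intro exI[of _ "1 / (1 - r)"]) simp
    next
      case 3
      have yb: "\<bar>\<sigma> / (exp x - \<sigma>)\<bar> \<le> 1 / (1 - r) * exp (- x)" if "x \<ge> a" for x
      proof -
        have "\<sigma> / (exp x - \<sigma>) = \<sigma> * exp (- x) / (1 - \<sigma> * exp (- x))"
          using ex[OF that] by (simp add: exp_minus field_simps)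
        also have "\<bar>\<dots>\<bar> = exp (- x) / (1 - \<sigma> * exp (- x))" using \<sigma> zr[OF that] r by (auto simp: abs_mult)
        also have "\<dots> \<le> exp (- x) / (1 - r)" using zr[OF that] r by (intro divide_left_mono) auto
        finally show ?thesis by simp
      qed
      have yb': "\<bar>\<sigma> / (exp x - \<sigma>)\<bar> \<le> 1 / (1 - r)" if "x \<ge> a" for x
      proof -
        have "1 / (1 - r) * exp (- x) \<le> 1 / (1 - r) * 1" using \<sigma> that r by (intro mult_left_mono) auto
        thus ?thesis using yb[OF that] by linarith
      qed
      obtain K where K: "K \<ge> 0" "\<And>y. \<bar>y\<bar> \<le> 1 / (1 - r) \<Longrightarrow> \<bar>poly (polylog_poly (Suc k)) y\<bar> \<le> K * \<bar>y\<bar>"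
        using poly_bounded_by_abs[OF poly_polylog_0] by metis
      have "\<bar>polylog_family \<sigma> G q x\<bar> \<le> K * (1 / (1 - r)) * exp (- x)" if "x \<ge> a" for x
      proof -
        have "\<bar>polylog_family \<sigma> G q x\<bar> = \<bar>poly (polylog_poly (Suc k)) (\<sigma> / (exp x - \<sigma>))\<bar>"
          using 3 by (simp add: abs_mult)
        also have "\<dots> \<le> K * \<bar>\<sigma> / (exp x - \<sigma>)\<bar>" by (intro K yb' that)
        also have "\<dots> \<le> K * (1 / (1 - r) * exp (- x))" by (intro mult_left_mono yb that K)
        finally show ?thesis by (simp add: mult.assoc)
      qed
      thus ?thesis by blast
    qed
  qed
qed

text \<open>Replacing \<open>Q\<close> by \<open>1 / Q\<close> sends \<open>X = Q / (1 - Q)\<close>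
  to \<open>- 1 - X\<close>. This leaves \<open>X ^ 2 + X\<close> invariant, while each
  differentiation contributes a sign. The fixed point \<open>- 1 / 2\<close> belongs to
  \<open>Q = - 1\<close>.\<close>

lemma polylog_poly_reflect:
  assumes "k \<ge> 2" shows "pcompose (polylog_poly k) [:-1, -1:] = smult ((-1) ^ k) (polylog_poly k)"
  using assms
proof (induction k rule: nat_induct_at_least)
  case base
  show ?case by (simp add: numeral_2_eq_2 pderiv_pCons pcompose_pCons)
next
  case (Suc k)
  obtain m where k: "k = Suc m" using Suc.hyps by (cases k) auto
  let ?P = "polylog_poly k"
  have "pderiv (pcompose ?P [:-1, -1:]) = pcompose (pderiv ?P) [:-1, -1:] * [:-1:]"
    by (simp add: pderiv_pcompose pderiv_pCons)
  hence "pcompose (pderiv ?P) [:-1, -1:] = smult (- ((-1) ^ k)) (pderiv ?P)"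
    unfolding Suc.IH by (simp add: pderiv_smult)
  moreover have "pcompose [:0, 1, 1:] [:-1, -1:] = [:0, 1, 1 :: real:]" by (simp add: pcompose_pCons)
  moreover have "polylog_poly (Suc k) = [:0, 1, 1:] * pderiv ?P" unfolding k by (rule polylog_poly.simps)
  ultimately show ?case by (simp only: pcompose_mult mult_smult_right power_Suc mult_minus1)
qed

lemma polylog_poly_half_odd:
  assumes "odd k" "k \<ge> 3" shows "poly (polylog_poly k) (-1/2) = 0"
proof -
  have "poly (pcompose (polylog_poly k) [:-1, -1:]) (-1/2) = - poly (polylog_poly k) (-1/2)"
    using assms by (subst polylog_poly_reflect) auto
  thus ?thesis by (simp add: poly_pcompose)
qed

text \<open>\<open>derivative_family\<close> asks for two-sided derivatives also at the endpoint 0,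
  but to its left \<open>- exp (- x)\<close> leaves the disc of convergence. Integrating
  \<open>ln (1 + exp (- x))\<close> from -1 continues the function across 0.\<close>

lemma dilog_neg_ex:
  "\<exists>J. \<forall>x\<ge>0. (J has_real_derivative ln (1 + exp (- x))) (at x) \<and> J x = Li2 (- exp (- x))"
proof -
  define f :: "real \<Rightarrow> real" where "f x = ln (1 + exp (- x))" for x
  define J where "J x = integral {-1..x} f - integral {-1..0} f + Li2 (-1)" for x
  have cont: "continuous_on S f" for S
    unfolding f_def by (intro continuous_intros) (auto simp: add_pos_pos less_imp_neq[symmetric])
  have J: "(J has_real_derivative f x) (at x)" if "x \<ge> 0" for x
  proof -
    have "((\<lambda>u. integral {-1..u} f) has_real_derivative f x) (at x within {-1..x+1})"
      by (rule integral_has_real_derivative[OF cont]) (use that in auto)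
    hence "((\<lambda>u. integral {-1..u} f) has_real_derivative f x) (at x)"
      using that by (subst (asm) at_within_interior) auto
    thus ?thesis unfolding J_def[abs_def] by (auto intro!: derivative_eq_intros)
  qed
  moreover have "J x = Li2 (- exp (- x))" if "x \<ge> 0" for x
  proof (cases "x = 0")
    case False
    have "- 1 \<le> exp (- x)" for x :: real by (rule order_trans[of _ 0]) auto
    note m1 = this
    have cL: "continuous_on {0..x} (\<lambda>x. Li2 (- exp (- x)))"
      by (rule continuous_on_compose2[OF continuous_on_Li2]) (use m1 in \<open>auto intro!: continuous_intros\<close>)
    have "J x - Li2 (- exp (- x)) = J 0 - Li2 (- exp (- 0))"
    proof (rule DERIV_isconst2[where a=0 and b=x])
      show "continuous_on {0..x} (\<lambda>x. J x - Li2 (- exp (- x)))"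
      proof (rule continuous_on_diff[OF _ cL])
        have "isCont J y" if "y \<in> {0..x}" for y using J[of y] that by (intro DERIV_isCont) auto
        thus "continuous_on {0..x} J" by (intro continuous_at_imp_continuous_on) auto
      qed
      fix y assume y: "0 < y" "y < x"
      show "((\<lambda>x. J x - Li2 (- exp (- x))) has_real_derivative 0) (at y)"
        using DERIV_diff[OF J[of y] DERIV_Li2_exp[of y "-1"]] y by (simp add: f_def)
    qed (use False that in auto)
    thus ?thesis by (simp add: J_def)
  qed (simp add: J_def)
  ultimately show ?thesis unfolding f_def by blast
qed

text \<open>The Euler--Maclaurin series at 0 terminates: odd \<open>p \<ge> 3\<close> drop out with
  the Bernoulli numbers, even \<open>p \<ge> 4\<close> because \<open>polylog_poly (p - 1)\<close>
  vanishes at \<open>- 1 / 2\<close>. Three terms survive, and the error is below every power of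
  \<epsilon>.\<close>

lemma sum_ln_one_plus_asymp:
  obtains K where "K \<ge> 0" "\<And>\<epsilon>. 0 < \<epsilon> \<Longrightarrow> \<epsilon> \<le> 1 \<Longrightarrow> summable (\<lambda>k. ln (1 + exp (- (real (Suc k) * \<epsilon>)))) \<and>
    \<bar>(\<Sum>k. ln (1 + exp (- (real (Suc k) * \<epsilon>)))) - (pi\<^sup>2 / (12 * \<epsilon>) - ln 2 / 2 + \<epsilon> / 24)\<bar> \<le> K * \<epsilon> ^ M"
proof -
  obtain J where J: "\<And>x. x \<ge> 0 \<Longrightarrow> (J has_real_derivative ln (1 + exp (- x))) (at x)"
    "\<And>x. x \<ge> 0 \<Longrightarrow> J x = Li2 (- exp (- x))" using dilog_neg_ex by blast
  have "\<exists>K. \<forall>x\<ge>0. \<bar>J x\<bar> \<le> K * exp (- x)"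
    using abs_Li2_le[of "- exp (- x)" for x] J(2) by (intro exI[of _ "pi\<^sup>2 / 6"]) auto
  then interpret derivative_family 0 "polylog_family (-1) J"
    by (intro polylog_family) (use J in auto)
  \<comment> \<open>The order \<open>M + 2\<close> puts the term \<open>p = 2\<close> in range even
    for \<open>M = 0\<close> and leaves room for the division by \<epsilon>.\<close>
  obtain K where K: "K \<ge> 0" "\<And>x \<epsilon>. x \<ge> 0 \<Longrightarrow> 0 < \<epsilon> \<Longrightarrow> \<epsilon> \<le> 1 \<Longrightarrow>
    \<bar>\<epsilon> * (\<Sum>k. polylog_family (-1) J 1 (x + real (Suc k) * \<epsilon>)) - euler_maclaurin (Suc (M + 2)) \<epsilon> x\<bar> \<le> K * \<epsilon> ^ Suc (M + 2)"
    using euler_maclaurin_bound by metis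
  show ?thesis
  proof (rule that[OF K(1)])
    fix \<epsilon> :: real assume e: "0 < \<epsilon>" "\<epsilon> \<le> 1"
    let ?S = "\<Sum>k. ln (1 + exp (- (real (Suc k) * \<epsilon>)))"
    have "(\<Sum>p\<le>Suc (M + 2). (-1) ^ p * bernoulli p / fact p * \<epsilon> ^ p * polylog_family (-1) J p 0) =
          (\<Sum>p\<le>2. (-1) ^ p * bernoulli p / fact p * \<epsilon> ^ p * polylog_family (-1) J p 0)"
    proof (rule sum.mono_neutral_right, simp, simp, rule ballI)
      fix p :: nat assume "p \<in> {..Suc (M + 2)} - {..2}"
      hence p: "\<not> p \<le> 2" by simp
      show "(-1) ^ p * bernoulli p / fact p * \<epsilon> ^ p * polylog_family (-1) J p 0 = 0"
      proof (cases "odd p")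
        case True thus ?thesis using p by (simp add: bernoulli_odd)
      next
        case False
        obtain k where k: "p = Suc (Suc k)" using p by (metis not_less_eq_eq numeral_2_eq_2 old.nat.exhaust zero_le)
        have "poly (polylog_poly (Suc k)) (-1/2) = 0" using False p k by (intro polylog_poly_half_odd) auto
        thus ?thesis by (simp add: k)
      qed
    qed
    hence em: "euler_maclaurin (Suc (M + 2)) \<epsilon> 0 = pi\<^sup>2 / 12 - \<epsilon> * ln 2 / 2 + \<epsilon>\<^sup>2 / 24"
      unfolding euler_maclaurin_def using bernoulli_1 bernoulli_2 J(2)[of 0]
      by (simp add: Li2_m1 numeral_2_eq_2)
    have "summable (\<lambda>k. ln (1 + exp (- (real (Suc k) * \<epsilon>))))"
      using summable_shift[of 0 \<epsilon> 1] e by simp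
    moreover have "\<bar>\<epsilon> * ?S - (pi\<^sup>2 / 12 - \<epsilon> * ln 2 / 2 + \<epsilon>\<^sup>2 / 24)\<bar> \<le> K * \<epsilon> ^ Suc (M + 2)"
      using K(2)[of 0 \<epsilon>] e unfolding em by simp
    moreover have "\<epsilon> * ?S - (pi\<^sup>2 / 12 - \<epsilon> * ln 2 / 2 + \<epsilon>\<^sup>2 / 24) = \<epsilon> * (?S - (pi\<^sup>2 / (12 * \<epsilon>) - ln 2 / 2 + \<epsilon> / 24))"
      using e by (simp add: field_simps power2_eq_square)
    ultimately have "\<epsilon> * \<bar>?S - (pi\<^sup>2 / (12 * \<epsilon>) - ln 2 / 2 + \<epsilon> / 24)\<bar> \<le> \<epsilon> * (K * \<epsilon> ^ (M + 2))"
      using e by (simp add: abs_mult mult_ac)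
    hence "\<bar>?S - (pi\<^sup>2 / (12 * \<epsilon>) - ln 2 / 2 + \<epsilon> / 24)\<bar> \<le> K * \<epsilon> ^ (M + 2)"
      using e by (simp only: mult_le_cancel_left_pos)
    also have "\<dots> \<le> K * \<epsilon> ^ M" using K e by (intro mult_left_mono power_decreasing) auto
    finally show "summable (\<lambda>k. ln (1 + exp (- (real (Suc k) * \<epsilon>)))) \<and> \<bar>?S - (pi\<^sup>2 / (12 * \<epsilon>) - ln 2 / 2 + \<epsilon> / 24)\<bar> \<le> K * \<epsilon> ^ M"
      using \<open>summable _\<close> by blast
  qed
qed

section \<open>The local exponent\<close>

lemma coeff_bernoulli_poly:
  assumes "k \<le> p" shows "coeff (bernoulli_poly p) (p - k) = real (p choose k) * bernoulli k"
proof -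
  have "coeff (bernoulli_poly p) (p - k) = (\<Sum>i\<le>p. if p - i = p - k then real (p choose i) * bernoulli i else 0)"
    by (simp add: bernoulli_poly_def coeff_sum)
  also have "\<dots> = (\<Sum>i\<le>p. if i = k then real (p choose k) * bernoulli k else 0)"
    by (intro sum.cong) (use assms in auto)
  finally show ?thesis using assms by simp
qed

text \<open>The monomial with the Bernoulli number of index \<open>k\<close> carries
  \<open>s ^ (p - 2 + k)\<close>, so at most one monomial contributes to a given power.\<close>

lemma bernoulli_term_nth:
  assumes "p \<ge> 2"
  shows "fps_nth (bernoulli_term T p) n =
    (if p \<le> n + 2 \<and> n + 2 \<le> 2 * p then real (p choose (n + 2 - p)) * bernoulli (n + 2 - p) * T ^ (2 * p - (n + 2)) else 0)"
proof -
  have "fps_nth (bernoulli_term T p) n = (\<Sum>j\<le>p. if n = 2 * (p - 1) - j then coeff (bernoulli_poly p) j * T ^ j else 0)"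
    unfolding bernoulli_term_def fps_sum_nth fps_mult_left_const_nth fps_X_power_nth
    by (intro sum.cong) auto
  also have "\<dots> = (\<Sum>k\<le>p. if n = 2 * (p - 1) - (p - k) then coeff (bernoulli_poly p) (p - k) * T ^ (p - k) else 0)"
    by (rule sum.nat_diff_reindex[of "\<lambda>j. if n = 2 * (p - 1) - j then coeff (bernoulli_poly p) j * T ^ j else 0" "Suc p", symmetric, simplified lessThan_Suc_atMost diff_Suc_Suc])
  also have "\<dots> = (\<Sum>k\<le>p. if p \<le> n + 2 \<and> k = n + 2 - p then real (p choose k) * bernoulli k * T ^ (p - k) else 0)"
  proof (intro sum.cong refl)
    fix k assume k: "k \<in> {..p}"
    have "n = 2 * (p - 1) - (p - k) \<longleftrightarrow> p \<le> n + 2 \<and> k = n + 2 - p" using assms k by auto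
    thus "(if n = 2 * (p - 1) - (p - k) then coeff (bernoulli_poly p) (p - k) * T ^ (p - k) else 0) =
      (if p \<le> n + 2 \<and> k = n + 2 - p then real (p choose k) * bernoulli k * T ^ (p - k) else 0)"
      using k by (simp only: coeff_bernoulli_poly atMost_iff)
  qed
  also have "\<dots> = (if p \<le> n + 2 \<and> n + 2 - p \<le> p then real (p choose (n + 2 - p)) * bernoulli (n + 2 - p) * T ^ (p - (n + 2 - p)) else 0)"
    by (cases "p \<le> n + 2") auto
  also have "\<dots> = (if p \<le> n + 2 \<and> n + 2 \<le> 2 * p then real (p choose (n + 2 - p)) * bernoulli (n + 2 - p) * T ^ (2 * p - (n + 2)) else 0)"
    by (rule if_cong) (auto simp: mult_2)
  finally show ?thesis .
qed

text \<open>Up to sign, the part of \<open>s ^ l\<close> with Bernoulli index \<open>k\<close> in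
  the Euler--Maclaurin series at \<open>u - T * s\<close> with step \<open>s ^ 2\<close>: the factor
  \<open>s ^ (2 * k)\<close> leaves the Taylor order \<open>l - 2 * k\<close>, and the derivative
  involved has order \<open>l - k\<close>. In the application \<open>h q\<close> is the derivative
  of order \<open>q\<close> at \<open>u\<close> times \<open>(-1) ^ q\<close>.\<close>

definition exponent_coeff :: "(nat \<Rightarrow> real) \<Rightarrow> real \<Rightarrow> nat \<Rightarrow> nat \<Rightarrow> real" where
  "exponent_coeff h T l k = bernoulli k / (fact k * fact (l - 2 * k)) * T ^ (l - 2 * k) * h (l - k)"

text \<open>With \<open>p = n + 2 - k\<close>, the condition \<open>p \<ge> 3\<close> becomes
  \<open>k < n\<close> and \<open>k \<le> p\<close> becomes \<open>2 * k \<le> n + 2\<close>. The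
  values \<open>h 0\<close> and \<open>h 1\<close> stay free, to be the dilogarithm and the
  logarithm later.\<close>

lemma D_exponent_nth:
  assumes h: "\<And>q. q \<ge> 2 \<Longrightarrow> h q = poly (polylog_poly (q - 1)) X"
  shows "fps_nth (D_exponent b X T) n = (if n = 1 then (b + 1/2 * X) * T else 0)
    - (\<Sum>k | k < n \<and> 2 * k \<le> n + 2. exponent_coeff h T (n + 2) k)"
proof -
  define f where "f m = (let p = m + 3 in fps_const (1 / fact p * poly (polylog_poly (p - 1)) X) * bernoulli_term T p)" for m
  have f: "fps_nth (f m) n = (if m < n \<and> 2 * (n - 1 - m) \<le> n + 2 then exponent_coeff h T (n + 2) (n - 1 - m) else 0)" for m n
  proof (cases "m < n \<and> n \<le> 2 * m + 4")
    case True
    define k where "k = n - 1 - m"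
    have k: "k \<le> m + 3" "n + 2 - (m + 3) = k" "n + 2 - 2 * k = m + 3 - k" "2 * (m + 3) - (n + 2) = m + 3 - k"
       "n + 2 - k = m + 3" "2 * k \<le> n + 2" using True by (auto simp: k_def)
    have "real (m + 3 choose k) / fact (m + 3) = 1 / (fact k * fact (m + 3 - k))"
      using k(1) by (simp add: binomial_fact)
    thus ?thesis using True k unfolding k_def[symmetric]
      by (simp add: f_def Let_def bernoulli_term_nth exponent_coeff_def h[of "m + 3"] del: fact_Suc)
         (simp add: field_simps del: fact_Suc)?
  next
    case False
    hence "\<not> (m < n \<and> 2 * (n - 1 - m) \<le> n + 2)" by auto
    moreover have "fps_nth (bernoulli_term T (m + 3)) n = 0"
      using False by (subst bernoulli_term_nth) auto
    ultimately show ?thesis unfolding f_def Let_def fps_mult_left_const_nth by auto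
  qed
  have "f sums Abs_fps (\<lambda>n. \<Sum>m<n. fps_nth (f m) n)"
    unfolding sums_def
  proof (rule tendsto_fpsI)
    fix n
    have "fps_nth (sum f {..<N}) n = (\<Sum>m<n. fps_nth (f m) n)" if "N \<ge> n" for N
      unfolding fps_sum_nth using that by (intro sum.mono_neutral_right) (auto simp: f)
    thus "eventually (\<lambda>N. fps_nth (sum f {..<N}) n = fps_nth (Abs_fps (\<lambda>n. \<Sum>m<n. fps_nth (f m) n)) n) sequentially"
      by (auto intro!: eventually_sequentiallyI[of n])
  qed
  hence "suminf f = Abs_fps (\<lambda>n. \<Sum>m<n. fps_nth (f m) n)" by (rule sums_unique[symmetric])
  hence "fps_nth (suminf f) n = (\<Sum>m<n. if 2 * (n - 1 - m) \<le> n + 2 then exponent_coeff h T (n + 2) (n - 1 - m) else 0)"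
    by (simp add: f)
  also have "\<dots> = (\<Sum>k<n. if 2 * k \<le> n + 2 then exponent_coeff h T (n + 2) k else 0)"
    by (subst sum.nat_diff_reindex[symmetric]) (rule sum.cong, auto)
  also have "\<dots> = (\<Sum>k | k < n \<and> 2 * k \<le> n + 2. exponent_coeff h T (n + 2) k)"
    by (subst sum.inter_filter[symmetric]) (auto intro!: sum.cong)
  finally have "fps_nth (suminf f) n = (\<Sum>k | k < n \<and> 2 * k \<le> n + 2. exponent_coeff h T (n + 2) k)" .
  moreover have "D_exponent b X T = fps_const ((b + 1/2 * X) * T) * fps_X - suminf f"
    unfolding D_exponent_def f_def by simp
  ultimately show ?thesis by simp
qed

lemma D_exponent_nth_0: "fps_nth (D_exponent b X T) 0 = 0"
  by (subst D_exponent_nth[of "\<lambda>q. poly (polylog_poly (q - 1)) X"]) auto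

text \<open>The coefficients with \<open>k \<ge> l - 2\<close> are the explicit terms split off in \<open>D_exponent\<close>.\<close>

lemma exponent_expansion:
  assumes h: "\<And>q. q \<ge> 2 \<Longrightarrow> h q = poly (polylog_poly (q - 1)) X"
  shows "fps_nth (fps_X ^ 2 * D_exponent b X T) l = - (\<Sum>k | 2 * k \<le> l. exponent_coeff h T l k)
    + (if l = 0 then h 0 else 0) + (if l = 1 then T * h 1 else 0) + (if l = 2 then X * T\<^sup>2 / 2 - h 1 / 2 else 0)
    + (if l = 3 then b * T else 0) + (if l = 4 then X / 12 else 0)"
proof -
  have h2: "h 2 = X" using h[of 2] by simp
  have b1: "bernoulli (Suc 0) = -1/2" using bernoulli_1 by simp
  consider "l = 0" | "l = 1" | "l = 2" | "l = 3" | "l = 4" | "l \<ge> 5" by linarith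
  thus ?thesis
  proof cases
    case 1
    have "{k. 2 * k \<le> (0::nat)} = {0}" by auto
    thus ?thesis using 1 by (simp add: fps_X_power_mult_nth exponent_coeff_def)
  next
    case 2
    have "{k. 2 * k \<le> (1::nat)} = {0}" by auto
    thus ?thesis using 2 by (simp add: fps_X_power_mult_nth exponent_coeff_def)
  next
    case 3
    have "{k. 2 * k \<le> (2::nat)} = {0, 1}" by auto
    hence "(\<Sum>k | 2 * k \<le> 2. exponent_coeff h T 2 k) = X * T\<^sup>2 / 2 - h 1 / 2"
      using h2 b1 by (simp add: exponent_coeff_def numeral_2_eq_2)
    thus ?thesis using 3 by (simp add: fps_X_power_mult_nth D_exponent_nth_0)
  next
    case 4
    have "{k. 2 * k \<le> (3::nat)} = {0, 1}" "{k. k < 1 \<and> 2 * k \<le> (1::nat) + 2} = {0}" by auto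
    thus ?thesis using 4 h2 b1
      by (simp add: fps_X_power_mult_nth D_exponent_nth[OF h]) (simp add: exponent_coeff_def eval_nat_numeral algebra_simps)
  next
    case 5
    have "{k. 2 * k \<le> (4::nat)} = {0, 1, 2}" "{k. k < 2 \<and> 2 * k \<le> (2::nat) + 2} = {0, 1}" by auto
    thus ?thesis using 5 h2 bernoulli_2
      by (simp add: fps_X_power_mult_nth D_exponent_nth[OF h]) (simp add: exponent_coeff_def numeral_2_eq_2)
  next
    case 6
    define n where "n = l - 2"
    have n: "l = n + 2" "n \<ge> 3" using 6 by (auto simp: n_def)
    hence "{k. k < n \<and> 2 * k \<le> n + 2} = {k. 2 * k \<le> l}" by auto
    thus ?thesis using n by (simp add: fps_X_power_mult_nth D_exponent_nth[OF h])
  qed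
qed

text \<open>At \<open>x = n * \<epsilon>\<close> this is the logarithm of the product of
  \<open>1 - q ^ k\<close> over all \<open>k > n\<close>. It expresses \<open>(q)_n\<close> as a
  quotient of two values and interpolates it to real \<open>n\<close>.\<close>

definition tail_log :: "real \<Rightarrow> real \<Rightarrow> real" where
  "tail_log \<epsilon> x = (\<Sum>k. ln (1 - exp (- (x + real (Suc k) * \<epsilon>))))"

text \<open>What is left of the logarithm of one factor of the summand once the critical value, the
  linear term and the Gaussian part are removed. The terms \<open>L / 2\<close> and
  \<open>X * s ^ 2 / 12\<close> are accounted for in \<beta> and \<gamma>, and
  \<open>b * T * s\<close> is the contribution of \<open>B\<close>.\<close>

definition local_exponent :: "real \<Rightarrow> real \<Rightarrow> real \<Rightarrow> real \<Rightarrow> real" where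
  "local_exponent b u s T = (let L = ln (1 - exp (- u)); X = 1 / (exp u - 1) in
     tail_log (s\<^sup>2) (u - T * s) + dilog u / s\<^sup>2 - T / s * L + L / 2 + X * T\<^sup>2 / 2 + X * s\<^sup>2 / 12 + b * T * s)"

context expansion_domain
begin

text \<open>Euler--Maclaurin is applied at the moving point \<open>u - \<tau> t * s\<close>, and
  each derivative occurring there is Taylor expanded about \<open>u\<close>. The bound on
  \<open>\<tau> t * s\<close> keeps that point in \<open>{u / 2..}\<close>, away from the
  singularity at 0.\<close>

lemma aexp_local_exponent:
  assumes u: "u > 0" and \<tau>: "\<And>t. \<bar>\<tau> t\<bar> \<le> 1 + norm t" and dom: "\<And>s t. (s, t) \<in> D \<Longrightarrow> \<bar>\<tau> t\<bar> * s \<le> u / 2"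
  shows "aexp (\<lambda>s t. local_exponent b u s (\<tau> t)) (\<lambda>t. D_exponent b (1 / (exp u - 1)) (\<tau> t))"
proof -
  define G where "G = polylog_family 1 dilog"
  interpret derivative_family "u / 2" G
    unfolding G_def
  proof (rule polylog_family)
    show "(dilog has_real_derivative ln (1 - 1 * exp (- x))) (at x)" if "x \<ge> u / 2" for x
      using DERIV_dilog[of x] u that by simp
    show "\<exists>K. \<forall>x\<ge>u / 2. \<bar>dilog x\<bar> \<le> K * exp (- x)"
      using abs_Li2_le[of "exp (- x)" for x] u by (intro exI[of _ "pi\<^sup>2 / 6"]) (auto simp: dilog_def)
  qed (use u in auto)
  define X where "X = 1 / (exp u - 1)"
  define L where "L = ln (1 - exp (- u))"
  define h where "h q = (-1) ^ q * G q u" for q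
  have h: "h q = poly (polylog_poly (q - 1)) X" if q: "q \<ge> 2" for q
  proof -
    obtain k where "q = Suc (Suc k)" using q by (metis Suc_diff_le add_2_eq_Suc le_add_diff_inverse)
    thus ?thesis by (simp add: h_def G_def X_def flip: power_add mult.assoc power_mult_distrib)
  qed
  have h0: "h 0 = dilog u" and h1: "h 1 = - L" by (simp_all add: h_def G_def L_def)
  have Tay: "aexp (\<lambda>s t. G p (u - \<tau> t * s)) (\<lambda>t. Abs_fps (\<lambda>j. G (p + j) u / fact j * (- \<tau> t) ^ j))" for p
    unfolding aexp_def
  proof
    fix M
    obtain K where K: "K \<ge> 0" "\<And>x. x \<ge> u / 2 \<Longrightarrow> \<bar>G (p + M) x\<bar> \<le> K * exp (- x)" using decayE by blast
    show "bigw M (\<lambda>s t. G p (u - \<tau> t * s) - (\<Sum>m<M. fps_nth (Abs_fps (\<lambda>j. G (p + j) u / fact j * (- \<tau> t) ^ j)) m * s ^ m))"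
    proof (rule bigwI)
      fix s t assume st: "(s, t) \<in> D"
      let ?y = "u - \<tau> t * s"
      have s: "0 < s" "s \<le> 1" using D01[OF st] by auto
      have "\<tau> t * s \<le> \<bar>\<tau> t\<bar> * s" using s by (intro mult_right_mono) auto
      hence y: "?y \<ge> u / 2" using dom[OF st] by simp
      have "\<bar>G p ?y - (\<Sum>m<M. G (p + m) u / fact m * (?y - u) ^ m)\<bar> \<le> K * exp (- min ?y u) * \<bar>?y - u\<bar> ^ M"
        by (rule taylor_bound[OF y _ K]) (use u in auto)
      also have "(\<Sum>m<M. G (p + m) u / fact m * (?y - u) ^ m) = (\<Sum>m<M. fps_nth (Abs_fps (\<lambda>j. G (p + j) u / fact j * (- \<tau> t) ^ j)) m * s ^ m)"
      proof (intro sum.cong refl)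
        fix m
        have "?y - u = - \<tau> t * s" by simp
        hence "(?y - u) ^ m = (- \<tau> t) ^ m * s ^ m" by (simp only: power_mult_distrib)
        thus "G (p + m) u / fact m * (?y - u) ^ m = fps_nth (Abs_fps (\<lambda>j. G (p + j) u / fact j * (- \<tau> t) ^ j)) m * s ^ m"
          by (simp only: fps_nth_Abs_fps mult.assoc)
      qed
      also have "K * exp (- min ?y u) * \<bar>?y - u\<bar> ^ M \<le> K * 1 * ((1 + norm t) * s) ^ M"
      proof (intro mult_mono power_mono)
        show "exp (- min ?y u) \<le> 1" using y u by simp
        show "\<bar>?y - u\<bar> \<le> (1 + norm t) * s" using \<tau>[of t] s by (simp add: abs_mult mult_right_mono)
      qed (use K in auto)
      finally show "\<bar>G p ?y - (\<Sum>m<M. fps_nth (Abs_fps (\<lambda>j. G (p + j) u / fact j * (- \<tau> t) ^ j)) m * s ^ m)\<bar> \<le> K * (1 + norm t) ^ M * s ^ M"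
        by (simp add: power_mult_distrib)
    qed
  qed
  define E where "E t = Abs_fps (\<lambda>l. - (\<Sum>k | 2 * k \<le> l. exponent_coeff h (\<tau> t) l k))" for t
  have em: "aexp (\<lambda>s t. s\<^sup>2 * tail_log (s\<^sup>2) (u - \<tau> t * s)) E"
  proof (rule aexp_approx)
    fix M
    obtain K where K: "K \<ge> 0" "\<And>x \<epsilon>. x \<ge> u / 2 \<Longrightarrow> 0 < \<epsilon> \<Longrightarrow> \<epsilon> \<le> 1 \<Longrightarrow>
      \<bar>\<epsilon> * (\<Sum>k. G 1 (x + real (Suc k) * \<epsilon>)) - euler_maclaurin (Suc M) \<epsilon> x\<bar> \<le> K * \<epsilon> ^ Suc M"
      using euler_maclaurin_bound by metis
    let ?c = "\<lambda>p. (-1) ^ p * bernoulli p / fact p"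
    let ?\<phi> = "\<lambda>s t. euler_maclaurin (Suc M) (s\<^sup>2) (u - \<tau> t * s)"
    let ?\<Phi> = "\<lambda>t. \<Sum>p\<le>Suc M. (fps_const (- ?c p) * fps_X ^ (2 * p)) * Abs_fps (\<lambda>j. G (p + j) u / fact j * (- \<tau> t) ^ j)"
    have "aexp (\<lambda>s t. \<Sum>p\<le>Suc M. (- ?c p * s ^ (2 * p)) * G p (u - \<tau> t * s)) ?\<Phi>"
      by (intro aexp_sum aexp_mult Tay aexp_monom[of "\<lambda>t. - ?c p" "\<bar>?c p\<bar>" 0 for p]) auto
    also have "(\<lambda>s t. \<Sum>p\<le>Suc M. (- ?c p * s ^ (2 * p)) * G p (u - \<tau> t * s)) = ?\<phi>"
      by (intro ext) (simp only: euler_maclaurin_def sum_negf[symmetric] power_mult mult_minus_left)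
    finally have 1: "aexp ?\<phi> ?\<Phi>" .
    have 2: "bigw M (\<lambda>s t. s\<^sup>2 * tail_log (s\<^sup>2) (u - \<tau> t * s) - ?\<phi> s t)"
    proof (rule bigwI)
      fix s t assume st: "(s, t) \<in> D"
      have s: "0 < s" "s \<le> 1" using D01[OF st] by auto
      have "\<tau> t * s \<le> \<bar>\<tau> t\<bar> * s" using s by (intro mult_right_mono) auto
      hence y: "u - \<tau> t * s \<ge> u / 2" using dom[OF st] by simp
      have s2: "s\<^sup>2 \<le> 1" using s by (intro power_le_one) auto
      have "\<bar>s\<^sup>2 * tail_log (s\<^sup>2) (u - \<tau> t * s) - ?\<phi> s t\<bar> \<le> K * (s\<^sup>2) ^ Suc M"
        using K(2)[OF y _ s2] s by (simp add: tail_log_def G_def)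
      also have "(s\<^sup>2) ^ Suc M = s ^ (2 * Suc M)" by (rule power_mult[symmetric])
      also have "K * s ^ (2 * Suc M) \<le> K * s ^ M" using K s by (intro mult_left_mono power_decreasing) auto
      finally show "\<bar>s\<^sup>2 * tail_log (s\<^sup>2) (u - \<tau> t * s) - ?\<phi> s t\<bar> \<le> K * (1 + norm t) ^ 0 * s ^ M" by simp
    qed
    have 3: "fps_nth (?\<Phi> t) l = fps_nth (E t) l" if l: "l < M" for t l
    proof -
      have "fps_nth (?\<Phi> t) l = (\<Sum>p\<le>Suc M. - (if 2 * p \<le> l then exponent_coeff h (\<tau> t) l p else 0))"
        unfolding fps_sum_nth
      proof (intro sum.cong refl)
        fix p
        show "fps_nth ((fps_const (- ?c p) * fps_X ^ (2 * p)) * Abs_fps (\<lambda>j. G (p + j) u / fact j * (- \<tau> t) ^ j)) l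
           = - (if 2 * p \<le> l then exponent_coeff h (\<tau> t) l p else 0)"
        proof (cases "2 * p \<le> l")
          case True
          hence e: "p + (l - 2 * p) = l - p" by simp
          have "(-1) ^ p * (-1) ^ (l - 2 * p) = (-1 :: real) ^ (l - p)" by (simp add: power_add[symmetric] e)
          moreover have "(- \<tau> t) ^ (l - 2 * p) = (-1) ^ (l - 2 * p) * \<tau> t ^ (l - 2 * p)" by (rule power_minus)
          ultimately show ?thesis using True
            by (simp add: mult.assoc fps_X_power_mult_nth exponent_coeff_def h_def e) (simp add: field_simps)?
        qed (simp add: mult.assoc fps_X_power_mult_nth)
      qed
      also have "\<dots> = - (\<Sum>p | 2 * p \<le> l. exponent_coeff h (\<tau> t) l p)"
        unfolding sum_negf by (rule arg_cong[of _ _ uminus]) (use l in \<open>auto intro!: sum.mono_neutral_cong_right split: if_splits\<close>)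
      finally show ?thesis by (simp add: E_def)
    qed
    show "\<exists>\<phi>' \<Phi>'. aexp \<phi>' \<Phi>' \<and> bigw M (\<lambda>s t. s\<^sup>2 * tail_log (s\<^sup>2) (u - \<tau> t * s) - \<phi>' s t) \<and> (\<forall>t. \<forall>p<M. fps_nth (\<Phi>' t) p = fps_nth (E t) p)"
      using 1 2 3 by blast
  qed
  have mono: "aexp (\<lambda>s t. (c * \<tau> t ^ j) * s ^ k) (\<lambda>t. fps_const (c * \<tau> t ^ j) * fps_X ^ k)" for c j k
  proof (rule aexp_monom[of _ "\<bar>c\<bar>" j])
    fix t show "\<bar>c * \<tau> t ^ j\<bar> \<le> \<bar>c\<bar> * (1 + norm t) ^ j"
      unfolding abs_mult power_abs by (intro mult_left_mono power_mono \<tau>) auto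
  qed
  let ?R = "\<lambda>s t. s\<^sup>2 * tail_log (s\<^sup>2) (u - \<tau> t * s) + (dilog u * \<tau> t ^ 0) * s ^ 0 + (- L * \<tau> t ^ 1) * s ^ 1
      + (X / 2 * \<tau> t ^ 2) * s ^ 2 + (L / 2 * \<tau> t ^ 0) * s ^ 2 + (b * \<tau> t ^ 1) * s ^ 3 + (X / 12 * \<tau> t ^ 0) * s ^ 4"
  let ?F = "\<lambda>t. E t + fps_const (dilog u * \<tau> t ^ 0) * fps_X ^ 0 + fps_const (- L * \<tau> t ^ 1) * fps_X ^ 1
      + fps_const (X / 2 * \<tau> t ^ 2) * fps_X ^ 2 + fps_const (L / 2 * \<tau> t ^ 0) * fps_X ^ 2 + fps_const (b * \<tau> t ^ 1) * fps_X ^ 3 + fps_const (X / 12 * \<tau> t ^ 0) * fps_X ^ 4"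
  have "aexp ?R ?F" by (intro aexp_add em mono)
  also have "?F = (\<lambda>t. fps_X\<^sup>2 * D_exponent b X (\<tau> t))"
  proof (intro ext fps_ext)
    fix t l
    show "fps_nth (?F t) l = fps_nth (fps_X\<^sup>2 * D_exponent b X (\<tau> t)) l"
    proof -
      have "fps_nth (fps_X ^ 2 * D_exponent b X (\<tau> t)) l = - (\<Sum>k | 2 * k \<le> l. exponent_coeff h (\<tau> t) l k)
        + (if l = 0 then h 0 else 0) + (if l = 1 then \<tau> t * h 1 else 0) + (if l = 2 then X * (\<tau> t)\<^sup>2 / 2 - h 1 / 2 else 0)
        + (if l = 3 then b * \<tau> t else 0) + (if l = 4 then X / 12 else 0)"
        by (rule exponent_expansion) (rule h)
      thus ?thesis
        unfolding h0 h1 fps_add_nth fps_mult_left_const_nth fps_X_power_nth E_def fps_nth_Abs_fps by simp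
    qed
  qed
  finally have "aexp ?R (\<lambda>t. fps_X\<^sup>2 * D_exponent b X (\<tau> t))" .
  hence "aexp (\<lambda>s t. s\<^sup>2 * local_exponent b u s (\<tau> t)) (\<lambda>t. fps_X\<^sup>2 * D_exponent b X (\<tau> t))"
    unfolding aexp_def
  proof (intro allI, elim allE)
    fix M
    let ?S = "\<lambda>s t. \<Sum>p<M. fps_nth (fps_X\<^sup>2 * D_exponent b X (\<tau> t)) p * s ^ p"
    assume "bigw M (\<lambda>s t. ?R s t - ?S s t)"
    also have "bigw M (\<lambda>s t. ?R s t - ?S s t) \<longleftrightarrow> bigw M (\<lambda>s t. s\<^sup>2 * local_exponent b u s (\<tau> t) - ?S s t)"
    proof (rule bigw_cong)
      fix s t assume "(s, t) \<in> D"
      hence "s > 0" using D01 by blast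
      hence "?R s t = s\<^sup>2 * local_exponent b u s (\<tau> t)"
        unfolding local_exponent_def Let_def L_def[symmetric] X_def[symmetric]
        by (simp add: field_simps power2_eq_square power3_eq_cube power4_eq_xxxx)
      thus "?R s t - ?S s t = s\<^sup>2 * local_exponent b u s (\<tau> t) - ?S s t" by simp
    qed
    finally show "bigw M (\<lambda>s t. s\<^sup>2 * local_exponent b u s (\<tau> t) - ?S s t)" .
  qed
  thus ?thesis unfolding X_def by (rule aexp_shift)
qed

end

section \<open>Sums over lattices\<close>

lemma lborel_prod_integral:
  fixes f :: "'a::euclidean_space \<Rightarrow> real \<Rightarrow> real"
  assumes f: "\<And>b. b \<in> Basis \<Longrightarrow> integrable lborel (f b)"
  shows "integrable lborel (\<lambda>x::'a. \<Prod>b\<in>Basis. f b (x \<bullet> b))"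
    and "(LINT x|lborel. (\<Prod>b\<in>Basis. f b (x \<bullet> b))) = (\<Prod>b\<in>Basis. LINT y|lborel. f b y)"
proof -
  interpret product_sigma_finite "\<lambda>_::'a. lborel :: real measure" by standard
  have [measurable]: "f b \<in> borel_measurable borel" if "b \<in> Basis" for b
    using borel_measurable_integrable[OF f[OF that]] by simp
  have meas: "(\<lambda>x::'a. \<Prod>b\<in>Basis. f b (x \<bullet> b)) \<in> borel_measurable borel" by measurable
  have meas2: "(\<lambda>y. \<Sum>b\<in>Basis. y b *\<^sub>R b) \<in> measurable (\<Pi>\<^sub>M b\<in>Basis. lborel) (borel :: 'a measure)" by measurable
  have e: "(\<Prod>b\<in>Basis. f b ((\<Sum>b'\<in>Basis. y b' *\<^sub>R b') \<bullet> b)) = (\<Prod>b\<in>Basis. f b (y b))" for y :: "'a \<Rightarrow> real"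
    by (intro prod.cong refl) simp
  show "integrable lborel (\<lambda>x::'a. \<Prod>b\<in>Basis. f b (x \<bullet> b))"
    by (subst lborel_eq, subst integrable_distr_eq[OF meas2 meas], unfold e)
       (intro product_integrable_prod f finite_Basis)
  show "(LINT x|lborel. (\<Prod>b\<in>Basis. f b (x \<bullet> b))) = (\<Prod>b\<in>Basis. LINT y|lborel. f b y)"
    by (subst lborel_eq, subst integral_distr[OF meas2 meas], unfold e)
       (intro product_integral_prod f finite_Basis)
qed

lemma norm_power2_eq_sum_Basis: "(norm (x::'a::euclidean_space))\<^sup>2 = (\<Sum>b\<in>Basis. (x \<bullet> b)\<^sup>2)"
  unfolding power2_norm_eq_inner by (subst euclidean_inner) (simp add: power2_eq_square)

lemma exp_norm_power2: "exp (- c * (norm (x::'a::euclidean_space))\<^sup>2) = (\<Prod>b\<in>Basis. exp (- c * (x \<bullet> b)\<^sup>2))"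
  by (simp add: norm_power2_eq_sum_Basis exp_sum[symmetric] sum_distrib_left)

lemma integrable_exp_norm_power2:
  assumes c: "c > 0" shows "integrable lborel (\<lambda>x::'a::euclidean_space. exp (- c * (norm x)\<^sup>2))"
proof -
  define \<sigma> where "\<sigma> = 1 / sqrt (2 * c)"
  have s: "\<sigma> > 0" "2 * \<sigma>\<^sup>2 = 1 / c" using c by (auto simp: \<sigma>_def power_divide)
  have "integrable lborel (\<lambda>x. sqrt (2 * pi * \<sigma>\<^sup>2) * normal_density 0 \<sigma> x)"
    using s by (intro integrable_mult_right integrable_normal_density)
  also have "(\<lambda>x. sqrt (2 * pi * \<sigma>\<^sup>2) * normal_density 0 \<sigma> x) = (\<lambda>x. exp (- c * x\<^sup>2))"
    using s(1) by (intro ext) (simp add: normal_density_def s(2))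
  finally have "integrable lborel (\<lambda>x::real. exp (- c * x\<^sup>2))" .
  thus ?thesis unfolding exp_norm_power2 by (rule lborel_prod_integral(1))
qed

text \<open>A bounded shift is paid for by halving the exponent. This compares a lattice point with
  the points of its cell and also gives majorants uniform in a parameter.\<close>

lemma exp_norm_shift:
  fixes x v :: "'a::real_normed_vector"
  assumes c: "c > 0" and v: "norm v \<le> R"
  shows "exp (- c * (norm (x + v))\<^sup>2) \<le> exp (c * R\<^sup>2) * exp (- (c / 2) * (norm x)\<^sup>2)"
proof -
  have "norm x \<le> norm (x + v) + norm v" using norm_triangle_ineq4[of "x + v" v] by simp
  also have "\<dots> \<le> norm (x + v) + R" using v by simp
  finally have "(norm x)\<^sup>2 \<le> (norm (x + v) + R)\<^sup>2" by (intro power_mono) auto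
  also have "\<dots> \<le> 2 * (norm (x + v))\<^sup>2 + 2 * R\<^sup>2"
    using sum_squares_bound[of "norm (x + v)" R] by (simp add: power2_sum)
  finally have "c * (norm x)\<^sup>2 \<le> c * (2 * (norm (x + v))\<^sup>2 + 2 * R\<^sup>2)" using c by (intro mult_left_mono) auto
  thus ?thesis by (simp add: exp_add[symmetric] algebra_simps)
qed

definition ivec :: "int^'r \<Rightarrow> real^'r" where "ivec n = (\<chi> i. real_of_int (n $ i))"

lemma ivec_nth [simp]: "ivec n $ i = real_of_int (n $ i)" by (simp add: ivec_def)

lemma ivec_add: "ivec (m + n) = ivec m + ivec n" by (simp add: vec_eq_iff)

text \<open>Half-open, so that the translates by \<open>s\<close> times integer vectors partition
  the space; \<open>cell_index\<close> identifies the translate containing a given point.\<close>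

definition cell :: "real \<Rightarrow> real^'r \<Rightarrow> (real^'r) set" where
  "cell s x = {y. \<forall>i. x $ i \<le> y $ i \<and> y $ i < x $ i + s}"

lemma sets_cell [measurable]:
  fixes x :: "real^'r" shows "cell s x \<in> sets borel"
proof -
  have "{y \<in> space borel. \<forall>i. x $ i \<le> y $ i \<and> y $ i < x $ i + s} \<in> sets (borel :: (real^'r) measure)"
    by measurable
  thus ?thesis by (simp add: cell_def)
qed

lemma emeasure_cell:
  fixes x :: "real^'r"
  assumes s: "s > 0" shows "emeasure lborel (cell s x) = ennreal (s ^ CARD('r))"
proof -
  define y where "y = x + (\<chi> i. s)"
  have le: "x \<bullet> b \<le> y \<bullet> b" and pr: "(y - x) \<bullet> b = s" if b: "b \<in> Basis" for b
  proof -
    obtain i where "b = axis i 1" using b by (auto simp: Basis_vec_def)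
    thus "x \<bullet> b \<le> y \<bullet> b" "(y - x) \<bullet> b = s" using s by (auto simp: y_def inner_axis)
  qed
  have prod: "(\<Prod>b\<in>Basis. (y - x) \<bullet> b) = s ^ CARD('r)" by (simp add: pr)
  have "box x y \<subseteq> cell s x" "cell s x \<subseteq> cbox x y"
    by (auto simp: cell_def mem_box_cart y_def less_imp_le)
  hence "emeasure lborel (box x y) \<le> emeasure lborel (cell s x)" "emeasure lborel (cell s x) \<le> emeasure lborel (cbox x y)"
    by (intro emeasure_mono; simp)+
  thus ?thesis using le by (simp add: emeasure_lborel_box_eq emeasure_lborel_cbox_eq prod antisym)
qed

lemma integrable_cell: "s > 0 \<Longrightarrow> integrable lborel (indicator (cell s (x :: real^'r)) :: _ \<Rightarrow> real)"
  by (subst integrable_indicator_iff) (auto simp: emeasure_cell)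

lemma measure_cell: "s > 0 \<Longrightarrow> measure lborel (cell s (x :: real^'r)) = s ^ CARD('r)"
  by (simp add: measure_def emeasure_cell)

lemma cell_index:
  fixes \<theta> :: "real^'r"
  assumes "s > 0"
  shows "y \<in> cell s (\<theta> + s *\<^sub>R ivec n) \<longleftrightarrow> n = (\<chi> i. \<lfloor>(y $ i - \<theta> $ i) / s\<rfloor>)"
proof -
  have "(\<theta> $ i + s * real_of_int (n $ i) \<le> y $ i \<and> y $ i < \<theta> $ i + s * real_of_int (n $ i) + s) \<longleftrightarrow>
     n $ i = \<lfloor>(y $ i - \<theta> $ i) / s\<rfloor>" for i
  proof -
    have "n $ i = \<lfloor>(y $ i - \<theta> $ i) / s\<rfloor> \<longleftrightarrow> real_of_int (n $ i) \<le> (y $ i - \<theta> $ i) / s \<and> (y $ i - \<theta> $ i) / s < real_of_int (n $ i) + 1"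
      using floor_eq_iff[of "(y $ i - \<theta> $ i) / s" "n $ i"] by auto
    also have "\<dots> \<longleftrightarrow> (\<theta> $ i + s * real_of_int (n $ i) \<le> y $ i \<and> y $ i < \<theta> $ i + s * real_of_int (n $ i) + s)"
      using assms by (auto simp: field_simps)
    finally show ?thesis by blast
  qed
  thus ?thesis by (simp add: cell_def vec_eq_iff)
qed

text \<open>A summand times the volume of its cell is at most the integral of a wider Gaussian over
  that cell. Since the cells are disjoint, the total is bounded by one integral, whatever \<theta>
  and \<open>s\<close> are.\<close>

lemma gaussian_lattice_bound:
  assumes c: "c > 0"
  obtains K where "K \<ge> 0" "\<And>(s::real) (\<theta>::real^'r). 0 < s \<Longrightarrow> s \<le> 1 \<Longrightarrow>
    (\<lambda>n. exp (- c * (norm (\<theta> + s *\<^sub>R ivec n))\<^sup>2)) summable_on UNIV \<and>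
    s ^ CARD('r) * (\<Sum>\<^sub>\<infinity>n. exp (- c * (norm (\<theta> + s *\<^sub>R ivec n))\<^sup>2)) \<le> K"
proof -
  \<comment> \<open>A crude bound for the distance of two points in a cell with
    \<open>s \<le> 1\<close>, through the sum of the coordinate differences.\<close>
  define R where "R = real CARD('r)"
  define g where "g = (\<lambda>y::real^'r. exp (c * R\<^sup>2) * exp (- (c / 2) * (norm y)\<^sup>2))"
  have g: "integrable lborel g" unfolding g_def
    using integrable_exp_norm_power2[of "c / 2", where 'a="real^'r"] c by (intro integrable_mult_right) auto
  have g0: "g y \<ge> 0" for y by (simp add: g_def)
  define K where "K = (LINT y|lborel. g y)"
  have fin: "(\<Sum>n\<in>F. exp (- c * (norm (\<theta> + s *\<^sub>R ivec n))\<^sup>2)) \<le> K / s ^ CARD('r)"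
    if s: "0 < s" "s \<le> 1" and F: "finite F" for s and \<theta> :: "real^'r" and F
  proof -
    let ?x = "\<lambda>n. \<theta> + s *\<^sub>R ivec n"
    have ptw: "indicator (cell s (?x n)) y * exp (- c * (norm (?x n))\<^sup>2) \<le> indicator (cell s (?x n)) y * g y" for n y
    proof (cases "y \<in> cell s (?x n)")
      case True
      have "norm (?x n - y) \<le> (\<Sum>i\<in>UNIV. \<bar>(?x n - y) $ i\<bar>)" by (rule norm_le_l1_cart)
      also have "\<dots> \<le> (\<Sum>i\<in>(UNIV::'r set). 1)"
      proof (intro sum_mono)
        fix i
        have "?x n $ i \<le> y $ i \<and> y $ i < ?x n $ i + s" using True by (auto simp: cell_def)
        thus "\<bar>(?x n - y) $ i\<bar> \<le> 1" using s by auto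
      qed
      finally have "norm (?x n - y) \<le> R" by (simp add: R_def)
      from exp_norm_shift[OF c this, of y] show ?thesis using True by (simp add: g_def)
    qed simp
    have "s ^ CARD('r) * (\<Sum>n\<in>F. exp (- c * (norm (?x n))\<^sup>2)) = (\<Sum>n\<in>F. LINT y|lborel. indicator (cell s (?x n)) y * exp (- c * (norm (?x n))\<^sup>2))"
      using s by (simp add: measure_cell sum_distrib_left)
    also have "\<dots> \<le> (\<Sum>n\<in>F. LINT y|lborel. indicator (cell s (?x n)) y * g y)"
      using integrable_cell s g
      by (intro sum_mono integral_mono ptw integrable_mult_left) (auto intro!: integrable_mult_indicator[where 'b=real, unfolded real_scaleR_def])
    also have "\<dots> = (LINT y|lborel. (\<Sum>n\<in>F. indicator (cell s (?x n)) y * g y))"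
      using g by (intro Bochner_Integration.integral_sum[symmetric] integrable_mult_indicator[where 'b=real, unfolded real_scaleR_def]) auto
    also have "\<dots> \<le> K" unfolding K_def
    proof (intro integral_mono g)
      show "integrable lborel (\<lambda>y. \<Sum>n\<in>F. indicator (cell s (?x n)) y * g y)"
        using g by (intro Bochner_Integration.integrable_sum integrable_mult_indicator[where 'b=real, unfolded real_scaleR_def]) auto
      fix y
      have "(\<Sum>n\<in>F. indicator (cell s (?x n)) y * g y) = (\<Sum>n\<in>F. if n = (\<chi> i. \<lfloor>(y $ i - \<theta> $ i) / s\<rfloor>) then g y else 0)"
        using cell_index[OF s(1), of y \<theta>] by (intro sum.cong) (auto simp: indicator_def)
      also have "\<dots> \<le> g y" using F g0 by (simp add: sum.delta)
      finally show "(\<Sum>n\<in>F. indicator (cell s (?x n)) y * g y) \<le> g y" .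
    qed
    finally show ?thesis using s by (simp add: field_simps)
  qed
  show ?thesis
  proof (rule that)
    show "K \<ge> 0" unfolding K_def by (rule Bochner_Integration.integral_nonneg) (rule g0)
    fix s :: real and \<theta> :: "real^'r" assume s: "0 < s" "s \<le> 1"
    have sm: "(\<lambda>n. exp (- c * (norm (\<theta> + s *\<^sub>R ivec n))\<^sup>2)) summable_on UNIV"
      using fin[OF s] by (intro nonneg_bdd_above_summable_on bdd_aboveI2[of _ _ "K / s ^ CARD('r)"]) auto
    have "(\<Sum>\<^sub>\<infinity>n. exp (- c * (norm (\<theta> + s *\<^sub>R ivec n))\<^sup>2)) \<le> K / s ^ CARD('r)"
      using fin[OF s] by (intro infsum_le_finite_sums sm) auto
    thus "(\<lambda>n. exp (- c * (norm (\<theta> + s *\<^sub>R ivec n))\<^sup>2)) summable_on UNIV \<and>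
      s ^ CARD('r) * (\<Sum>\<^sub>\<infinity>n. exp (- c * (norm (\<theta> + s *\<^sub>R ivec n))\<^sup>2)) \<le> K"
      using sm s by (simp add: field_simps)
  qed
qed

definition lattice_sum :: "(real^'r \<Rightarrow> real) \<Rightarrow> real \<Rightarrow> real^'r \<Rightarrow> real" where
  "lattice_sum g s \<theta> = (\<Sum>\<^sub>\<infinity>n. g (\<theta> + s *\<^sub>R ivec n))"

lemma lattice_sum_periodic: "lattice_sum g s (\<theta> + s *\<^sub>R ivec m) = lattice_sum g s \<theta>"
proof -
  have "bij_betw (\<lambda>n. m + n) UNIV (UNIV :: (int^'a) set)"
    by (rule bij_betw_byWitness[of _ "\<lambda>n. n - m"]) auto
  from infsum_reindex_bij_betw[OF this, of "\<lambda>n. g (\<theta> + s *\<^sub>R ivec n)"] show ?thesis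
    by (simp add: lattice_sum_def ivec_add scaleR_add_right add_ac)
qed

definition gaussian_bounded :: "(real^'r \<Rightarrow> real) \<Rightarrow> bool" where
  "gaussian_bounded g \<longleftrightarrow> (\<exists>K c. K \<ge> 0 \<and> c > 0 \<and> (\<forall>x. \<bar>g x\<bar> \<le> K * exp (- c * (norm x)\<^sup>2)))"

lemma gaussian_bounded_lattice:
  fixes g :: "real^'r \<Rightarrow> real"
  assumes "gaussian_bounded g"
  obtains K where "K \<ge> 0" "\<And>(s::real) \<theta>. 0 < s \<Longrightarrow> s \<le> 1 \<Longrightarrow> (\<lambda>n. norm (g (\<theta> + s *\<^sub>R ivec n))) summable_on UNIV \<and> s ^ CARD('r) * \<bar>lattice_sum g s \<theta>\<bar> \<le> K"
proof -
  obtain K c where K: "K \<ge> 0" "c > 0" "\<And>x. \<bar>g x\<bar> \<le> K * exp (- c * (norm x)\<^sup>2)"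
    using assms unfolding gaussian_bounded_def by blast
  obtain K' where K': "K' \<ge> 0" "\<And>(s::real) (\<theta>::real^'r). 0 < s \<Longrightarrow> s \<le> 1 \<Longrightarrow>
    (\<lambda>n. exp (- c * (norm (\<theta> + s *\<^sub>R ivec n))\<^sup>2)) summable_on UNIV \<and>
    s ^ CARD('r) * (\<Sum>\<^sub>\<infinity>n. exp (- c * (norm (\<theta> + s *\<^sub>R ivec n))\<^sup>2)) \<le> K'"
    using gaussian_lattice_bound[OF K(2)] by blast
  show ?thesis
  proof (rule that)
    show "K * K' \<ge> 0" using K K' by simp
    fix s :: real and \<theta> :: "real^'r" assume s: "0 < s" "s \<le> 1"
    let ?e = "\<lambda>n. exp (- c * (norm (\<theta> + s *\<^sub>R ivec n))\<^sup>2)"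
    have sm: "?e summable_on UNIV" using K'(2)[OF s] by blast
    have sm2: "(\<lambda>n. K * ?e n) summable_on UNIV" by (intro summable_on_cmult_right sm)
    have ab: "(\<lambda>n. norm (g (\<theta> + s *\<^sub>R ivec n))) summable_on UNIV"
      by (rule Infinite_Sum.abs_summable_on_comparison_test'[OF sm2]) (use K in auto)
    have "\<bar>lattice_sum g s \<theta>\<bar> \<le> (\<Sum>\<^sub>\<infinity>n. norm (g (\<theta> + s *\<^sub>R ivec n)))"
      unfolding lattice_sum_def real_norm_def[symmetric] by (rule norm_infsum_bound[OF ab])
    also have "\<dots> \<le> (\<Sum>\<^sub>\<infinity>n. K * ?e n)" by (intro infsum_mono ab sm2) (use K in auto)
    also have "\<dots> = K * (\<Sum>\<^sub>\<infinity>n. ?e n)" by (rule infsum_cmult_right[OF sm])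
    finally have "s ^ CARD('r) * \<bar>lattice_sum g s \<theta>\<bar> \<le> s ^ CARD('r) * (K * (\<Sum>\<^sub>\<infinity>n. ?e n))"
      using s by (intro mult_left_mono) auto
    also have "\<dots> = K * (s ^ CARD('r) * (\<Sum>\<^sub>\<infinity>n. ?e n))" by simp
    also have "\<dots> \<le> K * K'" using K'(2)[OF s] K by (intro mult_left_mono) auto
    finally show "(\<lambda>n. norm (g (\<theta> + s *\<^sub>R ivec n))) summable_on UNIV \<and> s ^ CARD('r) * \<bar>lattice_sum g s \<theta>\<bar> \<le> K * K'"
      using ab by blast
  qed
qed

text \<open>An enumeration turns unordered sums over integer vectors into series, to which termwise
  differentiation, termwise integration and dominated limits apply.\<close>

lemma int_vec_enum:
  obtains e :: "nat \<Rightarrow> int^'r" where "bij e"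
proof -
  have "inj (\<lambda>k::int. (\<chi> i. k) :: int^'r)" by (auto simp: inj_def vec_eq_iff)
  hence "infinite (range (\<lambda>k::int. (\<chi> i. k) :: int^'r))" by (subst finite_image_iff) (auto simp: infinite_UNIV_int)
  hence "infinite (UNIV :: (int^'r) set)" using finite_subset[OF subset_UNIV] by blast
  thus ?thesis using countableE_infinite[of "UNIV :: (int^'r) set"] that
    by (metis countableI_type bij_betw_inv_into)
qed

lemma abs_summable_enum:
  fixes f :: "int^'r \<Rightarrow> real"
  assumes e: "bij e" and f: "(\<lambda>n. norm (f n)) summable_on UNIV"
  shows "summable (\<lambda>k. norm (f (e k)))" "infsum f UNIV = (\<Sum>k. f (e k))"
proof -
  have "(\<lambda>k. norm (f (e k))) summable_on UNIV"
    using summable_on_reindex_bij_betw[OF e, of "\<lambda>n. norm (f n)"] f by simp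
  thus 1: "summable (\<lambda>k. norm (f (e k)))" by (rule summable_on_imp_summable)
  have "((\<lambda>k. f (e k)) has_sum (\<Sum>k. f (e k))) UNIV"
    by (intro norm_summable_imp_has_sum[OF 1] summable_sums summable_norm_cancel[OF 1])
  hence "infsum (\<lambda>k. f (e k)) UNIV = (\<Sum>k. f (e k))" by (rule infsumI)
  thus "infsum f UNIV = (\<Sum>k. f (e k))" using infsum_reindex_bij_betw[OF e, of f] by simp
qed

text \<open>A whole class instead of one function, because closure under partial derivatives is what
  lets the order of the error be raised by induction.\<close>

locale smooth_gaussian_class =
  fixes \<G> :: "(real^'r \<Rightarrow> real) set"
  assumes cont: "g \<in> \<G> \<Longrightarrow> continuous_on UNIV g"
    and bounded: "g \<in> \<G> \<Longrightarrow> gaussian_bounded g"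
    and partial: "g \<in> \<G> \<Longrightarrow> \<exists>g'\<in>\<G>. \<forall>x. ((\<lambda>h. g (x + h *\<^sub>R axis i 1)) has_real_derivative g' x) (at 0)"
begin

lemma DERIV_lattice_sum:
  assumes g: "g \<in> \<G>" "g' \<in> \<G>" and d: "\<And>x. ((\<lambda>h. g (x + h *\<^sub>R axis i 1)) has_real_derivative g' x) (at 0)"
    and s: "0 < s" "s \<le> 1"
  shows "((\<lambda>\<tau>. lattice_sum g s (\<theta> + \<tau> *\<^sub>R axis i 1)) has_real_derivative lattice_sum g' s (\<theta> + \<tau> *\<^sub>R axis i 1)) (at \<tau>)"
proof -
  obtain e :: "nat \<Rightarrow> int^'r" where e: "bij e" by (rule int_vec_enum)
  let ?p = "\<lambda>\<tau> k. \<theta> + s *\<^sub>R ivec (e k) + \<tau> *\<^sub>R axis i 1"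
  have pe: "\<theta> + \<tau> *\<^sub>R axis i 1 + s *\<^sub>R v = \<theta> + s *\<^sub>R v + \<tau> *\<^sub>R axis i 1" for \<tau> v
    by (simp only: add_ac)
  have d': "((\<lambda>h. g (x + h *\<^sub>R axis i 1)) has_real_derivative g' (x + \<tau> *\<^sub>R axis i 1)) (at \<tau>)" for x \<tau>
    using d[of "x + \<tau> *\<^sub>R axis i 1"] DERIV_shift[of "\<lambda>h. g (x + h *\<^sub>R axis i 1)" "g' (x + \<tau> *\<^sub>R axis i 1)" 0 \<tau>]
    by (simp add: scaleR_add_left add_ac)
  have sums: "lattice_sum f s (\<theta> + \<tau> *\<^sub>R axis i 1) = (\<Sum>k. f (?p \<tau> k))" "summable (\<lambda>k. norm (f (?p \<tau> k)))" if "f \<in> \<G>" for f \<tau>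
  proof -
    have "(\<lambda>n. norm (f (\<theta> + \<tau> *\<^sub>R axis i 1 + s *\<^sub>R ivec n))) summable_on UNIV"
      using gaussian_bounded_lattice[OF bounded[OF that]] s by metis
    from abs_summable_enum[OF e this] show "lattice_sum f s (\<theta> + \<tau> *\<^sub>R axis i 1) = (\<Sum>k. f (?p \<tau> k))" "summable (\<lambda>k. norm (f (?p \<tau> k)))"
      by (simp_all only: lattice_sum_def pe)
  qed
  obtain K c where K: "K \<ge> 0" "c > 0" "\<And>x. \<bar>g' x\<bar> \<le> K * exp (- c * (norm x)\<^sup>2)"
    using bounded[OF g(2)] unfolding gaussian_bounded_def by blast
  \<comment> \<open>Majorant of the derivatives for parameters within distance 1 of \<tau>, from
    \<open>exp_norm_shift\<close>.\<close>
  define M where "M k = K * exp (c * 1\<^sup>2) * exp (- (c / 2) * (norm (?p \<tau> k))\<^sup>2)" for k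
  have "c / 2 > 0" using K by simp
  then obtain K' where "\<And>(s::real) (\<theta>::real^'r). 0 < s \<Longrightarrow> s \<le> 1 \<Longrightarrow>
    (\<lambda>n. exp (- (c / 2) * (norm (\<theta> + s *\<^sub>R ivec n))\<^sup>2)) summable_on UNIV"
    using gaussian_lattice_bound by metis
  hence "(\<lambda>n. norm (exp (- (c / 2) * (norm (\<theta> + \<tau> *\<^sub>R axis i 1 + s *\<^sub>R ivec n))\<^sup>2))) summable_on UNIV" using s by simp
  from abs_summable_enum(1)[OF e this] have M: "summable M" unfolding M_def by (intro summable_mult) (simp add: pe)
  have "((\<lambda>\<tau>. \<Sum>k. g (?p \<tau> k)) has_real_derivative (\<Sum>k. g' (?p \<tau> k))) (at \<tau>)"
  proof (rule has_field_derivative_series'(2)[where S="{\<tau> - 1..\<tau> + 1}" and ?x0.0=\<tau> and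
      f="\<lambda>k \<tau>. g (?p \<tau> k)" and f'="\<lambda>k \<tau>. g' (?p \<tau> k)"])
    show "((\<lambda>\<tau>. g (?p \<tau> k)) has_real_derivative g' (?p x k)) (at x within {\<tau> - 1..\<tau> + 1})" for k x
      by (rule has_field_derivative_at_within[OF d'])
    show "uniformly_convergent_on {\<tau> - 1..\<tau> + 1} (\<lambda>n x. \<Sum>k<n. g' (?p x k))"
    proof (rule Weierstrass_m_test'[OF _ M])
      fix k x assume x: "x \<in> {\<tau> - 1..\<tau> + 1}"
      have "norm ((x - \<tau>) *\<^sub>R axis i (1::real)) \<le> 1" using x by auto
      from exp_norm_shift[OF K(2) this, of "?p \<tau> k"]
      have "exp (- c * (norm (?p x k))\<^sup>2) \<le> exp (c * 1\<^sup>2) * exp (- (c / 2) * (norm (?p \<tau> k))\<^sup>2)"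
      proof -
        have "?p x k = ?p \<tau> k + (x - \<tau>) *\<^sub>R axis i 1" by (simp add: scaleR_diff_left)
        thus ?thesis using \<open>exp (- c * (norm (?p \<tau> k + (x - \<tau>) *\<^sub>R axis i 1))\<^sup>2) \<le> _\<close> by (simp only:)
      qed
      hence "K * exp (- c * (norm (?p x k))\<^sup>2) \<le> M k" using K unfolding M_def mult.assoc by (intro mult_left_mono) auto
      thus "norm (g' (?p x k)) \<le> M k" using K(3)[of "?p x k"] by simp
    qed
    show "summable (\<lambda>k. g (?p \<tau> k))" by (rule summable_norm_cancel[OF sums(2)[OF g(1)]])
  qed auto
  thus ?thesis using sums(1) g by simp
qed

text \<open>In each coordinate direction the lattice sum is \<open>s\<close>-periodic, so its derivative, a lattice sum
  again, vanishes somewhere: the oscillation of the derivative bounds its size, and integrating over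
  a period gains one factor \<open>s\<close>.\<close>

lemma lattice_sum_oscillation:
  assumes "g \<in> \<G>"
  shows "\<exists>K\<ge>0. \<forall>s \<theta> \<tau>. 0 < s \<longrightarrow> s \<le> 1 \<longrightarrow>
    s ^ CARD('r) * \<bar>lattice_sum g s (\<theta> + \<tau> *\<^sub>R axis i 1) - lattice_sum g s \<theta>\<bar> \<le> K * s ^ M"
  using assms
proof (induction M arbitrary: g)
  case 0
  obtain K where K: "K \<ge> 0" "\<And>(s::real) \<theta>. 0 < s \<Longrightarrow> s \<le> 1 \<Longrightarrow> s ^ CARD('r) * \<bar>lattice_sum g s \<theta>\<bar> \<le> K"
    using gaussian_bounded_lattice[OF bounded[OF 0]] by metis
  show ?case
  proof (intro exI[of _ "K + K"] conjI allI impI)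
    fix s \<tau> :: real and \<theta> :: "real^'r" assume s: "0 < s" "s \<le> 1"
    have "s ^ CARD('r) * \<bar>lattice_sum g s (\<theta> + \<tau> *\<^sub>R axis i 1) - lattice_sum g s \<theta>\<bar> \<le>
      s ^ CARD('r) * (\<bar>lattice_sum g s (\<theta> + \<tau> *\<^sub>R axis i 1)\<bar> + \<bar>lattice_sum g s \<theta>\<bar>)"
      using s by (intro mult_left_mono) auto
    also have "\<dots> \<le> K + K" unfolding distrib_left by (intro add_mono K s)
    finally show "s ^ CARD('r) * \<bar>lattice_sum g s (\<theta> + \<tau> *\<^sub>R axis i 1) - lattice_sum g s \<theta>\<bar> \<le> (K + K) * s ^ 0" by simp
  qed (use K in auto)
next
  case (Suc M)
  obtain g' where g': "g' \<in> \<G>" "\<And>x. ((\<lambda>h. g (x + h *\<^sub>R axis i 1)) has_real_derivative g' x) (at 0)"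
    using partial[OF Suc.prems] by blast
  obtain K where K: "K \<ge> 0" "\<And>(s::real) \<theta> \<tau>. 0 < s \<Longrightarrow> s \<le> 1 \<Longrightarrow>
    s ^ CARD('r) * \<bar>lattice_sum g' s (\<theta> + \<tau> *\<^sub>R axis i 1) - lattice_sum g' s \<theta>\<bar> \<le> K * s ^ M"
    using Suc.IH[OF g'(1)] by blast
  show ?case
  proof (intro exI[of _ K] conjI allI impI)
    fix s \<tau> :: real and \<theta> :: "real^'r" assume s: "0 < s" "s \<le> 1"
    define f where "f \<tau> = lattice_sum g s (\<theta> + \<tau> *\<^sub>R axis i 1)" for \<tau>
    define f' where "f' \<tau> = lattice_sum g' s (\<theta> + \<tau> *\<^sub>R axis i 1)" for \<tau>
    have df: "(f has_real_derivative f' \<tau>) (at \<tau>)" for \<tau>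
      unfolding f_def f'_def by (rule DERIV_lattice_sum[OF Suc.prems g'(1,2) s])
    have per: "f (\<tau> + s * real_of_int m) = f \<tau>" for \<tau> m
    proof -
      have "s *\<^sub>R ivec (axis i m) = (s * real_of_int m) *\<^sub>R axis i 1" by (simp add: vec_eq_iff axis_def)
      thus ?thesis using lattice_sum_periodic[of g s "\<theta> + \<tau> *\<^sub>R axis i 1" "axis i m"]
        by (simp add: f_def scaleR_add_left add_ac)
    qed
    have "\<exists>z. 0 < z \<and> z < s \<and> f s - f 0 = (s - 0) * f' z" by (rule MVT2) (use s df in auto)
    moreover have "f s = f 0" using per[of 0 1] by simp
    ultimately obtain z where z: "f' z = 0" using s by auto
    have f'b: "s ^ CARD('r) * \<bar>f' y\<bar> \<le> K * s ^ M" for y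
      using K(2)[OF s, of "\<theta> + z *\<^sub>R axis i 1" "y - z"] z by (simp add: f'_def scaleR_diff_left)
    \<comment> \<open>The representative of \<tau> modulo the period \<open>s\<close> in the first
      period, so that the mean value theorem runs over a length of at most \<open>s\<close>.\<close>
    define \<tau>0 where "\<tau>0 = \<tau> + s * real_of_int (- \<lfloor>\<tau> / s\<rfloor>)"
    have \<tau>0: "0 \<le> \<tau>0" "\<tau>0 \<le> s"
    proof -
      have "real_of_int \<lfloor>\<tau> / s\<rfloor> \<le> \<tau> / s" "\<tau> / s < real_of_int \<lfloor>\<tau> / s\<rfloor> + 1" using floor_correct[of "\<tau> / s"] by auto
      hence "real_of_int \<lfloor>\<tau> / s\<rfloor> * s \<le> \<tau>" "\<tau> < (real_of_int \<lfloor>\<tau> / s\<rfloor> + 1) * s"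
        using s by (simp_all only: pos_le_divide_eq pos_divide_less_eq)
      thus "0 \<le> \<tau>0" "\<tau>0 \<le> s" by (auto simp: \<tau>0_def algebra_simps)
    qed
    have "s ^ CARD('r) * \<bar>f \<tau>0 - f 0\<bar> \<le> K * s ^ Suc M"
    proof (cases "\<tau>0 = 0")
      case False
      have "\<exists>z. 0 < z \<and> z < \<tau>0 \<and> f \<tau>0 - f 0 = (\<tau>0 - 0) * f' z" by (rule MVT2) (use \<tau>0 False df in auto)
      then obtain y where y: "f \<tau>0 - f 0 = \<tau>0 * f' y" by auto
      have "s ^ CARD('r) * \<bar>f \<tau>0 - f 0\<bar> = \<tau>0 * (s ^ CARD('r) * \<bar>f' y\<bar>)" using \<tau>0 by (simp add: y abs_mult)
      also have "\<dots> \<le> s * (K * s ^ M)" by (rule mult_mono[OF \<tau>0(2) f'b]) (use s in auto)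
      finally show ?thesis by (simp add: mult_ac)
    qed (use K s in simp)
    moreover have "f \<tau>0 = f \<tau>" unfolding \<tau>0_def by (rule per)
    ultimately show "s ^ CARD('r) * \<bar>lattice_sum g s (\<theta> + \<tau> *\<^sub>R axis i 1) - lattice_sum g s \<theta>\<bar> \<le> K * s ^ Suc M"
      by (simp add: f_def)
  qed (rule K)
qed

lemma lattice_sum_almost_constant:
  assumes g: "g \<in> \<G>"
  obtains K where "K \<ge> 0" "\<And>(s::real) \<theta> \<theta>'. 0 < s \<Longrightarrow> s \<le> 1 \<Longrightarrow>
    s ^ CARD('r) * \<bar>lattice_sum g s \<theta>' - lattice_sum g s \<theta>\<bar> \<le> K * s ^ M"
proof -
  have "\<exists>K. \<forall>i. K i \<ge> 0 \<and> (\<forall>s \<theta> \<tau>. 0 < s \<longrightarrow> s \<le> 1 \<longrightarrow>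
    s ^ CARD('r) * \<bar>lattice_sum g s (\<theta> + \<tau> *\<^sub>R axis i 1) - lattice_sum g s \<theta>\<bar> \<le> K i * s ^ M)"
    using lattice_sum_oscillation[OF g] by (intro choice) blast
  then obtain K where K: "\<And>i. K i \<ge> 0" "\<And>i s \<theta> \<tau>. 0 < s \<Longrightarrow> s \<le> 1 \<Longrightarrow>
    s ^ CARD('r) * \<bar>lattice_sum g s (\<theta> + \<tau> *\<^sub>R axis i 1) - lattice_sum g s \<theta>\<bar> \<le> K i * s ^ M" by blast
  show ?thesis
  proof (rule that[of "\<Sum>i\<in>UNIV. K i"])
    show "(\<Sum>i\<in>UNIV. K i) \<ge> 0" by (intro sum_nonneg K)
    fix s :: real and \<theta> \<theta>' :: "real^'r" assume s: "0 < s" "s \<le> 1"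
    \<comment> \<open>Interpolates from \<theta> to \<open>\<theta>'\<close> by switching one
      coordinate at a time.\<close>
    define h where "h I = (\<chi> i. if i \<in> I then \<theta>' $ i else \<theta> $ i)" for I
    have "s ^ CARD('r) * \<bar>lattice_sum g s (h I) - lattice_sum g s \<theta>\<bar> \<le> (\<Sum>i\<in>I. K i) * s ^ M" if "finite I" for I
      using that
    proof (induction I rule: finite_induct)
      case empty
      have "h {} = \<theta>" by (simp add: h_def)
      thus ?case by simp
    next
      case (insert i I)
      have "h (insert i I) = h I + (\<theta>' $ i - \<theta> $ i) *\<^sub>R axis i 1"
        using insert.hyps by (auto simp: h_def vec_eq_iff axis_def)
      hence 1: "s ^ CARD('r) * \<bar>lattice_sum g s (h (insert i I)) - lattice_sum g s (h I)\<bar> \<le> K i * s ^ M"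
        using K(2)[OF s] by simp
      have "s ^ CARD('r) * \<bar>lattice_sum g s (h (insert i I)) - lattice_sum g s \<theta>\<bar> \<le>
        s ^ CARD('r) * (\<bar>lattice_sum g s (h (insert i I)) - lattice_sum g s (h I)\<bar> + \<bar>lattice_sum g s (h I) - lattice_sum g s \<theta>\<bar>)"
        using s by (intro mult_left_mono) auto
      also have "\<dots> \<le> K i * s ^ M + (\<Sum>i\<in>I. K i) * s ^ M" unfolding distrib_left by (intro add_mono 1 insert.IH)
      finally show ?case using insert.hyps by (simp add: distrib_right)
    qed
    from this[of UNIV] show "s ^ CARD('r) * \<bar>lattice_sum g s \<theta>' - lattice_sum g s \<theta>\<bar> \<le> (\<Sum>i\<in>UNIV. K i) * s ^ M"
      by (simp add: h_def)
  qed
qed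

lemma integrable_class:
  assumes g: "g \<in> \<G>" shows "integrable lborel g"
proof -
  obtain K c where K: "K \<ge> 0" "c > 0" "\<And>x. \<bar>g x\<bar> \<le> K * exp (- c * (norm x)\<^sup>2)"
    using bounded[OF g] unfolding gaussian_bounded_def by blast
  have "integrable lborel (\<lambda>x::real^'r. K * exp (- c * (norm x)\<^sup>2))"
    using integrable_exp_norm_power2[OF K(2)] by (intro integrable_mult_right) auto
  moreover have "g \<in> borel_measurable lborel" using cont[OF g] by (simp add: borel_measurable_continuous_onI)
  ultimately show ?thesis by (rule Bochner_Integration.integrable_bound) (use K in \<open>auto intro!: AE_I2\<close>)
qed

text \<open>The cells tile the space; translating each of them onto \<open>cell s 0\<close> and
  exchanging sum and integral folds \<open>g\<close> into its lattice sum.\<close>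

lemma integral_eq_cell_integral:
  assumes g: "g \<in> \<G>" and s: "0 < s" "s \<le> 1"
  shows "integrable lborel (\<lambda>z. indicator (cell s 0) z * lattice_sum g s z)"
    and "(LINT y|lborel. g y) = (LINT z|lborel. indicator (cell s 0) z * lattice_sum g s z)"
proof -
  obtain e :: "nat \<Rightarrow> int^'r" where e: "bij e" by (rule int_vec_enum)
  note int = integrable_class[OF g]
  let ?C = "\<lambda>k. cell s (0 + s *\<^sub>R ivec (e k))"
  note im = integrable_mult_indicator[where 'b=real, unfolded real_scaleR_def]
  have ci: "indicator (?C k) y = (if e k = (\<chi> i. \<lfloor>(y $ i - 0 $ i) / s\<rfloor>) then 1 else 0 :: real)" for k y
    using cell_index[OF s(1), of y 0 "e k"] by (simp add: indicator_def)
  have single: "(\<lambda>k. indicator (?C k) y * v) sums v" for y and v :: real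
  proof -
    define k0 where "k0 = inv e (\<chi> i. \<lfloor>(y $ i - 0 $ i) / s\<rfloor>)"
    have "e k = (\<chi> i. \<lfloor>(y $ i - 0 $ i) / s\<rfloor>) \<longleftrightarrow> k = k0" for k
      unfolding k0_def by (rule bij_inv_eq_iff[OF e, symmetric])
    hence "indicator (?C k) y * v = (if k = k0 then v else 0)" for k by (simp only: ci) simp
    thus ?thesis using sums_single[of k0 "\<lambda>_. v"] by simp
  qed
  have tr: "(LINT y|lborel. indicator (?C k) y * f y) = (LINT z|lborel. indicator (cell s 0) z * f (z + s *\<^sub>R ivec (e k)))"
    and tri: "integrable lborel (\<lambda>y. indicator (?C k) y * f y) \<Longrightarrow> integrable lborel (\<lambda>z. indicator (cell s 0) z * f (z + s *\<^sub>R ivec (e k)))"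
    if [measurable]: "f \<in> borel_measurable borel" for f :: "real^'r \<Rightarrow> real" and k
  proof -
    have shift: "indicator (?C k) (s *\<^sub>R ivec (e k) + z) = (indicator (cell s 0) z :: real)" for z
      by (auto simp: indicator_def cell_def)
    have "(LINT y|lborel. indicator (?C k) y * f y) = (LINT y|distr lborel borel ((+) (s *\<^sub>R ivec (e k))). indicator (?C k) y * f y)"
      by (simp add: lborel_distr_plus)
    also have "\<dots> = (LINT z|lborel. indicator (?C k) (s *\<^sub>R ivec (e k) + z) * f (s *\<^sub>R ivec (e k) + z))"
      by (rule integral_distr) auto
    finally show "(LINT y|lborel. indicator (?C k) y * f y) = (LINT z|lborel. indicator (cell s 0) z * f (z + s *\<^sub>R ivec (e k)))"
      unfolding shift by (simp add: add.commute)
    assume "integrable lborel (\<lambda>y. indicator (?C k) y * f y)"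
    hence "integrable (distr lborel borel ((+) (s *\<^sub>R ivec (e k)))) (\<lambda>y. indicator (?C k) y * f y)" by (simp add: lborel_distr_plus)
    hence "integrable lborel (\<lambda>z. indicator (?C k) (s *\<^sub>R ivec (e k) + z) * f (s *\<^sub>R ivec (e k) + z))"
      by (subst (asm) integrable_distr_eq) auto
    thus "integrable lborel (\<lambda>z. indicator (cell s 0) z * f (z + s *\<^sub>R ivec (e k)))"
      unfolding shift by (simp add: add.commute)
  qed
  have gm [measurable]: "g \<in> borel_measurable borel" using cont[OF g] by (simp add: borel_measurable_continuous_onI)
  have i1: "integrable lborel (\<lambda>y. indicator (?C k) y * g y)" for k using int by (intro im) auto
  have i2: "integrable lborel (\<lambda>z. indicator (cell s 0) z * g (z + s *\<^sub>R ivec (e k)))" for k by (rule tri[OF gm i1])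
  have sm: "summable (\<lambda>k. LINT y|lborel. indicator (?C k) y * \<bar>g y\<bar>)"
  proof (rule summableI_nonneg_bounded)
    have i3: "integrable lborel (\<lambda>y. indicator (?C k) y * \<bar>g y\<bar>)" for k using int by (intro im integrable_abs) auto
    show "0 \<le> (LINT y|lborel. indicator (?C k) y * \<bar>g y\<bar>)" for k by (intro Bochner_Integration.integral_nonneg) auto
    fix n
    have "(\<Sum>k<n. LINT y|lborel. indicator (?C k) y * \<bar>g y\<bar>) = (LINT y|lborel. (\<Sum>k<n. indicator (?C k) y * \<bar>g y\<bar>))"
      using i3 by (intro Bochner_Integration.integral_sum[symmetric]) auto
    also have "\<dots> \<le> (LINT y|lborel. \<bar>g y\<bar>)"
    proof (intro integral_mono Bochner_Integration.integrable_sum i3 integrable_abs int)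
      fix y
      show "(\<Sum>k<n. indicator (?C k) y * \<bar>g y\<bar>) \<le> \<bar>g y\<bar>"
        using sum_le_suminf[of "\<lambda>k. indicator (?C k) y * \<bar>g y\<bar>" "{..<n}"] single[of y "\<bar>g y\<bar>"]
        by (simp add: sums_iff)
    qed
    finally show "(\<Sum>k<n. LINT y|lborel. indicator (?C k) y * \<bar>g y\<bar>) \<le> (LINT y|lborel. \<bar>g y\<bar>)" .
  qed
  have "(LINT y|lborel. (\<Sum>k. indicator (?C k) y * g y)) = (\<Sum>k. LINT y|lborel. indicator (?C k) y * g y)"
  proof (rule integral_suminf[OF i1])
    show "AE y in lborel. summable (\<lambda>k. norm (indicator (?C k) y * g y))"
      using single[of _ "\<bar>g _\<bar>"] by (intro AE_I2) (auto simp: sums_iff abs_mult)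
    show "summable (\<lambda>k. LINT y|lborel. norm (indicator (?C k) y * g y))" using sm by (simp add: abs_mult)
  qed
  also have "(\<lambda>y. \<Sum>k. indicator (?C k) y * g y) = g" using single[of _ "g _"] by (auto simp: sums_iff)
  finally have 1: "(LINT y|lborel. g y) = (\<Sum>k. LINT z|lborel. indicator (cell s 0) z * g (z + s *\<^sub>R ivec (e k)))"
    unfolding tr[OF gm] .
  have ls: "summable (\<lambda>k. norm (g (z + s *\<^sub>R ivec (e k))))" "lattice_sum g s z = (\<Sum>k. g (z + s *\<^sub>R ivec (e k)))" for z
  proof -
    have "(\<lambda>n. norm (g (z + s *\<^sub>R ivec n))) summable_on UNIV"
      using gaussian_bounded_lattice[OF bounded[OF g]] s by metis
    from abs_summable_enum[OF e this] show "summable (\<lambda>k. norm (g (z + s *\<^sub>R ivec (e k))))" "lattice_sum g s z = (\<Sum>k. g (z + s *\<^sub>R ivec (e k)))"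
      by (simp_all add: lattice_sum_def)
  qed
  have "integrable lborel (\<lambda>z. \<Sum>k. indicator (cell s 0) z * g (z + s *\<^sub>R ivec (e k))) \<and>
    (LINT z|lborel. (\<Sum>k. indicator (cell s 0) z * g (z + s *\<^sub>R ivec (e k)))) = (\<Sum>k. LINT z|lborel. indicator (cell s 0) z * g (z + s *\<^sub>R ivec (e k)))"
  proof -
    have ae: "AE z in lborel. summable (\<lambda>k. norm (indicator (cell s 0) z * g (z + s *\<^sub>R ivec (e k))))"
      using ls(1) by (intro AE_I2) (auto simp: abs_mult intro!: summable_mult)
    have "(\<lambda>y. \<bar>g y\<bar>) \<in> borel_measurable borel" by measurable
    from tr[OF this] have sm': "summable (\<lambda>k. LINT z|lborel. norm (indicator (cell s 0) z * g (z + s *\<^sub>R ivec (e k))))"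
      using sm by (simp add: abs_mult)
    show ?thesis using integrable_suminf[OF i2 ae sm'] integral_suminf[OF i2 ae sm'] by blast
  qed
  moreover have "(\<Sum>k. indicator (cell s 0) z * g (z + s *\<^sub>R ivec (e k))) = indicator (cell s 0) z * lattice_sum g s z" for z
    unfolding ls(2) by (intro suminf_mult summable_norm_cancel[OF ls(1)])
  ultimately show "integrable lborel (\<lambda>z. indicator (cell s 0) z * lattice_sum g s z)"
    "(LINT y|lborel. g y) = (LINT z|lborel. indicator (cell s 0) z * lattice_sum g s z)"
    using 1 by simp_all
qed

text \<open>The integral is exactly \<open>s ^ CARD('r)\<close> times the average of the lattice sum
  over one cell, and by \<open>lattice_sum_almost_constant\<close> the sum is everywhere close to
  its average. This stands in for Poisson summation.\<close>

theorem lattice_sum_asymp: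
  assumes g: "g \<in> \<G>"
  obtains K where "K \<ge> 0" "\<And>(s::real) \<theta>. 0 < s \<Longrightarrow> s \<le> 1 \<Longrightarrow>
    \<bar>s ^ CARD('r) * lattice_sum g s \<theta> - (LINT y|lborel. g y)\<bar> \<le> K * s ^ M"
proof -
  obtain K where K: "K \<ge> 0" "\<And>(s::real) \<theta> \<theta>'. 0 < s \<Longrightarrow> s \<le> 1 \<Longrightarrow>
    s ^ CARD('r) * \<bar>lattice_sum g s \<theta>' - lattice_sum g s \<theta>\<bar> \<le> K * s ^ M"
    using lattice_sum_almost_constant[OF g] by metis
  show ?thesis
  proof (rule that[OF K(1)])
    fix s :: real and \<theta> :: "real^'r" assume s: "0 < s" "s \<le> 1"
    note ic = integral_eq_cell_integral[OF g s]
    have "s ^ CARD('r) * lattice_sum g s \<theta> - (LINT y|lborel. g y) =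
      (LINT z|lborel. indicator (cell s 0) z * lattice_sum g s \<theta> - indicator (cell s (0::real^'r)) z * lattice_sum g s z)"
      unfolding ic(2) using s by (subst Bochner_Integration.integral_diff) (auto simp: measure_cell integrable_cell ic)
    also have "\<bar>\<dots>\<bar> \<le> (LINT z|lborel. indicator (cell s (0::real^'r)) z * (K * s ^ M / s ^ CARD('r)))"
      unfolding real_norm_def[symmetric]
    proof (rule Bochner_Integration.integral_norm_bound_integral)
      show "integrable lborel (\<lambda>z. indicator (cell s 0) z * lattice_sum g s \<theta> - indicator (cell s 0) z * lattice_sum g s z)"
        using s by (intro Bochner_Integration.integrable_diff integrable_mult_left integrable_cell ic) auto
      show "integrable lborel (\<lambda>z. indicator (cell s (0::real^'r)) z * (K * s ^ M / s ^ CARD('r)))"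
        using s by (intro integrable_mult_left integrable_cell) auto
      fix z :: "real^'r" assume "z \<in> space lborel"
      have "\<bar>lattice_sum g s \<theta> - lattice_sum g s z\<bar> \<le> K * s ^ M / s ^ CARD('r)"
        using K(2)[OF s, of \<theta> z] s by (simp add: field_simps)
      thus "norm (indicator (cell s 0) z * lattice_sum g s \<theta> - indicator (cell s 0) z * lattice_sum g s z)
        \<le> indicator (cell s 0) z * (K * s ^ M / s ^ CARD('r))"
        by (auto simp: indicator_def)
    qed
    also have "\<dots> = K * s ^ M" using s by (simp add: measure_cell)
    finally show "\<bar>s ^ CARD('r) * lattice_sum g s \<theta> - (LINT y|lborel. g y)\<bar> \<le> K * s ^ M" .
  qed
qed

end

section \<open>Gaussian integrals\<close>

text \<open>The change of variables formula of the library needs a well-ordered index type; a copy of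
  the index type with a transported order provides it.\<close>

typedef 'a ordered_copy = "UNIV :: 'a set" by simp

instance ordered_copy :: (finite) finite
proof
  have "(UNIV :: 'a::finite ordered_copy set) \<subseteq> Abs_ordered_copy ` UNIV"
  proof
    fix x :: "'a ordered_copy"
    show "x \<in> Abs_ordered_copy ` UNIV"
      by (rule image_eqI[of _ _ "Rep_ordered_copy x"]) (simp_all add: Rep_ordered_copy_inverse)
  qed
  thus "finite (UNIV :: 'a ordered_copy set)" by (rule finite_subset) simp
qed

instantiation ordered_copy :: (finite) wellorder
begin

definition less_eq_ordered_copy :: "'a ordered_copy \<Rightarrow> 'a ordered_copy \<Rightarrow> bool" where
  "x \<le> y \<longleftrightarrow> to_nat (Rep_ordered_copy x) \<le> to_nat (Rep_ordered_copy y)"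

definition less_ordered_copy :: "'a ordered_copy \<Rightarrow> 'a ordered_copy \<Rightarrow> bool" where
  "x < y \<longleftrightarrow> to_nat (Rep_ordered_copy x) < to_nat (Rep_ordered_copy y)"

instance
proof
  fix x y z a :: "'a ordered_copy" and P :: "'a ordered_copy \<Rightarrow> bool"
  show "x < y \<longleftrightarrow> x \<le> y \<and> \<not> y \<le> x" "x \<le> x" "x \<le> y \<Longrightarrow> y \<le> z \<Longrightarrow> x \<le> z" "x \<le> y \<or> y \<le> x"
    by (auto simp: less_eq_ordered_copy_def less_ordered_copy_def)
  show "x \<le> y \<Longrightarrow> y \<le> x \<Longrightarrow> x = y"
    by (auto simp: less_eq_ordered_copy_def Rep_ordered_copy_inject)
  assume step: "\<And>x. (\<And>y. y < x \<Longrightarrow> P y) \<Longrightarrow> P x"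
  show "P a"
  proof (induction "to_nat (Rep_ordered_copy a)" arbitrary: a rule: less_induct)
    case less
    show ?case by (rule step) (use less in \<open>auto simp: less_ordered_copy_def\<close>)
  qed
qed

end

lemma bij_Rep_ordered_copy: "bij Rep_ordered_copy"
  by (metis Abs_ordered_copy_inverse Rep_ordered_copy_inverse UNIV_I bij_iff)

definition to_copy :: "real^'r \<Rightarrow> real^('r::finite ordered_copy)" where
  "to_copy x = (\<chi> i. x $ Rep_ordered_copy i)"

definition of_copy :: "real^('r::finite ordered_copy) \<Rightarrow> real^'r" where
  "of_copy x = (\<chi> i. x $ Abs_ordered_copy i)"

lemma of_to_copy [simp]: "of_copy (to_copy x) = x"
  by (simp add: of_copy_def to_copy_def Abs_ordered_copy_inverse)

lemma to_of_copy [simp]: "to_copy (of_copy x) = x"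
  by (simp add: of_copy_def to_copy_def Rep_ordered_copy_inverse)

lemma measurable_of_copy [measurable]: "of_copy \<in> borel_measurable borel"
  unfolding of_copy_def by (intro borel_measurable_continuous_onI continuous_intros)

lemma sum_copy: "(\<Sum>i\<in>UNIV. f (Rep_ordered_copy i)) = (\<Sum>j\<in>UNIV. f (j::'r::finite))"
  by (rule sum.reindex_bij_betw[OF bij_Rep_ordered_copy])

lemma prod_copy: "(\<Prod>i\<in>UNIV. f (Rep_ordered_copy i)) = (\<Prod>j\<in>UNIV. f (j::'r::finite))"
  by (rule prod.reindex_bij_betw[OF bij_Rep_ordered_copy])

lemma prod_Basis_cart:
  fixes x :: "real^'r" and f :: "real \<Rightarrow> real"
  shows "(\<Prod>b\<in>Basis. f (x \<bullet> b)) = (\<Prod>i\<in>UNIV. f (x $ i))"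
proof -
  have "bij_betw (\<lambda>i. axis i 1) (UNIV :: 'r set) (Basis :: (real^'r) set)"
    by (auto simp: bij_betw_def inj_def axis_eq_axis Basis_vec_def)
  from prod.reindex_bij_betw[OF this, of "\<lambda>b. f (x \<bullet> b)"] show ?thesis by (simp add: inner_axis)
qed

lemma lborel_of_copy: "distr lborel borel of_copy = (lborel :: (real^'r) measure)"
proof (rule lborel_eqI[symmetric])
  fix l u :: "real^'r" assume le: "\<And>b. b \<in> Basis \<Longrightarrow> l \<bullet> b \<le> u \<bullet> b"
  have le': "l $ i \<le> u $ i" for i using le[of "axis i 1"] by (simp add: inner_axis)
  have "of_copy -` box l u = box (to_copy l) (to_copy u)"
  proof (intro set_eqI)
    fix x :: "real^'r ordered_copy"
    have "(\<forall>i. P (Abs_ordered_copy i) i) \<longleftrightarrow> (\<forall>i. P i (Rep_ordered_copy i))" for P :: "'r ordered_copy \<Rightarrow> 'r \<Rightarrow> bool"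
      by (metis Abs_ordered_copy_inverse Rep_ordered_copy_inverse UNIV_I)
    from this[of "\<lambda>a b. l $ b < x $ a \<and> x $ a < u $ b"]
    show "x \<in> of_copy -` box l u \<longleftrightarrow> x \<in> box (to_copy l) (to_copy u)"
      by (simp add: mem_box_cart of_copy_def to_copy_def)
  qed
  hence "emeasure (distr lborel borel of_copy) (box l u) = emeasure lborel (box (to_copy l) (to_copy u))"
    by (subst emeasure_distr) auto
  also have "\<dots> = ennreal (\<Prod>b\<in>Basis. (to_copy u - to_copy l) \<bullet> b)"
  proof -
    have "to_copy l \<bullet> b \<le> to_copy u \<bullet> b" if b: "b \<in> Basis" for b
    proof -
      obtain i where "b = axis i 1" using b by (auto simp: Basis_vec_def)
      thus ?thesis using le' by (simp add: inner_axis to_copy_def)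
    qed
    thus ?thesis by (simp add: emeasure_lborel_box_eq)
  qed
  also have "(\<Prod>b\<in>Basis. (to_copy u - to_copy l) \<bullet> b) = (\<Prod>b\<in>Basis. (u - l) \<bullet> b)"
    using prod_copy[of "\<lambda>i. (u - l) $ i"]
    by (simp only: prod_Basis_cart[of "\<lambda>x. x"]) (simp add: to_copy_def)
  finally show "emeasure (distr lborel borel of_copy) (box l u) = ennreal (\<Prod>b\<in>Basis. (u - l) \<bullet> b)" .
qed simp

text \<open>A bijection of the index types conjugates permutations and preserves their signs, so the
  Leibniz sums agree term by term.\<close>

lemma det_copy:
  fixes S :: "real^'r^'r"
  shows "det (\<chi> i j. S $ Rep_ordered_copy i $ Rep_ordered_copy j) = det S"
proof -
  let ?f = "Rep_ordered_copy :: 'r ordered_copy \<Rightarrow> 'r"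
  note b = bij_Rep_ordered_copy
  have img: "?f ` UNIV = UNIV" by (rule bij_is_surj[OF b])
  have mp: "map_permutation UNIV ?f p (?f i) = ?f (p i)" for p i
    by (simp add: map_permutation_def restrict_id_def bij_is_inj[OF b] img)
  have bij: "bij_betw (map_permutation UNIV ?f) {p. p permutes UNIV} {p. p permutes UNIV}"
  proof (rule bij_betw_byWitness[of _ "map_permutation UNIV Abs_ordered_copy"])
    have c: "bij (Abs_ordered_copy :: 'r \<Rightarrow> 'r ordered_copy)"
      by (metis Abs_ordered_copy_inverse Rep_ordered_copy_inverse UNIV_I bij_iff)
    have 1: "Abs_ordered_copy \<circ> ?f = id" "?f \<circ> Abs_ordered_copy = id"
      by (auto simp: Rep_ordered_copy_inverse Abs_ordered_copy_inverse)
    show "\<forall>p\<in>{p. p permutes UNIV}. map_permutation UNIV Abs_ordered_copy (map_permutation UNIV ?f p) = p"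
      using map_permutation_compose[OF b bij_is_inj[OF c]] by (simp add: 1)
    show "\<forall>p\<in>{p. p permutes UNIV}. map_permutation UNIV ?f (map_permutation UNIV Abs_ordered_copy p) = p"
      using map_permutation_compose[OF c bij_is_inj[OF b]] by (simp add: 1)
    show "map_permutation UNIV ?f ` {p. p permutes UNIV} \<subseteq> {p. p permutes UNIV}"
      using map_permutation_permutes[OF b] by auto
    show "map_permutation UNIV Abs_ordered_copy ` {p. p permutes UNIV} \<subseteq> {p. p permutes (UNIV :: 'r ordered_copy set)}"
      using map_permutation_permutes[OF c] by auto
  qed
  have "det S = (\<Sum>p | p permutes (UNIV :: 'r ordered_copy set). of_int (sign (map_permutation UNIV ?f p)) * (\<Prod>i\<in>UNIV. S $ i $ map_permutation UNIV ?f p i))"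
    unfolding det_def by (rule sum.reindex_bij_betw[OF bij, symmetric])
  also have "\<dots> = det (\<chi> i j. S $ ?f i $ ?f j)"
    unfolding det_def
  proof (intro sum.cong refl, clarify)
    fix p :: "'r ordered_copy \<Rightarrow> 'r ordered_copy" assume p: "p permutes UNIV"
    have "(\<Prod>i\<in>UNIV. S $ i $ map_permutation UNIV ?f p i) = (\<Prod>i\<in>UNIV. S $ ?f i $ ?f (p i))"
      by (subst prod_copy[symmetric]) (simp add: mp)
    moreover have "sign (map_permutation UNIV ?f p) = sign p"
      by (rule sign_map_permutation[OF bij_is_inj[OF b] p]) simp
    ultimately show "of_int (sign (map_permutation UNIV ?f p)) * (\<Prod>i\<in>UNIV. S $ i $ map_permutation UNIV ?f p i) =
      of_int (sign p) * (\<Prod>i\<in>UNIV. (\<chi> i j. S $ ?f i $ ?f j) $ i $ p i)" by simp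
  qed
  finally show ?thesis by simp
qed

lemma lborel_integral_linear:
  fixes S :: "real^'r^'r" and f :: "real^'r \<Rightarrow> real"
  assumes f: "continuous_on UNIV f" "integrable lborel f" "integrable lborel (\<lambda>x. f (S *v x))" and det: "det S \<noteq> 0"
  shows "(LINT x|lborel. f x) = \<bar>det S\<bar> * (LINT x|lborel. f (S *v x))"
proof -
  define S' where "S' = (\<chi> i j. S $ Rep_ordered_copy i $ Rep_ordered_copy j)"
  define F where "F = (\<lambda>x. f (of_copy x))"
  have Sx: "of_copy (S' *v x) = S *v of_copy x" for x
  proof -
    have "(\<Sum>j\<in>UNIV. S $ i $ Rep_ordered_copy j * x $ j) = (\<Sum>j\<in>UNIV. S $ i $ j * x $ Abs_ordered_copy j)" for i
      using sum_copy[of "\<lambda>j. S $ i $ j * x $ Abs_ordered_copy j"] by (simp add: Rep_ordered_copy_inverse)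
    thus ?thesis by (simp add: vec_eq_iff of_copy_def matrix_vector_mult_def S'_def Abs_ordered_copy_inverse)
  qed
  have fm [measurable]: "f \<in> borel_measurable borel" by (rule borel_measurable_continuous_onI[OF f(1)])
  have "continuous_on UNIV (\<lambda>x. f (S *v x))"
    by (rule continuous_on_compose2[OF f(1)]) (auto intro: continuous_intros)
  hence fSm [measurable]: "(\<lambda>x. f (S *v x)) \<in> borel_measurable borel" by (rule borel_measurable_continuous_onI)
  have i1: "integrable lborel F"
    using f(2) unfolding F_def by (subst (asm) lborel_of_copy[symmetric]) (simp add: integrable_distr_eq)
  have i2: "integrable lborel (\<lambda>x. F (S' *v x))"
    using f(3) unfolding F_def Sx by (subst (asm) lborel_of_copy[symmetric]) (simp add: integrable_distr_eq)
  have e1: "(LINT x|lborel. f x) = (LINT x|lborel. F x)"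
    unfolding F_def by (subst lborel_of_copy[symmetric]) (simp add: integral_distr)
  have e2: "(LINT x|lborel. f (S *v x)) = (LINT x|lborel. F (S' *v x))"
    unfolding F_def Sx by (subst lborel_of_copy[symmetric]) (simp add: integral_distr)
  have d: "det S' = det S" unfolding S'_def by (rule det_copy)
  have inv: "invertible S'" using det d by (simp add: invertible_det_nz)
  have r: "range ((*v) S') = UNIV" using inv by (metis invertible_def matrix_vector_mul_assoc matrix_vector_mul_lid surjI)
  \<comment> \<open>The substitution rule applied below concerns vector-valued functions;
    \<open>h\<close> embeds the reals into \<open>real^1\<close>, and the component is read off at
    the end.\<close>
  define h :: "real \<Rightarrow> real^1" where "h y = y *\<^sub>R axis 1 1" for y
  have h: "bounded_linear h" unfolding h_def by (rule bounded_linear_scaleR_left)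
  have "F absolutely_integrable_on UNIV"
    using i1 borel_measurable_integrable[OF i1] by (simp add: set_integrable_def integrable_completion)
  hence ai: "(h \<circ> F) absolutely_integrable_on UNIV" by (rule absolutely_integrable_linear[OF _ h])
  have "integral (range ((*v) S')) (h \<circ> F) = \<bar>det (matrix ((*v) S'))\<bar> *\<^sub>R integral UNIV ((h \<circ> F) \<circ> (*v) S')"
    by (rule integral_change_of_variables_linear) (use ai in \<open>simp_all add: r\<close>)
  moreover have "integral UNIV (h \<circ> F) = h (integral UNIV F)"
    by (rule integral_linear[OF integrable_on_lborel[OF i1] h])
  moreover have "integral UNIV (h \<circ> (\<lambda>x. F (S' *v x))) = h (integral UNIV (\<lambda>x. F (S' *v x)))"
    by (rule integral_linear[OF integrable_on_lborel[OF i2] h])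
  ultimately have "h (integral UNIV F) = \<bar>det S\<bar> *\<^sub>R h (integral UNIV (\<lambda>x. F (S' *v x)))"
    by (simp add: d o_def r)
  from arg_cong[OF this, of "\<lambda>v. v $ 1"]
  have "integral UNIV F = \<bar>det S\<bar> * integral UNIV (\<lambda>x. F (S' *v x))" by (simp add: h_def)
  thus ?thesis unfolding e1 e2 integral_lborel[OF i1] integral_lborel[OF i2] .
qed

text \<open>Instantiated with the algebraic reals for the arithmetic of the coefficients, and with
  all reals where only polynomiality in \<open>t\<close> matters. The square roots come from
  normalizing vectors.\<close>

definition sqrt_closed_field :: "real set \<Rightarrow> bool" where
  "sqrt_closed_field K \<longleftrightarrow> \<rat> \<subseteq> K \<and> (\<forall>x\<in>K. \<forall>y\<in>K. x + y \<in> K \<and> x - y \<in> K \<and> x * y \<in> K \<and> x / y \<in> K)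
     \<and> (\<forall>x\<in>K. x > 0 \<longrightarrow> sqrt x \<in> K)"

lemma sqrt_closed_fieldD:
  assumes "sqrt_closed_field K"
  shows "x \<in> \<rat> \<Longrightarrow> x \<in> K" "x \<in> K \<Longrightarrow> y \<in> K \<Longrightarrow> x + y \<in> K" "x \<in> K \<Longrightarrow> y \<in> K \<Longrightarrow> x - y \<in> K"
    "x \<in> K \<Longrightarrow> y \<in> K \<Longrightarrow> x * y \<in> K" "x \<in> K \<Longrightarrow> y \<in> K \<Longrightarrow> x / y \<in> K" "x \<in> K \<Longrightarrow> x > 0 \<Longrightarrow> sqrt x \<in> K"
  using assms unfolding sqrt_closed_field_def by blast+

lemma sqrt_closed_field_sum:
  assumes K: "sqrt_closed_field K" and "\<And>i. i \<in> I \<Longrightarrow> f i \<in> K" shows "sum f I \<in> K"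
  using assms(2)
proof (induction I rule: infinite_finite_induct)
  case (insert i I) thus ?case using sqrt_closed_fieldD(2)[OF K] by simp
qed (use sqrt_closed_fieldD(1)[OF K] in auto)

lemma sqrt_closed_field_UNIV: "sqrt_closed_field UNIV"
  by (simp add: sqrt_closed_field_def)

text \<open>The standard basis is orthonormalized for the inner product given by \<open>M\<close>.
  The support condition carried through the induction keeps each new vector nonzero, since its own
  coordinate \<open>k\<close> remains 1 before normalization.\<close>

lemma gram_schmidt:
  fixes M :: "real^'r^'r"
  assumes sym: "transpose M = M" and pd: "positive_definite M" and K: "sqrt_closed_field K"
    and M: "\<And>i j. M $ i $ j \<in> K"
  obtains S :: "real^'r^'r" where "\<And>i j. S $ i $ j \<in> K" "transpose S ** M ** S = mat 1"
proof -
  note Kc = sqrt_closed_fieldD[OF K]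
  have 01: "0 \<in> K" "1 \<in> K" by (auto intro: Kc(1))
  have innK: "x \<bullet> (M *v y) \<in> K" if "\<And>i. x $ i \<in> K" "\<And>i. y $ i \<in> K" for x y
    unfolding inner_vec_def matrix_vector_mult_def
    by (simp, intro sqrt_closed_field_sum[OF K] Kc(4) that M)
  have "\<exists>w :: 'r \<Rightarrow> real^'r. (\<forall>i\<in>I. \<forall>j\<in>I. w i \<bullet> (M *v w j) = (if i = j then 1 else 0)) \<and>
     (\<forall>i\<in>I. \<forall>k. w i $ k \<in> K) \<and> (\<forall>i\<in>I. \<forall>k. k \<notin> I \<longrightarrow> w i $ k = 0)" if "finite I" for I
    using that
  proof (induction I rule: finite_induct)
    case (insert k I)
    then obtain w :: "'r \<Rightarrow> real^'r" where w: "\<And>i j. i \<in> I \<Longrightarrow> j \<in> I \<Longrightarrow> w i \<bullet> (M *v w j) = (if i = j then 1 else 0)"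
      "\<And>i a. i \<in> I \<Longrightarrow> w i $ a \<in> K" "\<And>i a. i \<in> I \<Longrightarrow> a \<notin> I \<Longrightarrow> w i $ a = 0" by blast
    define e :: "real^'r" where "e = axis k 1"
    have eK: "e $ a \<in> K" for a using 01 by (simp add: e_def axis_def)
    define v where "v = e - (\<Sum>i\<in>I. (e \<bullet> (M *v w i)) *\<^sub>R w i)"
    have vK: "v $ a \<in> K" for a
      unfolding v_def by (simp, intro Kc(3) eK sqrt_closed_field_sum[OF K] Kc(4) innK w(2)) auto
    have "v $ k = 1" using insert.hyps w(3) by (simp add: v_def e_def axis_def)
    hence "v \<noteq> 0" by auto
    hence q: "v \<bullet> (M *v v) > 0" using pd by (simp add: positive_definite_def)
    have orth: "v \<bullet> (M *v w j) = 0" if j: "j \<in> I" for j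
    proof -
      have "(\<Sum>i\<in>I. (e \<bullet> (M *v w i)) * (w i \<bullet> (M *v w j))) = (\<Sum>i\<in>I. if i = j then e \<bullet> (M *v w j) else 0)"
        by (intro sum.cong) (use w(1) j in auto)
      thus ?thesis using j insert.hyps by (simp add: v_def inner_diff_left inner_sum_left)
    qed
    define z where "z = v /\<^sub>R sqrt (v \<bullet> (M *v v))"
    have zz: "z \<bullet> (M *v z) = 1"
      using q by (simp add: z_def matrix_vector_mult_scaleR field_simps)
    have zw: "z \<bullet> (M *v w j) = 0" "w j \<bullet> (M *v z) = 0" if "j \<in> I" for j
      using orth[OF that] symmetric_inner_matrix[OF sym, of "w j" v] by (simp_all add: z_def matrix_vector_mult_scaleR)
    have zK: "z $ a \<in> K" for a
      using Kc(5)[OF vK Kc(6)[OF innK[OF vK vK] q]] by (simp add: z_def divide_inverse mult.commute)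
    have z0: "z $ a = 0" if "a \<notin> insert k I" for a
      using that w(3) by (simp add: z_def v_def e_def axis_def)
    show ?case
    proof (intro exI[of _ "w(k := z)"] conjI ballI allI impI)
      fix i j assume "i \<in> insert k I" "j \<in> insert k I"
      thus "(w(k := z)) i \<bullet> (M *v (w(k := z)) j) = (if i = j then 1 else 0)"
        using insert.hyps w(1) zz zw by auto
    next
      fix i a assume "i \<in> insert k I"
      thus "(w(k := z)) i $ a \<in> K" using w(2) zK by auto
    next
      fix i a assume "i \<in> insert k I" "a \<notin> insert k I"
      thus "(w(k := z)) i $ a = 0" using w(3) z0 by auto
    qed
  qed auto
  from this[of UNIV] obtain w :: "'r \<Rightarrow> real^'r" where w: "\<And>i j. w i \<bullet> (M *v w j) = (if i = j then 1 else 0)"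
      "\<And>i a. w i $ a \<in> K" by auto
  define S where "S = (\<chi> a i. w i $ a)"
  have "transpose S ** M ** S = mat 1"
  proof -
    have "(transpose S ** (M ** S)) $ i $ j = w i \<bullet> (M *v w j)" for i j
      by (simp add: S_def transpose_def matrix_matrix_mult_def inner_vec_def matrix_vector_mult_def)
    thus ?thesis using w(1) by (simp add: vec_eq_iff mat_def matrix_mul_assoc)
  qed
  thus ?thesis using that[of S] w(2) by (simp add: S_def)
qed

text \<open>Polynomial functions with coefficients in \<open>K\<close>, generated by multiplication
  with one coordinate at a time; this fits the moment computation, where such a coordinate raises
  one exponent.\<close>

inductive kpoly :: "real set \<Rightarrow> (real^'r \<Rightarrow> real) \<Rightarrow> bool" for K where
  const: "c \<in> K \<Longrightarrow> kpoly K (\<lambda>x. c)"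
| add: "kpoly K p \<Longrightarrow> kpoly K q \<Longrightarrow> kpoly K (\<lambda>x. p x + q x)"
| coord: "kpoly K p \<Longrightarrow> kpoly K (\<lambda>x. x $ i * p x)"

lemma kpoly_cmult:
  assumes K: "sqrt_closed_field K" and c: "c \<in> K" and p: "kpoly K p"
  shows "kpoly K (\<lambda>x. c * p x)"
  using p
proof induction
  case (const d) thus ?case by (intro kpoly.const sqrt_closed_fieldD(4)[OF K c])
next
  case (add p q) thus ?case using kpoly.add[OF add.IH] by (simp add: distrib_left)
next
  case (coord p i) thus ?case using kpoly.coord[OF coord.IH, of i] by (simp add: mult.left_commute)
qed

lemma kpoly_mult:
  assumes K: "sqrt_closed_field K" and q: "kpoly K q" and p: "kpoly K p"
  shows "kpoly K (\<lambda>x. p x * q x)"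
  using p
proof induction
  case (const d) thus ?case by (rule kpoly_cmult[OF K _ q])
next
  case (add p q) thus ?case using kpoly.add[OF add.IH] by (simp add: distrib_right)
next
  case (coord p i) thus ?case using kpoly.coord[OF coord.IH, of i] by (simp add: mult.assoc)
qed

lemma kpoly_01:
  assumes K: "sqrt_closed_field K" shows "kpoly K (\<lambda>x. 0)" "kpoly K (\<lambda>x. 1)"
  by (auto intro!: kpoly.const sqrt_closed_fieldD(1)[OF K])

lemma kpoly_sum:
  assumes K: "sqrt_closed_field K" and "\<And>i. i \<in> I \<Longrightarrow> kpoly K (p i)" shows "kpoly K (\<lambda>x. \<Sum>i\<in>I. p i x)"
  using assms(2)
proof (induction I rule: infinite_finite_induct)
  case (insert i I) thus ?case using kpoly.add[of K "p i"] by simp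
qed (simp_all add: kpoly_01[OF K])

lemma kpoly_prod:
  assumes K: "sqrt_closed_field K" and "\<And>i. i \<in> I \<Longrightarrow> kpoly K (p i)" shows "kpoly K (\<lambda>x. \<Prod>i\<in>I. p i x)"
  using assms(2)
proof (induction I rule: infinite_finite_induct)
  case (insert i I) thus ?case using kpoly_mult[OF K, of _ "p i"] by simp
qed (simp_all add: kpoly_01[OF K])

lemma kpoly_nth: "sqrt_closed_field K \<Longrightarrow> kpoly K (\<lambda>x. x $ i)"
  using kpoly.coord[OF kpoly.const[of 1 K], of i] sqrt_closed_fieldD(1)[of K 1] by simp

lemma kpoly_linear:
  assumes K: "sqrt_closed_field K" and S: "\<And>i j. S $ i $ j \<in> K" and p: "kpoly K p"
  shows "kpoly K (\<lambda>x. p (S *v x))"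
  using p
proof induction
  case (const c) thus ?case by (rule kpoly.const)
next
  case (add p q) thus ?case by (intro kpoly.add)
next
  case (coord p i)
  have "kpoly K (\<lambda>x. (S *v x) $ i)" unfolding matrix_vector_mult_def
    by (simp, intro kpoly_sum[OF K] kpoly_cmult[OF K S] kpoly_nth[OF K])
  thus ?case by (rule kpoly_mult[OF K coord.IH])
qed

lemma kpoly_mono: "kpoly K p \<Longrightarrow> K \<subseteq> K' \<Longrightarrow> kpoly K' p"
  by (induction rule: kpoly.induct) (auto intro: kpoly.intros)

lemma continuous_on_kpoly: "kpoly K p \<Longrightarrow> continuous_on S p"
  by (induction rule: kpoly.induct) (auto intro!: continuous_intros)

lemma kpoly_bound:
  assumes "kpoly K p" shows "\<exists>C L. C \<ge> 0 \<and> (\<forall>x. \<bar>p x\<bar> \<le> C * (1 + norm x) ^ L)"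
  using assms
proof induction
  case (const c) show ?case by (intro exI[of _ "\<bar>c\<bar>"] exI[of _ 0]) auto
next
  case (add p q)
  then obtain C L C' L' where *: "C \<ge> 0" "\<And>x. \<bar>p x\<bar> \<le> C * (1 + norm x) ^ L" "C' \<ge> 0" "\<And>x. \<bar>q x\<bar> \<le> C' * (1 + norm x) ^ L'" by blast
  show ?case
  proof (intro exI[of _ "C + C'"] exI[of _ "L + L'"] conjI allI)
    fix x :: "real^'a"
    have "C * (1 + norm x) ^ L \<le> C * (1 + norm x) ^ (L + L')" "C' * (1 + norm x) ^ L' \<le> C' * (1 + norm x) ^ (L + L')"
      using * by (intro mult_left_mono power_increasing; simp)+
    thus "\<bar>p x + q x\<bar> \<le> (C + C') * (1 + norm x) ^ (L + L')" using *(2,4)[of x] by (simp add: distrib_right)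
  qed (use * in auto)
next
  case (coord p i)
  then obtain C L where *: "C \<ge> 0" "\<And>x. \<bar>p x\<bar> \<le> C * (1 + norm x) ^ L" by blast
  show ?case
  proof (intro exI[of _ C] exI[of _ "Suc L"] conjI allI)
    fix x :: "real^'a"
    have "\<bar>x $ i\<bar> \<le> 1 + norm x" using component_le_norm_cart[of x i] by simp
    hence "\<bar>x $ i\<bar> * \<bar>p x\<bar> \<le> (1 + norm x) * (C * (1 + norm x) ^ L)" using * by (intro mult_mono) auto
    thus "\<bar>x $ i * p x\<bar> \<le> C * (1 + norm x) ^ Suc L" by (simp add: abs_mult mult_ac)
  qed (use * in auto)
qed

lemma kpoly_partial:
  assumes "kpoly UNIV p"
  shows "\<exists>p'. kpoly UNIV p' \<and> (\<forall>x. ((\<lambda>h. p (x + h *\<^sub>R axis i 1)) has_real_derivative p' x) (at 0))"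
  using assms
proof induction
  case (const c) show ?case by (intro exI[of _ "\<lambda>x. 0"]) (auto intro: kpoly.const)
next
  case (add p q)
  then obtain p' q' where "kpoly UNIV p'" "\<And>x. ((\<lambda>h. p (x + h *\<^sub>R axis i 1)) has_real_derivative p' x) (at 0)"
    "kpoly UNIV q'" "\<And>x. ((\<lambda>h. q (x + h *\<^sub>R axis i 1)) has_real_derivative q' x) (at 0)" by blast
  thus ?case by (intro exI[of _ "\<lambda>x. p' x + q' x"]) (auto intro!: kpoly.add derivative_intros)
next
  case (coord p j)
  then obtain p' where p': "kpoly UNIV p'" "\<And>x. ((\<lambda>h. p (x + h *\<^sub>R axis i 1)) has_real_derivative p' x) (at 0)" by blast
  define d :: real where "d = axis i 1 $ j"
  show ?case
  proof (intro exI[of _ "\<lambda>x. d * p x + x $ j * p' x"] conjI allI)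
    show "kpoly UNIV (\<lambda>x. d * p x + x $ j * p' x)"
      by (intro kpoly.add kpoly.coord p' kpoly_cmult[OF sqrt_closed_field_UNIV] coord.hyps) auto
    fix x
    have "((\<lambda>h. (x $ j + h * d) * p (x + h *\<^sub>R axis i 1)) has_real_derivative (0 + 1 * d) * p (x + 0 *\<^sub>R axis i 1) + p' x * (x $ j + 0 * d)) (at 0)"
      by (intro DERIV_mult DERIV_add DERIV_const DERIV_cmult_right DERIV_ident p')
    thus "((\<lambda>h. (x + h *\<^sub>R axis i 1) $ j * p (x + h *\<^sub>R axis i 1)) has_real_derivative d * p x + x $ j * p' x) (at 0)"
      by (simp add: d_def mult.commute)
  qed
qed

text \<open>Bound \<open>1 + y\<close> by \<open>exp y\<close> and complete the square; the price is
  half of the Gaussian exponent.\<close>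

lemma power_exp_absorb:
  assumes c: "c > 0" and y: "y \<ge> (0::real)"
  shows "(1 + y) ^ L * exp (- c * y\<^sup>2) \<le> exp ((real L)\<^sup>2 / (2 * c)) * exp (- (c / 2) * y\<^sup>2)"
proof -
  have "(1 + y) ^ L \<le> exp y ^ L" using y by (intro power_mono exp_ge_add_one_self) auto
  also have "\<dots> = exp (real L * y)" by (simp add: exp_of_nat_mult)
  finally have "(1 + y) ^ L * exp (- c * y\<^sup>2) \<le> exp (real L * y) * exp (- c * y\<^sup>2)" by (intro mult_right_mono) auto
  also have "\<dots> = exp (real L * y - c * y\<^sup>2)" by (simp add: exp_add[symmetric])
  also have "\<dots> \<le> exp ((real L)\<^sup>2 / (2 * c) - (c / 2) * y\<^sup>2)"
  proof -
    have "0 \<le> (c * y - real L)\<^sup>2 / (2 * c)" using c by simp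
    also have "\<dots> = c / 2 * y\<^sup>2 - real L * y + (real L)\<^sup>2 / (2 * c)"
      using c by (simp add: power2_eq_square field_simps)
    finally show ?thesis by simp
  qed
  also have "\<dots> = exp ((real L)\<^sup>2 / (2 * c)) * exp (- (c / 2) * y\<^sup>2)" by (simp add: exp_add[symmetric])
  finally show ?thesis .
qed

definition gauss_weight :: "real^'r^'r \<Rightarrow> real^'r \<Rightarrow> real" where
  "gauss_weight M x = exp (- 1/2 * (x \<bullet> (M *v x)))"

text \<open>Differentiating the weight produces a linear factor, so the polynomial multiples of a
  fixed Gaussian are closed under partial derivatives.\<close>

definition gauss_class :: "real^'r^'r \<Rightarrow> (real^'r \<Rightarrow> real) set" where
  "gauss_class M = {\<lambda>x. p x * gauss_weight M x | p. kpoly UNIV p}"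

lemma gauss_weight_le:
  fixes M :: "real^'r^'r"
  assumes "positive_definite M"
  obtains c where "c > 0" "\<And>x. gauss_weight M x \<le> exp (- c * (norm x)\<^sup>2)"
proof -
  obtain c where c: "c > 0" "\<And>x. x \<bullet> (M *v x) \<ge> c * (norm x)\<^sup>2"
    using positive_definite_lower[OF assms] by blast
  show ?thesis using that[of "c / 2"] c by (simp add: gauss_weight_def)
qed

lemma smooth_gaussian_class_gauss_class:
  fixes M :: "real^'r^'r"
  assumes sym: "transpose M = M" and pd: "positive_definite M"
  shows "smooth_gaussian_class (gauss_class M)"
proof -
  have main: "continuous_on UNIV g \<and> gaussian_bounded g \<and>
    (\<forall>i. \<exists>g'\<in>gauss_class M. \<forall>x. ((\<lambda>h. g (x + h *\<^sub>R axis i 1)) has_real_derivative g' x) (at 0))"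
    if "g \<in> gauss_class M" for g
  proof (intro conjI allI)
  from that
  obtain p where p: "kpoly UNIV p" and g: "g = (\<lambda>x. p x * gauss_weight M x)" by (auto simp: gauss_class_def)
  show "continuous_on UNIV g"
    unfolding g gauss_weight_def by (intro continuous_intros continuous_on_kpoly[OF p])
  show "gaussian_bounded g"
  proof -
    obtain c where c: "c > 0" "\<And>x. gauss_weight M x \<le> exp (- c * (norm x)\<^sup>2)"
      using gauss_weight_le[OF pd] by blast
    obtain C L where C: "C \<ge> 0" "\<And>x. \<bar>p x\<bar> \<le> C * (1 + norm x) ^ L" using kpoly_bound[OF p] by blast
    show ?thesis unfolding gaussian_bounded_def
    proof (rule exI[of _ "C * exp ((real L)\<^sup>2 / (2 * c))"], rule exI[of _ "c / 2"], intro conjI allI)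
      fix x
      have "\<bar>g x\<bar> = \<bar>p x\<bar> * gauss_weight M x" by (simp add: g abs_mult gauss_weight_def)
      also have "\<dots> \<le> (C * (1 + norm x) ^ L) * exp (- c * (norm x)\<^sup>2)"
        using C c by (intro mult_mono) (auto simp: gauss_weight_def)
      also have "\<dots> = C * ((1 + norm x) ^ L * exp (- c * (norm x)\<^sup>2))" by simp
      also have "\<dots> \<le> C * (exp ((real L)\<^sup>2 / (2 * c)) * exp (- (c / 2) * (norm x)\<^sup>2))"
        by (intro mult_left_mono power_exp_absorb c C) auto
      finally show "\<bar>g x\<bar> \<le> C * exp ((real L)\<^sup>2 / (2 * c)) * exp (- (c / 2) * (norm x)\<^sup>2)" by simp
    qed (use c C in auto)
  qed
  fix i
  obtain p' where p': "kpoly UNIV p'" "\<And>x. ((\<lambda>h. p (x + h *\<^sub>R axis i 1)) has_real_derivative p' x) (at 0)"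
    using kpoly_partial[OF p] by blast
  define r where "r = (\<lambda>x. p' x + (- 1) * (p x * (M *v x) $ i))"
  have "kpoly UNIV (\<lambda>x. (M *v x) $ i)"
    by (rule kpoly_linear[OF sqrt_closed_field_UNIV _ kpoly_nth[OF sqrt_closed_field_UNIV]]) simp
  hence r: "kpoly UNIV r" unfolding r_def
    by (intro kpoly.add p' kpoly_cmult[OF sqrt_closed_field_UNIV] kpoly_mult[OF sqrt_closed_field_UNIV] p) auto
  have "((\<lambda>h. g (x + h *\<^sub>R axis i 1)) has_real_derivative r x * gauss_weight M x) (at 0)" for x
  proof -
    have ax: "axis i 1 \<bullet> y = y $ i" for y :: "real^'r" by (simp add: inner_axis inner_commute)
    define a where "a = axis i 1 \<bullet> (M *v axis i (1::real))"
    have q: "(x + h *\<^sub>R axis i 1) \<bullet> (M *v (x + h *\<^sub>R axis i 1)) = x \<bullet> (M *v x) + 2 * h * (M *v x) $ i + h\<^sup>2 * a" for h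
      using symmetric_inner_matrix[OF sym, of x "axis i 1"]
      by (simp add: matrix_vector_right_distrib matrix_vector_mult_scaleR inner_add_left inner_add_right ax a_def
          power2_eq_square algebra_simps)
    have "((\<lambda>h. exp (- 1/2 * (x \<bullet> (M *v x) + 2 * h * (M *v x) $ i + h\<^sup>2 * a))) has_real_derivative - (M *v x) $ i * gauss_weight M x) (at 0)"
      by (auto intro!: derivative_eq_intros simp: gauss_weight_def)
    hence "((\<lambda>h. gauss_weight M (x + h *\<^sub>R axis i 1)) has_real_derivative - (M *v x) $ i * gauss_weight M x) (at 0)"
      unfolding gauss_weight_def q .
    from DERIV_mult[OF p'(2)[of x] this] show ?thesis by (simp add: g r_def algebra_simps)
  qed
  moreover have "(\<lambda>x. r x * gauss_weight M x) \<in> gauss_class M" using r by (auto simp: gauss_class_def)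
  ultimately show "\<exists>g'\<in>gauss_class M. \<forall>x. ((\<lambda>h. g (x + h *\<^sub>R axis i 1)) has_real_derivative g' x) (at 0)"
    by (intro bexI[of _ "\<lambda>x. r x * gauss_weight M x"] allI)
  qed
  show ?thesis by unfold_locales (use main in blast)+
qed

lemma std_moment:
  obtains m where "m \<in> \<rat>" "integrable lborel (\<lambda>x::real. x ^ k * exp (- 1/2 * x\<^sup>2))"
    "(LINT x|lborel. x ^ k * exp (- 1/2 * x\<^sup>2)) = sqrt (2 * pi) * m" "k = 0 \<Longrightarrow> m = 1"
proof -
  have e: "x ^ k * exp (- 1/2 * x\<^sup>2) = sqrt (2 * pi) * (std_normal_density x * x ^ k)" for x
    by (simp add: std_normal_density_def)
  define m where "m = (LINT x|lborel. std_normal_density x * x ^ k)"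
  have "m \<in> \<rat>"
  proof (cases "even k")
    case True
    then obtain j where k: "k = 2 * j" by blast
    have "fact (2 * j) / (2 ^ j * fact j) = (real (fact (2 * j)) / real (2 ^ j * fact j))" by simp
    hence "m = real (fact (2 * j)) / real (2 ^ j * fact j)" unfolding m_def k integral_std_normal_moment_even .
    thus ?thesis by (simp only:) (intro Rats_divide Rats_of_nat)
  next
    case False
    then obtain j where k: "k = 2 * j + 1" by (blast elim: oddE)
    show ?thesis unfolding m_def k integral_std_normal_moment_odd by simp
  qed
  moreover have "integrable lborel (\<lambda>x::real. x ^ k * exp (- 1/2 * x\<^sup>2))"
    unfolding e by (intro integrable_mult_right integrable_std_normal_moment)
  moreover have "(LINT x|lborel. x ^ k * exp (- 1/2 * x\<^sup>2)) = sqrt (2 * pi) * m" unfolding e m_def by simp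
  moreover have "m = 1" if "k = 0" using integral_std_normal_moment_even[of 0] that by (simp add: m_def)
  ultimately show ?thesis by (rule that)
qed

lemma std_gauss_monomial:
  fixes k :: "'r::finite \<Rightarrow> nat"
  obtains m where "m \<in> \<rat>" "integrable lborel (\<lambda>x::real^'r. (\<Prod>i\<in>UNIV. x $ i ^ k i) * exp (- 1/2 * (norm x)\<^sup>2))"
    "(LINT x|lborel. (\<Prod>i\<in>UNIV. (x::real^'r) $ i ^ k i) * exp (- 1/2 * (norm x)\<^sup>2)) = sqrt (2 * pi) ^ CARD('r) * m"
    "(\<forall>i. k i = 0) \<Longrightarrow> m = 1"
proof -
  have "\<forall>j. \<exists>m. m \<in> \<rat> \<and> integrable lborel (\<lambda>x::real. x ^ j * exp (- 1/2 * x\<^sup>2)) \<and>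
    (LINT x|lborel. x ^ j * exp (- 1/2 * x\<^sup>2)) = sqrt (2 * pi) * m \<and> (j = 0 \<longrightarrow> m = 1)"
    using std_moment by metis
  then obtain m where m: "\<And>j. m j \<in> \<rat>" "\<And>j. integrable lborel (\<lambda>x::real. x ^ j * exp (- 1/2 * x\<^sup>2))"
    "\<And>j. (LINT x|lborel. x ^ j * exp (- 1/2 * x\<^sup>2)) = sqrt (2 * pi) * m j" "m 0 = 1" by metis
  have bij: "bij_betw (\<lambda>i. axis i 1) (UNIV :: 'r set) (Basis :: (real^'r) set)"
    by (auto simp: bij_betw_def inj_def axis_eq_axis Basis_vec_def)
  define f :: "real^'r \<Rightarrow> real \<Rightarrow> real" where "f b y = y ^ k (axis_index b) * exp (- 1/2 * y\<^sup>2)" for b y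
  have ix: "axis_index (axis i (1::real)) = i" for i :: 'r by simp
  have e: "(\<Prod>b\<in>Basis. f b (x \<bullet> b)) = (\<Prod>i\<in>UNIV. x $ i ^ k i) * exp (- 1/2 * (norm x)\<^sup>2)" for x
    using exp_norm_power2[of "1/2" x] prod.reindex_bij_betw[OF bij, of "\<lambda>b. f b (x \<bullet> b)"] prod.reindex_bij_betw[OF bij, of "\<lambda>b. exp (- 1/2 * (x \<bullet> b)\<^sup>2)"]
    by (simp add: f_def inner_axis prod.distrib)
  have int: "integrable lborel (f b)" for b unfolding f_def[abs_def] by (rule m(2))
  have "(\<Prod>b\<in>Basis. LINT y|lborel. f b y) = (\<Prod>i\<in>(UNIV::'r set). sqrt (2 * pi) * m (k i))"
    using prod.reindex_bij_betw[OF bij, of "\<lambda>b. LINT y|lborel. f b y"] m(3) by (simp add: f_def)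
  hence "(LINT x|lborel. (\<Prod>i\<in>UNIV. (x::real^'r) $ i ^ k i) * exp (- 1/2 * (norm x)\<^sup>2)) = sqrt (2 * pi) ^ CARD('r) * (\<Prod>i\<in>(UNIV::'r set). m (k i))"
    using lborel_prod_integral(2)[of f, OF int] unfolding e by (simp add: prod.distrib)
  moreover have "integrable lborel (\<lambda>x::real^'r. (\<Prod>i\<in>UNIV. x $ i ^ k i) * exp (- 1/2 * (norm x)\<^sup>2))"
    using lborel_prod_integral(1)[of f, OF int] unfolding e .
  moreover have "(\<Prod>i\<in>(UNIV::'r set). m (k i)) \<in> \<rat>" using m(1) by (intro Rats_prod) auto
  ultimately show ?thesis using that m(4) by simp
qed

text \<open>The monomial in front of \<open>p\<close> is arbitrary so that, in the induction, a
  coordinate split off from \<open>p\<close> can be moved into it. The base case consists of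
  rational moments.\<close>

lemma std_gauss_kpoly:
  fixes p :: "real^'r \<Rightarrow> real"
  assumes K: "sqrt_closed_field K" and p: "kpoly K p"
  shows "\<exists>m\<in>K. integrable lborel (\<lambda>x. (\<Prod>i\<in>UNIV. x $ i ^ k i) * p x * exp (- 1/2 * (norm x)\<^sup>2)) \<and>
    (LINT x|lborel. (\<Prod>i\<in>UNIV. x $ i ^ k i) * p x * exp (- 1/2 * (norm x)\<^sup>2)) = sqrt (2 * pi) ^ CARD('r) * m"
  using p
proof (induction arbitrary: k)
  case (const c)
  obtain m where m: "m \<in> \<rat>" "integrable lborel (\<lambda>x::real^'r. (\<Prod>i\<in>UNIV. x $ i ^ k i) * exp (- 1/2 * (norm x)\<^sup>2))"
    "(LINT x|lborel. (\<Prod>i\<in>UNIV. (x::real^'r) $ i ^ k i) * exp (- 1/2 * (norm x)\<^sup>2)) = sqrt (2 * pi) ^ CARD('r) * m"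
    by (rule std_gauss_monomial)
  have e: "(\<Prod>i\<in>UNIV. x $ i ^ k i) * c * exp (- 1/2 * (norm x)\<^sup>2) = c * ((\<Prod>i\<in>UNIV. x $ i ^ k i) * exp (- 1/2 * (norm x)\<^sup>2))" for x :: "real^'r"
    by simp
  show ?case unfolding e
  proof (intro bexI[of _ "c * m"] conjI)
    show "c * m \<in> K" using const m(1) sqrt_closed_fieldD(1,4)[OF K] by blast
    show "integrable lborel (\<lambda>x. c * ((\<Prod>i\<in>UNIV. (x::real^'r) $ i ^ k i) * exp (- 1/2 * (norm x)\<^sup>2)))"
      by (intro integrable_mult_right m)
    show "(LINT x|lborel. c * ((\<Prod>i\<in>UNIV. (x::real^'r) $ i ^ k i) * exp (- 1/2 * (norm x)\<^sup>2))) = sqrt (2 * pi) ^ CARD('r) * (c * m)"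
      using m(3) by simp
  qed
next
  case (add p q)
  obtain m where m: "m \<in> K" "integrable lborel (\<lambda>x. (\<Prod>i\<in>UNIV. x $ i ^ k i) * p x * exp (- 1/2 * (norm x)\<^sup>2))"
    "(LINT x|lborel. (\<Prod>i\<in>UNIV. x $ i ^ k i) * p x * exp (- 1/2 * (norm x)\<^sup>2)) = sqrt (2 * pi) ^ CARD('r) * m"
    using add.IH(1)[of k] by blast
  obtain n where n: "n \<in> K" "integrable lborel (\<lambda>x. (\<Prod>i\<in>UNIV. x $ i ^ k i) * q x * exp (- 1/2 * (norm x)\<^sup>2))"
    "(LINT x|lborel. (\<Prod>i\<in>UNIV. x $ i ^ k i) * q x * exp (- 1/2 * (norm x)\<^sup>2)) = sqrt (2 * pi) ^ CARD('r) * n"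
    using add.IH(2)[of k] by blast
  show ?case unfolding distrib_left distrib_right
  proof (intro bexI[of _ "m + n"] conjI)
    show "m + n \<in> K" using m n sqrt_closed_fieldD(2)[OF K] by blast
    show "integrable lborel (\<lambda>x. (\<Prod>i\<in>UNIV. x $ i ^ k i) * p x * exp (- 1/2 * (norm x)\<^sup>2) + (\<Prod>i\<in>UNIV. x $ i ^ k i) * q x * exp (- 1/2 * (norm x)\<^sup>2))"
      by (intro Bochner_Integration.integrable_add m n)
    show "(LINT x|lborel. (\<Prod>i\<in>UNIV. x $ i ^ k i) * p x * exp (- 1/2 * (norm x)\<^sup>2) + (\<Prod>i\<in>UNIV. x $ i ^ k i) * q x * exp (- 1/2 * (norm x)\<^sup>2)) = sqrt (2 * pi) ^ CARD('r) * (m + n)"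
      unfolding Bochner_Integration.integral_add[OF m(2) n(2)] m(3) n(3) by (simp add: distrib_left)
  qed
next
  case (coord p i)
  have e: "(\<Prod>j\<in>UNIV. x $ j ^ k j) * (x $ i * p x) = (\<Prod>j\<in>UNIV. x $ j ^ (k(i := Suc (k i))) j) * p x" for x :: "real^'r"
  proof -
    have "(\<Prod>j\<in>UNIV. x $ j ^ (k(i := Suc (k i))) j) = (\<Prod>j\<in>UNIV. x $ j ^ k j * (if j = i then x $ i else 1))"
      by (intro prod.cong) auto
    also have "\<dots> = (\<Prod>j\<in>UNIV. x $ j ^ k j) * x $ i" by (simp add: prod.distrib)
    finally show ?thesis by simp
  qed
  show ?case unfolding e by (rule coord.IH)
qed

text \<open>Substituting \<open>S *v x\<close> with \<open>S\<close> from
  \<open>gram_schmidt\<close> reduces to the standard Gaussian and keeps the coefficients in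
  \<open>K\<close>. The Jacobian is the inverse of the square root of \<open>det M\<close>, so both
  normalizing factors cancel.\<close>

theorem gaussian_integral_kpoly:
  fixes M :: "real^'r^'r"
  assumes sym: "transpose M = M" and pd: "positive_definite M" and K: "sqrt_closed_field K" and MK: "\<And>i j. M $ i $ j \<in> K"
    and p: "kpoly K p"
  shows "det M > 0"
    and "det M powr (1/2) * (2 * pi) powr (- real CARD('r) / 2) * (LINT x|lborel. p x * gauss_weight M x) \<in> K"
    and "p = (\<lambda>x. 1) \<Longrightarrow> det M powr (1/2) * (2 * pi) powr (- real CARD('r) / 2) * (LINT x|lborel. p x * gauss_weight M x) = 1"
proof -
  obtain S :: "real^'r^'r" where S: "\<And>i j. S $ i $ j \<in> K" "transpose S ** M ** S = mat 1"
    using gram_schmidt[OF sym pd K MK] by blast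
  have d: "det S * det M * det S = 1"
    using arg_cong[OF S(2), of det] by (simp add: det_mul)
  hence dS: "det S \<noteq> 0" by auto
  have dM: "det M = (1 / \<bar>det S\<bar>)\<^sup>2" using d dS by (simp add: field_simps power2_eq_square)
  thus pos: "det M > 0" using dS by simp
  have dM': "det M powr (1/2) * \<bar>det S\<bar> = 1"
    using dS pos by (simp add: powr_half_sqrt dM)
  interpret G: smooth_gaussian_class "gauss_class M" by (rule smooth_gaussian_class_gauss_class[OF sym pd])
  define f where "f = (\<lambda>x. p x * gauss_weight M x)"
  have f: "f \<in> gauss_class M" using kpoly_mono[OF p] by (auto simp: gauss_class_def f_def)
  define r where "r = (\<lambda>x. p (S *v x))"
  have r: "kpoly K r" unfolding r_def by (rule kpoly_linear[OF K S(1) p])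
  have fS: "f (S *v x) = r x * exp (- 1/2 * (norm x)\<^sup>2)" for x
  proof -
    have "(S *v x) \<bullet> (M *v (S *v x)) = x \<bullet> ((transpose S ** M ** S) *v x)"
      by (simp add: matrix_vector_mul_assoc[symmetric] dot_lmul_matrix[symmetric] vector_transpose_matrix)
        (metis dot_lmul_matrix vector_transpose_matrix transpose_transpose inner_commute)?
    also have "\<dots> = (norm x)\<^sup>2" unfolding S(2) by (simp add: power2_norm_eq_inner)
    finally show ?thesis by (simp add: f_def r_def gauss_weight_def)
  qed
  obtain m where m: "m \<in> K" "integrable lborel (\<lambda>x. r x * exp (- 1/2 * (norm x)\<^sup>2))"
    "(LINT x|lborel. r x * exp (- 1/2 * (norm x)\<^sup>2)) = sqrt (2 * pi) ^ CARD('r) * m"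
    using std_gauss_kpoly[OF K r, of "\<lambda>_. 0"] by auto
  have "(LINT x|lborel. f x) = \<bar>det S\<bar> * (LINT x|lborel. f (S *v x))"
    by (rule lborel_integral_linear[OF G.cont[OF f] G.integrable_class[OF f] _ dS]) (use m(2) in \<open>simp add: fS\<close>)
  hence I: "(LINT x|lborel. f x) = \<bar>det S\<bar> * (sqrt (2 * pi) ^ CARD('r) * m)" unfolding fS m(3) .
  have pw: "(2 * pi) powr (- real CARD('r) / 2) * sqrt (2 * pi) ^ CARD('r) = 1"
  proof -
    have "sqrt (2 * pi) ^ CARD('r) = (2 * pi) powr (real CARD('r) / 2)"
      by (simp add: powr_half_sqrt[symmetric] powr_power)
    thus ?thesis by (simp add: powr_add[symmetric])
  qed
  have "det M powr (1/2) * (2 * pi) powr (- real CARD('r) / 2) * (LINT x|lborel. f x) =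
    (det M powr (1/2) * \<bar>det S\<bar>) * ((2 * pi) powr (- real CARD('r) / 2) * sqrt (2 * pi) ^ CARD('r)) * m"
    unfolding I by (simp only: mult_ac)
  hence e: "det M powr (1/2) * (2 * pi) powr (- real CARD('r) / 2) * (LINT x|lborel. f x) = m"
    unfolding dM' pw by simp
  show "det M powr (1/2) * (2 * pi) powr (- real CARD('r) / 2) * (LINT x|lborel. p x * gauss_weight M x) \<in> K"
    using e m(1) by (simp add: f_def)
  assume p1: "p = (\<lambda>x. 1)"
  obtain m' where "m' = 1" "(LINT x|lborel. (\<Prod>i\<in>UNIV. (x::real^'r) $ i ^ 0) * exp (- 1/2 * (norm x)\<^sup>2)) = sqrt (2 * pi) ^ CARD('r) * m'"
    by (rule std_gauss_monomial[of "\<lambda>_. 0"]) auto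
  hence "m = 1" using m(3) p1 by (simp add: r_def)
  thus "det M powr (1/2) * (2 * pi) powr (- real CARD('r) / 2) * (LINT x|lborel. p x * gauss_weight M x) = 1"
    using e by (simp add: f_def)
qed

text \<open>Substitution by the negative of the identity matrix, whose determinant has absolute
  value 1.\<close>

lemma gaussian_integral_odd:
  fixes M :: "real^'r^'r"
  assumes sym: "transpose M = M" and pd: "positive_definite M" and p: "kpoly UNIV p" and odd: "\<And>x. p (- x) = - p x"
  shows "(LINT x|lborel. p x * gauss_weight M x) = 0"
proof -
  interpret G: smooth_gaussian_class "gauss_class M" by (rule smooth_gaussian_class_gauss_class[OF sym pd])
  define f where "f = (\<lambda>x. p x * gauss_weight M x)"
  have f: "f \<in> gauss_class M" using p by (auto simp: gauss_class_def f_def)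
  define S :: "real^'r^'r" where "S = (\<chi> i j. if i = j then - 1 else 0)"
  have "det S = (\<Prod>i\<in>(UNIV::'r set). - 1)" by (subst det_diagonal) (auto simp: S_def)
  hence d: "\<bar>det S\<bar> = 1" by simp
  have S: "S *v x = - x" for x
    by (simp add: vec_eq_iff matrix_vector_mult_def S_def if_distrib[of "\<lambda>a. a * _"] cong: if_cong)
  have "M *v (- x) = - (M *v x)" for x using matrix_vector_mult_diff_distrib[of M 0 x] by simp
  hence fS: "f (S *v x) = - f x" for x by (simp add: S f_def odd gauss_weight_def)
  have "(LINT x|lborel. f x) = \<bar>det S\<bar> * (LINT x|lborel. f (S *v x))"
    by (rule lborel_integral_linear[OF G.cont[OF f] G.integrable_class[OF f]]) (use d G.integrable_class[OF f] in \<open>auto simp: fS\<close>)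
  hence "(LINT x|lborel. f x) = 0" unfolding fS d by simp
  thus ?thesis by (simp add: f_def)
qed

section \<open>The coefficients and the local expansion\<close>

lemma bernoulli_Rats: "bernoulli n \<in> \<rat>"
proof (induction n rule: less_induct)
  case (less n)
  show ?case
  proof (cases "n = 0")
    case False
    have "(\<Sum>k<n. real (Suc n choose k) * bernoulli k) \<in> \<rat>" using less by (intro Rats_sum Rats_mult) auto
    thus ?thesis using False by (subst bernoulli.simps) (simp del: of_nat_Suc)
  qed simp
qed

lemma coeff_polylog_poly_Rats: "coeff (polylog_poly k) i \<in> \<rat>"
proof (induction k arbitrary: i rule: polylog_poly.induct)
  case 2 show ?case by (auto simp: coeff_pCons split: nat.split)
next
  case (3 k)
  have "coeff [:0, 1, 1 :: real:] j \<in> \<rat>" for j by (auto simp: coeff_pCons split: nat.split)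
  moreover have "coeff (pderiv (polylog_poly (Suc k))) j \<in> \<rat>" for j
    unfolding coeff_pderiv using 3 by (intro Rats_mult Rats_of_nat) auto
  ultimately show ?case unfolding polylog_poly.simps coeff_mult by (intro Rats_sum Rats_mult) auto
qed simp

lemma sqrt_closed_field_power:
  assumes K: "sqrt_closed_field K" and x: "x \<in> K" shows "x ^ n \<in> K"
proof (induction n)
  case (Suc n) thus ?case using sqrt_closed_fieldD(4)[OF K x] by simp
qed (use sqrt_closed_fieldD(1)[OF K] in simp)

lemma poly_polylog_closed:
  assumes K: "sqrt_closed_field K" and x: "x \<in> K" shows "poly (polylog_poly k) x \<in> K"
  unfolding poly_altdef
  by (intro sqrt_closed_field_sum[OF K] sqrt_closed_fieldD(4)[OF K] sqrt_closed_field_power[OF K x]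
      sqrt_closed_fieldD(1)[OF K] coeff_polylog_poly_Rats)

lemma kpoly_power: "sqrt_closed_field K \<Longrightarrow> kpoly K p \<Longrightarrow> kpoly K (\<lambda>x. p x ^ n)"
  by (induction n) (simp_all add: kpoly_01 kpoly_mult)

definition kpoly_fps :: "real set \<Rightarrow> (real^'r \<Rightarrow> real fps) \<Rightarrow> bool" where
  "kpoly_fps K F \<longleftrightarrow> (\<forall>n. kpoly K (\<lambda>t. fps_nth (F t) n))"

lemma kpoly_fps_mult:
  assumes K: "sqrt_closed_field K" and "kpoly_fps K F" "kpoly_fps K G"
  shows "kpoly_fps K (\<lambda>t. F t * G t)"
  unfolding kpoly_fps_def fps_mult_nth
  using assms(2,3) by (intro allI kpoly_sum[OF K] kpoly_mult[OF K]) (auto simp: kpoly_fps_def)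

lemma kpoly_fps_power:
  assumes K: "sqrt_closed_field K" and F: "kpoly_fps K F" shows "kpoly_fps K (\<lambda>t. F t ^ n)"
proof (induction n)
  case 0
  show ?case unfolding kpoly_fps_def power_0
  proof
    fix m show "kpoly K (\<lambda>t. fps_nth 1 m)" by (cases "m = 0") (simp_all add: kpoly_01[OF K])
  qed
next
  case (Suc n) show ?case unfolding power_Suc by (rule kpoly_fps_mult[OF K F Suc])
qed

lemma kpoly_fps_D_exponent:
  assumes K: "sqrt_closed_field K" and b: "b \<in> K" and X: "X \<in> K"
  shows "kpoly_fps K (\<lambda>t. D_exponent b X (t $ i))"
  unfolding kpoly_fps_def
proof
  fix n :: nat
  note Kc = sqrt_closed_fieldD[OF K]
  define h where "h q = poly (polylog_poly (q - 1)) X" for q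
  have hK: "h q \<in> K" for q unfolding h_def by (rule poly_polylog_closed[OF K X])
  have e: "kpoly K (\<lambda>t. exponent_coeff h (t $ i) l k)" for l k
  proof -
    have "fact k * fact (l - 2 * k) \<in> (\<rat> :: real set)" by (intro Rats_mult) (metis Rats_of_nat of_nat_fact)+
    hence "bernoulli k / (fact k * fact (l - 2 * k)) * h (l - k) \<in> K"
      by (intro Kc(4) hK Kc(1) Rats_divide bernoulli_Rats)
    hence "kpoly K (\<lambda>t. bernoulli k / (fact k * fact (l - 2 * k)) * h (l - k) * (t $ i) ^ (l - 2 * k))"
      by (intro kpoly_cmult[OF K] kpoly_power[OF K] kpoly_nth[OF K])
    thus ?thesis by (simp add: exponent_coeff_def mult_ac)
  qed
  have "b + 1/2 * X \<in> K" by (intro Kc(2,4) b X Kc(1)) auto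
  hence 1: "kpoly K (\<lambda>t. if n = 1 then (b + 1/2 * X) * t $ i else 0)"
    using kpoly_cmult[OF K _ kpoly_nth[OF K]] by (cases "n = 1") (simp_all add: kpoly_01[OF K])
  have "kpoly K (\<lambda>t. (if n = 1 then (b + 1/2 * X) * t $ i else 0) + (- 1) * (\<Sum>k | k < n \<and> 2 * k \<le> n + 2. exponent_coeff h (t $ i) (n + 2) k))"
    by (intro kpoly.add 1 kpoly_cmult[OF K] kpoly_sum[OF K] e Kc(1)) auto
  moreover have "fps_nth (D_exponent b X T) n = (if n = 1 then (b + 1/2 * X) * T else 0) + (- 1) * (\<Sum>k | k < n \<and> 2 * k \<le> n + 2. exponent_coeff h T (n + 2) k)" for T
    using D_exponent_nth[of h X b T n] by (simp add: h_def)
  ultimately show "kpoly K (\<lambda>t. fps_nth (D_exponent b X (t $ i)) n)" by (simp only:)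
qed

lemma kpoly_D_coeff:
  assumes K: "sqrt_closed_field K" and b: "b \<in> K" and X: "X \<in> K"
  shows "kpoly K (\<lambda>t. D_coeff p b X (t $ i))"
proof -
  have "1 / fact j \<in> K" for j
  proof -
    have "1 / fact j = (1 / of_nat (fact j) :: real)" by simp
    thus ?thesis by (simp only:) (intro sqrt_closed_fieldD(1)[OF K] Rats_divide Rats_of_nat Rats_1)
  qed
  moreover have "kpoly K (\<lambda>t. fps_nth (D_exponent b X (t $ i) ^ j) p)" for j
    using kpoly_fps_power[OF K kpoly_fps_D_exponent[OF K b X]] unfolding kpoly_fps_def by blast
  ultimately show ?thesis
    unfolding D_coeff_def fps_compose_nth by (intro kpoly_sum[OF K] kpoly_cmult[OF K]) (simp_all add: fps_exp_def)
qed

lemma kpoly_C_coeff: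
  assumes K: "sqrt_closed_field K" and B: "\<And>i. B $ i \<in> K" and \<xi>: "\<And>i. \<xi> $ i \<in> K"
  shows "kpoly K (C_coeff p B \<xi>)"
  unfolding C_coeff_def[abs_def] by (intro kpoly_sum[OF K] kpoly_prod[OF K] kpoly_D_coeff[OF K] B \<xi>)

text \<open>Changing the sign of \<open>T\<close> amounts to changing the sign of \<open>s\<close>,
  because in the coefficient of \<open>s ^ n\<close> every exponent of \<open>T\<close> has the
  parity of \<open>n\<close>. This is the source of the vanishing of all odd orders.\<close>

lemma D_exponent_uminus: "D_exponent b X (- T) = D_exponent b X T oo (fps_const (-1) * fps_X)"
proof (rule fps_ext)
  fix n
  define h where "h q = poly (polylog_poly (q - 1)) X" for q
  have e: "exponent_coeff h (- T) (n + 2) k = (-1) ^ n * exponent_coeff h T (n + 2) k" if "2 * k \<le> n + 2" for k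
  proof -
    have "(-1::real) ^ n = (-1) ^ (n + 2)" by simp
    also have "\<dots> = (-1) ^ (n + 2 - 2 * k) * (-1) ^ (2 * k)" using that by (simp only: power_add[symmetric]) simp
    also have "\<dots> = (-1) ^ (n + 2 - 2 * k)" by simp
    finally show ?thesis unfolding exponent_coeff_def power_minus[of T] by simp
  qed
  have "(\<Sum>k | k < n \<and> 2 * k \<le> n + 2. exponent_coeff h (- T) (n + 2) k) = (-1) ^ n * (\<Sum>k | k < n \<and> 2 * k \<le> n + 2. exponent_coeff h T (n + 2) k)"
    unfolding sum_distrib_left by (intro sum.cong refl e) auto
  thus "fps_nth (D_exponent b X (- T)) n = fps_nth (D_exponent b X T oo (fps_const (-1) * fps_X)) n"
    unfolding fps_nth_compose_linear using D_exponent_nth[of h X b T n] D_exponent_nth[of h X b "- T" n]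
    by (simp add: h_def right_diff_distrib)
qed

lemma D_coeff_uminus: "D_coeff p b X (- T) = (-1) ^ p * D_coeff p b X T"
proof -
  have "fps_exp 1 oo D_exponent b X (- T) = (fps_exp 1 oo D_exponent b X T) oo (fps_const (-1) * fps_X)"
    unfolding D_exponent_uminus by (rule fps_compose_assoc) (simp_all add: D_exponent_nth_0)
  thus ?thesis by (simp add: D_coeff_def fps_nth_compose_linear del: fps_const_neg fps_const_minus)
qed

lemma C_coeff_uminus:
  fixes B :: "real^'r"
  shows "C_coeff p B \<xi> (- t) = (-1) ^ p * C_coeff p B \<xi> t"
  unfolding C_coeff_def sum_distrib_left
proof (intro sum.cong refl)
  fix k :: "'r \<Rightarrow> nat" assume "k \<in> {k. (\<Sum>i\<in>UNIV. k i) = p}"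
  thus "(\<Prod>i\<in>UNIV. D_coeff (k i) (B $ i) (\<xi> $ i) ((- t) $ i)) = (-1) ^ p * (\<Prod>i\<in>UNIV. D_coeff (k i) (B $ i) (\<xi> $ i) (t $ i))"
    by (auto simp: D_coeff_uminus prod.distrib power_sum)
qed

text \<open>The multi-indices are pinned to 0 outside \<open>I\<close> to keep the index set finite
  in the induction; for \<open>I = UNIV\<close> it is the index set of
  \<open>C_coeff\<close>.\<close>

lemma fps_prod_nth_compositions:
  fixes F :: "'i \<Rightarrow> real fps"
  assumes "finite I"
  shows "finite {k. (\<forall>i. i \<notin> I \<longrightarrow> k i = 0) \<and> (\<Sum>i\<in>I. k i) = (p::nat)} \<and>
    fps_nth (\<Prod>i\<in>I. F i) p = (\<Sum>k | (\<forall>i. i \<notin> I \<longrightarrow> k i = 0) \<and> (\<Sum>i\<in>I. k i) = p. \<Prod>i\<in>I. fps_nth (F i) (k i))"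
  using assms
proof (induction I arbitrary: p rule: finite_induct)
  case empty
  have "{k :: 'i \<Rightarrow> nat. (\<forall>i. k i = 0) \<and> 0 = p} = (if p = 0 then {\<lambda>_. 0} else {})" by auto
  thus ?case by simp
next
  case (insert j I)
  let ?S = "\<lambda>I p. {k :: 'i \<Rightarrow> nat. (\<forall>i. i \<notin> I \<longrightarrow> k i = 0) \<and> (\<Sum>i\<in>I. k i) = p}"
  have bij: "bij_betw (\<lambda>(a, k). k(j := a)) (Sigma {..p} (\<lambda>a. ?S I (p - a))) (?S (insert j I) p)"
  proof (rule bij_betw_byWitness[of _ "\<lambda>k. (k j, k(j := 0))"])
    have s: "(\<Sum>i\<in>I. (k(j := a)) i) = (\<Sum>i\<in>I. k i)" for k a
      by (intro sum.cong) (use insert.hyps in auto)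
    show "\<forall>x\<in>Sigma {..p} (\<lambda>a. ?S I (p - a)). (\<lambda>k. (k j, k(j := 0))) ((\<lambda>(a, k). k(j := a)) x) = x"
      using insert.hyps by (auto simp: fun_eq_iff)
    show "\<forall>k\<in>?S (insert j I) p. (\<lambda>(a, k). k(j := a)) (k j, k(j := 0)) = k" by auto
    show "(\<lambda>(a, k). k(j := a)) ` Sigma {..p} (\<lambda>a. ?S I (p - a)) \<subseteq> ?S (insert j I) p"
      using insert.hyps by (auto simp: s simp del: fun_upd_apply) (auto simp: )
    show "(\<lambda>k. (k j, k(j := 0))) ` ?S (insert j I) p \<subseteq> Sigma {..p} (\<lambda>a. ?S I (p - a))"
      using insert.hyps by (auto simp: s simp del: fun_upd_apply) (auto simp: )
  qed
  have fin: "finite (Sigma {..p} (\<lambda>a. ?S I (p - a)))" using insert.IH by auto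
  have "fps_nth (\<Prod>i\<in>insert j I. F i) p = (\<Sum>a\<le>p. fps_nth (F j) a * fps_nth (\<Prod>i\<in>I. F i) (p - a))"
    using insert.hyps by (simp add: fps_mult_nth atLeast0AtMost)
  also have "\<dots> = (\<Sum>a\<le>p. \<Sum>k\<in>?S I (p - a). fps_nth (F j) a * (\<Prod>i\<in>I. fps_nth (F i) (k i)))"
    using insert.IH by (simp add: sum_distrib_left)
  also have "\<dots> = (\<Sum>(a,k)\<in>Sigma {..p} (\<lambda>a. ?S I (p - a)). fps_nth (F j) a * (\<Prod>i\<in>I. fps_nth (F i) (k i)))"
    by (rule sum.Sigma) (use insert.IH in auto)
  also have "\<dots> = (\<Sum>(a,k)\<in>Sigma {..p} (\<lambda>a. ?S I (p - a)). \<Prod>i\<in>insert j I. fps_nth (F i) ((k(j := a)) i))"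
  proof (intro sum.cong refl, clarify)
    fix a k
    have "(\<Prod>i\<in>I. fps_nth (F i) ((k(j := a)) i)) = (\<Prod>i\<in>I. fps_nth (F i) (k i))"
      by (intro prod.cong) (use insert.hyps in auto)
    thus "fps_nth (F j) a * (\<Prod>i\<in>I. fps_nth (F i) (k i)) = (\<Prod>i\<in>insert j I. fps_nth (F i) ((k(j := a)) i))"
      using insert.hyps by simp
  qed
  also have "\<dots> = (\<Sum>k\<in>?S (insert j I) p. \<Prod>i\<in>insert j I. fps_nth (F i) (k i))"
    using sum.reindex_bij_betw[OF bij, of "\<lambda>k. \<Prod>i\<in>insert j I. fps_nth (F i) (k i)"] by (simp add: case_prod_unfold)
  finally show ?case using bij_betw_finite[OF bij] fin by blast
qed

lemma C_coeff_eq_fps_nth: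
  fixes B :: "real^'r"
  shows "C_coeff p B \<xi> t = fps_nth (\<Prod>i\<in>UNIV. fps_exp 1 oo D_exponent (B $ i) (\<xi> $ i) (t $ i)) p"
  using fps_prod_nth_compositions[of "UNIV :: 'r set" p "\<lambda>i. fps_exp 1 oo D_exponent (B $ i) (\<xi> $ i) (t $ i)"]
  by (simp add: C_coeff_def D_coeff_def)

lemma C_coeff_0:
  fixes B :: "real^'r"
  shows "C_coeff 0 B \<xi> t = 1"
proof -
  have "fps_nth (\<Prod>i\<in>I. F i) 0 = (\<Prod>i\<in>I. fps_nth (F i) 0)" for F :: "'r \<Rightarrow> real fps" and I
    by (induction I rule: infinite_finite_induct) (auto simp: fps_mult_nth)
  thus ?thesis unfolding C_coeff_eq_fps_nth by (simp add: fps_compose_nth)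
qed

text \<open>The domain shrinks with a high power of \<open>1 + norm t\<close> so that the exponent stays bounded.\<close>

definition local_domain :: "real \<Rightarrow> nat \<Rightarrow> (real \<times> (real^'r)) set" where
  "local_domain \<rho> L = {(s, t). 0 < s \<and> s \<le> 1 \<and> s * (1 + norm t) ^ L \<le> \<rho>}"

text \<open>Two nested domains are used. On the one with exponent 1 the local exponents have
  expansions and are bounded by \<open>(1 + norm t) ^ L0 i * s\<close>; the exponent
  \<open>L\<close> is then taken large enough to make this bound constant, as
  \<open>aexp_exp\<close> requires.\<close>

lemma local_expansion:
  fixes u B :: "real^'r"
  assumes u: "\<And>i. u $ i > 0"
  defines "\<xi> \<equiv> (\<chi> i. 1 / (exp (u $ i) - 1))"
  obtains \<rho> L where "\<rho> > 0" "\<And>s t i. (s, t) \<in> local_domain \<rho> L \<Longrightarrow> \<bar>t $ i\<bar> * s \<le> u $ i / 2"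
    "\<And>M. \<exists>K L'. K \<ge> 0 \<and> (\<forall>s t. (s, t) \<in> local_domain \<rho> L \<longrightarrow>
      \<bar>exp (\<Sum>i\<in>UNIV. local_exponent (B $ i) (u $ i) s (t $ i)) - (\<Sum>p<M. C_coeff p B \<xi> t * s ^ p)\<bar> \<le> K * (1 + norm t) ^ L' * s ^ M)"
proof -
  define \<rho> where "\<rho> = min 1 (Min (range (\<lambda>i. u $ i / 2)))"
  have \<rho>: "\<rho> > 0" "\<rho> \<le> 1" "\<And>i. \<rho> \<le> u $ i / 2"
  proof -
    show "\<rho> > 0" unfolding \<rho>_def using u by (subst min_less_iff_conj) (auto simp: Min_gr_iff)
    show "\<rho> \<le> u $ i / 2" for i unfolding \<rho>_def by (intro min.coboundedI2 Min_le) auto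
  qed (simp add: \<rho>_def)
  have dom: "\<bar>t $ i\<bar> * s \<le> u $ i / 2" if st: "(s, t) \<in> local_domain \<rho> L" and L: "L \<ge> 1" for s t i L
  proof -
    have s: "0 < s" "s * (1 + norm t) ^ L \<le> \<rho>" using st by (auto simp: local_domain_def)
    have "\<bar>t $ i\<bar> \<le> (1 + norm t) ^ 1" using component_le_norm_cart[of t i] by simp
    also have "\<dots> \<le> (1 + norm t) ^ L" using L by (intro power_increasing) auto
    finally have "s * \<bar>t $ i\<bar> \<le> s * (1 + norm t) ^ L" using s by (intro mult_left_mono) auto
    hence "s * \<bar>t $ i\<bar> \<le> u $ i / 2" using s(2) \<rho>(3)[of i] by linarith
    thus ?thesis by (simp add: mult.commute)
  qed
  have tau: "\<bar>t $ i\<bar> \<le> 1 + norm t" for t :: "real^'r" and i using component_le_norm_cart[of t i] by simp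
  let ?\<phi> = "\<lambda>i s t. local_exponent (B $ i) (u $ i) s (t $ i)"
  interpret D0: expansion_domain "local_domain \<rho> 1 :: (real \<times> (real^'r)) set"
    by unfold_locales (auto simp: local_domain_def)
  have a0: "D0.aexp (?\<phi> i) (\<lambda>t. D_exponent (B $ i) (1 / (exp (u $ i) - 1)) (t $ i))" for i
    by (rule D0.aexp_local_exponent[OF u tau]) (rule dom, auto)
  have "\<exists>K L. K \<ge> 0 \<and> (\<forall>s t. (s, t) \<in> local_domain \<rho> 1 \<longrightarrow> \<bar>?\<phi> i s t\<bar> \<le> K * (1 + norm t) ^ L * s)" for i
  proof -
    have "D0.bigw (Suc 0) (?\<phi> i)" using D0.aexpD[OF a0[of i], of "Suc 0"] by (simp add: D_exponent_nth_0)
    then obtain K L where "K \<ge> 0" "\<And>s t. (s, t) \<in> local_domain \<rho> 1 \<Longrightarrow> \<bar>?\<phi> i s t\<bar> \<le> K * (1 + norm t) ^ L * s ^ Suc 0"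
      by (rule D0.bigwE) blast
    thus ?thesis by (intro exI[of _ K] exI[of _ L]) auto
  qed
  then obtain K0 L0 where K0: "\<And>i. K0 i \<ge> 0" "\<And>i s t. (s, t) \<in> local_domain \<rho> 1 \<Longrightarrow> \<bar>?\<phi> i s t\<bar> \<le> K0 i * (1 + norm t) ^ L0 i * s"
    by metis
  define L where "L = 1 + (\<Sum>i\<in>UNIV. L0 i)"
  have L: "L \<ge> 1" "\<And>i. L0 i \<le> L"
  proof -
    show "L0 i \<le> L" for i unfolding L_def using member_le_sum[of i UNIV L0] by simp
  qed (simp add: L_def)
  have sub: "(s, t) \<in> local_domain \<rho> 1" if st: "(s, t) \<in> local_domain \<rho> L" for s and t :: "real^'r"
  proof -
    have s: "0 < s" "s \<le> 1" "s * (1 + norm t) ^ L \<le> \<rho>" using st by (auto simp: local_domain_def)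
    have "(1 + norm t) ^ 1 \<le> (1 + norm t) ^ L" using L by (intro power_increasing) auto
    hence "s * (1 + norm t) ^ 1 \<le> s * (1 + norm t) ^ L" using s by (intro mult_left_mono) auto
    hence "s * (1 + norm t) ^ 1 \<le> \<rho>" using s(3) by (rule order_trans)
    thus ?thesis using s by (simp add: local_domain_def)
  qed
  interpret D1: expansion_domain "local_domain \<rho> L :: (real \<times> (real^'r)) set"
    by unfold_locales (auto simp: local_domain_def)
  have a1: "D1.aexp (?\<phi> i) (\<lambda>t. D_exponent (B $ i) (1 / (exp (u $ i) - 1)) (t $ i))" for i
    by (rule D1.aexp_local_exponent[OF u tau]) (rule dom[OF _ L(1)])
  have bd: "\<bar>?\<phi> i s t\<bar> \<le> K0 i" if st: "(s, t) \<in> local_domain \<rho> L" for i s t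
  proof -
    have s: "0 < s" "s * (1 + norm t) ^ L \<le> \<rho>" using st by (auto simp: local_domain_def)
    have "(1 + norm t) ^ L0 i \<le> (1 + norm t) ^ L" using L by (intro power_increasing) auto
    hence "s * (1 + norm t) ^ L0 i \<le> s * (1 + norm t) ^ L" using s by (intro mult_left_mono) auto
    hence "s * (1 + norm t) ^ L0 i \<le> 1" using s \<rho>(2) by linarith
    hence "K0 i * (s * (1 + norm t) ^ L0 i) \<le> K0 i * 1" using K0(1)[of i] by (intro mult_left_mono) auto
    thus ?thesis using K0(2)[OF sub[OF st], of i] by (simp add: mult_ac)
  qed
  have ex: "D1.aexp (\<lambda>s t. exp (?\<phi> i s t)) (\<lambda>t. fps_exp 1 oo D_exponent (B $ i) (1 / (exp (u $ i) - 1)) (t $ i))" for i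
    by (rule D1.aexp_exp[OF a1 D_exponent_nth_0 bd])
  have pr: "D1.aexp (\<lambda>s t. \<Prod>i\<in>UNIV. exp (?\<phi> i s t)) (\<lambda>t. \<Prod>i\<in>UNIV. fps_exp 1 oo D_exponent (B $ i) (1 / (exp (u $ i) - 1)) (t $ i))"
    by (rule D1.aexp_prod[OF ex])
  show ?thesis
  proof (rule that[OF \<rho>(1)])
    show "\<bar>t $ i\<bar> * s \<le> u $ i / 2" if "(s, t) \<in> local_domain \<rho> L" for s t i by (rule dom[OF that L(1)])
    fix M
    obtain K L' where "K \<ge> 0" "\<And>s t. (s, t) \<in> local_domain \<rho> L \<Longrightarrow> \<bar>(\<Prod>i\<in>UNIV. exp (?\<phi> i s t)) -
      (\<Sum>p<M. fps_nth (\<Prod>i\<in>UNIV. fps_exp 1 oo D_exponent (B $ i) (1 / (exp (u $ i) - 1)) (t $ i)) p * s ^ p)\<bar> \<le> K * (1 + norm t) ^ L' * s ^ M"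
      using D1.aexpD[OF pr, of M] by (rule D1.bigwE) blast
    moreover have "C_coeff p B \<xi> t = fps_nth (\<Prod>i\<in>UNIV. fps_exp 1 oo D_exponent (B $ i) (1 / (exp (u $ i) - 1)) (t $ i)) p" for p t
      unfolding C_coeff_eq_fps_nth by (simp add: \<xi>_def)
    moreover have "exp (\<Sum>i\<in>UNIV. ?\<phi> i s t) = (\<Prod>i\<in>UNIV. exp (?\<phi> i s t))" for s t by (simp add: exp_sum)
    ultimately show "\<exists>K L'. K \<ge> 0 \<and> (\<forall>s t. (s, t) \<in> local_domain \<rho> L \<longrightarrow>
      \<bar>exp (\<Sum>i\<in>UNIV. ?\<phi> i s t) - (\<Sum>p<M. C_coeff p B \<xi> t * s ^ p)\<bar> \<le> K * (1 + norm t) ^ L' * s ^ M)"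
      by (intro exI[of _ K] exI[of _ L']) (simp only:, blast)
  qed
qed

section \<open>The Jacobi triple product\<close>

definition qbinomial :: "real \<Rightarrow> nat \<Rightarrow> nat \<Rightarrow> real" where
  "qbinomial q m j = qfact q m / (qfact q j * qfact q (m - j))"

lemma qbinomial_pascal:
  assumes q: "0 < q" "q < 1" and j: "1 \<le> j" "j \<le> m"
  shows "qbinomial q (Suc m) j = qbinomial q m j + q ^ (Suc m - j) * qbinomial q m (j - 1)"
proof -
  obtain i where i: "j = Suc i" using j by (cases j) auto
  obtain l where l: "m = i + Suc l" using j i by (metis Suc_le_eq less_imp_Suc_add add_Suc_right)
  have nz: "qfact q n \<noteq> 0" "1 - q ^ Suc n \<noteq> 0" for n
    using qfact_pos[OF q, of n] power_less_one_iff[of q "Suc n"] q by auto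
  have d: "Suc m - Suc i = Suc l" "m - Suc i = l" "Suc i - 1 = i" "m - i = Suc l" using l by auto
  have e: "1 - q ^ Suc m = (1 - q ^ Suc l) + q ^ Suc l * (1 - q ^ Suc i)"
    by (simp add: l power_add algebra_simps)
  have "qbinomial q (Suc m) j = qfact q m * (1 - q ^ Suc m) / (qfact q i * (1 - q ^ Suc i) * (qfact q l * (1 - q ^ Suc l)))"
    unfolding qbinomial_def i d qfact_Suc ..
  also have "\<dots> = qfact q m / (qfact q i * (1 - q ^ Suc i) * qfact q l) + q ^ Suc l * (qfact q m / (qfact q i * (qfact q l * (1 - q ^ Suc l))))"
  proof -
    have "a * (Y + y * X) / (b * X * (c * Y)) = a / (b * X * c) + y * (a / (b * (c * Y)))"
      if "b \<noteq> 0" "c \<noteq> 0" "X \<noteq> 0" "Y \<noteq> 0" for a b c X Y y :: real using that by (simp add: field_simps)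
    thus ?thesis unfolding e using nz by blast
  qed
  also have "\<dots> = qbinomial q m j + q ^ (Suc m - j) * qbinomial q m (j - 1)"
    unfolding qbinomial_def i d qfact_Suc ..
  finally show ?thesis .
qed

theorem qbinomial_theorem:
  assumes q: "0 < q" "q < 1"
  shows "(\<Prod>k<m. 1 + z * q ^ k) = (\<Sum>j\<le>m. qbinomial q m j * q ^ (j choose 2) * z ^ j)"
proof (induction m)
  case 0
  show ?case by (simp add: qbinomial_def qfact_def binomial_eq_0)
next
  case (Suc m)
  define a where "a n j = qbinomial q n j * q ^ (j choose 2) * z ^ j" for n j
  have nz: "qfact q n \<noteq> 0" for n using qfact_pos[OF q, of n] by simp
  have qf0: "qfact q 0 = 1" by (simp add: qfact_def)
  have ends: "a (Suc m) 0 = a m 0" "a (Suc m) (Suc m) = q ^ m * z * a m m"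
  proof -
    have "Suc m choose 2 = (m choose 2) + m" by (simp add: numeral_2_eq_2)
    thus "a (Suc m) 0 = a m 0" "a (Suc m) (Suc m) = q ^ m * z * a m m"
      using nz qf0 by (simp_all add: a_def qbinomial_def power_add binomial_eq_0)
  qed
  have mid: "a (Suc m) (Suc i) = a m (Suc i) + q ^ m * z * a m i" if "i < m" for i
  proof -
    have c: "Suc i choose 2 = (i choose 2) + i" by (simp add: numeral_2_eq_2)
    have "q ^ m = q ^ (m - i) * q ^ i" using that by (simp flip: power_add)
    thus ?thesis using that qbinomial_pascal[OF q, of "Suc i" m]
      by (simp add: a_def c power_add algebra_simps)
  qed
  have "(\<Prod>k<Suc m. 1 + z * q ^ k) = (\<Sum>j\<le>m. a m j) * (1 + z * q ^ m)"
    using Suc.IH by (simp add: a_def)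
  also have "\<dots> = (\<Sum>j\<le>m. a m j) + (\<Sum>j\<le>m. q ^ m * z * a m j)"
    by (simp add: distrib_left sum_distrib_left mult_ac)
  also have "(\<Sum>j\<le>m. a m j) = a m 0 + (\<Sum>i<m. a m (Suc i))"
    by (simp add: lessThan_Suc_atMost[symmetric] sum.lessThan_Suc_shift del: sum.lessThan_Suc)
  also have "(\<Sum>j\<le>m. q ^ m * z * a m j) = (\<Sum>i<m. q ^ m * z * a m i) + q ^ m * z * a m m"
    by (simp add: lessThan_Suc_atMost[symmetric])
  also have "a m 0 + (\<Sum>i<m. a m (Suc i)) + ((\<Sum>i<m. q ^ m * z * a m i) + q ^ m * z * a m m) =
     a (Suc m) 0 + (\<Sum>i<m. a (Suc m) (Suc i)) + a (Suc m) (Suc m)"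
    by (simp add: ends mid sum.distrib)
  also have "\<dots> = (\<Sum>j\<le>Suc m. a (Suc m) j)"
    by (simp only: lessThan_Suc_atMost[symmetric] sum.lessThan_Suc[of _ "Suc m"] sum.lessThan_Suc_shift[of _ m])
  finally show ?case by (simp add: a_def)
qed

text \<open>A finite triple product. The choice of \<open>z\<close> as \<open>q\<close> to the power
  \<open>1/2 - n\<close> centres the \<open>2 * n\<close> factors: the first half mirrors the second
  up to exponentials, so the product becomes a square, and the exponents on the right become squares
  of \<open>j - n\<close>.\<close>

lemma finite_jacobi:
  assumes e: "\<epsilon> > 0"
  shows "(\<Prod>k<n. 1 + exp (- ((real k + 1/2) * \<epsilon>)))\<^sup>2 =
    (\<Sum>j\<le>2*n. qbinomial (exp (- \<epsilon>)) (2 * n) j * exp (- \<epsilon> * (real j - real n)\<^sup>2 / 2))"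
proof -
  define q where "q = exp (- \<epsilon>)"
  have q: "0 < q" "q < 1" using e by (auto simp: q_def)
  define z where "z = exp ((real n - 1/2) * \<epsilon>)"
  define P where "P = (\<Prod>k<n. 1 + exp (- ((real k + 1/2) * \<epsilon>)))"
  have qk: "q ^ k = exp (- (real k * \<epsilon>))" for k by (simp add: q_def exp_of_nat_mult[symmetric])
  have "(\<Prod>k<2*n. 1 + z * q ^ k) = (\<Prod>k<n. 1 + z * q ^ k) * (\<Prod>k<n. 1 + z * q ^ (k + n))"
  proof -
    have "{..<2*n} = {..<n} \<union> {n..<2*n}" by auto
    moreover have "{..<n} \<inter> {n..<2*n} = {}" by auto
    moreover have "(\<Prod>k=n..<2*n. 1 + z * q ^ k) = (\<Prod>k<n. 1 + z * q ^ (k + n))"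
      using prod.shift_bounds_nat_ivl[of "\<lambda>k. 1 + z * q ^ k" 0 n n] by (simp add: mult_2 lessThan_atLeast0)
    ultimately show ?thesis by (simp add: prod.union_disjoint)
  qed
  also have "(\<Prod>k<n. 1 + z * q ^ (k + n)) = P"
    unfolding P_def z_def qk by (intro prod.cong refl) (simp add: exp_add[symmetric] algebra_simps)
  also have "(\<Prod>k<n. 1 + z * q ^ k) = (\<Prod>k<n. 1 + z * q ^ (n - Suc k))"
    by (rule prod.nat_diff_reindex[symmetric])
  also have "\<dots> = (\<Prod>k<n. exp ((real k + 1/2) * \<epsilon>) * (1 + exp (- ((real k + 1/2) * \<epsilon>))))"
  proof (intro prod.cong refl)
    fix k assume "k \<in> {..<n}"
    hence "real (n - Suc k) = real n - real k - 1" by (simp add: of_nat_diff)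
    hence "z * q ^ (n - Suc k) = exp ((real k + 1/2) * \<epsilon>)"
      unfolding z_def qk by (simp add: exp_add[symmetric] algebra_simps)
    thus "1 + z * q ^ (n - Suc k) = exp ((real k + 1/2) * \<epsilon>) * (1 + exp (- ((real k + 1/2) * \<epsilon>)))"
      by (simp add: distrib_left exp_add[symmetric])
  qed
  also have "\<dots> = (\<Prod>k<n. exp ((real k + 1/2) * \<epsilon>)) * P" by (simp add: prod.distrib P_def)
  also have "(\<Prod>k<n. exp ((real k + 1/2) * \<epsilon>)) = exp ((real n)\<^sup>2 * \<epsilon> / 2)"
    by (induction n) (simp_all add: exp_add[symmetric] power2_eq_square field_simps)
  finally have "exp ((real n)\<^sup>2 * \<epsilon> / 2) * P\<^sup>2 = (\<Sum>j\<le>2*n. qbinomial q (2 * n) j * q ^ (j choose 2) * z ^ j)"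
    unfolding qbinomial_theorem[OF q] by (simp add: power2_eq_square mult.assoc)
  also have "\<dots> = (\<Sum>j\<le>2*n. exp ((real n)\<^sup>2 * \<epsilon> / 2) * (qbinomial q (2 * n) j * exp (- \<epsilon> * (real j - real n)\<^sup>2 / 2)))"
  proof (intro sum.cong refl)
    fix j
    have c: "real (j choose 2) = real j * (real j - 1) / 2"
      by (induction j) (simp_all add: numeral_2_eq_2 field_simps)
    have "- (real (j choose 2) * \<epsilon>) + real j * ((real n - 1/2) * \<epsilon>) = (real n)\<^sup>2 * \<epsilon> / 2 + - \<epsilon> * (real j - real n)\<^sup>2 / 2"
      unfolding c by (simp add: power2_eq_square field_simps)
    moreover have "z ^ j = exp (real j * ((real n - 1/2) * \<epsilon>))" by (simp only: z_def exp_of_nat_mult)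
    ultimately have "q ^ (j choose 2) * z ^ j = exp ((real n)\<^sup>2 * \<epsilon> / 2) * exp (- \<epsilon> * (real j - real n)\<^sup>2 / 2)"
      unfolding qk by (simp only: exp_add[symmetric])
    thus "qbinomial q (2 * n) j * q ^ (j choose 2) * z ^ j = exp ((real n)\<^sup>2 * \<epsilon> / 2) * (qbinomial q (2 * n) j * exp (- \<epsilon> * (real j - real n)\<^sup>2 / 2))"
      by simp
  qed
  finally show ?thesis by (simp add: sum_distrib_left[symmetric] P_def q_def)
qed

context
  fixes \<epsilon> :: real assumes e: "\<epsilon> > 0"
begin

lemma summable_tail_log:
  assumes x: "x \<ge> 0" shows "summable (\<lambda>k. ln (1 - exp (- (x + real (Suc k) * \<epsilon>))))"
proof (rule summable_comparison_test'[of "\<lambda>k. exp (- x) * exp (- \<epsilon>) ^ Suc k / (1 - exp (- \<epsilon>))" 0])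
  show "summable (\<lambda>k. exp (- x) * exp (- \<epsilon>) ^ Suc k / (1 - exp (- \<epsilon>)))"
    using e by (intro summable_divide summable_mult summable_Suc_iff[THEN iffD2] summable_geometric) auto
  fix k
  have "\<epsilon> \<le> x + real (Suc k) * \<epsilon>" using e x by (simp add: algebra_simps)
  hence "\<bar>ln (1 - exp (- (x + real (Suc k) * \<epsilon>)))\<bar> \<le> \<bar>exp (- (x + real (Suc k) * \<epsilon>))\<bar> / (1 - exp (- \<epsilon>))"
    using e by (intro abs_ln_one_minus_le) auto
  also have "\<bar>exp (- (x + real (Suc k) * \<epsilon>))\<bar> = exp (- x) * exp (- \<epsilon>) ^ Suc k"
    by (simp only: abs_exp_cancel exp_of_nat_mult[symmetric] exp_add[symmetric]) simp
  finally show "norm (ln (1 - exp (- (x + real (Suc k) * \<epsilon>)))) \<le> exp (- x) * exp (- \<epsilon>) ^ Suc k / (1 - exp (- \<epsilon>))" by simp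
qed

lemma qfact_eq_exp_sum: "qfact (exp (- \<epsilon>)) n = exp (\<Sum>k<n. ln (1 - exp (- (0 + real (Suc k) * \<epsilon>))))"
proof (induction n)
  case (Suc n)
  have "exp (- \<epsilon>) ^ Suc n = exp (- (0 + real (Suc n) * \<epsilon>))" by (simp only: exp_of_nat_mult[symmetric]) simp
  moreover have "exp (- (0 + real (Suc n) * \<epsilon>)) < 1" using e by (subst exp_less_one_iff) (simp add: add_pos_nonneg)
  ultimately show ?case using Suc unfolding qfact_Suc by (simp only: sum.lessThan_Suc exp_add) simp
qed (simp add: qfact_def)

lemma qfact_eq_tail_log: "qfact (exp (- \<epsilon>)) n = exp (tail_log \<epsilon> 0 - tail_log \<epsilon> (real n * \<epsilon>))"
proof -
  let ?f = "\<lambda>k. ln (1 - exp (- (0 + real (Suc k) * \<epsilon>)))"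
  have "tail_log \<epsilon> 0 = (\<Sum>k. ?f (k + n)) + sum ?f {..<n}"
    unfolding tail_log_def by (rule suminf_split_initial_segment[OF summable_tail_log]) simp
  also have "(\<Sum>k. ?f (k + n)) = tail_log \<epsilon> (real n * \<epsilon>)"
    unfolding tail_log_def by (intro suminf_cong) (simp add: algebra_simps)
  finally show ?thesis unfolding qfact_eq_exp_sum by simp
qed

lemma qfact_tendsto: "qfact (exp (- \<epsilon>)) \<longlonglongrightarrow> exp (tail_log \<epsilon> 0)"
  unfolding qfact_eq_exp_sum[abs_def] tail_log_def
  by (intro tendsto_exp summable_LIMSEQ summable_tail_log) simp

lemma qfact_bounds: "exp (tail_log \<epsilon> 0) \<le> qfact (exp (- \<epsilon>)) n" "qfact (exp (- \<epsilon>)) n \<le> 1"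
proof -
  have neg: "ln (1 - exp (- (x + real (Suc k) * \<epsilon>))) \<le> 0" if "x \<ge> 0" for x k
  proof -
    have "0 < x + real (Suc k) * \<epsilon>" using e that by (intro add_nonneg_pos mult_pos_pos) auto
    thus ?thesis by (subst ln_le_zero_iff) (auto simp del: of_nat_Suc)
  qed
  have "tail_log \<epsilon> (real n * \<epsilon>) \<le> 0" unfolding tail_log_def
    using suminf_le[OF neg summable_tail_log summable_zero] e by simp
  thus "exp (tail_log \<epsilon> 0) \<le> qfact (exp (- \<epsilon>)) n" unfolding qfact_eq_tail_log by simp
  show "qfact (exp (- \<epsilon>)) n \<le> 1" unfolding qfact_eq_exp_sum using neg[of 0] by (simp add: sum_nonpos)
qed

lemma summable_ln_half: "summable (\<lambda>k. ln (1 + exp (- ((real k + 1/2) * \<epsilon>))))"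
proof (rule summable_comparison_test'[of "\<lambda>k. exp (- \<epsilon>) ^ k" 0])
  show "summable (\<lambda>k. exp (- \<epsilon>) ^ k)" using e by (intro summable_geometric) auto
  fix k
  have "0 \<le> ln (1 + exp (- ((real k + 1/2) * \<epsilon>)))" by (intro ln_ge_zero) auto
  moreover have "ln (1 + exp (- ((real k + 1/2) * \<epsilon>))) \<le> exp (- ((real k + 1/2) * \<epsilon>))"
    by (intro ln_add_one_self_le_self) auto
  moreover have "exp (- ((real k + 1/2) * \<epsilon>)) \<le> exp (- (real k * \<epsilon>))" using e by simp
  moreover have "exp (- (real k * \<epsilon>)) = exp (- \<epsilon>) ^ k" by (simp add: exp_of_nat_mult[symmetric])
  ultimately show "norm (ln (1 + exp (- ((real k + 1/2) * \<epsilon>)))) \<le> exp (- \<epsilon>) ^ k" by simp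
qed

text \<open>The limit of \<open>finite_jacobi\<close>: the \<open>q\<close>-binomials tend to the
  inverse of \<open>Q\<close> and are bounded by \<open>1 / Q ^ 2\<close>, so dominated convergence
  applies. Indices are taken in \<open>int^1\<close> so that the lattice results can be used for the
  theta sum.\<close>

theorem jacobi_triple_log:
  "exp (tail_log \<epsilon> 0) * exp (2 * (\<Sum>k. ln (1 + exp (- ((real k + 1/2) * \<epsilon>))))) =
    (\<Sum>\<^sub>\<infinity>v::int^1. exp (- \<epsilon> * (real_of_int (v $ 1))\<^sup>2 / 2))"
proof -
  let ?F = "qfact (exp (- \<epsilon>))"
  define Q where "Q = exp (tail_log \<epsilon> 0)"
  have Q: "Q > 0" "\<And>n. Q \<le> ?F n" "\<And>n. ?F n \<le> 1" "?F \<longlonglongrightarrow> Q"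
    unfolding Q_def using qfact_bounds qfact_tendsto by auto
  have Fpos: "?F n > 0" for n using Q(1) Q(2)[of n] by linarith
  let ?w = "\<lambda>v::int^1. exp (- \<epsilon> * (real_of_int (v $ 1))\<^sup>2 / 2)"
  \<comment> \<open>The finite identity recentred at \<open>v = j - n\<close> and extended by 0, so
    that all \<open>n\<close> share one index set.\<close>
  define c where "c n v = (if \<bar>v $ 1\<bar> \<le> int n then ?F (2 * n) / (?F (nat (int n + v $ 1)) * ?F (nat (int n - v $ 1))) * ?w v else 0)" for n and v :: "int^1"
  obtain en :: "nat \<Rightarrow> int^1" where en: "bij en" by (rule int_vec_enum)
  have fin: "(\<Sum>\<^sub>\<infinity>v. c n v) = (\<Prod>k<n. 1 + exp (- ((real k + 1/2) * \<epsilon>)))\<^sup>2"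
    and supp: "finite {v. c n v \<noteq> 0}" for n
  proof -
    let ?S = "{v :: int^1. \<bar>v $ 1\<bar> \<le> int n}"
    let ?h = "\<lambda>j::nat. (\<chi> i. int j - int n) :: int^1"
    have S: "bij_betw ?h {..2*n} ?S"
    proof (rule bij_betw_byWitness[of _ "\<lambda>v. nat (v $ 1 + int n)"])
      show "\<forall>v\<in>?S. ?h (nat (v $ 1 + int n)) = v" by (auto simp: vec_eq_iff forall_1)
    qed auto
    hence fS: "finite ?S" using bij_betw_finite by blast
    have "{v. c n v \<noteq> 0} \<subseteq> ?S" by (auto simp: c_def)
    thus "finite {v. c n v \<noteq> 0}" using fS by (rule finite_subset)
    have "(\<Sum>\<^sub>\<infinity>v. c n v) = (\<Sum>\<^sub>\<infinity>v\<in>?S. c n v)" by (rule infsum_cong_neutral) (auto simp: c_def)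
    also have "\<dots> = sum (c n) ?S" using fS by simp
    also have "\<dots> = (\<Sum>j\<le>2*n. c n (?h j))" by (rule sum.reindex_bij_betw[OF S, symmetric])
    also have "\<dots> = (\<Sum>j\<le>2*n. qbinomial (exp (- \<epsilon>)) (2 * n) j * exp (- \<epsilon> * (real j - real n)\<^sup>2 / 2))"
    proof (intro sum.cong refl)
      fix j assume j: "j \<in> {..2*n}"
      have "nat (int n - (int j - int n)) = 2 * n - j" "nat (int n + (int j - int n)) = j" using j by auto
      thus "c n (?h j) = qbinomial (exp (- \<epsilon>)) (2 * n) j * exp (- \<epsilon> * (real j - real n)\<^sup>2 / 2)"
        using j by (simp add: c_def qbinomial_def)
    qed
    finally show "(\<Sum>\<^sub>\<infinity>v. c n v) = (\<Prod>k<n. 1 + exp (- ((real k + 1/2) * \<epsilon>)))\<^sup>2"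
      unfolding finite_jacobi[OF e] .
  qed
  have wsum: "(\<lambda>v. norm (?w v)) summable_on UNIV"
  proof -
    define s where "s = min 1 (sqrt \<epsilon>)"
    have s: "0 < s" "s \<le> 1" "s\<^sup>2 \<le> \<epsilon>" using e by (auto simp: s_def min_def power_le_one)
    obtain K where "(\<lambda>v::int^1. exp (- (1/2) * (norm (0 + s *\<^sub>R ivec v))\<^sup>2)) summable_on UNIV"
      using gaussian_lattice_bound[of "1/2"] s by (metis half_gt_zero_iff zero_less_one)
    thus ?thesis
    proof (rule summable_on_comparison_test)
      fix v :: "int^1"
      have "(norm (0 + s *\<^sub>R ivec v))\<^sup>2 = s\<^sup>2 * (real_of_int (v $ 1))\<^sup>2"
        by (simp add: norm_vector_1 power_mult_distrib)
      moreover have "s\<^sup>2 * (real_of_int (v $ 1))\<^sup>2 \<le> \<epsilon> * (real_of_int (v $ 1))\<^sup>2" using s by (intro mult_right_mono) auto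
      ultimately show "norm (?w v) \<le> exp (- (1/2) * (norm (0 + s *\<^sub>R ivec v))\<^sup>2)" by simp
    qed auto
  qed
  define M where "M k = ?w (en k) / Q\<^sup>2" for k
  have "summable M" unfolding M_def
    using abs_summable_enum(1)[OF en wsum] by (intro summable_divide) simp
  have bd: "norm (c n (en k)) \<le> M k" for n k
  proof (cases "\<bar>en k $ 1\<bar> \<le> int n")
    case True
    have "?F (2 * n) / (?F a * ?F b) \<le> 1 / Q\<^sup>2" for a b
      unfolding power2_eq_square using Q Fpos by (intro frac_le mult_mono) (auto intro: less_imp_le)
    hence "?F (2 * n) / (?F (nat (int n + en k $ 1)) * ?F (nat (int n - en k $ 1))) * ?w (en k) \<le> 1 / Q\<^sup>2 * ?w (en k)"
      by (intro mult_right_mono) auto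
    thus ?thesis using True Fpos by (simp add: c_def M_def abs_mult less_imp_le)
  next
    case False
    thus ?thesis using Q by (simp add: c_def M_def)
  qed
  have lim: "(\<lambda>n. c n v) \<longlonglongrightarrow> ?w v / Q" for v
  proof -
    have "filterlim (\<lambda>n. 2 * n) at_top (sequentially)" by (intro filterlim_subseq) (auto simp: strict_mono_def)
    moreover have fl: "filterlim (\<lambda>n. nat (int n + a)) at_top sequentially" for a
      unfolding filterlim_at_top
    proof
      fix Z
      show "eventually (\<lambda>n. Z \<le> nat (int n + a)) sequentially"
        by (rule eventually_sequentiallyI[of "Z + nat \<bar>a\<bar>"]) auto
    qed
    moreover have "filterlim (\<lambda>n. nat (int n - a)) at_top sequentially" for a
      using fl[of "- a"] by simp
    ultimately have "(\<lambda>n. ?F (2 * n) / (?F (nat (int n + v $ 1)) * ?F (nat (int n - v $ 1))) * ?w v) \<longlonglongrightarrow> Q / (Q * Q) * ?w v"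
      by (intro tendsto_mult tendsto_divide tendsto_const filterlim_compose[OF Q(4)]) (use Q(1) in auto)
    moreover have "eventually (\<lambda>n. ?F (2 * n) / (?F (nat (int n + v $ 1)) * ?F (nat (int n - v $ 1))) * ?w v = c n v) sequentially"
      by (intro eventually_sequentiallyI[of "nat \<bar>v $ 1\<bar>"]) (auto simp: c_def)
    ultimately have "(\<lambda>n. c n v) \<longlonglongrightarrow> Q / (Q * Q) * ?w v" by (rule Lim_transform_eventually)
    thus ?thesis using Q by simp
  qed
  have "((\<lambda>n. \<Sum>k. c n (en k)) \<longlonglongrightarrow> (\<Sum>k. ?w (en k) / Q))"
    by (rule conjunct2[OF conjunct2[OF tannerys_theorem[OF lim _ \<open>summable M\<close>]]]) (use bd in \<open>auto intro!: always_eventually\<close>)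
  moreover have "(\<Sum>k. c n (en k)) = (\<Prod>k<n. 1 + exp (- ((real k + 1/2) * \<epsilon>)))\<^sup>2" for n
  proof -
    have "(\<lambda>v. norm (c n v)) summable_on UNIV"
      by (rule finite_nonzero_values_imp_summable_on) (use supp[of n] in simp)
    from abs_summable_enum(2)[OF en this] show ?thesis unfolding fin by simp
  qed
  moreover have "(\<Sum>k. ?w (en k) / Q) = (\<Sum>\<^sub>\<infinity>v. ?w v) / Q"
    using abs_summable_enum[OF en wsum] by (subst suminf_divide) (auto dest: summable_norm_cancel)
  ultimately have 1: "(\<lambda>n. (\<Prod>k<n. 1 + exp (- ((real k + 1/2) * \<epsilon>)))\<^sup>2) \<longlonglongrightarrow> (\<Sum>\<^sub>\<infinity>v. ?w v) / Q" by simp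
  have pexp: "(\<Prod>k<n. 1 + exp (- ((real k + 1/2) * \<epsilon>))) = exp (\<Sum>k<n. ln (1 + exp (- ((real k + 1/2) * \<epsilon>))))" for n
    by (simp add: exp_sum add_pos_pos)
  have 2: "(\<lambda>n. (\<Prod>k<n. 1 + exp (- ((real k + 1/2) * \<epsilon>)))\<^sup>2) \<longlonglongrightarrow> (exp (\<Sum>k. ln (1 + exp (- ((real k + 1/2) * \<epsilon>)))))\<^sup>2"
    unfolding pexp by (intro tendsto_power tendsto_exp summable_LIMSEQ summable_ln_half)
  have "(exp (\<Sum>k. ln (1 + exp (- ((real k + 1/2) * \<epsilon>)))))\<^sup>2 = (\<Sum>\<^sub>\<infinity>v. ?w v) / Q" by (rule LIMSEQ_unique[OF 2 1])
  thus ?thesis using Q by (simp add: Q_def exp_double field_simps)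
qed

end

text \<open>The behaviour of Euler's product near \<open>q = 1\<close>. In the logarithm of the
  triple product, the sums of \<open>ln (1 + exp (- x))\<close> have terminating expansions, and the
  theta value is \<open>sqrt (2 * pi / \<epsilon>)\<close> up to an error below every power.\<close>

theorem tail_log_0_asymp:
  obtains K \<delta> where "K \<ge> 0" "0 < \<delta>" "\<delta> \<le> 1" "\<And>\<epsilon>. 0 < \<epsilon> \<Longrightarrow> \<epsilon> \<le> \<delta> \<Longrightarrow>
    \<bar>tail_log \<epsilon> 0 - (- pi\<^sup>2 / (6 * \<epsilon>) + ln (2 * pi / \<epsilon>) / 2 + \<epsilon> / 24)\<bar> \<le> K * \<epsilon> ^ M"
proof -
  obtain K1 where K1: "K1 \<ge> 0" "\<And>\<epsilon>. 0 < \<epsilon> \<Longrightarrow> \<epsilon> \<le> 1 \<Longrightarrow> summable (\<lambda>k. ln (1 + exp (- (real (Suc k) * \<epsilon>)))) \<and>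
    \<bar>(\<Sum>k. ln (1 + exp (- (real (Suc k) * \<epsilon>)))) - (pi\<^sup>2 / (12 * \<epsilon>) - ln 2 / 2 + \<epsilon> / 24)\<bar> \<le> K1 * \<epsilon> ^ M"
    using sum_ln_one_plus_asymp by metis
  define I :: "real^1^1" where "I = mat 1"
  have sym: "transpose I = I" by (simp add: I_def transpose_mat)
  have pd: "positive_definite I" by (simp add: I_def positive_definite_def)
  interpret G: smooth_gaussian_class "gauss_class I" by (rule smooth_gaussian_class_gauss_class[OF sym pd])
  have k1: "kpoly UNIV (\<lambda>x::real^1. 1)" by (rule kpoly.const) simp
  have "(\<lambda>x. 1 * gauss_weight I x) \<in> gauss_class I" 
    unfolding gauss_class_def by (intro CollectI exI[of _ "\<lambda>x. 1"] conjI refl k1)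
  hence g: "gauss_weight I \<in> gauss_class I" by simp
  have int: "(LINT x|lborel. gauss_weight I x) = sqrt (2 * pi)"
  proof -
    have "(2 * pi) powr (- 1 / 2) * (LINT x|lborel. gauss_weight I x) = 1"
      using gaussian_integral_kpoly(3)[OF sym pd sqrt_closed_field_UNIV _ k1] by (simp add: I_def)
    moreover have "(2 * pi) powr (- 1 / 2) = 1 / sqrt (2 * pi)"
      using powr_minus_divide[of "2 * pi" "1/2"] by (simp add: powr_half_sqrt)
    ultimately have "1 / sqrt (2 * pi) * (LINT x|lborel. gauss_weight I x) = 1" by (simp only:)
    thus ?thesis by (simp add: field_simps)
  qed
  obtain K2 where K2: "K2 \<ge> 0" "\<And>s \<theta>. 0 < s \<Longrightarrow> s \<le> 1 \<Longrightarrow>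
    \<bar>s ^ CARD(1) * lattice_sum (gauss_weight I) s \<theta> - (LINT y|lborel. gauss_weight I y)\<bar> \<le> K2 * s ^ (2 * M + 1)"
    using G.lattice_sum_asymp[OF g] by metis
  \<comment> \<open>Small enough for the normalized theta value \<open>y\<close> to stay within 1/2
    of 1, where \<open>ln\<close> is controlled linearly.\<close>
  define \<delta> where "\<delta> = (min 1 (1 / (2 * (K2 + 1))))\<^sup>2"
  have \<delta>: "0 < \<delta>" "\<delta> \<le> 1" using K2 by (auto simp: \<delta>_def power_le_one)
  show ?thesis
  proof (rule that[OF _ \<delta>])
    show "2 * K2 + 4 * K1 \<ge> 0" using K1 K2 by simp
    fix \<epsilon> :: real assume e: "0 < \<epsilon>" "\<epsilon> \<le> \<delta>"
    have e1: "\<epsilon> \<le> 1" using e \<delta> by simp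
    define s where "s = sqrt \<epsilon>"
    have s: "0 < s" "s \<le> 1" "s\<^sup>2 = \<epsilon>" "s \<le> 1 / (2 * (K2 + 1))"
    proof -
      have "s \<le> min 1 (1 / (2 * (K2 + 1)))" using e(2) K2 unfolding s_def \<delta>_def by (intro real_le_lsqrt) auto
      thus "s \<le> 1" "s \<le> 1 / (2 * (K2 + 1))" by auto
    qed (use e in \<open>auto simp: s_def\<close>)
    define \<Theta> where "\<Theta> = (\<Sum>\<^sub>\<infinity>v::int^1. exp (- \<epsilon> * (real_of_int (v $ 1))\<^sup>2 / 2))"
    have "lattice_sum (gauss_weight I) s 0 = \<Theta>"
      unfolding lattice_sum_def \<Theta>_def gauss_weight_def I_def
      by (intro infsum_cong) (simp add: inner_vec_def UNIV_1 power2_eq_square[symmetric] power_mult_distrib s(3))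
    hence th: "\<bar>s * \<Theta> - sqrt (2 * pi)\<bar> \<le> K2 * s ^ (2 * M + 1)" using K2(2)[OF s(1,2), of 0] int by simp
    define y where "y = s * \<Theta> / sqrt (2 * pi)"
    have sq: "sqrt (2 * pi) \<ge> 1" using pi_gt3 by simp
    have "\<bar>y - 1\<bar> = \<bar>s * \<Theta> - sqrt (2 * pi)\<bar> / sqrt (2 * pi)" using sq by (simp add: y_def field_simps)
    also have "\<dots> \<le> (K2 * s ^ (2 * M + 1)) / 1" using th sq K2 s by (intro frac_le) auto
    finally have y: "\<bar>y - 1\<bar> \<le> K2 * s ^ (2 * M + 1)" by simp
    have y2: "K2 * s ^ (2 * M + 1) \<le> K2 * \<epsilon> ^ M"
    proof -
      have "s ^ (2 * M + 1) = \<epsilon> ^ M * s" using s(3) by (simp add: power_mult)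
      also have "\<dots> \<le> \<epsilon> ^ M * 1" using s e by (intro mult_left_mono) auto
      finally show ?thesis using K2 by (intro mult_left_mono) auto
    qed
    have yh: "\<bar>y - 1\<bar> \<le> 1/2"
    proof -
      have "s ^ (2 * M + 1) \<le> s ^ 1" using s by (intro power_decreasing) auto
      also have "s ^ 1 \<le> 1 / (2 * (K2 + 1))" using s(4) by simp
      finally have "K2 * s ^ (2 * M + 1) \<le> K2 * (1 / (2 * (K2 + 1)))" using K2(1) by (rule mult_left_mono)
      also have "\<dots> \<le> 1/2" using K2 by (simp add: field_simps)
      finally show ?thesis using y by linarith
    qed
    have lny: "\<bar>ln y\<bar> \<le> 2 * (K2 * \<epsilon> ^ M)"
    proof -
      have "1 - y \<le> 1/2" using yh abs_ge_minus_self[of "y - 1"] by linarith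
      hence "\<bar>ln (1 - (1 - y))\<bar> \<le> \<bar>1 - y\<bar> / (1 - 1/2)" by (rule abs_ln_one_minus_le) auto
      hence "\<bar>ln y\<bar> \<le> 2 * \<bar>y - 1\<bar>" by (simp add: abs_minus_commute)
      also have "2 * \<bar>y - 1\<bar> \<le> 2 * (K2 * \<epsilon> ^ M)"
        by (rule mult_left_mono[OF order_trans[OF y y2]]) simp
      finally show ?thesis .
    qed
    have ypos: "y > 0" using yh abs_ge_minus_self[of "y - 1"] by linarith
    have Th: "\<Theta> = y * sqrt (2 * pi) / s" using s sq by (simp add: y_def)
    have lnTh: "ln \<Theta> = ln y + ln (2 * pi / \<epsilon>) / 2"
      using ypos s e unfolding Th by (simp add: ln_mult ln_div ln_sqrt s_def)
    let ?S = "\<lambda>\<epsilon>. \<Sum>k. ln (1 + exp (- (real (Suc k) * \<epsilon>)))"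
    \<comment> \<open>The positive multiples of \<open>\<epsilon> / 2\<close> alternate between
      half-odd and integral multiples of \<epsilon>, so pairing the terms of the finer sum separates
      the two kinds.\<close>
    have half: "(\<Sum>k. ln (1 + exp (- ((real k + 1/2) * \<epsilon>)))) = ?S (\<epsilon> / 2) - ?S \<epsilon>"
    proof -
      have s2: "summable (\<lambda>k. ln (1 + exp (- (real (Suc k) * (\<epsilon> / 2)))))" using K1(2)[of "\<epsilon> / 2"] e e1 by simp
      have "(\<lambda>n. \<Sum>k\<in>{n*2..<n*2+2}. ln (1 + exp (- (real (Suc k) * (\<epsilon> / 2))))) sums ?S (\<epsilon> / 2)"
        by (rule sums_group[OF summable_sums[OF s2]]) simp
      also have "(\<lambda>n. \<Sum>k\<in>{n*2..<n*2+2}. ln (1 + exp (- (real (Suc k) * (\<epsilon> / 2))))) =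
        (\<lambda>n. ln (1 + exp (- ((real n + 1/2) * \<epsilon>))) + ln (1 + exp (- (real (Suc n) * \<epsilon>))))"
      proof
        fix n :: nat
        have split: "(\<Sum>k\<in>{n*2..<n*2+2}. f k) = f (n*2) + f (n*2+1)" for f :: "nat \<Rightarrow> real"
        proof -
          have "{n*2..<n*2+2} = {n*2, n*2+1}" by auto
          thus ?thesis by simp
        qed
        have r: "real (Suc (n*2)) * (\<epsilon> / 2) = (real n + 1/2) * \<epsilon>" "real (Suc (n*2+1)) * (\<epsilon> / 2) = real (Suc n) * \<epsilon>"
          by (simp_all add: field_simps)
        show "(\<Sum>k\<in>{n*2..<n*2+2}. ln (1 + exp (- (real (Suc k) * (\<epsilon> / 2))))) =
          ln (1 + exp (- ((real n + 1/2) * \<epsilon>))) + ln (1 + exp (- (real (Suc n) * \<epsilon>)))"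
          unfolding split r ..
      qed
      finally have "?S (\<epsilon> / 2) = (\<Sum>n. ln (1 + exp (- ((real n + 1/2) * \<epsilon>))) + ln (1 + exp (- (real (Suc n) * \<epsilon>))))"
        by (rule sums_unique)
      also have "\<dots> = (\<Sum>k. ln (1 + exp (- ((real k + 1/2) * \<epsilon>)))) + ?S \<epsilon>"
        using summable_ln_half[OF e(1)] K1(2)[OF e(1) e1] by (intro suminf_add[symmetric]) auto
      finally show ?thesis by simp
    qed
    have "ln (exp (tail_log \<epsilon> 0) * exp (2 * (\<Sum>k. ln (1 + exp (- ((real k + 1/2) * \<epsilon>)))))) = ln \<Theta>"
      unfolding jacobi_triple_log[OF e(1)] \<Theta>_def ..
    hence "tail_log \<epsilon> 0 + 2 * (\<Sum>k. ln (1 + exp (- ((real k + 1/2) * \<epsilon>)))) = ln \<Theta>"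
      by (simp only: exp_add[symmetric] ln_exp)
    hence main: "tail_log \<epsilon> 0 = ln y + ln (2 * pi / \<epsilon>) / 2 - 2 * (?S (\<epsilon> / 2) - ?S \<epsilon>)"
      unfolding half lnTh by simp
    have S1: "\<bar>?S \<epsilon> - (pi\<^sup>2 / (12 * \<epsilon>) - ln 2 / 2 + \<epsilon> / 24)\<bar> \<le> K1 * \<epsilon> ^ M" using K1(2)[OF e(1) e1] by blast
    have S2: "\<bar>?S (\<epsilon> / 2) - (pi\<^sup>2 / (12 * (\<epsilon> / 2)) - ln 2 / 2 + (\<epsilon> / 2) / 24)\<bar> \<le> K1 * \<epsilon> ^ M"
    proof -
      have "K1 * (\<epsilon> / 2) ^ M \<le> K1 * \<epsilon> ^ M" using e K1 by (intro mult_left_mono power_mono) auto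
      thus ?thesis using K1(2)[of "\<epsilon> / 2"] e e1 by auto
    qed
    have "tail_log \<epsilon> 0 - (- pi\<^sup>2 / (6 * \<epsilon>) + ln (2 * pi / \<epsilon>) / 2 + \<epsilon> / 24) =
      ln y - 2 * (?S (\<epsilon> / 2) - (pi\<^sup>2 / (12 * (\<epsilon> / 2)) - ln 2 / 2 + (\<epsilon> / 2) / 24))
        + 2 * (?S \<epsilon> - (pi\<^sup>2 / (12 * \<epsilon>) - ln 2 / 2 + \<epsilon> / 24))"
      unfolding main using e by (simp add: field_simps)
    also have "\<bar>\<dots>\<bar> \<le> 2 * (K2 * \<epsilon> ^ M) + 2 * (K1 * \<epsilon> ^ M) + 2 * (K1 * \<epsilon> ^ M)"
      using lny S1 S2 by (simp add: abs_le_iff) (linarith)?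
    finally show "\<bar>tail_log \<epsilon> 0 - (- pi\<^sup>2 / (6 * \<epsilon>) + ln (2 * pi / \<epsilon>) / 2 + \<epsilon> / 24)\<bar> \<le> (2 * K2 + 4 * K1) * \<epsilon> ^ M"
      by (simp add: algebra_simps)
  qed
qed

section \<open>The asymptotic expansion of the Nahm sum\<close>

lemma exp_linear_quadratic:
  assumes "c > 0" shows "exp (b * y - c * y\<^sup>2) \<le> exp (b\<^sup>2 / (2 * c)) * exp (- (c / 2) * (y::real)\<^sup>2)"
proof -
  have "0 \<le> (c * y - b)\<^sup>2 / (2 * c)" using assms by simp
  also have "\<dots> = c / 2 * y\<^sup>2 - b * y + b\<^sup>2 / (2 * c)" using assms by (simp add: power2_eq_square field_simps)
  finally show ?thesis by (simp add: exp_add[symmetric])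
qed

locale nahm_asymptotics =
  fixes A :: "real^'r^'r" and B :: "real^'r" and C :: real and Q :: "real^'r"
  assumes sym: "transpose A = A" and pd: "positive_definite A" and Q: "nahm_solution A Q"
begin

definition u :: "real^'r" where "u = (\<chi> i. - ln (Q $ i))"
definition \<xi> :: "real^'r" where "\<xi> = (\<chi> i. Q $ i / (1 - Q $ i))"
definition At :: "real^'r^'r" where "At = (\<chi> i j. A $ i $ j + (if i = j then \<xi> $ i else 0))"
definition \<alpha> :: real where "\<alpha> = (\<Sum>i\<in>UNIV. rogers_L 1 - rogers_L (Q $ i))"
definition \<beta>0 :: real where "\<beta>0 = (\<Prod>i\<in>UNIV. (Q $ i) powr (B $ i) * (1 - Q $ i) powr (-1/2))"
definition \<gamma> :: real where "\<gamma> = C + 1/24 * (\<Sum>i\<in>UNIV. (1 + Q $ i) / (1 - Q $ i))"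
text \<open>The error in \<open>tail_log \<epsilon> 0\<close>, smaller than every power of
  \<epsilon>. It is the same for all \<open>n\<close>, so it can be kept exactly and pulled out of
  the sum.\<close>

definition \<kappa> :: "real \<Rightarrow> real" where
  "\<kappa> \<epsilon> = tail_log \<epsilon> 0 - (- pi\<^sup>2 / (6 * \<epsilon>) + ln (2 * pi / \<epsilon>) / 2 + \<epsilon> / 24)"
definition summand :: "real \<Rightarrow> nat^'r \<Rightarrow> real" where
  "summand \<epsilon> n = (let v = (\<chi> i. real (n $ i))
     in exp (- \<epsilon>) powr (1/2 * (v \<bullet> (A *v v)) + v \<bullet> B + C) / (\<Prod>i\<in>UNIV. qfact (exp (- \<epsilon>)) (n $ i)))"
text \<open>The rescaled variable \<open>t\<close> with \<open>n = u / s ^ 2 - t / s\<close>; its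
  sign is that of the argument \<open>u - T * s\<close> in \<open>local_exponent\<close>.\<close>

definition point :: "real \<Rightarrow> nat^'r \<Rightarrow> real^'r" where
  "point s n = (1 / s) *\<^sub>R u - s *\<^sub>R (\<chi> i. real (n $ i))"
definition weight :: "real \<Rightarrow> real^'r \<Rightarrow> real" where
  "weight s t = gauss_weight At t * exp (\<Sum>i\<in>UNIV. local_exponent (B $ i) (u $ i) s (t $ i))"

lemma Q01: "0 < Q $ i" "Q $ i < 1" using Q by (auto simp: nahm_solution_def)

lemma u: "u $ i > 0" "Q $ i = exp (- u $ i)" "(A *v u) $ i = - ln (1 - exp (- u $ i))"
  using nahm_solution_critical[OF Q, folded u_def] by blast+

lemma \<xi>_eq: "\<xi> $ i = 1 / (exp (u $ i) - 1)"
  using u(1)[of i] unfolding \<xi>_def by (simp add: u(2)[of i] exp_minus field_simps)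

lemma \<xi>_pos: "\<xi> $ i > 0" using Q01[of i] by (simp add: \<xi>_def)

lemma At_sym: "transpose At = At"
proof -
  have "A $ i $ j = A $ j $ i" for i j using arg_cong[OF sym, of "\<lambda>M. M $ j $ i"] by (simp add: transpose_def)
  thus ?thesis by (simp add: vec_eq_iff transpose_def At_def)
qed

lemma At_quad: "x \<bullet> (At *v x) = x \<bullet> (A *v x) + (\<Sum>i\<in>UNIV. \<xi> $ i * (x $ i)\<^sup>2)"
proof -
  have "(At *v x) $ i = (A *v x) $ i + \<xi> $ i * x $ i" for i
    by (simp add: matrix_vector_mult_def At_def distrib_right sum.distrib if_distrib[of "\<lambda>a. a * _"] cong: if_cong)
  thus ?thesis by (simp add: inner_vec_def distrib_left sum.distrib power2_eq_square mult_ac)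
qed

lemma At_ge: "x \<bullet> (At *v x) \<ge> x \<bullet> (A *v x)"
  unfolding At_quad using \<xi>_pos by (simp add: sum_nonneg less_imp_le)

lemma At_pd: "positive_definite At"
  using pd At_ge unfolding positive_definite_def by (metis less_le_trans)

lemma \<alpha>_eq: "\<alpha> = real CARD('r) * (pi\<^sup>2 / 6) - nahm_potential A u"
  unfolding \<alpha>_def sum_rogers_L[OF Q] u_def[symmetric] by (simp add: nahm_potential_def dilog_0)

lemma \<beta>0_eq: "\<beta>0 = exp (\<Sum>i\<in>UNIV. - (u $ i * B $ i) - ln (1 - exp (- u $ i)) / 2)"
  unfolding \<beta>0_def exp_sum[OF finite]
proof (intro prod.cong refl)
  fix i
  have "Q $ i powr B $ i = exp (- (u $ i * B $ i))" unfolding u(2)[of i] by (simp add: powr_def mult.commute)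
  moreover have "(1 - Q $ i) powr (-1/2) = exp (- ln (1 - exp (- u $ i)) / 2)"
    using u(1)[of i] unfolding u(2)[of i] by (simp add: powr_def)
  ultimately show "Q $ i powr B $ i * (1 - Q $ i) powr (-1/2) = exp (- (u $ i * B $ i) - ln (1 - exp (- u $ i)) / 2)"
    by (simp add: exp_add[symmetric])
qed

lemma \<gamma>_eq: "\<gamma> = C + (\<Sum>i\<in>UNIV. \<xi> $ i / 12 + 1 / 24)"
proof -
  have "1/24 * ((1 + Q $ i) / (1 - Q $ i)) = \<xi> $ i / 12 + 1 / 24" for i
    using Q01[of i] by (simp add: \<xi>_def field_simps)
  thus ?thesis by (simp add: \<gamma>_def sum_distrib_left)
qed

text \<open>Combines the convexity bounds for the inverse factorials and for the potential. It
  covers all \<open>n\<close>, in particular those with zero entries, which no local expansion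
  reaches.\<close>

lemma summand_le:
  fixes n :: "nat^'r"
  assumes s: "s > 0"
  defines "t \<equiv> point s n"
  shows "summand (s\<^sup>2) n \<le> exp (\<alpha> / s\<^sup>2 - 1/2 * (t \<bullet> (A *v t)) - u \<bullet> B + s * (t \<bullet> B) - s\<^sup>2 * C)"
proof -
  define v where "v = (\<chi> i. real (n $ i))"
  have s2: "s\<^sup>2 > 0" using s by simp
  have x: "s\<^sup>2 *\<^sub>R v = u - s *\<^sub>R t"
    using s by (simp add: t_def point_def v_def scaleR_diff_right power2_eq_square)
  have vi: "real (n $ i) * s\<^sup>2 = (s\<^sup>2 *\<^sub>R v) $ i" for i by (simp add: v_def mult.commute)
  have "1 / (\<Prod>i\<in>UNIV. qfact (exp (- s\<^sup>2)) (n $ i)) = (\<Prod>i\<in>UNIV. 1 / qfact (exp (- s\<^sup>2)) (n $ i))"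
    by (simp add: prod_dividef)
  also have "\<dots> \<le> (\<Prod>i\<in>UNIV. exp ((pi\<^sup>2 / 6 - dilog ((s\<^sup>2 *\<^sub>R v) $ i)) / s\<^sup>2))"
  proof (intro prod_mono conjI)
    fix i
    show "0 \<le> 1 / qfact (exp (- s\<^sup>2)) (n $ i)" using qfact_pos[of "exp (- s\<^sup>2)" "n $ i"] s2 by simp
    show "1 / qfact (exp (- s\<^sup>2)) (n $ i) \<le> exp ((pi\<^sup>2 / 6 - dilog ((s\<^sup>2 *\<^sub>R v) $ i)) / s\<^sup>2)"
      using inverse_qfact_le[OF s2, of "n $ i"] unfolding vi .
  qed
  also have "\<dots> = exp ((real CARD('r) * (pi\<^sup>2 / 6) - (\<Sum>i\<in>UNIV. dilog ((s\<^sup>2 *\<^sub>R v) $ i))) / s\<^sup>2)"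
    by (simp add: exp_sum[symmetric] sum_divide_distrib[symmetric] sum_subtractf)
  finally have 1: "1 / (\<Prod>i\<in>UNIV. qfact (exp (- s\<^sup>2)) (n $ i)) \<le> \<dots>" .
  have "summand (s\<^sup>2) n = exp (- s\<^sup>2 * (1/2 * (v \<bullet> (A *v v)) + v \<bullet> B + C)) * (1 / (\<Prod>i\<in>UNIV. qfact (exp (- s\<^sup>2)) (n $ i)))"
    by (simp add: summand_def v_def Let_def powr_def mult.commute)
  also have "\<dots> \<le> exp (- s\<^sup>2 * (1/2 * (v \<bullet> (A *v v)) + v \<bullet> B + C)) * exp ((real CARD('r) * (pi\<^sup>2 / 6) - (\<Sum>i\<in>UNIV. dilog ((s\<^sup>2 *\<^sub>R v) $ i))) / s\<^sup>2)"
    by (intro mult_left_mono 1) auto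
  also have "\<dots> = exp ((real CARD('r) * (pi\<^sup>2 / 6) - nahm_potential A (s\<^sup>2 *\<^sub>R v)) / s\<^sup>2 - (s\<^sup>2 *\<^sub>R v) \<bullet> B - s\<^sup>2 * C)"
    unfolding exp_add[symmetric] nahm_potential_def
    using s by (simp add: matrix_vector_mult_scaleR field_simps power2_eq_square)
  also have "\<dots> \<le> exp ((real CARD('r) * (pi\<^sup>2 / 6) - (nahm_potential A u + 1/2 * ((s\<^sup>2 *\<^sub>R v - u) \<bullet> (A *v (s\<^sup>2 *\<^sub>R v - u))))) / s\<^sup>2 - (s\<^sup>2 *\<^sub>R v) \<bullet> B - s\<^sup>2 * C)"
  proof -
    have "nahm_potential A (s\<^sup>2 *\<^sub>R v) \<ge> nahm_potential A u + 1/2 * ((s\<^sup>2 *\<^sub>R v - u) \<bullet> (A *v (s\<^sup>2 *\<^sub>R v - u)))"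
      by (rule nahm_potential_lower[OF sym u(1,3)]) (simp add: v_def)
    thus ?thesis using s2 by (intro exp_le_cancel_iff[THEN iffD2] diff_right_mono divide_right_mono diff_left_mono) auto
  qed
  also have "s\<^sup>2 *\<^sub>R v - u = - s *\<^sub>R t" unfolding x by simp
  also have "(- s *\<^sub>R t) \<bullet> (A *v (- s *\<^sub>R t)) = s\<^sup>2 * (t \<bullet> (A *v t))"
    by (simp only: matrix_vector_mult_scaleR inner_scaleR_left inner_scaleR_right) (simp add: power2_eq_square)
  also have "(s\<^sup>2 *\<^sub>R v) \<bullet> B = u \<bullet> B - s * (t \<bullet> B)" unfolding x by (simp add: inner_diff_left)
  also have "(real CARD('r) * (pi\<^sup>2 / 6) - (nahm_potential A u + 1 / 2 * (s\<^sup>2 * (t \<bullet> (A *v t))))) / s\<^sup>2 - (u \<bullet> B - s * (t \<bullet> B)) - s\<^sup>2 * C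
     = \<alpha> / s\<^sup>2 - 1/2 * (t \<bullet> (A *v t)) - u \<bullet> B + s * (t \<bullet> B) - s\<^sup>2 * C"
    unfolding \<alpha>_eq using s2 by (simp add: diff_divide_distrib add_divide_distrib)
  finally show ?thesis .
qed

text \<open>An exact identity. The terms linear in \<open>t\<close> cancel because \<open>u\<close>
  is critical, the quadratic form of \<open>A\<close> and the terms with \<xi> merge into
  \<open>At\<close>, and the constants assemble \<alpha>, \<open>\<beta>0\<close> and
  \<gamma>.\<close>

lemma summand_eq_weight:
  fixes n :: "nat^'r"
  assumes s: "s > 0"
  defines "t \<equiv> point s n"
  shows "summand (s\<^sup>2) n = exp (\<alpha> / s\<^sup>2) * (\<beta>0 * exp (- \<gamma> * s\<^sup>2) * exp (- real CARD('r) * \<kappa> (s\<^sup>2)) *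
    (2 * pi / s\<^sup>2) powr (- real CARD('r) / 2)) * weight s t"
proof -
  define v where "v = (\<chi> i. real (n $ i))"
  define L where "L i = ln (1 - exp (- u $ i))" for i
  define R where "R = real CARD('r)"
  have s2: "s\<^sup>2 > 0" using s by simp
  have x: "s\<^sup>2 *\<^sub>R v = u - s *\<^sub>R t"
    using s by (simp add: t_def point_def v_def scaleR_diff_right power2_eq_square)
  have vi: "real (n $ i) * s\<^sup>2 = u $ i - t $ i * s" for i
    using arg_cong[OF x, of "\<lambda>w. w $ i"] by (simp add: v_def mult.commute)
  let ?\<phi> = "\<lambda>i. local_exponent (B $ i) (u $ i) s (t $ i)"
  have tl: "tail_log (s\<^sup>2) (u $ i - t $ i * s) = ?\<phi> i - dilog (u $ i) / s\<^sup>2 + t $ i / s * L i - L i / 2 - \<xi> $ i * (t $ i)\<^sup>2 / 2 - \<xi> $ i * s\<^sup>2 / 12 - B $ i * t $ i * s" for i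
    by (simp add: local_exponent_def Let_def L_def \<xi>_eq)
  have "1 / (\<Prod>i\<in>UNIV. qfact (exp (- s\<^sup>2)) (n $ i)) = (\<Prod>i\<in>UNIV. exp (tail_log (s\<^sup>2) (u $ i - t $ i * s) - tail_log (s\<^sup>2) 0))"
    unfolding prod_dividef[symmetric, where f="\<lambda>_. 1", simplified] qfact_eq_tail_log[OF s2] vi
    by (simp add: exp_minus[symmetric] inverse_eq_divide[symmetric] prod_inversef[symmetric])
  also have "\<dots> = exp ((\<Sum>i\<in>UNIV. tail_log (s\<^sup>2) (u $ i - t $ i * s)) - R * tail_log (s\<^sup>2) 0)"
    by (simp add: exp_sum[symmetric] sum_subtractf R_def)
  finally have q: "1 / (\<Prod>i\<in>UNIV. qfact (exp (- s\<^sup>2)) (n $ i)) = \<dots>" .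
  have "summand (s\<^sup>2) n = exp (- s\<^sup>2 * (1/2 * (v \<bullet> (A *v v)) + v \<bullet> B + C)) * (1 / (\<Prod>i\<in>UNIV. qfact (exp (- s\<^sup>2)) (n $ i)))"
    by (simp add: summand_def v_def Let_def powr_def mult.commute)
  hence S: "summand (s\<^sup>2) n = exp (- s\<^sup>2 * (1/2 * (v \<bullet> (A *v v)) + v \<bullet> B + C) + ((\<Sum>i\<in>UNIV. tail_log (s\<^sup>2) (u $ i - t $ i * s)) - R * tail_log (s\<^sup>2) 0))"
    unfolding q exp_add .
  have sums: "(\<Sum>i\<in>UNIV. tail_log (s\<^sup>2) (u $ i - t $ i * s)) =
     (\<Sum>i\<in>UNIV. ?\<phi> i) - (\<Sum>i\<in>UNIV. dilog (u $ i)) / s\<^sup>2 - (t \<bullet> (A *v u)) / s - (\<Sum>i\<in>UNIV. L i) / 2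
      - (\<Sum>i\<in>UNIV. \<xi> $ i * (t $ i)\<^sup>2) / 2 - s\<^sup>2 * (\<Sum>i\<in>UNIV. \<xi> $ i) / 12 - s * (t \<bullet> B)"
  proof -
    have "(t \<bullet> (A *v u)) / s = - (\<Sum>i\<in>UNIV. t $ i / s * L i)"
      by (simp add: inner_vec_def u(3) L_def sum_divide_distrib sum_negf)
    moreover have "s * (t \<bullet> B) = (\<Sum>i\<in>UNIV. B $ i * t $ i * s)" by (simp add: inner_vec_def sum_distrib_left mult_ac)
    moreover have "s\<^sup>2 * (\<Sum>i\<in>UNIV. \<xi> $ i) / 12 = (\<Sum>i\<in>UNIV. \<xi> $ i * s\<^sup>2 / 12)"
      unfolding sum_distrib_left sum_divide_distrib by (simp add: mult.commute)
    moreover have "(\<Sum>i\<in>UNIV. dilog (u $ i)) / s\<^sup>2 = (\<Sum>i\<in>UNIV. dilog (u $ i) / s\<^sup>2)"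
      "(\<Sum>i\<in>UNIV. L i) / 2 = (\<Sum>i\<in>UNIV. L i / 2)"
      "(\<Sum>i\<in>UNIV. \<xi> $ i * (t $ i)\<^sup>2) / 2 = (\<Sum>i\<in>UNIV. \<xi> $ i * (t $ i)\<^sup>2 / 2)"
      by (rule sum_divide_distrib)+
    ultimately show ?thesis unfolding tl sum.distrib sum_subtractf by linarith
  qed
  have quad: "s\<^sup>2 * (v \<bullet> (A *v v)) = u \<bullet> (A *v u) / s\<^sup>2 - 2 * (t \<bullet> (A *v u)) / s + t \<bullet> (A *v t)"
  proof -
    have "s\<^sup>2 * s\<^sup>2 * (v \<bullet> (A *v v)) = (s\<^sup>2 *\<^sub>R v) \<bullet> (A *v (s\<^sup>2 *\<^sub>R v))" by (simp add: matrix_vector_mult_scaleR)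
    also have "\<dots> = u \<bullet> (A *v u) - 2 * s * (t \<bullet> (A *v u)) + s\<^sup>2 * (t \<bullet> (A *v t))"
      unfolding x using symmetric_inner_matrix[OF sym, of u t]
      by (simp add: matrix_vector_mult_diff_distrib matrix_vector_mult_scaleR inner_diff_left inner_diff_right power2_eq_square algebra_simps)
    finally have e: "s\<^sup>2 * s\<^sup>2 * (v \<bullet> (A *v v)) = u \<bullet> (A *v u) - 2 * s * (t \<bullet> (A *v u)) + s\<^sup>2 * (t \<bullet> (A *v t))" .
    have "s\<^sup>2 * (v \<bullet> (A *v v)) = (s\<^sup>2 * s\<^sup>2 * (v \<bullet> (A *v v))) / s\<^sup>2"
      by (subst mult.assoc, subst nonzero_mult_div_cancel_left) (use s2 in auto)
    also have "\<dots> = u \<bullet> (A *v u) / s\<^sup>2 - 2 * (t \<bullet> (A *v u)) / s + t \<bullet> (A *v t)"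
      unfolding e using s by (simp add: add_divide_distrib diff_divide_distrib power2_eq_square)
    finally show ?thesis .
  qed
  have lin: "s\<^sup>2 * (v \<bullet> B) = u \<bullet> B - s * (t \<bullet> B)"
  proof -
    have "s\<^sup>2 * (v \<bullet> B) = (s\<^sup>2 *\<^sub>R v) \<bullet> B" by simp
    thus ?thesis unfolding x by (simp add: inner_diff_left)
  qed
  have tl0: "tail_log (s\<^sup>2) 0 = \<kappa> (s\<^sup>2) + (- (pi\<^sup>2 / 6) / s\<^sup>2 + ln (2 * pi / s\<^sup>2) / 2 + s\<^sup>2 / 24)"
    by (simp add: \<kappa>_def)
  have expo: "- s\<^sup>2 * (1/2 * (v \<bullet> (A *v v)) + v \<bullet> B + C) + ((\<Sum>i\<in>UNIV. tail_log (s\<^sup>2) (u $ i - t $ i * s)) - R * tail_log (s\<^sup>2) 0)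
    = \<alpha> / s\<^sup>2 + (- (u \<bullet> B) - (\<Sum>i\<in>UNIV. L i) / 2) - \<gamma> * s\<^sup>2 - R * \<kappa> (s\<^sup>2) - R / 2 * ln (2 * pi / s\<^sup>2)
      - 1/2 * (t \<bullet> (At *v t)) + (\<Sum>i\<in>UNIV. ?\<phi> i)"
  proof -
    have a: "- s\<^sup>2 * (1/2 * (v \<bullet> (A *v v)) + v \<bullet> B + C) = - 1/2 * (s\<^sup>2 * (v \<bullet> (A *v v))) - s\<^sup>2 * (v \<bullet> B) - s\<^sup>2 * C"
      by (simp add: algebra_simps)
    have al: "\<alpha> / s\<^sup>2 = R * ((pi\<^sup>2 / 6) / s\<^sup>2) - 1/2 * (u \<bullet> (A *v u) / s\<^sup>2) - (\<Sum>i\<in>UNIV. dilog (u $ i)) / s\<^sup>2"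
      by (simp add: \<alpha>_eq nahm_potential_def R_def diff_divide_distrib add_divide_distrib)
    have ga: "\<gamma> * s\<^sup>2 = s\<^sup>2 * C + s\<^sup>2 * (\<Sum>i\<in>UNIV. \<xi> $ i) / 12 + R * (s\<^sup>2 / 24)"
      by (simp add: \<gamma>_eq R_def sum.distrib sum_divide_distrib[symmetric] algebra_simps)
    show ?thesis unfolding a quad lin sums tl0 al ga At_quad by (simp add: algebra_simps)
  qed
  have "\<beta>0 = exp (- (u \<bullet> B) - (\<Sum>i\<in>UNIV. L i) / 2)"
    unfolding \<beta>0_eq by (simp add: L_def sum_subtractf sum_negf inner_vec_def sum_divide_distrib)
  moreover have "(2 * pi / s\<^sup>2) powr (- R / 2) = exp (- R / 2 * ln (2 * pi / s\<^sup>2))" using s by (simp add: powr_def)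
  moreover have "weight s t = exp (- 1/2 * (t \<bullet> (At *v t)) + (\<Sum>i\<in>UNIV. ?\<phi> i))"
    unfolding weight_def gauss_weight_def exp_add ..
  ultimately show ?thesis unfolding S expo R_def[symmetric] by (simp only: exp_add[symmetric]) (simp add: algebra_simps)
qed

lemma \<kappa>_bound:
  obtains K \<delta> where "K \<ge> 0" "0 < \<delta>" "\<delta> \<le> 1" "\<And>\<epsilon>. 0 < \<epsilon> \<Longrightarrow> \<epsilon> \<le> \<delta> \<Longrightarrow> \<bar>\<kappa> \<epsilon>\<bar> \<le> K * \<epsilon> ^ M"
  using tail_log_0_asymp[of M] unfolding \<kappa>_def by blast

text \<open>Here the normalizing power of \<open>s\<close> is lost, but outside of the local domain \<open>1 / s\<close> is
  bounded by a power of \<open>1 + norm t\<close>.\<close>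

lemma weight_global_bound:
  obtains K b c \<delta> where "K \<ge> 0" "b \<ge> 0" "c > 0" "0 < \<delta>" "\<delta> \<le> 1"
    "\<And>s n. 0 < s \<Longrightarrow> s \<le> \<delta> \<Longrightarrow> weight s (point s n) \<le>
      K / s ^ CARD('r) * exp (b * norm (point s n) - c * (norm (point s n))\<^sup>2)"
proof -
  obtain K0 \<delta>0 where k: "K0 \<ge> 0" "0 < \<delta>0" "\<delta>0 \<le> 1" "\<And>\<epsilon>. 0 < \<epsilon> \<Longrightarrow> \<epsilon> \<le> \<delta>0 \<Longrightarrow> \<bar>\<kappa> \<epsilon>\<bar> \<le> K0 * \<epsilon> ^ 0"
    using \<kappa>_bound by metis
  obtain c where c: "c > 0" "\<And>x. x \<bullet> (A *v x) \<ge> c * (norm x)\<^sup>2" using positive_definite_lower[OF pd] by blast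
  define R where "R = real CARD('r)"
  define K where "K = exp (\<bar>u \<bullet> B\<bar> + \<bar>C\<bar> + \<bar>\<gamma>\<bar> + R * K0) * (2 * pi) powr (R / 2) / \<beta>0"
  have \<beta>0: "\<beta>0 > 0" unfolding \<beta>0_eq by simp
  show ?thesis
  proof (rule that[of K "norm B" "c / 2" \<delta>0])
    show "K \<ge> 0" using \<beta>0 by (simp add: K_def)
    fix s n assume s: "0 < s" "s \<le> \<delta>0"
    define t where "t = point s n"
    have s1: "s \<le> 1" "s\<^sup>2 \<le> 1" "s\<^sup>2 \<le> \<delta>0" "0 < s\<^sup>2"
    proof -
      show s1: "s \<le> 1" using s k by simp
      show "s\<^sup>2 \<le> 1" using s s1 by (simp add: power_le_one)
      have "s * s \<le> s * 1" using s s1 by (intro mult_left_mono) auto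
      thus "s\<^sup>2 \<le> \<delta>0" unfolding power2_eq_square using s by linarith
    qed (use s in simp)
    have kap: "\<bar>\<kappa> (s\<^sup>2)\<bar> \<le> K0" using k(4)[OF s1(4,3)] by simp
    define N where "N = \<beta>0 * exp (- \<gamma> * s\<^sup>2) * exp (- R * \<kappa> (s\<^sup>2)) * (2 * pi / s\<^sup>2) powr (- R / 2)"
    have N: "N > 0" using \<beta>0 s by (simp add: N_def)
    have "exp (\<alpha> / s\<^sup>2) * N * weight s t \<le> exp (\<alpha> / s\<^sup>2 - 1/2 * (t \<bullet> (A *v t)) - u \<bullet> B + s * (t \<bullet> B) - s\<^sup>2 * C)"
      using summand_le[OF s(1), of n] unfolding summand_eq_weight[OF s(1)] t_def[symmetric] N_def R_def .
    also have "\<dots> = exp (\<alpha> / s\<^sup>2) * exp (- 1/2 * (t \<bullet> (A *v t)) - u \<bullet> B + s * (t \<bullet> B) - s\<^sup>2 * C)"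
      by (simp add: exp_add[symmetric])
    finally have "weight s t \<le> exp (- 1/2 * (t \<bullet> (A *v t)) - u \<bullet> B + s * (t \<bullet> B) - s\<^sup>2 * C) / N"
      using N by (simp add: field_simps)
    also have "\<dots> = exp (- 1/2 * (t \<bullet> (A *v t)) - u \<bullet> B + s * (t \<bullet> B) - s\<^sup>2 * C + \<gamma> * s\<^sup>2 + R * \<kappa> (s\<^sup>2)) * (2 * pi / s\<^sup>2) powr (R / 2) / \<beta>0"
    proof -
      have "exp W / N = exp (W + \<gamma> * s\<^sup>2 + R * \<kappa> (s\<^sup>2)) * P powr (R / 2) / \<beta>0"
        if P: "P = 2 * pi / s\<^sup>2" "P > 0" for W P
        using P(2) \<beta>0 unfolding N_def P(1)[symmetric] exp_add by (simp add: exp_minus powr_minus field_simps)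
      thus ?thesis using s by simp
    qed
    also have "\<dots> \<le> exp ((norm B * norm t - c / 2 * (norm t)\<^sup>2) + (\<bar>u \<bullet> B\<bar> + \<bar>C\<bar> + \<bar>\<gamma>\<bar> + R * K0)) * (2 * pi / s\<^sup>2) powr (R / 2) / \<beta>0"
    proof (intro divide_right_mono mult_right_mono exp_le_cancel_iff[THEN iffD2])
      have "- 1/2 * (t \<bullet> (A *v t)) \<le> - (c / 2 * (norm t)\<^sup>2)" using c(2)[of t] by simp
      moreover have "- (u \<bullet> B) \<le> \<bar>u \<bullet> B\<bar>" by simp
      moreover have "s * (t \<bullet> B) \<le> norm B * norm t"
      proof -
        have "s * (t \<bullet> B) \<le> s * (norm t * norm B)" using s norm_cauchy_schwarz[of t B] by (intro mult_left_mono) auto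
        also have "\<dots> \<le> 1 * (norm t * norm B)" using s1 by (intro mult_right_mono) auto
        finally show ?thesis by (simp add: mult.commute)
      qed
      moreover have "- (s\<^sup>2 * C) \<le> \<bar>C\<bar>"
      proof -
        have "- (s\<^sup>2 * C) \<le> s\<^sup>2 * \<bar>C\<bar>" using s1(4) by (simp add: abs_if)
        also have "\<dots> \<le> 1 * \<bar>C\<bar>" using s1 by (intro mult_right_mono) auto
        finally show ?thesis by simp
      qed
      moreover have "\<gamma> * s\<^sup>2 \<le> \<bar>\<gamma>\<bar>"
      proof -
        have "\<gamma> * s\<^sup>2 \<le> \<bar>\<gamma>\<bar> * s\<^sup>2" by (intro mult_right_mono) auto
        also have "\<dots> \<le> \<bar>\<gamma>\<bar> * 1" using s1 by (intro mult_left_mono) auto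
        finally show ?thesis by simp
      qed
      moreover have "R * \<kappa> (s\<^sup>2) \<le> R * K0" using kap by (intro mult_left_mono) (auto simp: R_def)
      ultimately show "- 1/2 * (t \<bullet> (A *v t)) - u \<bullet> B + s * (t \<bullet> B) - s\<^sup>2 * C + \<gamma> * s\<^sup>2 + R * \<kappa> (s\<^sup>2)
        \<le> (norm B * norm t - c / 2 * (norm t)\<^sup>2) + (\<bar>u \<bullet> B\<bar> + \<bar>C\<bar> + \<bar>\<gamma>\<bar> + R * K0)" by linarith
    qed (use \<beta>0 in auto)
    also have "(2 * pi / s\<^sup>2) powr (R / 2) = (2 * pi) powr (R / 2) / s ^ CARD('r)"
    proof -
      have "s\<^sup>2 powr (R / 2) = s powr R" using s by (simp add: powr_powr flip: powr_numeral)
      also have "\<dots> = s ^ CARD('r)" using s by (simp add: R_def powr_realpow)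
      finally show ?thesis using s by (simp add: powr_divide)
    qed
    finally show "weight s (point s n) \<le> K / s ^ CARD('r) * exp (norm B * norm (point s n) - c / 2 * (norm (point s n))\<^sup>2)"
      unfolding t_def[symmetric] K_def exp_add by (simp add: mult_ac)
  qed (use c k in auto)
qed

text \<open>Extended by 0 from nonnegative to all integer vectors, to be compared with full lattice
  sums, and reflected by \<open>v = - n\<close> so that the arguments are
  \<open>u / s + s * v\<close>.\<close>

definition shifted_weight :: "real \<Rightarrow> int^'r \<Rightarrow> real" where
  "shifted_weight s v = (if \<forall>i. v $ i \<le> 0 then weight s (point s (\<chi> i. nat (- (v $ i)))) else 0)"

lemma point_lattice:
  assumes "\<forall>i. v $ i \<le> 0"
  shows "point s (\<chi> i. nat (- (v $ i))) = (1 / s) *\<^sub>R u + s *\<^sub>R ivec v"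
  using assms by (simp add: point_def vec_eq_iff algebra_simps)

lemma infsum_shifted_weight:
  "(\<Sum>\<^sub>\<infinity>n. weight s (point s n)) = (\<Sum>\<^sub>\<infinity>v. shifted_weight s v)"
proof -
  let ?h = "\<lambda>n::nat^'r. (\<chi> i. - int (n $ i)) :: int^'r"
  have bij: "bij_betw ?h UNIV {v. \<forall>i. v $ i \<le> 0}"
    by (rule bij_betw_byWitness[of _ "\<lambda>v. \<chi> i. nat (- (v $ i))"]) (auto simp: vec_eq_iff)
  have "(\<Sum>\<^sub>\<infinity>v. shifted_weight s v) = (\<Sum>\<^sub>\<infinity>v\<in>{v. \<forall>i. v $ i \<le> 0}. shifted_weight s v)"
    by (rule infsum_cong_neutral) (auto simp: shifted_weight_def)
  also have "\<dots> = (\<Sum>\<^sub>\<infinity>n. shifted_weight s (?h n))" by (rule infsum_reindex_bij_betw[OF bij, symmetric])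
  also have "\<dots> = (\<Sum>\<^sub>\<infinity>n. weight s (point s n))" by (intro infsum_cong) (simp add: shifted_weight_def)
  finally show ?thesis by simp
qed

lemma kpoly_C: "kpoly UNIV (C_coeff p B \<xi>)"
  by (rule kpoly_C_coeff[OF sqrt_closed_field_UNIV]) auto

text \<open>Inside the local domain this is \<open>local_expansion\<close> times the Gaussian.
  Outside it the weight and the truncated expansion are negligible separately, since
  \<open>1 \<le> s * (1 + norm t) ^ L / \<rho>\<close> may be inserted to any power.\<close>

lemma shifted_weight_expansion:
  obtains K c \<delta> where "K \<ge> 0" "c > 0" "0 < \<delta>" "\<delta> \<le> 1"
    "\<And>s v. 0 < s \<Longrightarrow> s \<le> \<delta> \<Longrightarrow>
      \<bar>shifted_weight s v - (\<Sum>p<M. s ^ p * (C_coeff p B \<xi> ((1 / s) *\<^sub>R u + s *\<^sub>R ivec v) * gauss_weight At ((1 / s) *\<^sub>R u + s *\<^sub>R ivec v)))\<bar>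
      \<le> K * s ^ M * exp (- c * (norm ((1 / s) *\<^sub>R u + s *\<^sub>R ivec v))\<^sup>2)"
proof -
  let ?d = "CARD('r)"
  obtain \<rho> L where \<rho>: "\<rho> > 0" "\<And>s t i. (s, t) \<in> local_domain \<rho> L \<Longrightarrow> \<bar>t $ i\<bar> * s \<le> u $ i / 2"
    and loc: "\<And>M. \<exists>K L'. K \<ge> 0 \<and> (\<forall>s t. (s, t) \<in> local_domain \<rho> L \<longrightarrow>
      \<bar>exp (\<Sum>i\<in>UNIV. local_exponent (B $ i) (u $ i) s (t $ i)) - (\<Sum>p<M. C_coeff p B (\<chi> i. 1 / (exp (u $ i) - 1)) t * s ^ p)\<bar> \<le> K * (1 + norm t) ^ L' * s ^ M)"
  proof (rule local_expansion[where u=u and B=B, OF u(1)], goal_cases)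
      case 1 show ?case by (rule 1(1)) (rule 1(2-4), assumption?)+
    qed
  have \<xi>': "(\<chi> i. 1 / (exp (u $ i) - 1)) = \<xi>" by (simp add: vec_eq_iff \<xi>_eq)
  obtain K1 L1 where K1: "K1 \<ge> 0" "\<And>s t. (s, t) \<in> local_domain \<rho> L \<Longrightarrow>
      \<bar>exp (\<Sum>i\<in>UNIV. local_exponent (B $ i) (u $ i) s (t $ i)) - (\<Sum>p<M. C_coeff p B \<xi> t * s ^ p)\<bar> \<le> K1 * (1 + norm t) ^ L1 * s ^ M"
    using loc[of M] unfolding \<xi>' by blast
  obtain K2 b c2 \<delta> where K2: "K2 \<ge> 0" "b \<ge> 0" "c2 > 0" "0 < \<delta>" "\<delta> \<le> 1"
    "\<And>s n. 0 < s \<Longrightarrow> s \<le> \<delta> \<Longrightarrow> weight s (point s n) \<le>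
      K2 / s ^ ?d * exp (b * norm (point s n) - c2 * (norm (point s n))\<^sup>2)"
  proof (rule weight_global_bound, goal_cases)
      case 1 show ?case by (rule 1(1)) (rule 1(2-7), assumption?)+
    qed
  obtain c3 where c3: "c3 > 0" "\<And>x. gauss_weight At x \<le> exp (- c3 * (norm x)\<^sup>2)"
    using gauss_weight_le[OF At_pd] by blast
  have gw0: "gauss_weight At x \<ge> 0" for x by (simp add: gauss_weight_def)
  have "\<forall>p. \<exists>K L. K \<ge> 0 \<and> (\<forall>x. \<bar>C_coeff p B \<xi> x\<bar> \<le> K * (1 + norm x) ^ L)"
    using kpoly_bound[OF kpoly_C] by blast
  then obtain KC LC where KC: "\<And>p. KC p \<ge> 0" "\<And>p x. \<bar>C_coeff p B \<xi> x\<bar> \<le> KC p * (1 + norm x) ^ LC p" by metis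
  \<comment> \<open>\<open>c2\<close> is halved twice below, once for the linear term and once for
    the polynomial factor; \<open>c3\<close> is halved once.\<close>
  define c where "c = min (c2 / 4) (c3 / 2)"
  have c: "c > 0" "c \<le> c2 / 4" "c \<le> c3 / 2" using K2 c3 by (auto simp: c_def)
  define E where "E l a = exp ((real l)\<^sup>2 / (2 * a))" for l a
  have mono: "exp (- a * (norm x)\<^sup>2) \<le> exp (- c * (norm x)\<^sup>2)" if "c \<le> a" for a and x :: "real^'r"
    using that by (simp add: mult_right_mono)
  define KA where "KA = K1 * E L1 c3"
  define KB where "KB = K2 * exp (b\<^sup>2 / (2 * c2)) * E (L * (M + ?d)) (c2 / 2) / \<rho> ^ (M + ?d)"
  define KD where "KD = (\<Sum>p<M. KC p * E (LC p + L * M) c3 / \<rho> ^ M)"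
  show ?thesis
  proof (rule that[of "KA + (KB + KD)" c \<delta>])
    have E0: "E l a \<ge> 0" for l a by (simp add: E_def)
    have nn: "KA \<ge> 0" "KB \<ge> 0" "KD \<ge> 0"
      using K1 K2 KC \<rho>(1) E0 by (auto simp: KA_def KB_def KD_def intro!: sum_nonneg)
    thus "KA + (KB + KD) \<ge> 0" by simp
    fix s and v :: "int^'r" assume s: "0 < s" "s \<le> \<delta>"
    have s1: "s \<le> 1" using s K2 by simp
    define t where "t = (1 / s) *\<^sub>R u + s *\<^sub>R ivec v"
    let ?G = "exp (- c * (norm t)\<^sup>2)"
    let ?S = "\<Sum>p<M. s ^ p * (C_coeff p B \<xi> t * gauss_weight At t)"
    have "\<bar>shifted_weight s v - ?S\<bar> \<le> (KA + (KB + KD)) * s ^ M * ?G"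
    proof (cases "(s, t) \<in> local_domain \<rho> L")
      case True
      \<comment> \<open>In the local domain \<open>t $ i * s\<close> stays below
        \<open>u $ i\<close>, so the lattice point comes from a vector \<open>n\<close> with
        positive entries and the extension by 0 is not felt.\<close>
      have neg: "\<forall>i. v $ i \<le> 0"
      proof
        fix i
        have "\<bar>t $ i\<bar> * s \<le> u $ i / 2" by (rule \<rho>(2)[OF True])
        moreover have "t $ i * s \<le> \<bar>t $ i\<bar> * s" using s by (intro mult_right_mono) auto
        moreover have "t $ i * s = u $ i + s\<^sup>2 * real_of_int (v $ i)"
          using s by (simp add: t_def power2_eq_square field_simps)
        ultimately have "s\<^sup>2 * real_of_int (v $ i) < 0" using u(1)[of i] by linarith
        thus "v $ i \<le> 0" using s by (simp add: mult_less_0_iff)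
      qed
      have sw: "shifted_weight s v = gauss_weight At t * exp (\<Sum>i\<in>UNIV. local_exponent (B $ i) (u $ i) s (t $ i))"
        using neg by (simp add: shifted_weight_def point_lattice[OF neg] weight_def t_def)
      have "?S = gauss_weight At t * (\<Sum>p<M. C_coeff p B \<xi> t * s ^ p)" by (simp add: sum_distrib_left mult_ac)
      hence "\<bar>shifted_weight s v - ?S\<bar> = gauss_weight At t * \<bar>exp (\<Sum>i\<in>UNIV. local_exponent (B $ i) (u $ i) s (t $ i)) - (\<Sum>p<M. C_coeff p B \<xi> t * s ^ p)\<bar>"
        unfolding sw using gw0[of t] by (simp add: right_diff_distrib[symmetric] abs_mult)
      also have "\<dots> \<le> exp (- c3 * (norm t)\<^sup>2) * (K1 * (1 + norm t) ^ L1 * s ^ M)"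
        using c3(2) K1(2)[OF True] by (intro mult_mono) auto
      also have "\<dots> = K1 * s ^ M * ((1 + norm t) ^ L1 * exp (- c3 * (norm t)\<^sup>2))" by simp
      also have "\<dots> \<le> K1 * s ^ M * (E L1 c3 * exp (- (c3 / 2) * (norm t)\<^sup>2))"
        unfolding E_def using K1 s by (intro mult_left_mono power_exp_absorb c3) auto
      also have "\<dots> \<le> K1 * s ^ M * (E L1 c3 * ?G)"
        using K1 s E0 by (intro mult_left_mono mono c) auto
      also have "\<dots> = KA * (s ^ M * ?G)" by (simp add: KA_def)
      also have "\<dots> \<le> (KA + (KB + KD)) * (s ^ M * ?G)" using nn s by (intro mult_right_mono) auto
      finally show ?thesis by (simp add: mult.assoc)
    next
      case False
      hence big: "1 \<le> s * (1 + norm t) ^ L / \<rho>" using s s1 \<rho>(1) by (simp add: local_domain_def)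
      hence bigm: "1 \<le> (s * (1 + norm t) ^ L / \<rho>) ^ m" for m by (rule one_le_power)
      have A: "\<bar>shifted_weight s v\<bar> \<le> KB * (s ^ M * ?G)"
      proof (cases "\<forall>i. v $ i \<le> 0")
        case neg: True
        have "weight s t \<ge> 0" by (simp add: weight_def gw0)
        hence "\<bar>shifted_weight s v\<bar> = weight s t * 1" using neg by (simp add: shifted_weight_def point_lattice[OF neg] t_def)
        \<comment> \<open>Of the \<open>M + ?d\<close> inserted factors, \<open>?d\<close> cancel
          the lost power of \<open>s\<close> and \<open>M\<close> give the required order.\<close>
        also have "\<dots> \<le> (K2 / s ^ ?d * exp (b * norm t - c2 * (norm t)\<^sup>2)) * (s * (1 + norm t) ^ L / \<rho>) ^ (M + ?d)"
          using K2(6)[OF s, of "\<chi> i. nat (- (v $ i))"] K2(1) s bigm[of "M + ?d"] unfolding point_lattice[OF neg] t_def[symmetric]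
          by (intro mult_mono) auto
        also have "\<dots> = K2 / \<rho> ^ (M + ?d) * s ^ M * ((1 + norm t) ^ (L * (M + ?d)) * exp (b * norm t - c2 * (norm t)\<^sup>2))"
          using s by (simp add: power_mult_distrib power_divide power_add power_mult field_simps)
        also have "\<dots> \<le> K2 / \<rho> ^ (M + ?d) * s ^ M * ((1 + norm t) ^ (L * (M + ?d)) * (exp (b\<^sup>2 / (2 * c2)) * exp (- (c2 / 2) * (norm t)\<^sup>2)))"
          using K2 \<rho>(1) s by (intro mult_left_mono exp_linear_quadratic) auto
        also have "\<dots> = K2 / \<rho> ^ (M + ?d) * s ^ M * exp (b\<^sup>2 / (2 * c2)) * ((1 + norm t) ^ (L * (M + ?d)) * exp (- (c2 / 2) * (norm t)\<^sup>2))"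
          by simp
        also have "\<dots> \<le> K2 / \<rho> ^ (M + ?d) * s ^ M * exp (b\<^sup>2 / (2 * c2)) * (E (L * (M + ?d)) (c2 / 2) * exp (- (c2 / 2 / 2) * (norm t)\<^sup>2))"
          unfolding E_def using K2 \<rho>(1) s by (intro mult_left_mono power_exp_absorb) auto
        also have "\<dots> \<le> K2 / \<rho> ^ (M + ?d) * s ^ M * exp (b\<^sup>2 / (2 * c2)) * (E (L * (M + ?d)) (c2 / 2) * ?G)"
          using K2 \<rho>(1) s E0 c by (intro mult_left_mono mono) auto
        also have "\<dots> = KB * (s ^ M * ?G)" by (simp add: KB_def)
        finally show ?thesis .
      next
        case neg: False
        have "shifted_weight s v = 0" unfolding shifted_weight_def by (rule if_not_P[OF neg])
        thus ?thesis using nn s by simp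
      qed
      have "\<bar>s ^ p * (C_coeff p B \<xi> t * gauss_weight At t)\<bar> \<le> (KC p * E (LC p + L * M) c3 / \<rho> ^ M) * (s ^ M * ?G)" for p
      proof -
        have sp: "s ^ p \<le> 1" using s s1 by (intro power_le_one) auto
        have "\<bar>s ^ p * (C_coeff p B \<xi> t * gauss_weight At t)\<bar> = s ^ p * (\<bar>C_coeff p B \<xi> t\<bar> * gauss_weight At t) * 1"
          using s gw0[of t] by (simp add: abs_mult)
        also have "\<dots> \<le> 1 * ((KC p * (1 + norm t) ^ LC p) * exp (- c3 * (norm t)\<^sup>2)) * (s * (1 + norm t) ^ L / \<rho>) ^ M"
        proof (rule mult_mono)
          show "s ^ p * (\<bar>C_coeff p B \<xi> t\<bar> * gauss_weight At t) \<le> 1 * ((KC p * (1 + norm t) ^ LC p) * exp (- c3 * (norm t)\<^sup>2))"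
          proof (rule mult_mono)
            show "\<bar>C_coeff p B \<xi> t\<bar> * gauss_weight At t \<le> (KC p * (1 + norm t) ^ LC p) * exp (- c3 * (norm t)\<^sup>2)"
              by (rule mult_mono) (use KC c3 gw0 in auto)
          qed (use sp gw0 in auto)
        qed (use bigm KC in auto)
        also have "\<dots> = KC p / \<rho> ^ M * s ^ M * ((1 + norm t) ^ (LC p + L * M) * exp (- c3 * (norm t)\<^sup>2))"
          by (simp add: power_mult_distrib power_divide power_add power_mult field_simps)
        also have "\<dots> \<le> KC p / \<rho> ^ M * s ^ M * (E (LC p + L * M) c3 * exp (- (c3 / 2) * (norm t)\<^sup>2))"
          unfolding E_def using KC \<rho>(1) s by (intro mult_left_mono power_exp_absorb c3) auto
        also have "\<dots> \<le> KC p / \<rho> ^ M * s ^ M * (E (LC p + L * M) c3 * ?G)"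
          using KC \<rho>(1) s E0 c by (intro mult_left_mono mono) auto
        finally show ?thesis by (simp add: mult_ac)
      qed
      hence "\<bar>?S\<bar> \<le> (\<Sum>p<M. (KC p * E (LC p + L * M) c3 / \<rho> ^ M) * (s ^ M * ?G))"
        by (intro order_trans[OF sum_abs] sum_mono)
      also have "\<dots> = KD * (s ^ M * ?G)" by (simp only: KD_def sum_distrib_right)
      finally have D: "\<bar>?S\<bar> \<le> KD * (s ^ M * ?G)" .
      have "\<bar>shifted_weight s v - ?S\<bar> \<le> \<bar>shifted_weight s v\<bar> + \<bar>?S\<bar>" by (rule abs_triangle_ineq4)
      also have "\<dots> \<le> KB * (s ^ M * ?G) + KD * (s ^ M * ?G)" by (intro add_mono A D)
      also have "\<dots> = (KB + KD) * (s ^ M * ?G)" by (rule distrib_right[symmetric])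
      also have "\<dots> \<le> (KA + (KB + KD)) * (s ^ M * ?G)" using nn s by (intro mult_right_mono) auto
      finally show ?thesis by (simp only: mult.assoc)
    qed
    thus "\<bar>shifted_weight s v - (\<Sum>p<M. s ^ p * (C_coeff p B \<xi> ((1 / s) *\<^sub>R u + s *\<^sub>R ivec v) * gauss_weight At ((1 / s) *\<^sub>R u + s *\<^sub>R ivec v)))\<bar>
      \<le> (KA + (KB + KD)) * s ^ M * exp (- c * (norm ((1 / s) *\<^sub>R u + s *\<^sub>R ivec v))\<^sup>2)" unfolding t_def .
  qed (use c K2 in auto)
qed

end

lemma exp_minus_one_bound: "\<bar>exp x - 1\<bar> \<le> \<bar>x\<bar> * exp \<bar>x :: real\<bar>"
proof (cases "x \<ge> 0")
  case True
  have "exp x * (1 - x) \<le> exp x * exp (- x)" using exp_ge_add_one_self[of "- x"] by (intro mult_left_mono) auto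
  thus ?thesis using True by (simp add: algebra_simps flip: exp_add)
next
  case False
  have "1 - exp x \<le> - x * 1" using exp_ge_add_one_self[of x] by linarith
  also have "\<dots> \<le> - x * exp \<bar>x\<bar>" using False by (intro mult_left_mono) auto
  finally show ?thesis using False by simp
qed

lemma sqrt_closed_field_algebraic: "sqrt_closed_field {x :: real. algebraic x}"
  unfolding sqrt_closed_field_def
  by (auto intro: algebraic_add algebraic_diff algebraic_mult algebraic_divide algebraic_sqrt rat_imp_algebraic)

lemma algebraic_det: "(\<And>i j. algebraic (M $ i $ j :: real)) \<Longrightarrow> algebraic (det M)"
  unfolding det_def by (intro algebraic_sum algebraic_mult algebraic_prod) (auto intro: rat_imp_algebraic)

context nahm_asymptotics
begin

definition I :: "nat \<Rightarrow> real" where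
  "I p = (LINT t|lborel. C_coeff p B \<xi> t * gauss_weight At t)"

text \<open>The pointwise error is a Gaussian times \<open>s ^ M\<close>, whose lattice sum times
  \<open>s ^ CARD('r)\<close> is bounded uniformly in the translate \<open>u / s\<close>; each
  coefficient's lattice sum is then replaced by its integral.\<close>

lemma weight_sum_expansion:
  obtains K \<delta> where "K \<ge> 0" "0 < \<delta>" "\<delta> \<le> 1"
    "\<And>s. 0 < s \<Longrightarrow> s \<le> \<delta> \<Longrightarrow>
      \<bar>s ^ CARD('r) * (\<Sum>\<^sub>\<infinity>n. weight s (point s n)) - (\<Sum>p<M. s ^ p * I p)\<bar> \<le> K * s ^ M"
proof -
  let ?d = "CARD('r)"
  define g where "g p = (\<lambda>t. C_coeff p B \<xi> t * gauss_weight At t)" for p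
  interpret G: smooth_gaussian_class "gauss_class At" by (rule smooth_gaussian_class_gauss_class[OF At_sym At_pd])
  have gc: "g p \<in> gauss_class At" for p using kpoly_C by (auto simp: g_def gauss_class_def)
  obtain K1 c \<delta> where K1: "K1 \<ge> 0" "c > 0" "0 < \<delta>" "\<delta> \<le> 1" and
    ex: "\<forall>s v. 0 < s \<longrightarrow> s \<le> \<delta> \<longrightarrow>
      \<bar>shifted_weight s v - (\<Sum>p<M. s ^ p * g p ((1 / s) *\<^sub>R u + s *\<^sub>R ivec v))\<bar>
      \<le> K1 * s ^ M * exp (- c * (norm ((1 / s) *\<^sub>R u + s *\<^sub>R ivec v))\<^sup>2)"
    unfolding g_def
  proof (rule shifted_weight_expansion[of M], goal_cases)
    case 1 show ?case by (rule 1(1)) (use 1(2-6) in auto)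
  qed
  obtain K2 where K2: "K2 \<ge> 0" "\<And>(s::real) (\<theta>::real^'r). 0 < s \<Longrightarrow> s \<le> 1 \<Longrightarrow>
    (\<lambda>n. exp (- c * (norm (\<theta> + s *\<^sub>R ivec n))\<^sup>2)) summable_on UNIV \<and>
    s ^ ?d * (\<Sum>\<^sub>\<infinity>n. exp (- c * (norm (\<theta> + s *\<^sub>R ivec n))\<^sup>2)) \<le> K2"
    using gaussian_lattice_bound[OF K1(2)] by blast
  have "\<exists>K. K \<ge> 0 \<and> (\<forall>s \<theta>. 0 < s \<longrightarrow> s \<le> 1 \<longrightarrow> \<bar>s ^ ?d * lattice_sum (g p) s \<theta> - I p\<bar> \<le> K * s ^ M)" for p
  proof (rule G.lattice_sum_asymp[OF gc[of p], of M], goal_cases)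
    case (1 K) thus ?case by (intro exI[of _ K]) (simp add: I_def g_def)
  qed
  then obtain KP where KP: "\<And>p. KP p \<ge> 0"
    "\<And>p s \<theta>. 0 < s \<Longrightarrow> s \<le> 1 \<Longrightarrow> \<bar>s ^ ?d * lattice_sum (g p) s \<theta> - I p\<bar> \<le> KP p * s ^ M" by metis
  show ?thesis
  proof (rule that[of "K1 * K2 + (\<Sum>p<M. KP p)" \<delta>])
    show "K1 * K2 + (\<Sum>p<M. KP p) \<ge> 0" using K1 K2 KP by (simp add: sum_nonneg)
    fix s :: real assume s: "0 < s" "s \<le> \<delta>"
    have s1: "s \<le> 1" using s K1 by simp
    define \<theta> where "\<theta> = (1 / s) *\<^sub>R u"
    let ?e = "\<lambda>n. exp (- c * (norm (\<theta> + s *\<^sub>R ivec n))\<^sup>2)"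
    define R where "R v = shifted_weight s v - (\<Sum>p<M. s ^ p * g p (\<theta> + s *\<^sub>R ivec v))" for v
    have sm: "(\<lambda>n. K1 * s ^ M * ?e n) summable_on UNIV"
      by (intro summable_on_cmult_right) (use K2(2)[OF s(1) s1] in blast)
    have Rb: "norm (R v) \<le> K1 * s ^ M * ?e v" for v
      using ex s by (simp add: R_def \<theta>_def)
    have "(\<lambda>v. norm (R v)) summable_on UNIV"
      by (rule Infinite_Sum.abs_summable_on_comparison_test'[OF sm Rb])
    hence Rs: "(R has_sum infsum R UNIV) UNIV" by (rule has_sum_infsum[OF abs_summable_summable])
    have "norm (infsum R UNIV) \<le> (\<Sum>\<^sub>\<infinity>n. K1 * s ^ M * ?e n)"
      by (rule norm_infsum_le[OF Rs has_sum_infsum[OF sm] Rb])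
    also have "\<dots> = K1 * s ^ M * (\<Sum>\<^sub>\<infinity>n. ?e n)" by (rule infsum_cmult_right')
    finally have "s ^ ?d * \<bar>infsum R UNIV\<bar> \<le> s ^ ?d * (K1 * s ^ M * (\<Sum>\<^sub>\<infinity>n. ?e n))"
      using s by (intro mult_left_mono) auto
    also have "\<dots> = K1 * s ^ M * (s ^ ?d * (\<Sum>\<^sub>\<infinity>n. ?e n))" by simp
    also have "\<dots> \<le> K1 * s ^ M * K2" using K2(2)[OF s(1) s1] K1 s by (intro mult_left_mono) auto
    finally have Rbound: "s ^ ?d * \<bar>infsum R UNIV\<bar> \<le> K1 * s ^ M * K2" .
    have gs: "((\<lambda>v. g p (\<theta> + s *\<^sub>R ivec v)) has_sum lattice_sum (g p) s \<theta>) UNIV" for p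
    proof -
      have "(\<lambda>n. norm (g p (\<theta> + s *\<^sub>R ivec n))) summable_on UNIV"
      proof (rule gaussian_bounded_lattice[OF G.bounded[OF gc[of p]]], goal_cases)
        case (1 K) show ?case using 1(2)[OF s(1) s1, of \<theta>] by (rule conjunct1)
      qed
      thus ?thesis unfolding lattice_sum_def by (rule has_sum_infsum[OF abs_summable_summable])
    qed
    have "((\<lambda>v. \<Sum>p<m. s ^ p * g p (\<theta> + s *\<^sub>R ivec v)) has_sum (\<Sum>p<m. s ^ p * lattice_sum (g p) s \<theta>)) UNIV" for m
    proof (induction m)
      case (Suc m) show ?case unfolding sum.lessThan_Suc by (rule has_sum_add[OF Suc.IH has_sum_cmult_right[OF gs]])
    qed simp
    note has_sum_add[OF Rs this[of M]]
    moreover have "(\<lambda>v. R v + (\<Sum>p<M. s ^ p * g p (\<theta> + s *\<^sub>R ivec v))) = shifted_weight s"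
      by (rule ext) (simp add: R_def)
    ultimately
    have "(shifted_weight s has_sum (infsum R UNIV + (\<Sum>p<M. s ^ p * lattice_sum (g p) s \<theta>))) UNIV"
      by simp
    hence W: "(\<Sum>\<^sub>\<infinity>n. weight s (point s n)) = infsum R UNIV + (\<Sum>p<M. s ^ p * lattice_sum (g p) s \<theta>)"
      unfolding infsum_shifted_weight by (rule infsumI)
    have "s ^ ?d * (\<Sum>\<^sub>\<infinity>n. weight s (point s n)) - (\<Sum>p<M. s ^ p * I p)
      = s ^ ?d * infsum R UNIV + (\<Sum>p<M. s ^ p * (s ^ ?d * lattice_sum (g p) s \<theta> - I p))"
    proof -
      have "(\<Sum>p<M. s ^ p * (s ^ ?d * lattice_sum (g p) s \<theta> - I p))
        = s ^ ?d * (\<Sum>p<M. s ^ p * lattice_sum (g p) s \<theta>) - (\<Sum>p<M. s ^ p * I p)"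
        by (simp add: right_diff_distrib sum_subtractf sum_distrib_left mult.left_commute)
      thus ?thesis unfolding W distrib_left by linarith
    qed
    also have "\<bar>\<dots>\<bar> \<le> s ^ ?d * \<bar>infsum R UNIV\<bar> + (\<Sum>p<M. \<bar>s ^ p * (s ^ ?d * lattice_sum (g p) s \<theta> - I p)\<bar>)"
      using s by (intro order_trans[OF abs_triangle_ineq] add_mono sum_abs) (simp add: abs_mult)
    also have "\<dots> \<le> K1 * s ^ M * K2 + (\<Sum>p<M. KP p * s ^ M)"
    proof (intro add_mono Rbound sum_mono)
      fix p
      have "\<bar>s ^ p * (s ^ ?d * lattice_sum (g p) s \<theta> - I p)\<bar> \<le> 1 * (KP p * s ^ M)"
        unfolding abs_mult using s s1 KP by (intro mult_mono) (auto intro: power_le_one)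
      thus "\<bar>s ^ p * (s ^ ?d * lattice_sum (g p) s \<theta> - I p)\<bar> \<le> KP p * s ^ M" by simp
    qed
    also have "\<dots> = (K1 * K2 + (\<Sum>p<M. KP p)) * s ^ M" by (simp add: distrib_right sum_distrib_right)
    finally show "\<bar>s ^ ?d * (\<Sum>\<^sub>\<infinity>n. weight s (point s n)) - (\<Sum>p<M. s ^ p * I p)\<bar> \<le> (K1 * K2 + (\<Sum>p<M. KP p)) * s ^ M" .
  qed (use K1 in auto)
qed

definition coef :: "nat \<Rightarrow> real" where
  "coef p = det At powr (1/2) * (2 * pi) powr (- real CARD('r) / 2) * I (2 * p)"

lemma I_odd: "odd p \<Longrightarrow> I p = 0"
  unfolding I_def by (rule gaussian_integral_odd[OF At_sym At_pd kpoly_C]) (simp add: C_coeff_uminus)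

lemma det_At: "det At > 0"
  by (rule gaussian_integral_kpoly(1)[OF At_sym At_pd sqrt_closed_field_UNIV _ kpoly_C]) simp

lemma coef_0: "coef 0 = 1"
proof -
  have C0: "C_coeff 0 B \<xi> = (\<lambda>t. 1)" by (rule ext) (rule C_coeff_0)
  show ?thesis unfolding coef_def I_def
    using gaussian_integral_kpoly(3)[OF At_sym At_pd sqrt_closed_field_UNIV _ kpoly_C C0] unfolding mult_0_right by simp
qed

text \<open>The odd integrals vanish, so only powers of \<epsilon> remain; factoring out the leading
  Gaussian integral leaves 1 as constant term.\<close>

lemma sum_I:
  "(2 * pi) powr (- real CARD('r) / 2) * (\<Sum>p<2 * Suc N. sqrt \<epsilon> ^ p * I p)
    = det At powr (-1/2) * (1 + (\<Sum>p=1..N. coef p * \<epsilon> ^ p))" if "\<epsilon> \<ge> 0"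
proof -
  have "(\<Sum>p<2 * n. sqrt \<epsilon> ^ p * I p) = (\<Sum>p<n. \<epsilon> ^ p * I (2 * p))" for n
    by (induction n) (use that in \<open>auto simp: I_odd power_mult\<close>)
  hence "(2 * pi) powr (- real CARD('r) / 2) * (\<Sum>p<2 * Suc N. sqrt \<epsilon> ^ p * I p)
      = (\<Sum>p<Suc N. (2 * pi) powr (- real CARD('r) / 2) * (\<epsilon> ^ p * I (2 * p)))" by (simp only: sum_distrib_left)
  also have "\<dots> = (\<Sum>p<Suc N. det At powr (-1/2) * (coef p * \<epsilon> ^ p))"
  proof (intro sum.cong refl)
    fix p
    have "det At powr (-1/2) * det At powr (1/2) = 1" using det_At by (simp flip: powr_add)
    hence "det At powr (-1/2) * (coef p * \<epsilon> ^ p) = 1 * ((2 * pi) powr (- real CARD('r) / 2) * I (2 * p) * \<epsilon> ^ p)"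
      unfolding coef_def by (metis mult.assoc)
    thus "(2 * pi) powr (- real CARD('r) / 2) * (\<epsilon> ^ p * I (2 * p)) = det At powr (-1/2) * (coef p * \<epsilon> ^ p)"
      by (simp only: mult_1 mult_ac)
  qed
  also have "\<dots> = det At powr (-1/2) * (1 + (\<Sum>p=1..N. coef p * \<epsilon> ^ p))"
    unfolding sum_distrib_left[symmetric] sum.lessThan_Suc_shift
    by (simp add: coef_0 sum.atLeast1_atMost_eq)
  finally show ?thesis .
qed

lemma nahm_sum_eq:
  assumes \<epsilon>: "\<epsilon> > 0"
  shows "nahm_sum A B C (exp (- \<epsilon>)) * exp (- \<alpha> / \<epsilon>) = \<beta>0 * exp (- \<gamma> * \<epsilon>) *
    (exp (- real CARD('r) * \<kappa> \<epsilon>) * ((2 * pi) powr (- real CARD('r) / 2) *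
      (sqrt \<epsilon> ^ CARD('r) * (\<Sum>\<^sub>\<infinity>n. weight (sqrt \<epsilon>) (point (sqrt \<epsilon>) n)))))"
proof -
  define s where "s = sqrt \<epsilon>"
  have s: "s > 0" "s\<^sup>2 = \<epsilon>" using \<epsilon> by (auto simp: s_def)
  define W where "W = (\<Sum>\<^sub>\<infinity>n. weight s (point s n))"
  have "nahm_sum A B C (exp (- \<epsilon>)) = (\<Sum>\<^sub>\<infinity>n. summand (s\<^sup>2) n)" by (simp add: nahm_sum_def summand_def s)
  also have "\<dots> = exp (\<alpha> / \<epsilon>) * (\<beta>0 * exp (- \<gamma> * \<epsilon>) * exp (- real CARD('r) * \<kappa> \<epsilon>) *
    (2 * pi / \<epsilon>) powr (- real CARD('r) / 2)) * W"
    unfolding W_def infsum_cmult_right'[symmetric] s(2)[symmetric] by (intro infsum_cong summand_eq_weight s(1))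
  also have "(2 * pi / \<epsilon>) powr (- real CARD('r) / 2) = (2 * pi) powr (- real CARD('r) / 2) * s ^ CARD('r)"
  proof -
    have "\<epsilon> powr (real CARD('r) / 2) = s powr real CARD('r)" using s by (simp add: powr_powr flip: s(2) powr_numeral)
    also have "\<dots> = s ^ CARD('r)" using s by (simp add: powr_realpow)
    finally have e: "\<epsilon> powr (real CARD('r) / 2) = s ^ CARD('r)" .
    have "(2 * pi / \<epsilon>) powr (- real CARD('r) / 2) = (2 * pi) powr (- real CARD('r) / 2) / \<epsilon> powr (- (real CARD('r) / 2))"
      using \<epsilon> by (simp add: powr_divide)
    also have "\<epsilon> powr (- (real CARD('r) / 2)) = inverse (s ^ CARD('r))" unfolding powr_minus e ..
    also have "a / inverse b = a * b" for a b :: real by (simp add: divide_inverse)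
    finally show ?thesis .
  qed
  finally have "nahm_sum A B C (exp (- \<epsilon>)) * exp (- \<alpha> / \<epsilon>) = (exp (\<alpha> / \<epsilon>) * exp (- \<alpha> / \<epsilon>)) * (\<beta>0 * exp (- \<gamma> * \<epsilon>) *
    (exp (- real CARD('r) * \<kappa> \<epsilon>) * ((2 * pi) powr (- real CARD('r) / 2) * (s ^ CARD('r) * W))))"
    by (simp only: mult_ac)
  thus ?thesis by (simp add: W_def s_def flip: exp_add)
qed

theorem nahm_sum_asymp:
  "(\<lambda>\<epsilon>. nahm_sum A B C (exp (- \<epsilon>)) * exp (- \<alpha> / \<epsilon>)
      - det At powr (-1/2) * \<beta>0 * exp (- \<gamma> * \<epsilon>) * (1 + (\<Sum>p=1..N. coef p * \<epsilon> ^ p)))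
    \<in> o[at_right 0](\<lambda>\<epsilon>. \<epsilon> ^ N)"
proof -
  define d where "d = real CARD('r)"
  define T where "T = (2 * pi) powr (- d / 2)"
  define J where "J \<epsilon> = det At powr (-1/2) * (1 + (\<Sum>p=1..N. coef p * \<epsilon> ^ p))" for \<epsilon>
  define X where "X \<epsilon> = T * (sqrt \<epsilon> ^ CARD('r) * (\<Sum>\<^sub>\<infinity>n. weight (sqrt \<epsilon>) (point (sqrt \<epsilon>) n)))" for \<epsilon>
  have T0: "T \<ge> 0" by (simp add: T_def)
  \<comment> \<open>The order \<open>2 * Suc N\<close> in \<open>s\<close> is order
    \<open>Suc N\<close> in \<epsilon>, one more than needed for an error
    \<open>o(\<epsilon> ^ N)\<close>.\<close>
  obtain K1 \<delta>1 where K1: "K1 \<ge> 0" "0 < \<delta>1" "\<delta>1 \<le> 1" and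
    ex: "\<And>s. 0 < s \<Longrightarrow> s \<le> \<delta>1 \<Longrightarrow>
      \<bar>s ^ CARD('r) * (\<Sum>\<^sub>\<infinity>n. weight s (point s n)) - (\<Sum>p<2 * Suc N. s ^ p * I p)\<bar> \<le> K1 * s ^ (2 * Suc N)"
  proof (rule weight_sum_expansion[of "2 * Suc N"], goal_cases)
    case 1 show ?case by (rule 1(1)) (rule 1(2-5), assumption?)+
  qed
  obtain K2 \<delta>2 where K2: "K2 \<ge> 0" "0 < \<delta>2" "\<delta>2 \<le> 1"
    and kap: "\<And>\<epsilon>. 0 < \<epsilon> \<Longrightarrow> \<epsilon> \<le> \<delta>2 \<Longrightarrow> \<bar>\<kappa> \<epsilon>\<bar> \<le> K2 * \<epsilon> ^ Suc N"
    using \<kappa>_bound by metis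
  define J0 where "J0 = det At powr (-1/2) * (1 + (\<Sum>p=1..N. \<bar>coef p\<bar>))"
  define K where "K = \<beta>0 * exp \<bar>\<gamma>\<bar> * (exp (d * K2) * (T * K1) + d * K2 * exp (d * K2) * J0)"
  have \<beta>0: "\<beta>0 > 0" unfolding \<beta>0_eq by simp
  have d0: "d \<ge> 0" by (simp add: d_def)
  have bound: "\<bar>nahm_sum A B C (exp (- \<epsilon>)) * exp (- \<alpha> / \<epsilon>)
      - det At powr (-1/2) * \<beta>0 * exp (- \<gamma> * \<epsilon>) * (1 + (\<Sum>p=1..N. coef p * \<epsilon> ^ p))\<bar> \<le> K * \<epsilon> ^ Suc N"
    if e: "0 < \<epsilon>" "\<epsilon> \<le> \<delta>1\<^sup>2" "\<epsilon> \<le> \<delta>2" for \<epsilon>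
  proof -
    have e1: "\<epsilon> \<le> 1" using e K2 by simp
    have sq: "0 < sqrt \<epsilon>" "sqrt \<epsilon> \<le> \<delta>1" using e K1 by (auto intro: real_le_lsqrt)
    define E where "E = exp (- d * \<kappa> \<epsilon>)"
    have "\<bar>X \<epsilon> - J \<epsilon>\<bar> = T * \<bar>sqrt \<epsilon> ^ CARD('r) * (\<Sum>\<^sub>\<infinity>n. weight (sqrt \<epsilon>) (point (sqrt \<epsilon>) n)) - (\<Sum>p<2 * Suc N. sqrt \<epsilon> ^ p * I p)\<bar>"
      using sum_I[of \<epsilon> N] e T0 unfolding X_def J_def T_def d_def
      by (simp only: right_diff_distrib[symmetric] abs_mult abs_of_nonneg less_imp_le flip: sum_I)
    also have "\<dots> \<le> T * (K1 * sqrt \<epsilon> ^ (2 * Suc N))" using T0 ex[OF sq] by (rule mult_left_mono[rotated])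
    also have "sqrt \<epsilon> ^ (2 * Suc N) = \<epsilon> ^ Suc N" using e unfolding power_mult by simp
    finally have XJ: "\<bar>X \<epsilon> - J \<epsilon>\<bar> \<le> T * (K1 * \<epsilon> ^ Suc N)" .
    have kd: "\<bar>- d * \<kappa> \<epsilon>\<bar> \<le> d * K2 * \<epsilon> ^ Suc N"
      using mult_left_mono[OF kap[OF e(1,3)] d0] d0 by (simp add: abs_mult mult.assoc)
    have "d * K2 * \<epsilon> ^ Suc N \<le> d * K2 * 1" using d0 K2 e e1 by (intro mult_left_mono power_le_one) auto
    hence kd1: "\<bar>- d * \<kappa> \<epsilon>\<bar> \<le> d * K2" using kd by linarith
    have E: "\<bar>E\<bar> \<le> exp (d * K2)" using kd1 by (simp add: E_def)
    have "\<bar>E - 1\<bar> \<le> \<bar>- d * \<kappa> \<epsilon>\<bar> * exp \<bar>- d * \<kappa> \<epsilon>\<bar>" unfolding E_def by (rule exp_minus_one_bound)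
    also have "\<dots> \<le> d * K2 * \<epsilon> ^ Suc N * exp (d * K2)" using kd kd1 by (intro mult_mono) auto
    finally have E1: "\<bar>E - 1\<bar> \<le> d * K2 * \<epsilon> ^ Suc N * exp (d * K2)" .
    have "\<bar>1 + (\<Sum>p=1..N. coef p * \<epsilon> ^ p)\<bar> \<le> 1 + (\<Sum>p=1..N. \<bar>coef p * \<epsilon> ^ p\<bar>)"
      using sum_abs[of "\<lambda>p. coef p * \<epsilon> ^ p" "{1..N}"] by linarith
    also have "(\<Sum>p=1..N. \<bar>coef p * \<epsilon> ^ p\<bar>) \<le> (\<Sum>p=1..N. \<bar>coef p\<bar>)"
      using e e1 by (intro sum_mono) (simp add: abs_mult mult_left_le power_le_one)
    finally have J: "\<bar>J \<epsilon>\<bar> \<le> J0" unfolding J_def J0_def abs_mult by (simp add: mult_left_mono)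
    have "nahm_sum A B C (exp (- \<epsilon>)) * exp (- \<alpha> / \<epsilon>)
      - det At powr (-1/2) * \<beta>0 * exp (- \<gamma> * \<epsilon>) * (1 + (\<Sum>p=1..N. coef p * \<epsilon> ^ p))
      = \<beta>0 * exp (- \<gamma> * \<epsilon>) * (E * X \<epsilon>) - \<beta>0 * exp (- \<gamma> * \<epsilon>) * J \<epsilon>"
      unfolding nahm_sum_eq[OF e(1)] by (simp only: E_def X_def J_def T_def d_def mult_ac)
    also have "\<dots> = \<beta>0 * exp (- \<gamma> * \<epsilon>) * (E * (X \<epsilon> - J \<epsilon>) + (E - 1) * J \<epsilon>)" by (simp add: algebra_simps)
    also have "\<bar>\<dots>\<bar> = \<beta>0 * exp (- \<gamma> * \<epsilon>) * \<bar>E * (X \<epsilon> - J \<epsilon>) + (E - 1) * J \<epsilon>\<bar>" using \<beta>0 by (simp add: abs_mult)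
    also have "\<dots> \<le> \<beta>0 * exp \<bar>\<gamma>\<bar> * (exp (d * K2) * (T * (K1 * \<epsilon> ^ Suc N)) + d * K2 * \<epsilon> ^ Suc N * exp (d * K2) * J0)"
    proof (intro mult_mono)
      have "\<bar>\<gamma>\<bar> * \<epsilon> \<le> \<bar>\<gamma>\<bar> * 1" using e1 by (intro mult_left_mono) auto
      moreover have "- \<gamma> * \<epsilon> \<le> \<bar>\<gamma>\<bar> * \<epsilon>" using e by (intro mult_right_mono) auto
      ultimately show "exp (- \<gamma> * \<epsilon>) \<le> exp \<bar>\<gamma>\<bar>" by simp
      have "\<bar>E * (X \<epsilon> - J \<epsilon>) + (E - 1) * J \<epsilon>\<bar> \<le> \<bar>E\<bar> * \<bar>X \<epsilon> - J \<epsilon>\<bar> + \<bar>E - 1\<bar> * \<bar>J \<epsilon>\<bar>"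
        unfolding abs_mult[symmetric] by (rule abs_triangle_ineq)
      also have "\<dots> \<le> exp (d * K2) * (T * (K1 * \<epsilon> ^ Suc N)) + d * K2 * \<epsilon> ^ Suc N * exp (d * K2) * J0"
        using E XJ E1 J d0 K2 e by (intro add_mono mult_mono) auto
      finally show "\<bar>E * (X \<epsilon> - J \<epsilon>) + (E - 1) * J \<epsilon>\<bar> \<le> exp (d * K2) * (T * (K1 * \<epsilon> ^ Suc N)) + d * K2 * \<epsilon> ^ Suc N * exp (d * K2) * J0" .
    qed (use \<beta>0 in auto)
    also have "\<dots> = K * \<epsilon> ^ Suc N" by (simp add: K_def algebra_simps)
    finally show ?thesis .
  qed
  define \<delta> where "\<delta> = min (\<delta>1\<^sup>2) \<delta>2"
  have \<delta>: "\<delta> > 0" using K1 K2 by (simp add: \<delta>_def)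
  have "\<forall>\<^sub>F \<epsilon> in at_right 0. 0 < \<epsilon> \<and> \<epsilon> < \<delta>" using \<delta> by (auto simp: eventually_at_right_field)
  hence "(\<lambda>\<epsilon>. nahm_sum A B C (exp (- \<epsilon>)) * exp (- \<alpha> / \<epsilon>)
      - det At powr (-1/2) * \<beta>0 * exp (- \<gamma> * \<epsilon>) * (1 + (\<Sum>p=1..N. coef p * \<epsilon> ^ p)))
    \<in> O[at_right 0](\<lambda>\<epsilon>. \<epsilon> ^ Suc N)"
  proof (intro bigoI[of _ K], elim eventually_mono)
    fix \<epsilon> :: real assume e: "0 < \<epsilon> \<and> \<epsilon> < \<delta>"
    show "norm (nahm_sum A B C (exp (- \<epsilon>)) * exp (- \<alpha> / \<epsilon>)
      - det At powr (-1/2) * \<beta>0 * exp (- \<gamma> * \<epsilon>) * (1 + (\<Sum>p=1..N. coef p * \<epsilon> ^ p))) \<le> K * norm (\<epsilon> ^ Suc N)"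
      using bound[of \<epsilon>] e by (simp add: \<delta>_def)
  qed
  also have "(\<lambda>\<epsilon>. \<epsilon> ^ Suc N) \<in> o[at_right 0](\<lambda>\<epsilon>::real. \<epsilon> ^ N)"
  proof (rule smalloI_tendsto)
    have pos: "\<forall>\<^sub>F \<epsilon> in at_right 0. 0 < (\<epsilon>::real)" by (rule eventually_at_right_less)
    thus "\<forall>\<^sub>F \<epsilon> in at_right 0. \<epsilon> ^ N \<noteq> (0::real)" by eventually_elim simp
    have "\<forall>\<^sub>F \<epsilon> in at_right 0. \<epsilon> = \<epsilon> ^ Suc N / (\<epsilon> ^ N :: real)" using pos by eventually_elim simp
    thus "((\<lambda>\<epsilon>::real. \<epsilon> ^ Suc N / \<epsilon> ^ N) \<longlongrightarrow> 0) (at_right 0)"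
      by (rule Lim_transform_eventually[rotated]) (intro tendsto_ident_at)
  qed
  finally show ?thesis .
qed

text \<open>The Gaussian integrals are taken over the square-root closed field of algebraic reals.
  Rationality of \<open>B\<close> makes the powers \<open>Q $ i powr B $ i\<close> algebraic; that
  of \<open>A\<close> enters through the algebraicity of \<open>Q\<close>.\<close>

theorem algebraic_coefficients:
  assumes A: "\<forall>i j. A $ i $ j \<in> \<rat>" and B: "\<forall>i. B $ i \<in> \<rat>" and C: "C \<in> \<rat>"
  shows "algebraic (det At powr (-1/2) * \<beta>0)" "algebraic \<gamma>" "algebraic (coef p)"
proof -
  have Qa: "algebraic (Q $ i)" for i by (rule nahm_solution_algebraic[OF pd Q A])
  have one: "algebraic (1::real)" "algebraic (1/24 :: real)" by (auto intro: rat_imp_algebraic)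
  have Q1: "algebraic (1 - Q $ i)" for i by (intro algebraic_diff one Qa)
  have \<xi>a: "algebraic (\<xi> $ i)" for i unfolding \<xi>_def by (simp add: algebraic_divide Qa Q1)
  have Ata: "algebraic (At $ i $ j)" for i j
    unfolding At_def using A \<xi>a by (auto intro!: algebraic_add intro: rat_imp_algebraic)
  show "algebraic (det At powr (-1/2) * \<beta>0)" unfolding \<beta>0_def
    using Q01 B by (intro algebraic_mult algebraic_powr algebraic_prod algebraic_det Ata det_At Qa Q1) auto
  show "algebraic \<gamma>" unfolding \<gamma>_def
    using C by (intro algebraic_add algebraic_mult algebraic_sum algebraic_divide one Qa Q1) (auto intro: rat_imp_algebraic)
  have "kpoly {x. algebraic x} (C_coeff (2 * p) B \<xi>)"
    by (rule kpoly_C_coeff[OF sqrt_closed_field_algebraic]) (use B \<xi>a in \<open>auto intro: rat_imp_algebraic\<close>)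
  from gaussian_integral_kpoly(2)[OF At_sym At_pd sqrt_closed_field_algebraic _ this]
  show "algebraic (coef p)" unfolding coef_def I_def using Ata by auto
qed

end

text \<open>The claims of algebraicity are made for rational \<open>A\<close>, \<open>B\<close> and
  \<open>C\<close>: already \<gamma> is \<open>C\<close> plus a quantity depending on
  \<open>Q\<close> alone. The expansion and the positivity of \<alpha> hold for all real
  data.\<close>

theorem theorem2p3:
  fixes A :: "real^'r^'r" and B :: "real^'r" and C :: real
  assumes symmetric: "transpose A = A"
    and pos_def: "positive_definite A"
  shows "(\<exists>!Q. nahm_solution A Q) \<and>
    (\<forall>Q. nahm_solution A Q \<longrightarrow>
      (let \<xi> = (\<chi> i. Q $ i / (1 - Q $ i));
           At = (\<chi> i j. A $ i $ j + (if i = j then \<xi> $ i else 0)) :: real^'r^'r;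
           \<alpha> = (\<Sum>i\<in>UNIV. rogers_L 1 - rogers_L (Q $ i));
           \<beta> = det At powr (-1/2) *
               (\<Prod>i\<in>UNIV. (Q $ i) powr (B $ i) * (1 - Q $ i) powr (-1/2));
           \<gamma> = C + 1/24 * (\<Sum>i\<in>UNIV. (1 + Q $ i) / (1 - Q $ i));
           c = (\<lambda>p. det At powr (1/2) * (2 * pi) powr (- real CARD('r) / 2) *
                 (LINT t|lborel. C_coeff (2 * p) B \<xi> t * exp (- 1/2 * (t \<bullet> (At *v t)))))
       in \<alpha> > 0 \<and>
          ((\<forall>i j. A $ i $ j \<in> \<rat>) \<and> (\<forall>i. B $ i \<in> \<rat>) \<and> C \<in> \<rat> \<longrightarrow>
             algebraic \<beta> \<and> algebraic \<gamma> \<and> (\<forall>p\<ge>1. algebraic (c p))) \<and>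
          (\<forall>N::nat.
             (\<lambda>\<epsilon>. nahm_sum A B C (exp (- \<epsilon>)) * exp (- \<alpha> / \<epsilon>)
                   - \<beta> * exp (- \<gamma> * \<epsilon>) * (1 + (\<Sum>p=1..N. c p * \<epsilon> ^ p)))
             \<in> o[at_right 0](\<lambda>\<epsilon>. \<epsilon> ^ N))))" (is "_ \<and> (\<forall>Q. _ \<longrightarrow> ?L Q)")
proof (intro conjI nahm_solution_unique[OF symmetric pos_def] allI impI)
  fix Q assume Q: "nahm_solution A Q"
  interpret nahm_asymptotics A B C Q by standard (fact symmetric pos_def Q)+
  have "\<alpha> > 0" unfolding \<alpha>_def by (rule sum_rogers_L_pos[OF symmetric pos_def Q])
  thus "?L Q"
    unfolding Let_def \<xi>_def[symmetric] At_def[symmetric] \<alpha>_def[symmetric] \<beta>0_def[symmetric] \<gamma>_def[symmetric]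
      gauss_weight_def[symmetric] I_def[symmetric] coef_def[symmetric]
    using algebraic_coefficients nahm_sum_asymp by blast
qed

end
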